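(* The walled Brauer-Clifford superalgebra $\mathsf{BC}_{r,s}$ is the classical limit of the quantum walled Brauer-Clifford superalgebra $\mathsf{BC}_{r,s}(q)$. That is, let $\mathcal R=\mathbb C[q,q^{-1}]_{(q-1)}$ be the localization of $\mathbb C[q,q^{-1}]$ at the ideal generated by $q-1$, and let $\mathsf{BC}_{r,s}(\mathcal R)$ be the $\mathcal R$-subalgebra of $\mathsf{BC}_{r,s}(q)$ generated by $\mathsf t_1,\dots,\mathsf t_{r-1},\mathsf c_1,\dots,\mathsf c_r,\mathsf t_1^*,\dots,\mathsf t_{s-1}^*,\mathsf c_1^*,\dots,\mathsf c_s^*,\mathsf e$. Then the natural homomorphism of $\mathbb C$-superalgebras $$\pi:\mathsf{BC}_{r,s}\longrightarrow\mathsf{BC}_{r,s}(\mathcal R)/(q-1)\mathsf{BC}_{r,s}(\mathcal R),$$ sending $s_i\mapsto\mathsf t_i$ ($1\le i\le r-1$), $s_{r+j}\mapsto\mathsf t_j^*$ ($1\le j\le s-1$), $e_{r,r+1}\mapsto\mathsf e$, $c_k\mapsto\mathsf c_k$ ($1\le k\le r$), $c_{r+l}\mapsto\mathsf c_l^*$ ($1\le l\le s$) (classes modulo $q-1$), is an isomorphism.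
   Context: $r,s$ are nonnegative integers; in the presentations below, generators and relations with out-of-range indices are omitted, and $e_{r,r+1}$, $\mathsf e$ are present only if $r,s\ge1$. $\mathsf{BC}_{r,s}$ is the associative $\mathbb C$-superalgebra generated by even elements $s_1,\dots,s_{r-1},s_{r+1},\dots,s_{r+s-1},e_{r,r+1}$ and odd elements $c_1,\dots,c_{r+s}$ with relations: $s_i^2=1$, $s_is_{i+1}s_i=s_{i+1}s_is_{i+1}$, $s_is_j=s_js_i$ ($|i-j|>1$); $e_{r,r+1}^2=0$, $e_{r,r+1}s_j=s_je_{r,r+1}$ ($j\ne r-1,r+1$), $e_{r,r+1}=e_{r,r+1}s_{r-1}e_{r,r+1}=e_{r,r+1}s_{r+1}e_{r,r+1}$; $s_{r-1}s_{r+1}e_{r,r+1}s_{r+1}s_{r-1}e_{r,r+1}=e_{r,r+1}s_{r-1}s_{r+1}e_{r,r+1}s_{r+1}s_{r-1}$; $c_i^2=-1$ ($1\le i\le r$), $c_i^2=1$ ($r+1\le i\le r+s$), $c_ic_j=-c_jc_i$ ($i\neq j$); $s_ic_is_i=c_{i+1}$, $s_ic_j=c_js_i$ ($j\ne i,i+1$); $c_re_{r,r+1}=c_{r+1}e_{r,r+1}$, $e_{r,r+1}c_r=e_{r,r+1}c_{r+1}$, $e_{r,r+1}c_re_{r,r+1}=0$, $e_{r,r+1}c_j=c_je_{r,r+1}$ ($j\ne r,r+1$). Let $q$ be an indeterminate. $\mathsf{BC}_{r,s}(q)$ is the associative $\mathbb C(q)$-superalgebra generated by even elements $\mathsf t_1,\dots,\mathsf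 t_{r-1},\mathsf t_1^*,\dots,\mathsf t_{s-1}^*,\mathsf e$ and odd elements $\mathsf c_1,\dots,\mathsf c_r,\mathsf c_1^*,\dots,\mathsf c_s^*$ with relations: (1) $\mathsf t_i^2-(q-q^{-1})\mathsf t_i-1=0$, $\mathsf t_i\mathsf t_{i+1}\mathsf t_i=\mathsf t_{i+1}\mathsf t_i\mathsf t_{i+1}$, $\mathsf t_i\mathsf t_j=\mathsf t_j\mathsf t_i$ ($|i-j|>1$); the same relations with every $\mathsf t$ replaced by $\mathsf t^*$; $\mathsf t_i\mathsf t_j^*=\mathsf t_j^*\mathsf t_i$. (2) $\mathsf e^2=0$, $\mathsf e\mathsf t_{r-1}\mathsf e=\mathsf e$, $\mathsf e\mathsf t_j=\mathsf t_j\mathsf e$ ($j\ne r-1$), $\mathsf e\mathsf t_1^*\mathsf e=\mathsf e$, $\mathsf e\mathsf t_j^*=\mathsf t_j^*\mathsf e$ ($j\neq1$). (3) $\mathsf e\mathsf t_{r-1}^{-1}\mathsf t_1^*\mathsf e\mathsf t_1^*\mathsf t_{r-1}^{-1}=\mathsf t_{r-1}^{-1}\mathsf t_1^*\mathsf e\mathsf t_1^*\mathsf t_{r-1}^{-1}\mathsf e$. (4) $\mathsf c_i^2=-1$, $\mathsf c_i\mathsf c_j=-\mathsf c_j\mathsf c_i$ ($i\ne j$), $\mathsf c_i\mathsf c_j^*=-\mathsf c_j^*\mathsf c_i$, $(\mathsf c_i^* )^2=1$, $\mathsf c_i^*\mathsf c_j^*=-\mathsf c_j^*\mathsf c_i^*$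 ($i\neq j$). (5) $\mathsf t_i\mathsf c_i=\mathsf c_{i+1}\mathsf t_i$, $\mathsf t_i\mathsf c_j=\mathsf c_j\mathsf t_i$ ($j\ne i,i+1$), $\mathsf t_i^*\mathsf c_i^*=\mathsf c_{i+1}^*\mathsf t_i^*$, $\mathsf t_i^*\mathsf c_j^*=\mathsf c_j^*\mathsf t_i^*$ ($j\ne i,i+1$), $\mathsf t_i\mathsf c_j^*=\mathsf c_j^*\mathsf t_i$, $\mathsf t_i^*\mathsf c_j=\mathsf c_j\mathsf t_i^*$. (6) $\mathsf c_r\mathsf e=\mathsf c_1^*\mathsf e$, $\mathsf e\mathsf c_r=\mathsf e\mathsf c_1^*$, $\mathsf c_j\mathsf e=\mathsf e\mathsf c_j$ ($j\ne r$), $\mathsf c_j^*\mathsf e=\mathsf e\mathsf c_j^*$ ($j\ne1$), $\mathsf e\mathsf c_r\mathsf e=0$. *)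

theory Defs
  imports
    "HOL-Computational_Algebra.Polynomial_Factorial"
    "HOL-Library.Poly_Mapping"
    "HOL-Library.Z2"
    Complex_Main
    "HOL-Algebra.QuotRing"
    "HOL-Algebra.Module"
begin

section \<open>Superalgebras\<close>

record ('k, 'a) superalgebra = "('k, 'a) module" +
  hpart :: "bit \<Rightarrow> 'a set"

locale superalgebra = Module.module K A + ring A
  for K :: "('k, 'm) ring_scheme" (structure)
    and A :: "('k, 'a, 'n) superalgebra_scheme" (structure) +
  assumes smult_mult_left:
      "\<lbrakk>a \<in> carrier K; x \<in> carrier A; y \<in> carrier A\<rbrakk>
        \<Longrightarrow> (a \<odot>\<^bsub>A\<^esub> x) \<otimes>\<^bsub>A\<^esub> y = a \<odot>\<^bsub>A\<^esub> (x \<otimes>\<^bsub>A\<^esub> y)"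
    and smult_mult_right:
      "\<lbrakk>a \<in> carrier K; x \<in> carrier A; y \<in> carrier A\<rbrakk>
        \<Longrightarrow> x \<otimes>\<^bsub>A\<^esub> (a \<odot>\<^bsub>A\<^esub> y) = a \<odot>\<^bsub>A\<^esub> (x \<otimes>\<^bsub>A\<^esub> y)"
    and hpart_submodule: "submodule (hpart A i) K A"
    and hpart_span: "carrier A = hpart A 0 <+>\<^bsub>A\<^esub> hpart A 1"
    and hpart_disjoint: "hpart A 0 \<inter> hpart A 1 = {\<zero>\<^bsub>A\<^esub>}"
    and hpart_mult:
      "\<lbrakk>x \<in> hpart A i; y \<in> hpart A j\<rbrakk> \<Longrightarrow> x \<otimes>\<^bsub>A\<^esub> y \<in> hpart A (i + j)"

locale superalgebra_hom = dom: superalgebra K A + cod: superalgebra K B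
  for K :: "('k, 'm) ring_scheme"
    and A :: "('k, 'a, 'n) superalgebra_scheme"
    and B :: "('k, 'b, 'p) superalgebra_scheme"
    and h :: "'a \<Rightarrow> 'b" +
  assumes hom_ring: "h \<in> ring_hom A B"
    and hom_smult:
      "\<lbrakk>a \<in> carrier K; x \<in> carrier A\<rbrakk> \<Longrightarrow> h (a \<odot>\<^bsub>A\<^esub> x) = a \<odot>\<^bsub>B\<^esub> h x"
    and hom_hpart: "x \<in> hpart A i \<Longrightarrow> h x \<in> hpart B i"

locale superalgebra_iso = superalgebra_hom +
  assumes iso_bij: "bij_betw h (carrier A) (carrier B)"

definition quot_superalgebra ::
    "('k, 'a, 'n) superalgebra_scheme \<Rightarrow> 'a set \<Rightarrow> ('k, 'a set) superalgebra" where
  "quot_superalgebra A I =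
    \<lparr>carrier = carrier (A Quot I), mult = mult (A Quot I), one = one (A Quot I),
     zero = zero (A Quot I), add = add (A Quot I),
     smult = (\<lambda>a X. \<Union>x\<in>X. I +>\<^bsub>A\<^esub> (a \<odot>\<^bsub>A\<^esub> x)),
     hpart = (\<lambda>i. (\<lambda>x. I +>\<^bsub>A\<^esub> x) ` hpart A i)\<rparr>"

definition restrict_scalars ::
    "('l \<Rightarrow> 'k) \<Rightarrow> ('k, 'a, 'n) superalgebra_scheme \<Rightarrow> ('l, 'a) superalgebra" where
  "restrict_scalars \<phi> A =
    \<lparr>carrier = carrier A, mult = mult A, one = one A, zero = zero A, add = add A,
     smult = (\<lambda>a. smult A (\<phi> a)), hpart = hpart A\<rparr>"

text \<open>The \<open>R\<close>-subalgebra generated by \<open>X\<close>, for a subring \<open>R\<close> of the ground ring. Zero and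
  negatives need no clauses of their own because \<open>R\<close> contains \<open>0\<close> and \<open>-1\<close>.\<close>

inductive_set gen_subalgebra ::
    "('k, 'a, 'n) superalgebra_scheme \<Rightarrow> 'k set \<Rightarrow> 'a set \<Rightarrow> 'a set"
  for A (structure) and R X where
  one: "\<one> \<in> gen_subalgebra A R X"
| incl: "x \<in> X \<Longrightarrow> x \<in> gen_subalgebra A R X"
| smult: "\<lbrakk>a \<in> R; x \<in> gen_subalgebra A R X\<rbrakk> \<Longrightarrow> a \<odot> x \<in> gen_subalgebra A R X"
| add: "\<lbrakk>x \<in> gen_subalgebra A R X; y \<in> gen_subalgebra A R X\<rbrakk>
    \<Longrightarrow> x \<oplus> y \<in> gen_subalgebra A R X"
| mult: "\<lbrakk>x \<in> gen_subalgebra A R X; y \<in> gen_subalgebra A R X\<rbrakk>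
    \<Longrightarrow> x \<otimes> y \<in> gen_subalgebra A R X"


section \<open>Presentations by generators and relations\<close>

text \<open>Words under concatenation, written additively so that \<^type>\<open>poly_mapping\<close> provides the
  (noncommutative) monoid algebra, i.e. the free associative algebra on the letters.\<close>

datatype 'g word = Word (letters: "'g list")

instantiation word :: (type) monoid_add
begin
definition "0 = Word []"
definition "v + w = Word (letters v @ letters w)"
instance by standard (auto simp: zero_word_def plus_word_def)
end

type_synonym ('g, 'k) free = "'g word \<Rightarrow>\<^sub>0 'k"

definition gen :: "'g \<Rightarrow> ('g, 'k::comm_ring_1) free" where
  "gen x = Poly_Mapping.single (Word [x]) 1"

definition scal :: "'k \<Rightarrow> ('g, 'k::comm_ring_1) free" where
  "scal a = Poly_Mapping.single 0 a"

definition type_ring :: "'k::comm_ring_1 ring" where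
  "type_ring = \<lparr>carrier = UNIV, mult = (*), one = 1, zero = 0, add = (+)\<rparr>"

definition free_superalgebra ::
    "'g set \<Rightarrow> ('g \<Rightarrow> bit) \<Rightarrow> ('k::comm_ring_1, ('g, 'k) free) superalgebra" where
  "free_superalgebra G par =
    \<lparr>carrier = {p. \<forall>w \<in> Poly_Mapping.keys p. set (letters w) \<subseteq> G},
     mult = (*), one = 1, zero = 0, add = (+), smult = (\<lambda>a p. scal a * p),
     hpart = (\<lambda>i. {p. \<forall>w \<in> Poly_Mapping.keys p.
        set (letters w) \<subseteq> G \<and> sum_list (map par (letters w)) = i})\<rparr>"

definition relation_ideal ::
    "'g set \<Rightarrow> ('g \<Rightarrow> bit) \<Rightarrow> (('g, 'k) free \<Rightarrow> ('g, 'k) free \<Rightarrow> bool)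
      \<Rightarrow> ('g, 'k::comm_ring_1) free set" where
  "relation_ideal G par rel =
    Idl\<^bsub>(free_superalgebra G par :: ('k, ('g, 'k) free) superalgebra)\<^esub> {x - y | x y. rel x y}"

definition presented_superalgebra ::
    "'g set \<Rightarrow> ('g \<Rightarrow> bit) \<Rightarrow> (('g, 'k) free \<Rightarrow> ('g, 'k) free \<Rightarrow> bool)
      \<Rightarrow> ('k::comm_ring_1, ('g, 'k) free set) superalgebra" where
  "presented_superalgebra G par rel =
    quot_superalgebra (free_superalgebra G par) (relation_ideal G par rel)"

definition presented_gen ::
    "'g set \<Rightarrow> ('g \<Rightarrow> bit) \<Rightarrow> (('g, 'k) free \<Rightarrow> ('g, 'k) free \<Rightarrow> bool)
      \<Rightarrow> 'g \<Rightarrow> ('g, 'k::comm_ring_1) free set" where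
  "presented_gen G par rel x =
    relation_ideal G par rel
      +>\<^bsub>(free_superalgebra G par :: ('k, ('g, 'k) free) superalgebra)\<^esub> gen x"


section \<open>The walled Brauer-Clifford superalgebra\<close>

text \<open>\<open>Sgen i\<close>, \<open>Egen\<close>, \<open>Cgen i\<close> stand for $s_i$, $e_{r,r+1}$, $c_i$.\<close>

datatype bc_gen = Sgen nat | Egen | Cgen nat

definition bc_gens :: "nat \<Rightarrow> nat \<Rightarrow> bc_gen set" where
  "bc_gens r s =
    {Sgen i | i. 1 \<le> i \<and> i \<le> r + s - 1 \<and> i \<noteq> r} \<union>
    (if 1 \<le> r \<and> 1 \<le> s then {Egen} else {}) \<union>
    {Cgen i | i. 1 \<le> i \<and> i \<le> r + s}"

fun bc_par :: "bc_gen \<Rightarrow> bit" where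
  "bc_par (Sgen i) = 0"
| "bc_par Egen = 0"
| "bc_par (Cgen i) = 1"

abbreviation sg :: "nat \<Rightarrow> (bc_gen, complex) free" where "sg i \<equiv> gen (Sgen i)"
abbreviation eg :: "(bc_gen, complex) free" where "eg \<equiv> gen Egen"
abbreviation cg :: "nat \<Rightarrow> (bc_gen, complex) free" where "cg i \<equiv> gen (Cgen i)"

text \<open>The premises \<open>\<dots> \<subseteq> bc_gens r s\<close> discard the relations with out-of-range indices. The
  subtraction in \<open>r - 1\<close> is harmless: \<open>Sgen 0\<close> is never a generator.\<close>

inductive bc_rel :: "nat \<Rightarrow> nat \<Rightarrow> (bc_gen, complex) free \<Rightarrow> (bc_gen, complex) free \<Rightarrow> bool"
  for r s :: nat where
  s_sq: "{Sgen i} \<subseteq> bc_gens r s \<Longrightarrow> bc_rel r s (sg i * sg i) 1"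
| s_braid: "{Sgen i, Sgen (i+1)} \<subseteq> bc_gens r s \<Longrightarrow>
    bc_rel r s (sg i * sg (i+1) * sg i) (sg (i+1) * sg i * sg (i+1))"
| s_comm: "\<lbrakk>{Sgen i, Sgen j} \<subseteq> bc_gens r s; \<bar>int i - int j\<bar> > 1\<rbrakk> \<Longrightarrow>
    bc_rel r s (sg i * sg j) (sg j * sg i)"
| e_sq: "{Egen} \<subseteq> bc_gens r s \<Longrightarrow> bc_rel r s (eg * eg) 0"
| e_s_comm: "\<lbrakk>{Egen, Sgen j} \<subseteq> bc_gens r s; j \<noteq> r - 1; j \<noteq> r + 1\<rbrakk> \<Longrightarrow>
    bc_rel r s (eg * sg j) (sg j * eg)"
| e_s_e_left: "{Egen, Sgen (r-1)} \<subseteq> bc_gens r s \<Longrightarrow> bc_rel r s eg (eg * sg (r-1) * eg)"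
| e_s_e_right: "{Egen, Sgen (r+1)} \<subseteq> bc_gens r s \<Longrightarrow> bc_rel r s eg (eg * sg (r+1) * eg)"
| e_s_s: "{Egen, Sgen (r-1), Sgen (r+1)} \<subseteq> bc_gens r s \<Longrightarrow>
    bc_rel r s (sg (r-1) * sg (r+1) * eg * sg (r+1) * sg (r-1) * eg)
               (eg * sg (r-1) * sg (r+1) * eg * sg (r+1) * sg (r-1))"
| c_sq_left: "\<lbrakk>1 \<le> i; i \<le> r\<rbrakk> \<Longrightarrow> bc_rel r s (cg i * cg i) (-1)"
| c_sq_right: "\<lbrakk>r + 1 \<le> i; i \<le> r + s\<rbrakk> \<Longrightarrow> bc_rel r s (cg i * cg i) 1"
| c_anticomm: "\<lbrakk>{Cgen i, Cgen j} \<subseteq> bc_gens r s; i \<noteq> j\<rbrakk> \<Longrightarrow>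
    bc_rel r s (cg i * cg j) (- (cg j * cg i))"
| s_c_s: "{Sgen i, Cgen i, Cgen (i+1)} \<subseteq> bc_gens r s \<Longrightarrow>
    bc_rel r s (sg i * cg i * sg i) (cg (i+1))"
| s_c_comm: "\<lbrakk>{Sgen i, Cgen j} \<subseteq> bc_gens r s; j \<noteq> i; j \<noteq> i + 1\<rbrakk> \<Longrightarrow>
    bc_rel r s (sg i * cg j) (cg j * sg i)"
| c_e: "{Egen, Cgen r, Cgen (r+1)} \<subseteq> bc_gens r s \<Longrightarrow> bc_rel r s (cg r * eg) (cg (r+1) * eg)"
| e_c: "{Egen, Cgen r, Cgen (r+1)} \<subseteq> bc_gens r s \<Longrightarrow> bc_rel r s (eg * cg r) (eg * cg (r+1))"
| e_c_e: "{Egen, Cgen r} \<subseteq> bc_gens r s \<Longrightarrow> bc_rel r s (eg * cg r * eg) 0"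
| e_c_comm: "\<lbrakk>{Egen, Cgen j} \<subseteq> bc_gens r s; j \<noteq> r; j \<noteq> r + 1\<rbrakk> \<Longrightarrow>
    bc_rel r s (eg * cg j) (cg j * eg)"

definition BC :: "nat \<Rightarrow> nat \<Rightarrow> (complex, (bc_gen, complex) free set) superalgebra" where
  "BC r s = presented_superalgebra (bc_gens r s) bc_par (bc_rel r s)"

definition BC_gen :: "nat \<Rightarrow> nat \<Rightarrow> bc_gen \<Rightarrow> (bc_gen, complex) free set" where
  "BC_gen r s = presented_gen (bc_gens r s) bc_par (bc_rel r s)"


section \<open>The quantum walled Brauer-Clifford superalgebra\<close>

type_synonym ratfun = "complex poly fract"

definition qq :: ratfun where
  "qq = to_fract [:0, 1:]"

definition const_ratfun :: "complex \<Rightarrow> ratfun" where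
  "const_ratfun a = to_fract [:a:]"

text \<open>\<open>Tgen i\<close>, \<open>Tsgen i\<close>, \<open>Qegen\<close>, \<open>Qcgen i\<close>, \<open>Qcsgen i\<close> stand for
  $\mathsf t_i$, $\mathsf t_i^*$, $\mathsf e$, $\mathsf c_i$, $\mathsf c_i^*$.\<close>

datatype qbc_gen = Tgen nat | Tsgen nat | Qegen | Qcgen nat | Qcsgen nat

definition qbc_gens :: "nat \<Rightarrow> nat \<Rightarrow> qbc_gen set" where
  "qbc_gens r s =
    {Tgen i | i. 1 \<le> i \<and> i \<le> r - 1} \<union>
    {Tsgen i | i. 1 \<le> i \<and> i \<le> s - 1} \<union>
    (if 1 \<le> r \<and> 1 \<le> s then {Qegen} else {}) \<union>
    {Qcgen i | i. 1 \<le> i \<and> i \<le> r} \<union>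
    {Qcsgen i | i. 1 \<le> i \<and> i \<le> s}"

fun qbc_par :: "qbc_gen \<Rightarrow> bit" where
  "qbc_par (Tgen i) = 0"
| "qbc_par (Tsgen i) = 0"
| "qbc_par Qegen = 0"
| "qbc_par (Qcgen i) = 1"
| "qbc_par (Qcsgen i) = 1"

abbreviation tg :: "nat \<Rightarrow> (qbc_gen, ratfun) free" where "tg i \<equiv> gen (Tgen i)"
abbreviation tsg :: "nat \<Rightarrow> (qbc_gen, ratfun) free" where "tsg i \<equiv> gen (Tsgen i)"
abbreviation qeg :: "(qbc_gen, ratfun) free" where "qeg \<equiv> gen Qegen"
abbreviation qcg :: "nat \<Rightarrow> (qbc_gen, ratfun) free" where "qcg i \<equiv> gen (Qcgen i)"
abbreviation qcsg :: "nat \<Rightarrow> (qbc_gen, ratfun) free" where "qcsg i \<equiv> gen (Qcsgen i)"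

text \<open>By the quadratic relation, $\mathsf t_i - (q - q^{-1})$ is the two-sided inverse of
  $\mathsf t_i$ in the algebra; this is what $\mathsf t_{r-1}^{-1}$ denotes in the relations.\<close>

definition tg_inv :: "nat \<Rightarrow> (qbc_gen, ratfun) free" where
  "tg_inv i = tg i - scal (qq - inverse qq)"

lemma tg_inv_right: "tg i * tg_inv i - 1 = tg i * tg i - scal (qq - inverse qq) * tg i - 1"
  and tg_inv_left: "tg_inv i * tg i - 1 = tg i * tg i - scal (qq - inverse qq) * tg i - 1"
  by (simp_all add: tg_inv_def algebra_simps scal_def gen_def mult_single)

inductive qbc_rel ::
    "nat \<Rightarrow> nat \<Rightarrow> (qbc_gen, ratfun) free \<Rightarrow> (qbc_gen, ratfun) free \<Rightarrow> bool"
  for r s :: nat where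
  t_quad: "{Tgen i} \<subseteq> qbc_gens r s \<Longrightarrow>
    qbc_rel r s (tg i * tg i - scal (qq - inverse qq) * tg i - 1) 0"
| t_braid: "{Tgen i, Tgen (i+1)} \<subseteq> qbc_gens r s \<Longrightarrow>
    qbc_rel r s (tg i * tg (i+1) * tg i) (tg (i+1) * tg i * tg (i+1))"
| t_comm: "\<lbrakk>{Tgen i, Tgen j} \<subseteq> qbc_gens r s; \<bar>int i - int j\<bar> > 1\<rbrakk> \<Longrightarrow>
    qbc_rel r s (tg i * tg j) (tg j * tg i)"
| ts_quad: "{Tsgen i} \<subseteq> qbc_gens r s \<Longrightarrow>
    qbc_rel r s (tsg i * tsg i - scal (qq - inverse qq) * tsg i - 1) 0"
| ts_braid: "{Tsgen i, Tsgen (i+1)} \<subseteq> qbc_gens r s \<Longrightarrow>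
    qbc_rel r s (tsg i * tsg (i+1) * tsg i) (tsg (i+1) * tsg i * tsg (i+1))"
| ts_comm: "\<lbrakk>{Tsgen i, Tsgen j} \<subseteq> qbc_gens r s; \<bar>int i - int j\<bar> > 1\<rbrakk> \<Longrightarrow>
    qbc_rel r s (tsg i * tsg j) (tsg j * tsg i)"
| t_ts_comm: "{Tgen i, Tsgen j} \<subseteq> qbc_gens r s \<Longrightarrow> qbc_rel r s (tg i * tsg j) (tsg j * tg i)"
| qe_sq: "{Qegen} \<subseteq> qbc_gens r s \<Longrightarrow> qbc_rel r s (qeg * qeg) 0"
| e_t_e: "{Qegen, Tgen (r-1)} \<subseteq> qbc_gens r s \<Longrightarrow> qbc_rel r s (qeg * tg (r-1) * qeg) qeg"
| e_t_comm: "\<lbrakk>{Qegen, Tgen j} \<subseteq> qbc_gens r s; j \<noteq> r - 1\<rbrakk> \<Longrightarrow>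
    qbc_rel r s (qeg * tg j) (tg j * qeg)"
| e_ts_e: "{Qegen, Tsgen 1} \<subseteq> qbc_gens r s \<Longrightarrow> qbc_rel r s (qeg * tsg 1 * qeg) qeg"
| e_ts_comm: "\<lbrakk>{Qegen, Tsgen j} \<subseteq> qbc_gens r s; j \<noteq> 1\<rbrakk> \<Longrightarrow>
    qbc_rel r s (qeg * tsg j) (tsg j * qeg)"
| e_t_ts: "{Qegen, Tgen (r-1), Tsgen 1} \<subseteq> qbc_gens r s \<Longrightarrow>
    qbc_rel r s (qeg * tg_inv (r-1) * tsg 1 * qeg * tsg 1 * tg_inv (r-1))
                (tg_inv (r-1) * tsg 1 * qeg * tsg 1 * tg_inv (r-1) * qeg)"
| qc_sq: "{Qcgen i} \<subseteq> qbc_gens r s \<Longrightarrow> qbc_rel r s (qcg i * qcg i) (-1)"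
| qc_anticomm: "\<lbrakk>{Qcgen i, Qcgen j} \<subseteq> qbc_gens r s; i \<noteq> j\<rbrakk> \<Longrightarrow>
    qbc_rel r s (qcg i * qcg j) (- (qcg j * qcg i))"
| qc_qcs_anticomm: "{Qcgen i, Qcsgen j} \<subseteq> qbc_gens r s \<Longrightarrow>
    qbc_rel r s (qcg i * qcsg j) (- (qcsg j * qcg i))"
| qcs_sq: "{Qcsgen i} \<subseteq> qbc_gens r s \<Longrightarrow> qbc_rel r s (qcsg i * qcsg i) 1"
| qcs_anticomm: "\<lbrakk>{Qcsgen i, Qcsgen j} \<subseteq> qbc_gens r s; i \<noteq> j\<rbrakk> \<Longrightarrow>
    qbc_rel r s (qcsg i * qcsg j) (- (qcsg j * qcsg i))"
| t_c: "{Tgen i, Qcgen i, Qcgen (i+1)} \<subseteq> qbc_gens r s \<Longrightarrow>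
    qbc_rel r s (tg i * qcg i) (qcg (i+1) * tg i)"
| t_c_comm: "\<lbrakk>{Tgen i, Qcgen j} \<subseteq> qbc_gens r s; j \<noteq> i; j \<noteq> i + 1\<rbrakk> \<Longrightarrow>
    qbc_rel r s (tg i * qcg j) (qcg j * tg i)"
| ts_cs: "{Tsgen i, Qcsgen i, Qcsgen (i+1)} \<subseteq> qbc_gens r s \<Longrightarrow>
    qbc_rel r s (tsg i * qcsg i) (qcsg (i+1) * tsg i)"
| ts_cs_comm: "\<lbrakk>{Tsgen i, Qcsgen j} \<subseteq> qbc_gens r s; j \<noteq> i; j \<noteq> i + 1\<rbrakk> \<Longrightarrow>
    qbc_rel r s (tsg i * qcsg j) (qcsg j * tsg i)"
| t_cs_comm: "{Tgen i, Qcsgen j} \<subseteq> qbc_gens r s \<Longrightarrow> qbc_rel r s (tg i * qcsg j) (qcsg j * tg i)"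
| ts_c_comm: "{Tsgen i, Qcgen j} \<subseteq> qbc_gens r s \<Longrightarrow> qbc_rel r s (tsg i * qcg j) (qcg j * tsg i)"
| qc_e: "{Qegen, Qcgen r, Qcsgen 1} \<subseteq> qbc_gens r s \<Longrightarrow>
    qbc_rel r s (qcg r * qeg) (qcsg 1 * qeg)"
| qe_c: "{Qegen, Qcgen r, Qcsgen 1} \<subseteq> qbc_gens r s \<Longrightarrow>
    qbc_rel r s (qeg * qcg r) (qeg * qcsg 1)"
| qc_e_comm: "\<lbrakk>{Qegen, Qcgen j} \<subseteq> qbc_gens r s; j \<noteq> r\<rbrakk> \<Longrightarrow>
    qbc_rel r s (qcg j * qeg) (qeg * qcg j)"
| qcs_e_comm: "\<lbrakk>{Qegen, Qcsgen j} \<subseteq> qbc_gens r s; j \<noteq> 1\<rbrakk> \<Longrightarrow>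
    qbc_rel r s (qcsg j * qeg) (qeg * qcsg j)"
| qe_c_e: "{Qegen, Qcgen r} \<subseteq> qbc_gens r s \<Longrightarrow> qbc_rel r s (qeg * qcg r * qeg) 0"

definition qBC :: "nat \<Rightarrow> nat \<Rightarrow> (ratfun, (qbc_gen, ratfun) free set) superalgebra" where
  "qBC r s = presented_superalgebra (qbc_gens r s) qbc_par (qbc_rel r s)"

definition qBC_gen :: "nat \<Rightarrow> nat \<Rightarrow> qbc_gen \<Rightarrow> (qbc_gen, ratfun) free set" where
  "qBC_gen r s = presented_gen (qbc_gens r s) qbc_par (qbc_rel r s)"


section \<open>The integral form and its specialization at $q = 1$\<close>

definition laurent :: "ratfun set" where
  "laurent = {to_fract p / qq ^ n | p n. True}"

text \<open>The localization of \<^const>\<open>laurent\<close> at the prime ideal generated by $q - 1$, realized inside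
  the field of fractions.\<close>

definition local_ring :: "ratfun set" where
  "local_ring = {f / g | f g. f \<in> laurent \<and> g \<in> laurent - {(qq - 1) * h | h. h \<in> laurent}}"

definition BC_int :: "nat \<Rightarrow> nat \<Rightarrow> (ratfun, (qbc_gen, ratfun) free set) superalgebra" where
  "BC_int r s =
    (let H = gen_subalgebra (qBC r s) local_ring (qBC_gen r s ` qbc_gens r s)
     in (qBC r s)\<lparr>carrier := H, hpart := (\<lambda>i. hpart (qBC r s) i \<inter> H)\<rparr>)"

definition spec_ideal :: "nat \<Rightarrow> nat \<Rightarrow> (qbc_gen, ratfun) free set set" where
  "spec_ideal r s = {(qq - 1) \<odot>\<^bsub>BC_int r s\<^esub> x | x. x \<in> carrier (BC_int r s)}"

definition BC_lim :: "nat \<Rightarrow> nat \<Rightarrow> (complex, (qbc_gen, ratfun) free set set) superalgebra" where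
  "BC_lim r s = restrict_scalars const_ratfun (quot_superalgebra (BC_int r s) (spec_ideal r s))"

definition BC_lim_gen :: "nat \<Rightarrow> nat \<Rightarrow> qbc_gen \<Rightarrow> (qbc_gen, ratfun) free set set" where
  "BC_lim_gen r s x = spec_ideal r s +>\<^bsub>BC_int r s\<^esub> qBC_gen r s x"

text \<open>The values on the generators determine \<open>\<pi>\<close> on \<open>carrier (BC r s)\<close>.\<close>

definition natural_hom ::
    "nat \<Rightarrow> nat \<Rightarrow> ((bc_gen, complex) free set \<Rightarrow> (qbc_gen, ratfun) free set set) \<Rightarrow> bool" where
  "natural_hom r s \<pi> \<longleftrightarrow>
    superalgebra_hom type_ring (BC r s) (BC_lim r s) \<pi> \<and>
    (\<forall>i. 1 \<le> i \<and> i \<le> r - 1 \<longrightarrow> \<pi> (BC_gen r s (Sgen i)) = BC_lim_gen r s (Tgen i)) \<and>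
    (\<forall>j. 1 \<le> j \<and> j \<le> s - 1 \<longrightarrow> \<pi> (BC_gen r s (Sgen (r + j))) = BC_lim_gen r s (Tsgen j)) \<and>
    (1 \<le> r \<and> 1 \<le> s \<longrightarrow> \<pi> (BC_gen r s Egen) = BC_lim_gen r s Qegen) \<and>
    (\<forall>k. 1 \<le> k \<and> k \<le> r \<longrightarrow> \<pi> (BC_gen r s (Cgen k)) = BC_lim_gen r s (Qcgen k)) \<and>
    (\<forall>l. 1 \<le> l \<and> l \<le> s \<longrightarrow> \<pi> (BC_gen r s (Cgen (r + l))) = BC_lim_gen r s (Qcsgen l))"

end

theory Submission
  imports Defs
    "HOL-Computational_Algebra.Formal_Power_Series"
    "HOL-Computational_Algebra.Polynomial_FPS"
begin

text \<open>Existence of the natural homomorphism is the easy half. Modulo \<open>q - 1\<close> the quadratic relation becomes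
  \<open>t\<^sub>i\<^sup>2 = 1\<close> and \<open>t\<^sub>i\<^sup>-\<^sup>1\<close> becomes \<open>t\<^sub>i\<close>, so the quantum relations specialize to the classical ones
  (\<open>bc_rel_limit\<close>); surjectivity holds because the residue field of the local ring is the field of constants
  (\<open>lift_mod\<close>). What needs an argument is injectivity: the quantum algebra must not collapse at \<open>q = 1\<close>.

  No basis of either algebra is constructed. Instead the quantum algebra acts on the Hecke-Clifford algebra \<open>H\<close>
  with \<open>n = r + s\<close> strands over the power series ring in \<open>q - 1\<close>: the generators \<open>t\<^sub>i\<close>, \<open>c\<^sub>i\<close> multiply from
  the left by generators with index shifted by \<open>s\<close>, the starred generators multiply from the right in reversed
  numbering (with the parity automorphism for the odd ones), and \<open>e\<close> acts as the conditional expectation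
  \<open>eps\<close> from \<open>n\<close> to \<open>n - 1\<close> strands that kills \<open>x\<close> and \<open>x c\<^sub>n\<close> and sends \<open>x T\<^sub>n\<^sub>-\<^sub>1 y\<close> to \<open>x y\<close>, for \<open>x\<close>, \<open>y\<close> on
  \<open>n - 1\<close> strands. That \<open>eps\<close> is well defined rests on the freeness of \<open>H\<close> over the previous layer,
  which is read off from an action on words (\<open>X_unique\<close>); \<open>qbc_rel_acts\<close> checks the defining relations.
  Power series have no torsion, hence an element of the relation ideal acts by zero even after denominators are
  cleared, and reduction to constant terms shows: if the image of a classical element \<open>p\<close> vanishes in the limit,
  then \<open>p\<close> acts by zero on \<open>H\<close> at \<open>q = 1\<close> (\<open>transfer\<close>).

  It remains to see that the classical action detects the relation ideal (\<open>bact_faithful\<close>). At \<open>q = 1\<close> every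
  generator sends a signed permutation, up to sign, to a signed permutation or to zero, so a word applied to a
  fixed starting vector ends in a state: a signed permutation \<open>f\<close>, or nothing. Distinct states are linearly independent
  in \<open>H\<close> (\<open>rep_independent\<close>). On the other side, the words of the classical algebra, taken up to sign
  and modulo relations, form a monoid in which every word has a normal form recording only its state
  (\<open>normal_word\<close>), and two words with the same state agree (\<open>NF_unique\<close>), while
  a word without a state is zero. So an element that acts by zero is a combination of words in which the
  coefficients of each state cancel, and lies in the relation ideal.\<close>

section \<open>Operators on signed words\<close>

text \<open>Linear operators on functions of a word. Multiplication below is composition in the opposite order, so that words, at which the functions are evaluated, form a left module: the right factor of a product meets the word first.\<close>

typedef (overloaded) ('i, 'k::comm_ring_1) lop =
  "{F :: ('i \<Rightarrow> 'k) \<Rightarrow> 'i \<Rightarrow> 'k. (\<forall>f g. F (\<lambda>i. f i + g i) = (\<lambda>i. F f i + F g i)) \<and>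
      (\<forall>a f. F (\<lambda>i. a * f i) = (\<lambda>i. a * F f i))}"
  morphisms app Lop
  by (rule exI[of _ id]) auto

setup_lifting type_definition_lop

instantiation lop :: (type, comm_ring_1) ring_1
begin
lift_definition zero_lop :: "('a, 'b) lop" is "\<lambda>f i. 0" by auto
lift_definition one_lop :: "('a, 'b) lop" is "\<lambda>f. f" by auto
lift_definition plus_lop :: "('a, 'b) lop \<Rightarrow> ('a, 'b) lop \<Rightarrow> ('a, 'b) lop"
  is "\<lambda>F G f i. F f i + G f i" by (auto simp: algebra_simps fun_eq_iff)
lift_definition uminus_lop :: "('a, 'b) lop \<Rightarrow> ('a, 'b) lop"
  is "\<lambda>F f i. - F f i" by (auto simp: algebra_simps fun_eq_iff)
lift_definition minus_lop :: "('a, 'b) lop \<Rightarrow> ('a, 'b) lop \<Rightarrow> ('a, 'b) lop"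
  is "\<lambda>F G f i. F f i - G f i" by (auto simp: algebra_simps fun_eq_iff)
lift_definition times_lop :: "('a, 'b) lop \<Rightarrow> ('a, 'b) lop \<Rightarrow> ('a, 'b) lop"
  is "\<lambda>F G f. G (F f)" by auto
instance
proof
  show "(0::('a,'b) lop) \<noteq> 1"
  proof
    assume "(0::('a,'b) lop) = 1"
    then have "app (0::('a,'b) lop) (\<lambda>i. 1) undefined = app 1 (\<lambda>i. 1) undefined" by simp
    then show False by (simp add: zero_lop.rep_eq one_lop.rep_eq)
  qed
qed (transfer; auto simp: algebra_simps fun_eq_iff)+
end

lift_definition lscal :: "'k \<Rightarrow> ('i, 'k::comm_ring_1) lop" is "\<lambda>a f i. a * f i"
  by (auto simp: algebra_simps fun_eq_iff)

lemmas app_simps = zero_lop.rep_eq one_lop.rep_eq plus_lop.rep_eq uminus_lop.rep_eq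
  minus_lop.rep_eq times_lop.rep_eq lscal.rep_eq

lemma app_scale: "app F (\<lambda>i. a * f i) w = a * app F f w"
  by transfer auto
lemma app_plus: "app F (\<lambda>i. f i + g i) w = app F f w + app F g w"
  by transfer auto
lemma lop_eqI: "(\<And>f w. app F f w = app G f w) \<Longrightarrow> F = G"
  by transfer (auto simp: fun_eq_iff)

lemma lscal_central: "lscal a * x = x * lscal a"
  by (rule lop_eqI) (simp add: app_simps app_scale)
lemma lscal_add: "lscal (a + b) = lscal a + lscal b" by (rule lop_eqI) (simp add: app_simps algebra_simps)
lemma lscal_mult: "lscal (a * b) = lscal a * lscal b" by (rule lop_eqI) (simp add: app_simps algebra_simps)
lemma lscal_1 [simp]: "lscal 1 = 1" by (rule lop_eqI) (simp add: app_simps)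
lemma lscal_0 [simp]: "lscal 0 = 0" by (rule lop_eqI) (simp add: app_simps)
lemma lscal_uminus: "lscal (- a) = - lscal a" by (rule lop_eqI) (simp add: app_simps)

text \<open>A word assigns to each position a letter in \<open>nat\<close> with a dot that may or may not be present; only the positions \<open>1..n\<close> are ever touched by an algebra with \<open>n\<close> strands.\<close>

type_synonym dword = "nat \<Rightarrow> nat \<times> bool"

definition dsg :: "bool \<Rightarrow> 'k::comm_ring_1" where "dsg b = (if b then -1 else 1)"
text \<open>The sign from moving an odd element past the dotted letters before a position.\<close>

definition wsg :: "dword \<Rightarrow> nat \<Rightarrow> 'k::comm_ring_1" where "wsg w i = (\<Prod>j<i. dsg (snd (w j)))"

lemma dsg_simps [simp]: "dsg True = -1" "dsg False = 1" "dsg (\<not> b) = - dsg b" "dsg b * dsg b = 1"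
   "dsg b * (dsg b * x) = x"
  by (auto simp: dsg_def)

lemma wsg_upd_ge [simp]: "i \<le> j \<Longrightarrow> wsg (w(j := x)) i = wsg w i"
  unfolding wsg_def by (rule prod.cong) auto

lemma wsg_upd_lt: "j < i \<Longrightarrow> wsg (w(j := x)) i = dsg (snd (w j)) * dsg (snd x) * wsg w i"
proof -
  assume ji: "j < i"
  have "(\<Prod>k<i. dsg (snd ((w(j := x)) k))) = dsg (snd x) * (\<Prod>k\<in>{..<i}-{j}. dsg (snd (w k)) :: 'a)"
    using ji by (subst prod.remove[of _ j]) (auto intro!: prod.cong)
  moreover have "(\<Prod>k<i. dsg (snd (w k))) = dsg (snd (w j)) * (\<Prod>k\<in>{..<i}-{j}. dsg (snd (w k)) :: 'a)"
    using ji by (subst prod.remove[of _ j]) auto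
  ultimately show ?thesis by (simp add: wsg_def algebra_simps)
qed

lemma wsg_Suc: "wsg w (Suc i) = wsg w i * dsg (snd (w i))"
  by (simp add: wsg_def)

lemma wsg_sq [simp]: "wsg w i * wsg w i = (1::'k::comm_ring_1)" "wsg w i * (wsg w i * x) = (x::'k)"
proof -
  show *: "wsg w i * wsg w i = (1::'k)"
    by (induction i) (auto simp: wsg_Suc wsg_def[of _ 0] algebra_simps)
  show "wsg w i * (wsg w i * x) = (x::'k)" by (simp add: mult.assoc[symmetric] *)
qed

text \<open>The Clifford generator toggles the dot at one position.\<close>

lift_definition cop :: "nat \<Rightarrow> (dword, 'k::comm_ring_1) lop" is
  "\<lambda>i \<phi> w. wsg w i * dsg (snd (w i)) * \<phi> (w(i := (fst (w i), \<not> snd (w i))))"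
  by (auto simp: algebra_simps fun_eq_iff)

text \<open>The parity operator; conjugation with it is the automorphism that negates the Clifford generators.\<close>

lift_definition pop :: "nat \<Rightarrow> (dword, 'k::comm_ring_1) lop" is
  "\<lambda>n \<phi> w. wsg w (Suc n) * \<phi> w"
  by (auto simp: algebra_simps fun_eq_iff)

text \<open>The action of a Hecke generator on two adjacent undotted letters: swap, scale or swap with a correction, according to their order.\<close>

definition hker :: "'k \<Rightarrow> 'k \<Rightarrow> (nat \<Rightarrow> nat \<Rightarrow> 'k) \<Rightarrow> nat \<Rightarrow> nat \<Rightarrow> 'k::comm_ring_1" where
  "hker q p \<chi> a b = (if a < b then \<chi> b a else if a = b then q * \<chi> a a else \<chi> b a + (q - p) * \<chi> a b)"

text \<open>The two-letter kernel of a Hecke generator in the presence of dots. The corrections in the cases with a dotted second letter are forced by \<open>T c\<^sub>i = c\<^sub>i\<^sub>+\<^sub>1 T\<close> together with the quadratic relation.\<close>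

definition tker :: "'k \<Rightarrow> 'k \<Rightarrow> (nat \<times> bool \<Rightarrow> nat \<times> bool \<Rightarrow> 'k) \<Rightarrow> nat \<times> bool \<Rightarrow> nat \<times> bool \<Rightarrow> 'k::comm_ring_1" where
  "tker q p \<psi> x y =
    (if snd x
     then if snd y
          then - hker q p (\<lambda>a b. \<psi> (a, True) (b, True)) (fst x) (fst y)
               + (q - p) * (\<psi> (fst x, True) (fst y, True) - \<psi> (fst x, False) (fst y, False))
          else hker q p (\<lambda>a b. \<psi> (a, False) (b, True)) (fst x) (fst y)
     else if snd y
          then hker q p (\<lambda>a b. \<psi> (a, True) (b, False)) (fst x) (fst y)
               + (q - p) * (\<psi> (fst x, False) (fst y, True) - \<psi> (fst x, True) (fst y, False))
          else hker q p (\<lambda>a b. \<psi> (a, False) (b, False)) (fst x) (fst y))"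

lift_definition top' :: "'k \<Rightarrow> 'k \<Rightarrow> nat \<Rightarrow> (dword, 'k::comm_ring_1) lop" is
  "\<lambda>q p i \<phi> w. tker q p (\<lambda>x y. \<phi> (w(i := x, Suc i := y))) (w i) (w (Suc i))"
  by (auto simp: algebra_simps fun_eq_iff tker_def hker_def)

lemmas op_app = cop.rep_eq pop.rep_eq top'.rep_eq app_simps

lemma cop_sq: "cop i * cop i = - 1"
  by (rule lop_eqI) (auto simp: op_app algebra_simps)

lemma cop_anti: assumes "i \<noteq> j" shows "cop i * cop j = - (cop j * cop i)"
proof -
  have A: "cop i * cop j = - (cop j * cop i)" if "i < j" for i j :: nat
    using that by (intro lop_eqI) (auto simp: op_app wsg_upd_lt algebra_simps fun_upd_twist)
  from assms consider "i < j" | "j < i" by linarith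
  then show ?thesis by cases (simp_all add: A)
qed

lemma pop_sq: "pop n * pop n = 1"
  by (rule lop_eqI) (simp add: op_app)

lemma pop_cop: assumes "i \<le> n" shows "pop n * cop i = - (cop i * pop n)"
  using assms by (intro lop_eqI) (auto simp: op_app wsg_upd_lt algebra_simps less_Suc_eq_le)

lemma tker_scale: "tker q p (\<lambda>x y. f x y * c) x y = tker q p f x y * c"
  by (auto simp: tker_def hker_def algebra_simps)

lemma pop_top:  assumes "Suc i \<le> n" shows "pop n * top' q p i = top' q p i * pop n"
  using assms by (intro lop_eqI) (auto simp: op_app wsg_upd_lt algebra_simps less_Suc_eq_le tker_def hker_def)

lemma top_cop_far: assumes "j \<noteq> i" "j \<noteq> Suc i" shows "top' q p i * cop j = cop j * top' q p i"
proof -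
  consider "j < i" | "j > Suc i" using assms by linarith
  then show ?thesis
    by cases (intro lop_eqI; auto simp: op_app wsg_upd_lt algebra_simps less_Suc_eq_le tker_def hker_def fun_upd_twist)+
qed

lemma top_cop: "top' q p i * cop i = cop (Suc i) * top' q p i"
  by (intro lop_eqI) (auto simp: op_app wsg_upd_lt algebra_simps wsg_Suc less_Suc_eq_le tker_def hker_def fun_upd_twist)

lemma top_top_far: assumes "Suc i < j" shows "top' q p i * top' q p j = top' q p j * top' q p i"
  apply (intro lop_eqI)
  subgoal for f w
    using assms apply (cases "w i"; cases "w (Suc i)"; cases "w j"; cases "w (Suc j)")
    apply (simp add: op_app fun_upd_twist)
    apply (auto simp: tker_def hker_def algebra_simps fun_upd_twist)
    done
  done

lemma tker_quad: assumes "q * p = 1"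
  shows "tker q p (\<lambda>x y. tker q p \<psi> x y) x y = (q - p) * tker q p \<psi> x y + \<psi> x y"
proof -
  have pq: "p * q = 1" "p * (q * z) = z" "q * (p * z) = z" for z
    using assms by (auto simp: mult.commute mult.assoc[symmetric])
  obtain a \<alpha> b \<beta> where xy: "x = (a, \<alpha>)" "y = (b, \<beta>)" by (cases x; cases y)
  consider "a < b" | "a = b" | "b < a" by linarith
  then show ?thesis unfolding xy
    by cases (cases \<alpha>; cases \<beta>; simp add: tker_def hker_def algebra_simps pq)+
qed

lemma app_top': "app (top' q p i) f w = tker q p (\<lambda>x y. f (w(i := x, Suc i := y))) (w i) (w (Suc i))"
  by (simp add: top'.rep_eq)

lemma top_quad: assumes "q * p = 1" shows "top' q p i * top' q p i = lscal (q - p) * top' q p i + 1"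
proof (rule lop_eqI)
  fix f :: "dword \<Rightarrow> 'a" and w :: dword
  have "app (top' q p i * top' q p i) f w = tker q p (\<lambda>x y. tker q p (\<lambda>x y. f (w(i := x, Suc i := y))) x y) (w i) (w (Suc i))"
    by (simp add: op_app fun_upd_twist)
  also have "\<dots> = (q - p) * app (top' q p i) f w + f w"
    by (subst tker_quad[OF assms]) (simp add: op_app)
  finally show "app (top' q p i * top' q p i) f w = app (lscal (q - p) * top' q p i + 1) f w"
    by (simp add: op_app tker_scale mult.commute[of "q - p"])
qed

lemma hker_cases:
  "a < b \<Longrightarrow> hker q p \<chi> a b = \<chi> b a"
  "hker q p \<chi> a a = q * \<chi> a a"
  "b < a \<Longrightarrow> hker q p \<chi> a b = \<chi> b a + (q - p) * \<chi> a b"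
  by (simp_all add: hker_def)

lemma tker_cases:
  "tker q p \<psi> (a, False) (b, False) = hker q p (\<lambda>a b. \<psi> (a, False) (b, False)) a b"
  "tker q p \<psi> (a, True) (b, False) = hker q p (\<lambda>a b. \<psi> (a, False) (b, True)) a b"
  "tker q p \<psi> (a, False) (b, True) = hker q p (\<lambda>a b. \<psi> (a, True) (b, False)) a b
      + (q - p) * (\<psi> (a, False) (b, True) - \<psi> (a, True) (b, False))"
  "tker q p \<psi> (a, True) (b, True) = - hker q p (\<lambda>a b. \<psi> (a, True) (b, True)) a b
      + (q - p) * (\<psi> (a, True) (b, True) - \<psi> (a, False) (b, False))"
  by (simp_all add: tker_def)

lemma tker_braid: assumes "q * p = 1"
  shows "tker q p (\<lambda>x y. tker q p (\<lambda>y z. tker q p (\<lambda>x y. \<psi> x y z) x y) y z) x y =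
         tker q p (\<lambda>y z. tker q p (\<lambda>x y. tker q p (\<lambda>y z. \<psi> x y z) y z) x y) y z"
proof -
  have pq: "p * q = 1" "p * (q * z) = z" "q * (p * z) = z" for z
    using assms by (auto simp: mult.commute mult.assoc[symmetric])
  obtain a \<alpha> b \<beta> c \<gamma> where xy: "x = (a, \<alpha>)" "y = (b, \<beta>)" "z = (c, \<gamma>)" by (cases x; cases y; cases z)
  have "a < b \<or> a = b \<or> b < a" "a < c \<or> a = c \<or> c < a" "b < c \<or> b = c \<or> c < b"
    by linarith+
  then show ?thesis unfolding xy
    by (elim disjE)
      (simp_all, (cases \<alpha>; cases \<beta>; cases \<gamma>; simp add: tker_cases hker_cases algebra_simps pq)+)
qed

lemma top_braid: assumes "q * p = 1"
  shows "top' q p i * top' q p (Suc i) * top' q p i = top' q p (Suc i) * top' q p i * top' q p (Suc i)"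
proof (rule lop_eqI)
  fix f :: "dword \<Rightarrow> 'a" and w :: dword
  define W where "W = (\<lambda>x y z. w(i := x, Suc i := y, Suc (Suc i) := z))"
  have w: "w = W (w i) (w (Suc i)) (w (Suc (Suc i)))"
    by (auto simp: W_def)
  have 1: "app (top' q p i) g (W x y z) = tker q p (\<lambda>x y. g (W x y z)) x y" for g x y z
    unfolding app_top' by (simp add: fun_upd_twist W_def)
  have 2: "app (top' q p (Suc i)) g (W x y z) = tker q p (\<lambda>y z. g (W x y z)) y z" for g x y z
    unfolding app_top' by (simp add: fun_upd_twist W_def)
  have "app (top' q p i * top' q p (Suc i) * top' q p i) f (W x y z) =
     app (top' q p (Suc i) * top' q p i * top' q p (Suc i)) f (W x y z)" for x y z
    unfolding times_lop.rep_eq 1 2 by (rule tker_braid[OF assms])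
  then show "app (top' q p i * top' q p (Suc i) * top' q p i) f w =
      app (top' q p (Suc i) * top' q p i * top' q p (Suc i)) f w"
    using w by metis
qed

section \<open>The tower of Hecke-Clifford algebras\<close>

locale hecke_clifford =
  fixes q p :: "'k::comm_ring_1"
  assumes qp: "q * p = 1"
begin

abbreviation "T \<equiv> top' q p"
abbreviation c :: "nat \<Rightarrow> (dword, 'k) lop" where "c \<equiv> cop"
abbreviation "xi \<equiv> lscal (q - p) :: (dword, 'k) lop"

text \<open>The algebra with \<open>k\<close> strands, as a set of operators; the tower is increasing in \<open>k\<close>.\<close>

inductive_set A :: "nat \<Rightarrow> (dword, 'k) lop set" for k where
  A_scal: "lscal a \<in> A k"
| A_T: "1 \<le> i \<Longrightarrow> Suc i \<le> k \<Longrightarrow> T i \<in> A k"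
| A_c: "1 \<le> i \<Longrightarrow> i \<le> k \<Longrightarrow> c i \<in> A k"
| A_add: "x \<in> A k \<Longrightarrow> y \<in> A k \<Longrightarrow> x + y \<in> A k"
| A_mult: "x \<in> A k \<Longrightarrow> y \<in> A k \<Longrightarrow> x * y \<in> A k"

lemma A_0 [simp]: "0 \<in> A k" and A_1 [simp]: "1 \<in> A k"
  using A_scal[of 0 k] A_scal[of 1 k] by auto
lemma A_uminus: "x \<in> A k \<Longrightarrow> - x \<in> A k"
  using A_mult[OF A_scal[of "-1"], of x k] by (simp add: lscal_uminus)
lemma A_diff: "x \<in> A k \<Longrightarrow> y \<in> A k \<Longrightarrow> x - y \<in> A k"
  using A_add[OF _ A_uminus, of x k y] by simp
lemma A_sum: "(\<And>i. i \<in> I \<Longrightarrow> f i \<in> A k) \<Longrightarrow> sum f I \<in> A k"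
  by (induction I rule: infinite_finite_induct) (auto intro: A_add)
lemma A_mono: "x \<in> A k \<Longrightarrow> k \<le> l \<Longrightarrow> x \<in> A l"
  by (induction rule: A.induct) (auto intro: A.intros)
lemma A_Suc: "x \<in> A k \<Longrightarrow> x \<in> A (Suc k)" by (erule A_mono) simp

lemmas A_intros = A_scal A_T A_c A_add A_mult A_0 A_1 A_uminus A_diff A_sum

lemma A_zero_eq: "x \<in> A 0 \<Longrightarrow> \<exists>a. x = lscal a"
  by (induction rule: A.induct) (auto simp: lscal_add[symmetric] lscal_mult[symmetric])

lemma T_comm_A: "x \<in> A k \<Longrightarrow> k < j \<Longrightarrow> T j * x = x * T j"
proof (induction rule: A.induct)
  case (A_add x y) then show ?case by (simp add: algebra_simps)
next
  case (A_mult x y)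
  have "T j * (x * y) = (T j * x) * y" by (simp add: mult.assoc)
  also have "\<dots> = x * (T j * y)" by (simp only: A_mult mult.assoc)
  finally show ?case by (simp only: A_mult mult.assoc)
qed (auto simp: lscal_central top_top_far[symmetric] top_cop_far)

lemma pop_sq': "pop N * (pop N * x) = x" by (simp add: mult.assoc[symmetric] pop_sq)

definition th :: "nat \<Rightarrow> (dword, 'k) lop \<Rightarrow> (dword, 'k) lop" where "th N x = pop N * x * pop N"

lemma th_add: "th N (x + y) = th N x + th N y" by (simp add: th_def algebra_simps)
lemma th_uminus: "th N (- x) = - th N x" by (simp add: th_def algebra_simps)
lemma th_mult: "th N (x * y) = th N x * th N y"
  by (simp add: th_def mult.assoc pop_sq')
lemma th_th [simp]: "th N (th N x) = x"
  by (simp add: th_def mult.assoc pop_sq' pop_sq)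
lemma th_scal [simp]: "th N (lscal a) = lscal a"
  by (simp add: th_def lscal_central[symmetric] mult.assoc pop_sq)
lemma th_0 [simp]: "th N 0 = 0" by (simp add: th_def)
lemma th_1 [simp]: "th N 1 = 1" by (simp add: th_def pop_sq)
lemma th_T: "Suc i \<le> N \<Longrightarrow> th N (T i) = T i"
  by (simp add: th_def pop_top mult.assoc pop_sq)
lemma th_c: "i \<le> N \<Longrightarrow> th N (c i) = - c i"
  by (simp add: th_def pop_cop mult.assoc pop_sq)

lemma th_A: "x \<in> A k \<Longrightarrow> k \<le> N \<Longrightarrow> th N x \<in> A k"
  by (induction rule: A.induct) (auto simp: th_add th_mult th_T th_c simp del: One_nat_def intro: A_intros)

lemma c_A: "x \<in> A k \<Longrightarrow> k < j \<Longrightarrow> k \<le> N \<Longrightarrow> c j * x = th N x * c j"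
proof (induction rule: A.induct)
  case (A_add x y) then show ?case by (simp add: algebra_simps th_add)
next
  case (A_mult x y)
  have "c j * (x * y) = (c j * x) * y" by (simp add: mult.assoc)
  also have "\<dots> = th N x * (c j * y)" using A_mult by (simp only: mult.assoc)
  also have "\<dots> = th N x * (th N y * c j)" using A_mult by simp
  finally show ?case by (simp only: th_mult mult.assoc)
next
  case (A_c i)
  then show ?case using cop_anti[of j i] by (simp add: th_c)
qed (simp_all add: lscal_central top_cop_far[symmetric] th_T)

lemma T_sq: "T i * T i = xi * T i + 1" by (rule top_quad[OF qp])
lemma Tc: "T i * c i = c (Suc i) * T i" by (rule top_cop)
lemma T_braid: "T i * T (Suc i) * T i = T (Suc i) * T i * T (Suc i)" by (rule top_braid[OF qp])

definition Ti :: "nat \<Rightarrow> (dword, 'k) lop" where "Ti i = T i - xi"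
lemma Ti_left: "Ti i * T i = 1" by (simp add: Ti_def T_sq algebra_simps)
lemma Ti_right: "T i * Ti i = 1" by (simp add: Ti_def T_sq algebra_simps lscal_central)
lemma Ti_left': "Ti i * (T i * x) = x" and Ti_right': "T i * (Ti i * x) = x"
  by (simp_all add: mult.assoc[symmetric] Ti_left Ti_right)

text \<open>Solving \<open>T c\<^sub>i = c\<^sub>i\<^sub>+\<^sub>1 T\<close> for the other order needs the inverse of \<open>T\<close>, which brings in the correction with \<open>q - q\<^sup>-\<^sup>1\<close>.\<close>

lemma Tc_Suc: "T i * c (Suc i) = c i * T i + xi * (c (Suc i) - c i)"
proof -
  have "Ti i * (T i * c i) * Ti i = Ti i * (c (Suc i) * T i) * Ti i" by (simp only: Tc)
  then have "c i * Ti i = Ti i * c (Suc i)" by (simp add: mult.assoc Ti_left' Ti_right)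
  then show ?thesis by (simp add: Ti_def algebra_simps lscal_central)
qed

text \<open>The candidates for the elements with one more strand: only one occurrence of the last generators is needed. Equality with the next layer is \<open>A_Suc_eq_B\<close>.\<close>

inductive_set B :: "nat \<Rightarrow> (dword, 'k) lop set" for m where
  B_1: "a \<in> A m \<Longrightarrow> a \<in> B m"
| B_2: "a \<in> A m \<Longrightarrow> a * c (Suc m) \<in> B m"
| B_3: "1 \<le> m \<Longrightarrow> a \<in> A m \<Longrightarrow> b \<in> A m \<Longrightarrow> a * T m * b \<in> B m"
| B_add: "x \<in> B m \<Longrightarrow> y \<in> B m \<Longrightarrow> x + y \<in> B m"

lemma B_A: "x \<in> B m \<Longrightarrow> x \<in> A (Suc m)"
proof (induction rule: B.induct)
  case (B_2 a)
  then show ?case by (intro A_mult A_c A_Suc) simp_all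
next
  case (B_3 a b)
  then show ?case using A_Suc[of a m] A_Suc[of b m] by (intro A_mult A_T) simp_all
qed (simp_all add: A_Suc A_add)

lemma B_lmult: "x \<in> B m \<Longrightarrow> a \<in> A m \<Longrightarrow> a * x \<in> B m"
  by (induction rule: B.induct)
    (simp_all add: distrib_left mult.assoc[symmetric] B.intros A_mult)

lemma B_rmult: "x \<in> B m \<Longrightarrow> y \<in> A m \<Longrightarrow> x * y \<in> B m"
proof (induction rule: B.induct)
  case (B_2 a)
  then have "a * c (Suc m) * y = (a * th (Suc m) y) * c (Suc m)"
    using c_A[of y m "Suc m" "Suc m"] by (simp add: mult.assoc)
  then show ?case using B_2 by (simp add: B.B_2 A_mult th_A)
next
  case (B_3 a b)
  then show ?case using B.B_3[of m a "b * y"] by (simp add: mult.assoc A_mult)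
qed (simp_all add: distrib_right B.intros A_mult)

text \<open>The only case with content is \<open>a T\<^sub>m b T\<^sub>m\<close>. Here \<open>b\<close> is itself reduced to one occurrence of the generators of the layer below, and the quadratic or braid relation removes the second \<open>T\<^sub>m\<close>.\<close>

lemma B_rmult_T: "x \<in> B m \<Longrightarrow> 1 \<le> m \<Longrightarrow> (\<And>m'. m = Suc m' \<Longrightarrow> A m = B m') \<Longrightarrow> x * T m \<in> B m"
proof (induction rule: B.induct)
  case (B_1 a)
  then show ?case using B.B_3[of m a 1] by simp
next
  case (B_2 a)
  have "a * c (Suc m) * T m = a * T m * c m" by (simp add: mult.assoc Tc)
  then show ?case using B.B_3[of m a "c m"] B_2 by (simp add: A_c)
next
  case (B_3 a b)
  obtain m' where m': "m = Suc m'" using B_3 by (cases m) auto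
  have m1: "1 \<le> m" "m' = m - 1" using m' by auto
  have "b \<in> B m'" using B_3 m' by auto
  then have "T m * b * T m \<in> B m"
  proof (induction rule: B.induct)
    case (B_1 b)
    have "T m * b * T m = b * (T m * T m)"
      using T_comm_A[OF B_1, of m] m' by (simp add: mult.assoc)
    also have "\<dots> = (b * xi) * T m * 1 + b"
      by (simp add: T_sq distrib_left mult.assoc)
    finally have eq: "T m * b * T m = (b * xi) * T m * 1 + b" .
    show ?case unfolding eq using A_Suc[OF B_1] m'
      by (intro B.B_add B.B_3) (simp_all add: A_mult A_scal B.B_1)
  next
    case (B_2 b)
    have "T m * (b * c m) * T m = b * (T m * c m * T m)"
      using T_comm_A[OF B_2, of m] m' by (simp add: mult.assoc[symmetric])
    also have "\<dots> = b * c (Suc m) * (xi * T m) + b * c (Suc m)"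
      by (simp add: Tc mult.assoc T_sq distrib_left)
    also have "b * c (Suc m) * (xi * T m) = (b * xi) * T m * c m"
    proof -
      have "b * c (Suc m) * (xi * T m) = b * (c (Suc m) * xi) * T m" by (simp only: mult.assoc)
      also have "\<dots> = b * (xi * c (Suc m)) * T m" by (simp only: lscal_central)
      finally show ?thesis by (simp only: mult.assoc Tc)
    qed
    finally have eq: "T m * (b * c m) * T m = (b * xi) * T m * c m + b * c (Suc m)" .
    show ?case using A_Suc[OF B_2] m1(1) unfolding m'[symmetric] eq
      by (intro B.B_add B.B_3 B.B_2) (simp_all add: A_mult A_scal A_c)
  next
    case (B_3 a b)
    have "T m * (a * T m' * b) * T m = (T m * a) * T m' * (b * T m)"
      by (simp only: mult.assoc)
    also have "\<dots> = (a * T m) * T m' * (T m * b)"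
      using T_comm_A[OF B_3(2), of m] T_comm_A[OF B_3(3), of m] m' by simp
    also have "\<dots> = a * (T m * T m' * T m) * b"
      by (simp only: mult.assoc)
    also have "\<dots> = a * (T m' * T m * T m') * b"
      using T_braid[of m'] m' by simp
    also have "\<dots> = (a * T m') * T m * (T m' * b)"
      by (simp only: mult.assoc)
    finally have eq: "T m * (a * T m' * b) * T m = (a * T m') * T m * (T m' * b)" .
    show ?case using A_Suc[OF B_3(2)] A_Suc[OF B_3(3)] B_3(1) m1(1) unfolding m'[symmetric] eq
      by (intro B.B_3) (simp_all add: A_mult A_T m')
  next
    case (B_add x y)
    then show ?case by (simp add: distrib_left distrib_right B.B_add)
  qed
  then show ?case using B_lmult[of _ m a] B_3 by (simp add: mult.assoc)
next
  case (B_add x y)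
  then show ?case by (simp add: distrib_right B.B_add)
qed

lemma B_rmult_c: "x \<in> B m \<Longrightarrow> x * c (Suc m) \<in> B m"
proof (induction rule: B.induct)
  case (B_1 a)
  then show ?case by (rule B.B_2)
next
  case (B_2 a)
  have "a * c (Suc m) * c (Suc m) = - a" by (simp add: mult.assoc cop_sq)
  then show ?case using B_2 by (simp add: B.B_1 A_uminus)
next
  case (B_3 a b)
  define b' where "b' = th (Suc m) b"
  have b': "b' \<in> A m" "b * c (Suc m) = c (Suc m) * b'" using B_3
    by (auto simp: b'_def th_A c_A[of _ m "Suc m" "Suc m"])
  have "a * T m * b * c (Suc m) = a * (T m * c (Suc m)) * b'"
    by (simp add: mult.assoc b')
  also have "\<dots> = (a * c m) * T m * b' + (a * xi * b) * c (Suc m) - a * xi * c m * b'"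
    by (simp add: Tc_Suc algebra_simps b'(2)[symmetric])
  also have "\<dots> = (a * c m) * T m * b' + (a * xi * b) * c (Suc m) + (- (a * xi * c m * b'))" by simp
  finally have eq: "a * T m * b * c (Suc m) = \<dots>" .
  show ?case using B_3 b' unfolding eq
    by (intro B.B_add B.B_3 B.B_2 B.B_1[of "- _"]) (simp_all add: A_uminus A_mult A_scal A_c)
next
  case (B_add x y)
  then show ?case by (simp add: distrib_right B.B_add)
qed

text \<open>The set \<open>B m\<close> contains 1 and is stable under right multiplication by every generator. The induction is needed because \<open>T\<^sub>m\<close> is moved past elements of the layer below in their own reduced form.\<close>

lemma A_Suc_eq_B: "A (Suc m) = B m"
proof (induction m)
  case (Suc m) note IH = this
  have "x * y \<in> B (Suc m)" if "y \<in> A (Suc (Suc m))" "x \<in> B (Suc m)" for x y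
    using that
  proof (induction y arbitrary: x rule: A.induct)
    case (A_T i)
    then show ?case
      using B_rmult_T[of x "Suc m"] B_rmult[of x "Suc m" "T i"] A.A_T[of i "Suc m"] IH
      by (cases "i = Suc m") auto
  next
    case (A_c i)
    then show ?case
      using B_rmult_c[of x "Suc m"] B_rmult[of x "Suc m" "c i"] A.A_c[of i "Suc m"]
      by (cases "i = Suc (Suc m)") auto
  next
    case (A_scal a)
    then show ?case by (auto intro: B_rmult A.A_scal)
  qed (auto simp: distrib_left mult.assoc[symmetric] intro: B.B_add)
  from this[of _ 1] B_1[OF A_1] show ?case using B_A by auto
next
  case 0
  have "x * y \<in> B 0" if "y \<in> A (Suc 0)" "x \<in> B 0" for x y
    using that
  proof (induction y arbitrary: x rule: A.induct)
    case (A_c i)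
    then show ?case
      using B_rmult_c[of x "0"] B_rmult[of x "0" "c i"] A.A_c[of i "0"]
      by (cases "i = Suc 0") auto
  next
    case (A_scal a)
    then show ?case by (auto intro: B_rmult A.A_scal)
  qed (auto simp: distrib_left mult.assoc[symmetric] intro: B.B_add)
  from this[of _ 1] B_1[OF A_1] show ?case using B_A by auto
qed

end

section \<open>One layer of the tower is free over the previous one\<close>

context hecke_clifford begin

text \<open>Coset representatives \<open>T\<^sub>k\<^sub>-\<^sub>1 \<cdots> T\<^sub>j c\<^sub>j\<^sup>d\<close> for one layer over the previous one; on words, \<open>X k j d\<close> brings the letter at position \<open>j\<close> to position \<open>k\<close> and marks it according to \<open>d\<close>.\<close>

fun X :: "nat \<Rightarrow> nat \<Rightarrow> bool \<Rightarrow> (dword, 'k) lop" where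
  "X 0 j d = 1"
| "X (Suc m) j d = (if j = Suc m then (if d then c j else 1) else T m * X m j d)"

lemma X_A: "1 \<le> j \<Longrightarrow> j \<le> k \<Longrightarrow> X k j d \<in> A k"
proof (induction k)
  case (Suc m)
  show ?case
  proof (cases "j = Suc m")
    case False
    then have "X m j d \<in> A (Suc m)" "T m \<in> A (Suc m)"
      using Suc A_Suc[of "X m j d" m] by (simp_all add: A_T)
    then show ?thesis using False by (simp add: A_mult)
  qed (simp add: A_c)
qed simp

definition xidx :: "nat \<Rightarrow> (nat \<times> bool) set" where "xidx k = {1..k} \<times> UNIV"

lemma finite_xidx [simp]: "finite (xidx k)" by (simp add: xidx_def)

lemma xidx_Suc: "xidx (Suc m) = insert (Suc m, False) (insert (Suc m, True) (xidx m))"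
  unfolding xidx_def by (auto simp: le_Suc_eq)

lemma xidx_notin: "(Suc m, d) \<notin> xidx m" by (simp add: xidx_def)

lemma sum_xidx_Suc: "(\<Sum>i\<in>xidx (Suc m). f i) = (\<Sum>i\<in>xidx m. f i) + f (Suc m, False) + f (Suc m, True)"
  unfolding xidx_Suc by (simp add: xidx_notin algebra_simps)

text \<open>This is \<open>A_Suc_eq_B\<close> iterated: in \<open>a T\<^sub>m b\<close> the factor \<open>b\<close> is expanded into coset representatives of the layer below.\<close>

lemma A_X_decomp: "x \<in> A (Suc m) \<Longrightarrow> \<exists>a. (\<forall>i\<in>xidx (Suc m). a i \<in> A m) \<and> x = (\<Sum>i\<in>xidx (Suc m). a i * X (Suc m) (fst i) (snd i))"
proof (induction m arbitrary: x)
  have dec_add: "\<exists>a. (\<forall>i\<in>xidx (Suc m). a i \<in> A m) \<and> x + y = (\<Sum>i\<in>xidx (Suc m). a i * X (Suc m) (fst i) (snd i))"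
    if "\<exists>a. (\<forall>i\<in>xidx (Suc m). a i \<in> A m) \<and> x = (\<Sum>i\<in>xidx (Suc m). a i * X (Suc m) (fst i) (snd i))"
       "\<exists>a. (\<forall>i\<in>xidx (Suc m). a i \<in> A m) \<and> y = (\<Sum>i\<in>xidx (Suc m). a i * X (Suc m) (fst i) (snd i))"
     for m x y
  proof -
    from that obtain a b where "\<forall>i\<in>xidx (Suc m). a i \<in> A m" "x = (\<Sum>i\<in>xidx (Suc m). a i * X (Suc m) (fst i) (snd i))"
       "\<forall>i\<in>xidx (Suc m). b i \<in> A m" "y = (\<Sum>i\<in>xidx (Suc m). b i * X (Suc m) (fst i) (snd i))" by blast
    then show ?thesis
      by (intro exI[of _ "\<lambda>i. a i + b i"]) (simp add: A_add distrib_right sum.distrib)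
  qed
  have dec_1: "\<exists>a. (\<forall>i\<in>xidx (Suc m). a i \<in> A m) \<and> x = (\<Sum>i\<in>xidx (Suc m). a i * X (Suc m) (fst i) (snd i))"
    if "x \<in> A m" for x m
    using that by (intro exI[of _ "\<lambda>i. if i = (Suc m, False) then x else 0"])
      (auto simp: sum_xidx_Suc xidx_notin intro!: sum.neutral)
  have dec_2: "\<exists>a. (\<forall>i\<in>xidx (Suc m). a i \<in> A m) \<and> x * c (Suc m) = (\<Sum>i\<in>xidx (Suc m). a i * X (Suc m) (fst i) (snd i))"
    if "x \<in> A m" for x m
    using that by (intro exI[of _ "\<lambda>i. if i = (Suc m, True) then x else 0"])
      (auto simp: sum_xidx_Suc xidx_notin intro!: sum.neutral)
  {
    case 0
    then have "x \<in> B 0" by (simp add: A_Suc_eq_B)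
    then show ?case
    proof (induction rule: B.induct)
      case (B_1 a) then show ?case by (rule dec_1)
    next
      case (B_2 a) then show ?case by (rule dec_2)
    next
      case (B_add x y) show ?case by (rule dec_add) fact+
    qed simp
  next
    case (Suc m)
    then have "x \<in> B (Suc m)" by (simp add: A_Suc_eq_B)
    then show ?case
    proof (induction rule: B.induct)
      case (B_3 a b)
      from Suc.IH[OF B_3(3)] obtain d where d: "\<And>i. i \<in> xidx (Suc m) \<Longrightarrow> d i \<in> A m"
         "b = (\<Sum>i\<in>xidx (Suc m). d i * X (Suc m) (fst i) (snd i))" by blast
      define e where "e = (\<lambda>i. if i \<in> xidx (Suc m) then a * d i else 0)"
      have "a * T (Suc m) * b = (\<Sum>i\<in>xidx (Suc m). a * (T (Suc m) * d i) * X (Suc m) (fst i) (snd i))"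
        unfolding d(2) by (simp add: sum_distrib_left mult.assoc)
      also have "\<dots> = (\<Sum>i\<in>xidx (Suc m). a * d i * (T (Suc m) * X (Suc m) (fst i) (snd i)))"
        by (rule sum.cong) (simp_all add: T_comm_A[OF d(1)] mult.assoc)
      also have "\<dots> = (\<Sum>i\<in>xidx (Suc m). e i * X (Suc (Suc m)) (fst i) (snd i))"
        by (rule sum.cong) (auto simp: e_def xidx_def)
      also have "\<dots> = (\<Sum>i\<in>xidx (Suc (Suc m)). e i * X (Suc (Suc m)) (fst i) (snd i))"
        by (subst (2) sum_xidx_Suc) (simp add: e_def xidx_notin)
      finally have eq: "a * T (Suc m) * b = (\<Sum>i\<in>xidx (Suc (Suc m)). e i * X (Suc (Suc m)) (fst i) (snd i))" .
      have "e i \<in> A (Suc m)" for i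
        using A_mult[OF B_3(2) A_Suc[OF d(1)]] by (simp add: e_def)
      then show ?case using eq by blast
    next
      case (B_1 a) then show ?case by (rule dec_1)
    next
      case (B_2 a) then show ?case by (rule dec_2)
    next
      case (B_add x y) show ?case by (rule dec_add) fact+
    qed
  }
qed

text \<open>On a word whose letters increase and carry no dots, no correction term of a Hecke generator occurs, so the coset representatives act by moving letters.\<close>

definition inc :: "dword \<Rightarrow> nat \<Rightarrow> bool" where
  "inc w k \<longleftrightarrow> (\<forall>i\<le>k. \<not> snd (w i)) \<and> (\<forall>i j. 1 \<le> i \<longrightarrow> i < j \<longrightarrow> j \<le> k \<longrightarrow> fst (w i) < fst (w j))"

fun mv :: "dword \<Rightarrow> nat \<Rightarrow> nat \<Rightarrow> bool \<Rightarrow> dword" where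
  "mv w 0 j d = w"
| "mv w (Suc m) j d = (if j = Suc m then w(j := (fst (w j), d)) else (mv w m j d)(m := w (Suc m), Suc m := (fst (w j), d)))"

lemma mv_gt: "1 \<le> j \<Longrightarrow> j \<le> k \<Longrightarrow> k < l \<Longrightarrow> mv w k j d l = w l"
  by (induction k) auto

lemma mv_at: "1 \<le> j \<Longrightarrow> j \<le> k \<Longrightarrow> mv w k j d k = (fst (w j), d)"
  by (cases k) auto

lemma mv_lt: "1 \<le> j \<Longrightarrow> j \<le> k \<Longrightarrow> l < k \<Longrightarrow> mv w k j d l = (if l < j then w l else w (Suc l))"
proof (induction k)
  case (Suc k) then show ?case by (cases "l < k") (auto simp: less_Suc_eq)
qed simp

lemma inc_mv: "inc w (Suc m) \<Longrightarrow> 1 \<le> j \<Longrightarrow> j \<le> Suc m \<Longrightarrow> inc (mv w (Suc m) j d) m"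
  unfolding inc_def by (auto simp: mv_lt simp del: mv.simps)

lemma app_X: "1 \<le> j \<Longrightarrow> j \<le> k \<Longrightarrow> inc w k \<Longrightarrow> app (X k j d) \<phi> w = \<phi> (mv w k j d)"
proof (induction k arbitrary: \<phi>)
  case (Suc m)
  show ?case
  proof (cases "j = Suc m")
    case True
    have "wsg w (Suc m) = (1 :: 'k)"
      unfolding wsg_def using Suc.prems by (intro prod.neutral) (auto simp: inc_def)
    moreover have "w(Suc m := (fst (w (Suc m)), False)) = w"
      using Suc.prems by (intro ext) (auto simp: inc_def prod_eq_iff)
    ultimately show ?thesis using True Suc.prems
      by (cases d) (auto simp: op_app inc_def simp del: fun_upd_apply)
  next
    case False
    then have j: "j \<le> m" using Suc.prems by simp
    have lt: "fst (w j) < fst (w (Suc m))" and nd: "\<not> snd (w (Suc m))"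
      using Suc.prems j by (auto simp: inc_def)
    then obtain b where b: "w (Suc m) = (b, False)" "fst (w j) < b" by (cases "w (Suc m)") auto
    have inc: "inc w m" using Suc.prems by (auto simp: inc_def)
    have "app (X (Suc m) j d) \<phi> w = app (T m) \<phi> (mv w m j d)"
      using False Suc.IH[of "app (T m) \<phi>"] Suc.prems j inc by (simp add: op_app(3-) times_lop.rep_eq del: top'.rep_eq)
    also have "\<dots> = \<phi> ((mv w m j d)(m := w (Suc m), Suc m := (fst (w j), d)))"
      using b Suc.prems j by (cases d) (simp_all add: app_top' mv_at mv_gt tker_cases hker_cases)
    finally show ?thesis using False by (simp del: fun_upd_apply)
  qed
qed simp

lemma app_A_local:
  assumes "x \<in> A m" and "\<And>w i y. 1 \<le> i \<Longrightarrow> i \<le> m \<Longrightarrow> g (w(i := y)) = g w"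
  shows "app x (\<lambda>w. g w * \<phi> w) w = g w * app x \<phi> w"
  using assms(1)
proof (induction arbitrary: \<phi> w rule: A.induct)
  case (A_T i)
  have "g (w(i := x, Suc i := y)) = g w" for x y using A_T assms(2) by simp
  then have "app (T i) (\<lambda>w. g w * \<phi> w) w = tker q p (\<lambda>x y. \<phi> (w(i := x, Suc i := y)) * g w) (w i) (w (Suc i))"
    unfolding app_top' by (simp add: mult.commute)
  also have "\<dots> = tker q p (\<lambda>x y. \<phi> (w(i := x, Suc i := y))) (w i) (w (Suc i)) * g w"
    by (rule tker_scale)
  finally show ?case by (simp only: app_top' mult.commute)
next
  case (A_mult x y)
  then show ?case by (simp add: times_lop.rep_eq)
       (metis (no_types, lifting) A_mult.IH ext)
qed (auto simp: op_app assms(2) algebra_simps)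

text \<open>After the representative has acted, position \<open>m + 1\<close> holds a letter that identifies the representative, and elements of \<open>A m\<close> do not touch that position. Test functions concentrated on one value there pick out a single coefficient.\<close>

lemma A_X_coeff_divisible:
  assumes a: "\<And>i. i \<in> xidx (Suc m) \<Longrightarrow> a i \<in> A m"
    and dvd: "\<And>\<phi>. d dvd app (\<Sum>i\<in>xidx (Suc m). a i * X (Suc m) (fst i) (snd i)) \<phi> w"
    and inc: "inc w (Suc m)" and i: "i \<in> xidx (Suc m)"
  shows "d dvd app (a i) \<phi> (mv w (Suc m) (fst i) (snd i))"
proof -
  have inj: "i' = i" if "i' \<in> xidx (Suc m)" "(fst (w (fst i')), snd i') = (fst (w (fst i)), snd i)" for i'
  proof -
    have "fst (w (fst i')) = fst (w (fst i))" using that by simp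
    moreover have "fst (w (fst i')) \<noteq> fst (w (fst i))" if "fst i' \<noteq> fst i"
    proof -
      have "1 \<le> fst i" "fst i \<le> Suc m" "1 \<le> fst i'" "fst i' \<le> Suc m"
        using i \<open>i' \<in> _\<close> by (auto simp: xidx_def)
      moreover have "fst i < fst i' \<or> fst i' < fst i" using that by linarith
      ultimately have "fst (w (fst i')) < fst (w (fst i)) \<or> fst (w (fst i)) < fst (w (fst i'))"
        using inc unfolding inc_def by blast
      then show ?thesis by auto
    qed
    ultimately show ?thesis using that by (auto simp: prod_eq_iff)
  qed
  have sumapp: "app (\<Sum>i\<in>I. f i) \<phi> w = (\<Sum>i\<in>I. app (f i) \<phi> w)" for I \<phi> and w :: dword and f :: "nat \<times> bool \<Rightarrow> (dword, 'k) lop"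
    by (induction I rule: infinite_finite_induct) (auto simp: op_app)
  define g :: "dword \<Rightarrow> 'k" where "g = (\<lambda>u. if u (Suc m) = (fst (w (fst i)), snd i) then 1 else 0)"
  have trm: "app (a i' * X (Suc m) (fst i') (snd i')) (\<lambda>u. g u * \<phi> u) w =
     (if i' = i then app (a i) \<phi> (mv w (Suc m) (fst i) (snd i)) else 0)" if i': "i' \<in> xidx (Suc m)" for i'
  proof -
    have j: "1 \<le> fst i'" "fst i' \<le> Suc m" using i' by (auto simp: xidx_def)
    have "app (a i' * X (Suc m) (fst i') (snd i')) (\<lambda>u. g u * \<phi> u) w = app (a i') (\<lambda>u. g u * \<phi> u) (mv w (Suc m) (fst i') (snd i'))"
      unfolding times_lop.rep_eq by (rule app_X[OF j inc])
    also have "\<dots> = g (mv w (Suc m) (fst i') (snd i')) * app (a i') \<phi> (mv w (Suc m) (fst i') (snd i'))"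
      by (rule app_A_local[OF a[OF i']]) (auto simp: g_def)
    also have "g (mv w (Suc m) (fst i') (snd i')) = (if i' = i then 1 else 0)"
      using inj[OF i'] unfolding g_def mv_at[OF j] by auto
    finally show ?thesis by simp
  qed
  have "app (\<Sum>i\<in>xidx (Suc m). a i * X (Suc m) (fst i) (snd i)) (\<lambda>u. g u * \<phi> u) w
      = (\<Sum>i'\<in>xidx (Suc m). if i' = i then app (a i) \<phi> (mv w (Suc m) (fst i) (snd i)) else 0)"
    unfolding sumapp by (rule sum.cong) (simp_all only: trm)
  also have "\<dots> = app (a i) \<phi> (mv w (Suc m) (fst i) (snd i))" using i by simp
  finally show ?thesis using dvd[of "\<lambda>u. g u * \<phi> u"] by (simp only:)
qed

text \<open>With \<open>d = 0\<close> this says that an element is determined by its action on one increasing undotted word.\<close>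

lemma A_divisible:
  "x \<in> A k \<Longrightarrow> (\<And>\<phi>. d dvd app x \<phi> w) \<Longrightarrow> inc w k \<Longrightarrow> \<exists>y\<in>A k. x = lscal d * y"
proof (induction k arbitrary: x w)
  case 0
  then obtain a where a: "x = lscal a" using A_zero_eq by blast
  have "app x (\<lambda>w. 1) w = a" by (simp add: a lscal.rep_eq)
  then have "d dvd a" using "0.prems"(2)[of "\<lambda>w. 1"] by simp
  then obtain b where "a = d * b" by (auto elim: dvdE)
  then have "x = lscal d * lscal b" using a by (simp add: lscal_mult)
  then show ?case using A_scal by blast
next
  case (Suc m)
  obtain a where a: "\<And>i. i \<in> xidx (Suc m) \<Longrightarrow> a i \<in> A m"
    and x: "x = (\<Sum>i\<in>xidx (Suc m). a i * X (Suc m) (fst i) (snd i))"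
    using A_X_decomp[OF Suc.prems(1)] by blast
  have "\<exists>y\<in>A m. a i = lscal d * y" if i: "i \<in> xidx (Suc m)" for i
  proof (rule Suc.IH[OF a[OF i]])
    show "inc (mv w (Suc m) (fst i) (snd i)) m"
      using i Suc.prems(3) by (intro inc_mv) (auto simp: xidx_def)
    show "d dvd app (a i) \<phi> (mv w (Suc m) (fst i) (snd i))" for \<phi>
      using A_X_coeff_divisible[where a = a and d = d and w = w, OF a _ Suc.prems(3) i] Suc.prems(2)[unfolded x] by blast
  qed
  then obtain y where y: "\<And>i. i \<in> xidx (Suc m) \<Longrightarrow> y i \<in> A m \<and> a i = lscal d * y i" by metis
  have "x = lscal d * (\<Sum>i\<in>xidx (Suc m). y i * X (Suc m) (fst i) (snd i))"
    unfolding x sum_distrib_left by (rule sum.cong) (simp_all add: y mult.assoc del: X.simps)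
  moreover have "(\<Sum>i\<in>xidx (Suc m). y i * X (Suc m) (fst i) (snd i)) \<in> A (Suc m)"
    using y by (intro A_sum A_mult X_A A_Suc) (auto simp: xidx_def)
  ultimately show ?case by blast
qed

end

section \<open>The conditional expectation\<close>

context hecke_clifford begin

text \<open>This is divisibility by zero of every coefficient.\<close>

lemma X_unique:
  assumes "\<And>i. i \<in> xidx (Suc m) \<Longrightarrow> a i \<in> A m"
    and "(\<Sum>i\<in>xidx (Suc m). a i * X (Suc m) (fst i) (snd i)) = 0" and "i \<in> xidx (Suc m)"
  shows "a i = 0"
proof -
  define w0 :: dword where "w0 = (\<lambda>j. (j, False))"
  have inc: "inc w0 (Suc m)" by (simp add: inc_def w0_def)
  have "0 dvd app (a i) \<phi> (mv w0 (Suc m) (fst i) (snd i))" for \<phi>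
    by (rule A_X_coeff_divisible[OF assms(1) _ inc assms(3)]) (simp_all only: assms(2), simp add: app_simps)
  moreover have "inc (mv w0 (Suc m) (fst i) (snd i)) m"
    using assms(3) by (intro inc_mv[OF inc]) (auto simp: xidx_def)
  ultimately obtain y where "a i = lscal 0 * y"
    using A_divisible[OF assms(1)[OF assms(3)], of 0] by blast
  then show ?thesis by simp
qed

text \<open>The choice of coefficients is harmless by \<open>X_unique\<close>. The sum runs over \<open>xidx m\<close> only: the representatives with index \<open>m + 1\<close> are dropped, and from the others the leading \<open>T\<^sub>m\<close> is removed.\<close>

definition eps :: "nat \<Rightarrow> (dword, 'k) lop \<Rightarrow> (dword, 'k) lop" where
  "eps k x = (let m = k - 1; a = (SOME a. (\<forall>i\<in>xidx (Suc m). a i \<in> A m) \<and>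
       x = (\<Sum>i\<in>xidx (Suc m). a i * X (Suc m) (fst i) (snd i)))
     in \<Sum>i\<in>xidx m. a i * X m (fst i) (snd i))"

lemma eps_eq:
  assumes "\<And>i. i \<in> xidx (Suc m) \<Longrightarrow> a i \<in> A m"
    and x: "x = (\<Sum>i\<in>xidx (Suc m). a i * X (Suc m) (fst i) (snd i))"
  shows "eps (Suc m) x = (\<Sum>i\<in>xidx m. a i * X m (fst i) (snd i))"
proof -
  define b where "b = (SOME a. (\<forall>i\<in>xidx (Suc m). a i \<in> A m) \<and>
       x = (\<Sum>i\<in>xidx (Suc m). a i * X (Suc m) (fst i) (snd i)))"
  have "(\<forall>i\<in>xidx (Suc m). b i \<in> A m) \<and> x = (\<Sum>i\<in>xidx (Suc m). b i * X (Suc m) (fst i) (snd i))"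
    unfolding b_def by (rule someI[of _ a]) (use assms in auto)
  then have b: "\<And>i. i \<in> xidx (Suc m) \<Longrightarrow> b i \<in> A m" "x = (\<Sum>i\<in>xidx (Suc m). b i * X (Suc m) (fst i) (snd i))"
    by auto
  have "(\<Sum>i\<in>xidx (Suc m). (a i - b i) * X (Suc m) (fst i) (snd i)) = 0"
    using x b(2) by (simp add: left_diff_distrib sum_subtractf)
  then have "a i - b i = 0" if "i \<in> xidx (Suc m)" for i
    using X_unique[where a = "\<lambda>i. a i - b i", OF A_diff[OF assms(1) b(1)] _ that] by blast
  then have "a i = b i" if "i \<in> xidx m" for i
    using that by (auto simp: xidx_def)
  then show ?thesis unfolding eps_def Let_def b_def[symmetric] diff_Suc_1
    by (intro sum.cong) auto
qed

lemma eps_add: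
  assumes "x \<in> A (Suc m)" "y \<in> A (Suc m)"
  shows "eps (Suc m) (x + y) = eps (Suc m) x + eps (Suc m) y"
proof -
  obtain a b where a: "\<And>i. i \<in> xidx (Suc m) \<Longrightarrow> a i \<in> A m" "x = (\<Sum>i\<in>xidx (Suc m). a i * X (Suc m) (fst i) (snd i))"
    and b: "\<And>i. i \<in> xidx (Suc m) \<Longrightarrow> b i \<in> A m" "y = (\<Sum>i\<in>xidx (Suc m). b i * X (Suc m) (fst i) (snd i))"
    using A_X_decomp[OF assms(1)] A_X_decomp[OF assms(2)] by blast
  have xy: "x + y = (\<Sum>i\<in>xidx (Suc m). (a i + b i) * X (Suc m) (fst i) (snd i))"
    unfolding a(2) b(2) by (simp add: distrib_right sum.distrib)
  have "eps (Suc m) (x + y) = (\<Sum>i\<in>xidx m. (a i + b i) * X m (fst i) (snd i))"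
    by (rule eps_eq[OF _ xy]) (use a(1) b(1) A_add in auto)
  then show ?thesis using eps_eq[OF a] eps_eq[OF b] by (simp add: distrib_right sum.distrib)
qed

lemma eps_lmult:
  assumes "x \<in> A (Suc m)" "z \<in> A m"
  shows "eps (Suc m) (z * x) = z * eps (Suc m) x"
proof -
  obtain a where a: "\<And>i. i \<in> xidx (Suc m) \<Longrightarrow> a i \<in> A m" "x = (\<Sum>i\<in>xidx (Suc m). a i * X (Suc m) (fst i) (snd i))"
    using A_X_decomp[OF assms(1)] by blast
  have zx: "z * x = (\<Sum>i\<in>xidx (Suc m). (z * a i) * X (Suc m) (fst i) (snd i))"
    unfolding a(2) by (simp add: sum_distrib_left mult.assoc)
  have "eps (Suc m) (z * x) = (\<Sum>i\<in>xidx m. (z * a i) * X m (fst i) (snd i))"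
    by (rule eps_eq[OF _ zx]) (use a(1) assms A_mult in auto)
  then show ?thesis using eps_eq[OF a] by (simp add: sum_distrib_left mult.assoc)
qed

lemma eps_A: "x \<in> A (Suc m) \<Longrightarrow> eps (Suc m) x \<in> A m"
proof -
  assume x: "x \<in> A (Suc m)"
  obtain a where a: "\<And>i. i \<in> xidx (Suc m) \<Longrightarrow> a i \<in> A m" "x = (\<Sum>i\<in>xidx (Suc m). a i * X (Suc m) (fst i) (snd i))"
    using A_X_decomp[OF x] by blast
  have "(\<Sum>i\<in>xidx m. a i * X m (fst i) (snd i)) \<in> A m"
    using a(1) by (intro A_sum A_mult) (auto simp: xidx_def intro: X_A)
  then show ?thesis using eps_eq[OF a] by simp
qed

lemma eps_B1: assumes "a \<in> A m" shows "eps (Suc m) a = 0"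
proof -
  define e where "e = (\<lambda>i. if i = (Suc m, False) then a else 0)"
  have a: "a = (\<Sum>i\<in>xidx (Suc m). e i * X (Suc m) (fst i) (snd i))"
    by (auto simp: sum_xidx_Suc xidx_notin e_def intro!: sum.neutral)
  have "eps (Suc m) a = (\<Sum>i\<in>xidx m. e i * X m (fst i) (snd i))"
    by (rule eps_eq[OF _ a]) (use assms in \<open>auto simp: e_def\<close>)
  also have "\<dots> = 0" by (rule sum.neutral) (auto simp: e_def xidx_notin)
  finally show ?thesis .
qed

lemma eps_B2: assumes "a \<in> A m" shows "eps (Suc m) (a * c (Suc m)) = 0"
proof -
  define e where "e = (\<lambda>i. if i = (Suc m, True) then a else 0)"
  have a: "a * c (Suc m) = (\<Sum>i\<in>xidx (Suc m). e i * X (Suc m) (fst i) (snd i))"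
    by (auto simp: sum_xidx_Suc xidx_notin e_def intro!: sum.neutral)
  have "eps (Suc m) (a * c (Suc m)) = (\<Sum>i\<in>xidx m. e i * X m (fst i) (snd i))"
    by (rule eps_eq[OF _ a]) (use assms in \<open>auto simp: e_def\<close>)
  also have "\<dots> = 0" by (rule sum.neutral) (auto simp: e_def xidx_notin)
  finally show ?thesis .
qed

lemma eps_B3: assumes "1 \<le> m" "a \<in> A m" "b \<in> A m" shows "eps (Suc m) (a * T m * b) = a * b"
proof -
  obtain m' where m': "m = Suc m'" using assms by (cases m) auto
  obtain d where d: "\<And>i. i \<in> xidx m \<Longrightarrow> d i \<in> A m'"
     "b = (\<Sum>i\<in>xidx m. d i * X m (fst i) (snd i))" using A_X_decomp[of b m'] assms m' by blast
  define e where "e = (\<lambda>i. if i \<in> xidx m then a * d i else 0)"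
  have "a * T m * b = (\<Sum>i\<in>xidx m. a * (T m * d i) * X m (fst i) (snd i))"
    unfolding d(2) by (simp add: sum_distrib_left mult.assoc)
  also have "\<dots> = (\<Sum>i\<in>xidx m. a * d i * (T m * X m (fst i) (snd i)))"
    by (rule sum.cong) (simp_all add: T_comm_A[OF d(1)] m' mult.assoc)
  also have "\<dots> = (\<Sum>i\<in>xidx m. e i * X (Suc m) (fst i) (snd i))"
    by (rule sum.cong) (auto simp: e_def xidx_def)
  also have "\<dots> = (\<Sum>i\<in>xidx (Suc m). e i * X (Suc m) (fst i) (snd i))"
    by (subst sum_xidx_Suc) (simp add: e_def xidx_notin)
  finally have "eps (Suc m) (a * T m * b) = (\<Sum>i\<in>xidx m. e i * X m (fst i) (snd i))"
    by (rule eps_eq[rotated]) (use assms d(1) m' A_Suc in \<open>auto simp: e_def intro!: A_mult\<close>)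
  also have "\<dots> = a * b"
    unfolding d(2) sum_distrib_left by (rule sum.cong) (auto simp: e_def mult.assoc)
  finally show ?thesis .
qed

text \<open>Immediate from the three defining values once \<open>A_Suc_eq_B\<close> is available; with \<open>eps_lmult\<close> this makes \<open>eps\<close> a bimodule map.\<close>

lemma eps_rmult: "x \<in> A (Suc m) \<Longrightarrow> y \<in> A m \<Longrightarrow> eps (Suc m) (x * y) = eps (Suc m) x * y"
  unfolding A_Suc_eq_B
proof (induction rule: B.induct)
  case (B_2 a)
  have "a * c (Suc m) * y = (a * th (Suc m) y) * c (Suc m)"
    using c_A[of y m "Suc m" "Suc m"] B_2 by (simp add: mult.assoc)
  then show ?case using B_2 eps_B2[of "a * th (Suc m) y" m] by (simp add: eps_B2 A_mult th_A)
next
  case (B_3 a b)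
  then show ?case using eps_B3[of m a "b * y"] by (simp add: mult.assoc[symmetric] eps_B3 A_mult)
next
  case (B_add x x')
  then show ?case using B_rmult by (simp add: distrib_right eps_add A_Suc_eq_B)
qed (simp add: eps_B1 A_mult)

lemma eps_th: "x \<in> A (Suc m) \<Longrightarrow> Suc m \<le> N \<Longrightarrow> eps (Suc m) (th N x) = th N (eps (Suc m) x)"
  unfolding A_Suc_eq_B
proof (induction rule: B.induct)
  case (B_2 a)
  have "- th N a \<in> A m" using B_2 by (simp add: A_uminus th_A)
  from eps_B2[OF this] show ?case using B_2 by (simp add: th_mult th_c eps_B2)
next
  case (B_add x x')
  then show ?case using th_A[of x "Suc m" N] th_A[of x' "Suc m" N]
     by (simp add: th_add eps_add A_Suc_eq_B)
qed (simp_all add: th_mult th_T eps_B1 eps_B3 th_A)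

lemma eps_scal: "x \<in> A (Suc m) \<Longrightarrow> eps (Suc m) (lscal a * x) = lscal a * eps (Suc m) x"
  by (rule eps_lmult) (auto intro: A_scal)

lemma eps_diff: "x \<in> A (Suc m) \<Longrightarrow> y \<in> A (Suc m) \<Longrightarrow> eps (Suc m) (x - y) = eps (Suc m) x - eps (Suc m) y"
  using eps_add[of "x - y" m y] A_diff[of x "Suc m" y] by simp

text \<open>Moving \<open>c\<close> cyclically, with the parity automorphism, does not change \<open>eps\<close>; this becomes the relation \<open>e c\<^sub>r = e c\<^sub>1\<^sup>*\<close>.\<close>

lemma eps_c_trace: "x \<in> A (Suc m) \<Longrightarrow> eps (Suc m) (c (Suc m) * x) = eps (Suc m) (th (Suc m) x * c (Suc m))"
  unfolding A_Suc_eq_B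
proof (induction rule: B.induct)
  case (B_1 a)
  then show ?case by (simp add: c_A[of a m _ "Suc m"])
next
  case (B_2 a)
  then have 1: "c (Suc m) * (a * c (Suc m)) = - th (Suc m) a"
    by (simp add: mult.assoc[symmetric] c_A[of a m _ "Suc m"]) (simp add: mult.assoc cop_sq)
  have 2: "th (Suc m) (a * c (Suc m)) * c (Suc m) = th (Suc m) a"
    by (simp add: th_mult th_c mult.assoc cop_sq)
  show ?case unfolding 1 2 using B_2 by (simp add: eps_B1 A_uminus th_A)
next
  case (B_3 a b)
  let ?t = "th (Suc m)"
  have 1: "c (Suc m) * (a * T m * b) = ?t a * T m * (c m * b)"
  proof -
    have "c (Suc m) * (a * T m * b) = (c (Suc m) * a) * T m * b" by (simp only: mult.assoc)
    also have "\<dots> = ?t a * (c (Suc m) * T m) * b" using B_3 c_A[of a m "Suc m" "Suc m"] by (simp add: mult.assoc)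
    also have "\<dots> = ?t a * (T m * c m) * b" by (simp only: Tc)
    finally show ?thesis by (simp only: mult.assoc)
  qed
  have 2: "?t (a * T m * b) * c (Suc m) = ?t a * T m * (c m * b) + ?t (?t a * xi) * c (Suc m) * 0
        + ?t a * T m * 0 + ((?t a * xi * ?t b) * c (Suc m) - ?t a * xi * c m * b + (?t a * c m * T m * b - ?t a * T m * (c m * b)))"
  proof -
    have "?t (a * T m * b) * c (Suc m) = ?t a * T m * (?t b * c (Suc m))"
      by (simp add: th_mult th_T mult.assoc)
    also have "?t b * c (Suc m) = c (Suc m) * b" using B_3 c_A[of b m "Suc m" "Suc m"] by simp
    also have "?t a * T m * (c (Suc m) * b) = ?t a * (T m * c (Suc m)) * b" by (simp only: mult.assoc)
    also have "\<dots> = ?t a * c m * T m * b + ?t a * xi * (c (Suc m) * b) - ?t a * xi * c m * b"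
      by (simp add: Tc_Suc algebra_simps)
    also have "c (Suc m) * b = ?t b * c (Suc m)" using B_3 c_A[of b m "Suc m" "Suc m"] by simp
    finally show ?thesis by (simp add: algebra_simps)
  qed
  have m: "c m \<in> A m" "?t a \<in> A m" "?t b \<in> A m" using B_3 by (simp_all add: A_c th_A)
  have 3: "?t (a * T m * b) * c (Suc m) = (?t a * c m) * T m * b + (?t a * xi * ?t b) * c (Suc m) - ?t a * xi * c m * b"
    unfolding 2 by (simp add: algebra_simps)
  have in3: "(?t a * c m) * T m * b \<in> A (Suc m)" "(?t a * xi * ?t b) * c (Suc m) \<in> A (Suc m)" "?t a * xi * c m * b \<in> A (Suc m)"
    "?t a * xi * c m * b \<in> A m" "?t a * xi * ?t b \<in> A m"
    using B_3 m A_Suc[OF m(1)] A_Suc[OF m(2)] A_Suc[OF m(3)] A_Suc[OF B_3(3)]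
    by (simp_all add: A_mult A_T A_c A_scal)
  have "eps (Suc m) (?t (a * T m * b) * c (Suc m)) = ?t a * c m * b"
    unfolding 3 eps_diff[OF A_add[OF in3(1,2)] in3(3)] eps_add[OF in3(1,2)]
      eps_B1[OF in3(4)] eps_B2[OF in3(5)] eps_B3[OF B_3(1) A_mult[OF m(2,1)] B_3(3)] by simp
  then show ?case unfolding 1 eps_B3[OF B_3(1) m(2) A_mult[OF m(1) B_3(3)]] by (simp add: mult.assoc)
next
  case (B_add x y)
  then have "c (Suc m) * x \<in> A (Suc m)" "c (Suc m) * y \<in> A (Suc m)"
     "th (Suc m) x * c (Suc m) \<in> A (Suc m)" "th (Suc m) y * c (Suc m) \<in> A (Suc m)"
    by (simp_all add: A_Suc_eq_B[symmetric] A_mult A_c th_A)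
  then show ?case using B_add by (simp add: distrib_left distrib_right th_add eps_add)
qed

lemma Ti_A: "1 \<le> i \<Longrightarrow> Suc i \<le> k \<Longrightarrow> Ti i \<in> A k"
  unfolding Ti_def by (intro A_diff A_T A_scal)

lemma Ti_comm_A: "x \<in> A k \<Longrightarrow> k < j \<Longrightarrow> Ti j * x = x * Ti j"
  using T_comm_A[of x k j] by (simp add: Ti_def algebra_simps lscal_central[of "q-p" x])

lemma Ti_braid: "Ti (Suc i) * T i * T (Suc i) = T i * T (Suc i) * Ti i"
proof -
  have "T (Suc i) * (Ti (Suc i) * T i * T (Suc i)) * T i = T (Suc i) * (T i * T (Suc i) * Ti i) * T i"
    using T_braid[of i] by (simp add: mult.assoc Ti_right' Ti_left Ti_left')
  then have "Ti (Suc i) * (T (Suc i) * (Ti (Suc i) * T i * T (Suc i)) * T i) * Ti i = Ti (Suc i) * (T (Suc i) * (T i * T (Suc i) * Ti i) * T i) * Ti i"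
    by simp
  then show ?thesis by (simp add: mult.assoc Ti_right' Ti_left' Ti_right)
qed

lemma Ti_c: "Ti i * c i * T i = xi * (T i * c i) + c (Suc i) - xi * (c i * T i)"
proof -
  have "Ti i * c i * T i = (T i * c i) * T i - xi * (c i * T i)"
    by (simp add: Ti_def left_diff_distrib mult.assoc)
  also have "(T i * c i) * T i = c (Suc i) * (xi * T i + 1)"
    by (simp add: Tc mult.assoc T_sq)
  also have "\<dots> = xi * (c (Suc i) * T i) + c (Suc i)"
    by (simp add: distrib_left mult.assoc[symmetric] lscal_central[of _ "c (Suc i)"])
  finally show ?thesis by (simp add: Tc)
qed

lemma th_indep: "x \<in> A k \<Longrightarrow> k \<le> N \<Longrightarrow> k \<le> N' \<Longrightarrow> th N x = th N' x"
  by (induction rule: A.induct) (simp_all add: th_add th_mult th_T th_c)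

text \<open>Compatibility of two consecutive expectations; together with the trace property \<open>eps_eps_conj\<close> it gives the long relation between \<open>e\<close>, \<open>t\<^sub>r\<^sub>-\<^sub>1\<close> and \<open>t\<^sub>1\<^sup>*\<close>.\<close>

lemma eps_Ti_conj:
  assumes "y \<in> A (Suc m)" "1 \<le> m"
  shows "eps (Suc (Suc m)) (Ti (Suc m) * y * T (Suc m)) = eps (Suc m) y"
  using assms unfolding A_Suc_eq_B
proof (induction rule: B.induct)
  case (B_1 a)
  have "Ti (Suc m) * a * T (Suc m) = a"
    using Ti_comm_A[OF B_1(1), of "Suc m"] by (simp add: mult.assoc Ti_left)
  then show ?case using B_1 by (simp add: eps_B1 A_Suc)
next
  case (B_2 a)
  let ?T = "T (Suc m)" and ?c = "c (Suc m)"
  have "Ti (Suc m) * (a * ?c) * ?T = a * (Ti (Suc m) * ?c * ?T)"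
    using Ti_comm_A[OF B_2(1), of "Suc m"] by (simp add: mult.assoc[symmetric])
  also have "\<dots> = (a * xi) * ?T * ?c + a * c (Suc (Suc m)) - (a * xi * ?c) * ?T * 1"
    unfolding Ti_c by (simp add: algebra_simps)
  finally have eq: "Ti (Suc m) * (a * ?c) * ?T = (a * xi) * ?T * ?c + a * c (Suc (Suc m)) - (a * xi * ?c) * ?T * 1" .
  have a: "a \<in> A (Suc m)" "?c \<in> A (Suc m)" "xi \<in> A (Suc m)" using B_2 by (simp_all add: A_Suc A_c A_scal)
  have "eps (Suc (Suc m)) (Ti (Suc m) * (a * ?c) * ?T) = (a * xi) * ?c + 0 - (a * xi * ?c) * 1"
    unfolding eq using a A_Suc[OF a(1)] A_Suc[OF a(2)] 
      eps_B3[of "Suc m" "a * xi" ?c] eps_B2[of a "Suc m"] eps_B3[of "Suc m" "a * xi * ?c" 1]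
    by (subst eps_diff; (subst eps_add)?) (simp_all add: A_mult A_add A_T A_c A_scal)
  then show ?case using B_2 by (simp add: eps_B2)
next
  case (B_3 a b)
  let ?T = "T (Suc m)"
  have "Ti (Suc m) * (a * T m * b) * ?T = a * (Ti (Suc m) * T m * ?T) * b"
  proof -
    have "Ti (Suc m) * (a * T m * b) * ?T = (Ti (Suc m) * a) * T m * (b * ?T)" by (simp only: mult.assoc)
    also have "\<dots> = (a * Ti (Suc m)) * T m * (?T * b)"
      using Ti_comm_A[OF B_3(2), of "Suc m"] T_comm_A[OF B_3(3), of "Suc m"] by simp
    finally show ?thesis by (simp only: mult.assoc)
  qed
  also have "\<dots> = (a * T m) * ?T * (Ti m * b)"
    unfolding Ti_braid by (simp only: mult.assoc)
  finally have eq: "Ti (Suc m) * (a * T m * b) * ?T = (a * T m) * ?T * (Ti m * b)" .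
  have "eps (Suc (Suc m)) ((a * T m) * ?T * (Ti m * b)) = (a * T m) * (Ti m * b)"
    using B_3 A_Suc[OF B_3(2)] A_Suc[OF B_3(3)] by (intro eps_B3) (simp_all add: A_mult A_T Ti_A)
  also have "\<dots> = a * b" by (simp add: mult.assoc Ti_right')
  finally show ?case unfolding eq using B_3 by (simp add: eps_B3)
next
  case (B_add x y)
  then have xy: "x \<in> A (Suc m)" "y \<in> A (Suc m)" by (simp_all add: A_Suc_eq_B)
  have "Ti (Suc m) * x * T (Suc m) \<in> A (Suc (Suc m))" "Ti (Suc m) * y * T (Suc m) \<in> A (Suc (Suc m))"
    using xy A_Suc[OF xy(1)] A_Suc[OF xy(2)] by (simp_all add: A_mult Ti_A A_T)
  then show ?case using B_add xy by (simp add: distrib_left distrib_right eps_add)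
qed

lemma eps_T_conj:
  assumes "y \<in> A (Suc m)" "1 \<le> m"
  shows "eps (Suc (Suc m)) (T (Suc m) * y * T (Suc m)) = xi * y + eps (Suc m) y"
proof -
  have eq: "T (Suc m) * y * T (Suc m) = Ti (Suc m) * y * T (Suc m) + (xi * y) * T (Suc m) * 1"
    by (simp add: Ti_def algebra_simps)
  have "eps (Suc (Suc m)) ((xi * y) * T (Suc m) * 1) = xi * y * 1"
    using assms by (intro eps_B3) (simp_all add: A_mult A_scal)
  then show ?thesis unfolding eq using assms A_Suc[OF assms(1)]
    by (subst eps_add) (simp_all add: eps_Ti_conj A_mult A_scal A_T Ti_A)
qed

text \<open>Under two consecutive expectations \<open>T\<close> can be moved cyclically.\<close>

lemma eps_eps_T_trace:
  assumes "x \<in> A (Suc (Suc m))" "1 \<le> m"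
  shows "eps (Suc m) (eps (Suc (Suc m)) (x * T (Suc m))) = eps (Suc m) (eps (Suc (Suc m)) (T (Suc m) * x))"
  using assms unfolding A_Suc_eq_B[of "Suc m"]
proof (induction rule: B.induct)
  case (B_1 a)
  then show ?case using eps_B3[of "Suc m" a 1] eps_B3[of "Suc m" 1 a] by simp
next
  case (B_2 a)
  let ?T = "T (Suc m)" and ?c = "c (Suc (Suc m))" and ?t = "th (Suc (Suc m))"
  have c: "c (Suc m) \<in> A (Suc m)" by (simp add: A_c)
  have 1: "a * ?c * ?T = a * ?T * c (Suc m)" by (simp add: mult.assoc Tc)
  have "?T * (a * ?c) = (?T * ?c) * ?t a"
    using c_A[of "?t a" "Suc m" "Suc (Suc m)" "Suc (Suc m)"] B_2 by (simp add: th_A mult.assoc)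
  also have "\<dots> = c (Suc m) * ?T * ?t a + (xi * a) * ?c - xi * c (Suc m) * ?t a"
    using c_A[of "?t a" "Suc m" "Suc (Suc m)" "Suc (Suc m)"] B_2 by (simp add: th_A Tc_Suc algebra_simps)
  finally have 2: "?T * (a * ?c) = c (Suc m) * ?T * ?t a + (xi * a) * ?c - xi * c (Suc m) * ?t a" .
  have ta: "?t a \<in> A (Suc m)" using B_2 by (simp add: th_A)
  have e2: "eps (Suc (Suc m)) (?T * (a * ?c)) = c (Suc m) * ?t a"
    unfolding 2 using c ta A_Suc[OF c] A_Suc[OF ta] B_2 A_Suc[OF B_2(1)]
      eps_B3[of "Suc m" "c (Suc m)" "?t a"] eps_B2[of "xi * a" "Suc m"] eps_B1[of "xi * c (Suc m) * ?t a" "Suc m"]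
    by (subst eps_diff; (subst eps_add)?) (simp_all add: A_mult A_add A_T A_c A_scal)
  have t2: "th (Suc m) a = th (Suc (Suc m)) a"
    by (rule th_indep[OF B_2(1)]) simp_all
  have "eps (Suc m) (c (Suc m) * ?t a) = eps (Suc m) (th (Suc m) (?t a) * c (Suc m))"
    by (rule eps_c_trace[OF ta])
  also have "th (Suc m) (?t a) = a" using t2 by (metis th_th)
  finally show ?case unfolding 1 e2 using B_2 c by (simp add: eps_B3)
next
  case (B_3 a b)
  let ?T = "T (Suc m)"
  have A2: "a \<in> A (Suc (Suc m))" "b \<in> A (Suc (Suc m))" "?T \<in> A (Suc (Suc m))" using B_3 by (simp_all add: A_Suc A_T)
  have e: "eps (Suc m) a \<in> A (Suc m)" "eps (Suc m) b \<in> A (Suc m)" "eps (Suc m) a \<in> A m" "eps (Suc m) b \<in> A m"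
    using B_3 by (simp_all add: A_Suc eps_A)
  have "eps (Suc (Suc m)) (a * ?T * b * ?T) = a * eps (Suc (Suc m)) (?T * b * ?T)"
    using B_3 A2 eps_lmult[of "?T * b * ?T" "Suc m" a] by (simp add: mult.assoc A_mult)
  also have "\<dots> = lscal (q - p) * (a * b) + a * eps (Suc m) b"
    using B_3 by (simp add: eps_T_conj distrib_left mult.assoc[symmetric] lscal_central[of _ a])
  finally have 1: "eps (Suc m) (eps (Suc (Suc m)) (a * ?T * b * ?T)) = xi * eps (Suc m) (a * b) + eps (Suc m) a * eps (Suc m) b"
    using B_3 e by (simp add: eps_add A_mult A_scal eps_scal eps_rmult)
  have "eps (Suc (Suc m)) (?T * (a * ?T * b)) = eps (Suc (Suc m)) (?T * a * ?T) * b"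
    using B_3 A2 eps_rmult[of "?T * a * ?T" "Suc m" b] by (simp add: mult.assoc A_mult)
  also have "\<dots> = lscal (q - p) * (a * b) + eps (Suc m) a * b"
    unfolding eps_T_conj[OF B_3(2) B_3(4)] by (simp add: distrib_right mult.assoc)
  finally have 2: "eps (Suc m) (eps (Suc (Suc m)) (?T * (a * ?T * b))) = xi * eps (Suc m) (a * b) + eps (Suc m) a * eps (Suc m) b"
    using B_3 e by (simp add: eps_add A_mult A_scal eps_scal eps_lmult)
  show ?case unfolding 1 2 ..
next
  case (B_add x y)
  then have xy: "x \<in> A (Suc (Suc m))" "y \<in> A (Suc (Suc m))" by (simp_all add: A_Suc_eq_B)
  have T: "T (Suc m) \<in> A (Suc (Suc m))" by (simp add: A_T)
  then show ?case using B_add xy by (simp add: distrib_left distrib_right eps_add A_mult eps_A)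
qed

lemma eps_eps_conj:
  assumes "x \<in> A (Suc (Suc m))" "1 \<le> m"
  shows "eps (Suc m) (eps (Suc (Suc m)) (Ti (Suc m) * x * T (Suc m))) = eps (Suc m) (eps (Suc (Suc m)) x)"
  using eps_eps_T_trace[of "Ti (Suc m) * x" m] assms by (simp add: A_mult Ti_A Ti_right' mult.assoc)

end

section \<open>Monoids with type B relations\<close>

text \<open>Self-maps as a monoid; as a type of its own it can be used as the monoid in the locales below.\<close>

datatype 'c endo = Endo (ap: "'c \<Rightarrow> 'c")

instantiation endo :: (type) monoid_mult
begin
definition "1 = Endo (\<lambda>x. x)"
definition "f * g = Endo (\<lambda>x. ap f (ap g x))"
instance by standard (auto simp: one_endo_def times_endo_def)
end

lemma ap_mult [simp]: "ap (f * g) x = ap f (ap g x)" by (simp add: times_endo_def)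
lemma ap_one [simp]: "ap 1 x = x" by (simp add: one_endo_def)
lemma endo_eqI: "(\<And>x. ap f x = ap g x) \<Longrightarrow> f = g"
  by (cases f; cases g) (auto simp: fun_eq_iff)

instantiation prod :: (monoid_mult, monoid_mult) monoid_mult
begin
definition "1 = (1, 1)"
definition "p * q = (fst p * fst q, snd p * snd q)"
instance by standard (auto simp: one_prod_def times_prod_def mult.assoc)
end

lemma commute_mult:
  fixes c :: "'m::monoid_mult"
  shows "c * s = s * c \<Longrightarrow> c * z = z * c \<Longrightarrow> c * (s * z) = s * z * c"
  by (metis mult.assoc)

text \<open>A monoid containing elements that satisfy the Coxeter relations of type B, in the range of indices above \<open>a\<close> and up to \<open>n\<close>. In the applications the elements are classes up to sign, so that Clifford generators square to 1 and commute.\<close>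

locale typeB =
  fixes S C :: "nat \<Rightarrow> 'm::monoid_mult" and a n :: nat
  assumes S_sq: "a < i \<Longrightarrow> i < n \<Longrightarrow> S i * S i = 1"
    and S_braid: "a < i \<Longrightarrow> Suc i < n \<Longrightarrow> S i * S (Suc i) * S i = S (Suc i) * S i * S (Suc i)"
    and S_comm: "a < i \<Longrightarrow> Suc i < j \<Longrightarrow> j < n \<Longrightarrow> S i * S j = S j * S i"
    and C_sq: "a < i \<Longrightarrow> i \<le> n \<Longrightarrow> C i * C i = 1"
    and C_comm: "a < i \<Longrightarrow> i \<le> n \<Longrightarrow> a < j \<Longrightarrow> j \<le> n \<Longrightarrow> C i * C j = C j * C i"
    and S_C: "a < i \<Longrightarrow> i < n \<Longrightarrow> S i * C i = C (Suc i) * S i"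
    and S_C_far: "a < i \<Longrightarrow> i < n \<Longrightarrow> a < j \<Longrightarrow> j \<le> n \<Longrightarrow> j \<noteq> i \<Longrightarrow> j \<noteq> Suc i \<Longrightarrow> S i * C j = C j * S i"
begin

inductive_set RB :: "nat \<Rightarrow> 'm set" for k where
  RB_1: "1 \<in> RB k"
| RB_S: "z \<in> RB k \<Longrightarrow> a < i \<Longrightarrow> Suc i \<le> k \<Longrightarrow> S i * z \<in> RB k"
| RB_C: "z \<in> RB k \<Longrightarrow> a < i \<Longrightarrow> i \<le> k \<Longrightarrow> C i * z \<in> RB k"

lemma RB_mult: "x \<in> RB k \<Longrightarrow> y \<in> RB k \<Longrightarrow> x * y \<in> RB k"
  by (induction rule: RB.induct) (simp_all add: mult.assoc RB.intros)

lemma RB_gen_S: "a < i \<Longrightarrow> Suc i \<le> k \<Longrightarrow> S i \<in> RB k"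
  using RB_S[OF RB_1] by simp
lemma RB_gen_C: "a < i \<Longrightarrow> i \<le> k \<Longrightarrow> C i \<in> RB k"
  using RB_C[OF RB_1] by simp

lemma RB_mono: "x \<in> RB k \<Longrightarrow> k \<le> l \<Longrightarrow> x \<in> RB l"
  by (induction rule: RB.induct) (simp_all add: RB.intros)

lemma S_C_Suc: assumes "a < i" "i < n" shows "S i * C (Suc i) = C i * S i"
proof -
  have "S i * (S i * C i) * S i = S i * (C (Suc i) * S i) * S i"
    using assms by (simp add: S_C)
  then have "(S i * S i) * C i * S i = S i * C (Suc i) * (S i * S i)"
    by (simp only: mult.assoc)
  then show ?thesis using assms by (simp add: S_sq)
qed

lemma RB_inverse: "x \<in> RB k \<Longrightarrow> k \<le> n \<Longrightarrow> \<exists>y\<in>RB k. x * y = 1 \<and> y * x = 1"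
proof (induction rule: RB.induct)
  case (RB_S z i)
  then obtain y where y: "y \<in> RB k" "z * y = 1" "y * z = 1" by auto
  have "S i * z * (y * S i) = S i * (z * y) * S i" "y * S i * (S i * z) = y * (S i * S i) * z"
    by (simp_all only: mult.assoc)
  then show ?case using RB_S y by (intro bexI[of _ "y * S i"] RB_mult RB_gen_S) (simp_all add: S_sq)
next
  case (RB_C z i)
  then obtain y where y: "y \<in> RB k" "z * y = 1" "y * z = 1" by auto
  have "C i * z * (y * C i) = C i * (z * y) * C i" "y * C i * (C i * z) = y * (C i * C i) * z"
    by (simp_all only: mult.assoc)
  then show ?case using RB_C y by (intro bexI[of _ "y * C i"] RB_mult RB_gen_C) (simp_all add: C_sq)
qed (use RB.RB_1 in auto)

lemma C_comm_RB: "x \<in> RB k \<Longrightarrow> k < j \<Longrightarrow> a < j \<Longrightarrow> j \<le> n \<Longrightarrow> C j * x = x * C j"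
  by (induction rule: RB.induct)
    (auto intro!: commute_mult simp: S_C_far C_comm[of j])

lemma S_comm_RB: "x \<in> RB k \<Longrightarrow> k < j \<Longrightarrow> a < j \<Longrightarrow> j < n \<Longrightarrow> S j * x = x * S j"
  by (induction rule: RB.induct)
    (auto intro!: commute_mult simp: S_C_far S_comm[symmetric])

definition D :: "nat \<Rightarrow> 'm set" where
  "D k = RB k \<union> {x * C (Suc k) |x. x \<in> RB k} \<union> {x * S k * y |x y. a < k \<and> x \<in> RB k \<and> y \<in> RB k}"

text \<open>The monoid analogue of the one-occurrence decomposition for Hecke algebras; it is proved without knowing that the \<open>S\<close> and \<open>C\<close> generate a copy of the signed permutations.\<close>

lemma RB_decomp: "x \<in> RB (Suc k) \<Longrightarrow> a \<le> k \<Longrightarrow> Suc k \<le> n \<Longrightarrow> x \<in> D k"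
proof (induction k arbitrary: x)
  have low: "g * x \<in> D k" if "x \<in> D k" "g \<in> RB k" for g x k
  proof -
    from that(1) consider "x \<in> RB k" | y where "y \<in> RB k" "x = y * C (Suc k)"
      | y w where "a < k" "y \<in> RB k" "w \<in> RB k" "x = y * S k * w" unfolding D_def by blast
    then show ?thesis
    proof cases
      case 1
      then show ?thesis using RB_mult[OF that(2)] unfolding D_def by blast
    next
      case 2
      have "g * x = (g * y) * C (Suc k)" by (simp only: 2 mult.assoc)
      then show ?thesis using RB_mult[OF that(2) 2(1)] unfolding D_def by blast
    next
      case 3
      have "g * x = (g * y) * S k * w" by (simp only: 3 mult.assoc)
      then show ?thesis using RB_mult[OF that(2) 3(2)] 3 unfolding D_def by blast
    qed
  qed
  have Cstep: "C (Suc k) * x \<in> D k" if "x \<in> D k" "a \<le> k" "Suc k \<le> n" for x k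
  proof -
    from that(1) consider "x \<in> RB k" | y where "y \<in> RB k" "x = y * C (Suc k)"
      | y w where "a < k" "y \<in> RB k" "w \<in> RB k" "x = y * S k * w" unfolding D_def by blast
    then show ?thesis
    proof cases
      case 1
      then have "C (Suc k) * x = x * C (Suc k)" using that by (intro C_comm_RB) auto
      then show ?thesis using 1 unfolding D_def by auto
    next
      case 2
      have "C (Suc k) * x = (C (Suc k) * y) * C (Suc k)" by (simp only: 2 mult.assoc)
      also have "\<dots> = y * (C (Suc k) * C (Suc k))" using 2 that C_comm_RB[of y k "Suc k"] by (simp only: mult.assoc; simp)
      also have "\<dots> = y" using that by (simp add: C_sq)
      finally show ?thesis using 2 unfolding D_def by auto
    next
      case 3
      have "C (Suc k) * x = (C (Suc k) * y) * S k * w" by (simp only: 3 mult.assoc)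
      also have "\<dots> = y * (C (Suc k) * S k) * w" using 3 that C_comm_RB[of y k "Suc k"] by (simp only: mult.assoc; simp)
      also have "\<dots> = y * (S k * C k) * w" using 3 that S_C[of k] by simp
      also have "\<dots> = y * S k * (C k * w)" by (simp only: mult.assoc)
      finally show ?thesis using 3 RB_C[of w k k] unfolding D_def by auto
    qed
  qed
  {
    case 0
    then have a: "a = 0" by simp
    from 0(1) show ?case
    proof (induction rule: RB.induct)
      case RB_1 then show ?case using RB.RB_1[of 0] unfolding D_def by blast
    next
      case (RB_C z i)
      have i: "i = Suc 0" using RB_C by simp
      show ?case unfolding i using Cstep[of z 0] RB_C.IH a 0(3) by simp
    qed (use a in simp)
  next
    case (Suc k)
    from Suc.prems(1) show ?case
    proof (induction rule: RB.induct)
      case RB_1 then show ?case using RB.RB_1[of "Suc k"] unfolding D_def by blast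
    next
      case (RB_C z i)
      then show ?case using Cstep[of z "Suc k"] low[of z "Suc k" "C i"] Suc.prems RB_gen_C[of i "Suc k"]
        by (cases "i = Suc (Suc k)") auto
    next
      case (RB_S z i)
      show ?case
      proof (cases "i = Suc k")
        case False
        then show ?thesis using low[of z "Suc k" "S i"] RB_S RB_gen_S[of i "Suc k"] by simp
      next
        case True
        let ?S = "S (Suc k)" and ?C = "C (Suc (Suc k))"
        have ak: "a < Suc k" using True RB_S by simp
        have n: "Suc k < n" using Suc.prems by simp
        from RB_S.IH consider "z \<in> RB (Suc k)" | y where "y \<in> RB (Suc k)" "z = y * ?C"
          | y w where "y \<in> RB (Suc k)" "w \<in> RB (Suc k)" "z = y * ?S * w" unfolding D_def by blast
        then have "?S * z \<in> D (Suc k)"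
        proof cases
          case 1
          then have "1 * ?S * z \<in> D (Suc k)" using RB.RB_1 ak unfolding D_def by blast
          then show ?thesis by simp
        next
          case 2
          have "?S * z = ?S * (?C * y)" using C_comm_RB[of y "Suc k" "Suc (Suc k)"] 2 ak Suc.prems by simp
          also have "\<dots> = (?S * ?C) * y" by (simp only: mult.assoc)
          also have "\<dots> = C (Suc k) * ?S * y" using S_C_Suc[of "Suc k"] ak n by simp
          finally show ?thesis using 2 RB_gen_C[of "Suc k" "Suc k"] ak unfolding D_def by blast
        next
          case 3
          have "y \<in> D k" using Suc.IH[of y] 3 ak n by simp
          then consider "y \<in> RB k" | v where "v \<in> RB k" "y = v * C (Suc k)"
            | v u where "a < k" "v \<in> RB k" "u \<in> RB k" "y = v * S k * u" unfolding D_def by blast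
          then show ?thesis
          proof cases
            case 31: 1
            have "?S * z = (?S * y) * ?S * w" by (simp only: 3 mult.assoc)
            also have "\<dots> = y * (?S * ?S) * w" using S_comm_RB[OF 31, of "Suc k"] ak n by (simp only: mult.assoc; simp)
            also have "\<dots> = y * w" using ak n by (simp add: S_sq)
            finally show ?thesis using 3 RB_mult unfolding D_def by auto
          next
            case 32: 2
            have "?S * z = (?S * v) * C (Suc k) * ?S * w" by (simp only: 3 32 mult.assoc)
            also have "\<dots> = v * (?S * C (Suc k)) * ?S * w" using S_comm_RB[OF 32(1), of "Suc k"] ak n by (simp only: mult.assoc; simp)
            also have "\<dots> = v * ?C * (?S * ?S) * w" using S_C[of "Suc k"] ak n by (simp only: mult.assoc; simp)
            also have "\<dots> = v * (?C * w)" using S_sq[of "Suc k"] ak n by (simp add: mult.assoc)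
            also have "\<dots> = (v * w) * ?C" using C_comm_RB[of w "Suc k" "Suc (Suc k)"] 3 ak n by (simp add: mult.assoc)
            finally show ?thesis using 3 32 RB_mult[of v "Suc k" w] RB_mono[of v k "Suc k"] unfolding D_def by auto
          next
            case 33: 3
            have "?S * z = (?S * v) * S k * (u * ?S) * w" by (simp only: 3 33 mult.assoc)
            also have "\<dots> = (v * ?S) * S k * (?S * u) * w" using S_comm_RB[OF 33(2), of "Suc k"] S_comm_RB[OF 33(3), of "Suc k"] ak n by simp
            also have "\<dots> = v * (?S * S k * ?S) * u * w" by (simp only: mult.assoc)
            also have "\<dots> = v * (S k * ?S * S k) * u * w" using S_braid[of k] 33 n by simp
            also have "\<dots> = (v * S k) * ?S * (S k * u * w)" by (simp only: mult.assoc)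
            finally have eq: "?S * z = (v * S k) * ?S * (S k * u * w)" .
            have "S k \<in> RB (Suc k)" "v \<in> RB (Suc k)" "u \<in> RB (Suc k)"
              using 33 RB_gen_S[of k "Suc k"] RB_mono[of _ k "Suc k"] by auto
            then have "v * S k \<in> RB (Suc k)" "S k * u * w \<in> RB (Suc k)" using 3 RB_mult by auto
            then show ?thesis unfolding eq D_def using ak by blast
          qed
        qed
        then show ?thesis using True by simp
      qed
    qed
  }
qed

lemma RB_a: "x \<in> RB k \<Longrightarrow> k \<le> a \<Longrightarrow> x = 1"
  by (induction rule: RB.induct) auto

end

text \<open>The signed permutation exchanging \<open>x\<close> and \<open>y\<close>, and \<open>- x\<close> and \<open>- y\<close>. For \<open>y = - x\<close> it changes the sign of \<open>x\<close>, so that one notation covers both kinds of generators.\<close>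

definition sw :: "int \<Rightarrow> int \<Rightarrow> int \<Rightarrow> int" where
  "sw x y z = (if z = x then y else if z = y then x else if z = - x then - y else if z = - y then - x else z)"

definition odd_bij :: "(int \<Rightarrow> int) \<Rightarrow> bool" where
  "odd_bij f \<longleftrightarrow> bij f \<and> (\<forall>x. f (- x) = - f x)"

lemma sw_sq [simp]: "x \<noteq> 0 \<Longrightarrow> y \<noteq> 0 \<Longrightarrow> sw x y (sw x y z) = z"
  by (auto simp: sw_def)
lemma sw_odd [simp]: "x \<noteq> 0 \<Longrightarrow> y \<noteq> 0 \<Longrightarrow> sw x y (- z) = - sw x y z"
  by (auto simp: sw_def)
lemma sw_self [simp]: "sw x x = id"
  by (auto simp: sw_def fun_eq_iff)
lemma sw_sym: "x \<noteq> 0 \<Longrightarrow> y \<noteq> 0 \<Longrightarrow> sw x y = sw y x"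
  by (auto simp: sw_def fun_eq_iff)
lemma sw_neg: "x \<noteq> 0 \<Longrightarrow> y \<noteq> 0 \<Longrightarrow> sw (- x) (- y) = sw x y"
  by (auto simp: sw_def fun_eq_iff)
lemma sw_left [simp]: "sw x y x = y" by (simp add: sw_def)
lemma sw_right [simp]: "sw x y y = x" by (simp add: sw_def)
lemma sw_other: "\<bar>z\<bar> \<noteq> \<bar>x\<bar> \<Longrightarrow> \<bar>z\<bar> \<noteq> \<bar>y\<bar> \<Longrightarrow> sw x y z = z"
  by (auto simp: sw_def)

lemma odd_bij_sw: "x \<noteq> 0 \<Longrightarrow> y \<noteq> 0 \<Longrightarrow> odd_bij (sw x y)"
  unfolding odd_bij_def
  by (auto intro!: o_bij[of "sw x y"] simp: fun_eq_iff)

lemma odd_bij_0: "odd_bij f \<Longrightarrow> f 0 = 0"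
  unfolding odd_bij_def by (metis add.inverse_neutral equation_minus_iff neg_equal_zero)

lemma odd_bij_nz: "odd_bij f \<Longrightarrow> x \<noteq> 0 \<Longrightarrow> f x \<noteq> 0"
  using odd_bij_0[of f] unfolding odd_bij_def bij_def inj_def by metis

lemma odd_bij_neg: "odd_bij f \<Longrightarrow> f (- x) = - f x" by (simp add: odd_bij_def)
lemma odd_bij_inj: "odd_bij f \<Longrightarrow> f x = f y \<longleftrightarrow> x = y" by (auto simp: odd_bij_def bij_def inj_def)

lemma odd_bij_abs: "odd_bij f \<Longrightarrow> \<bar>f x\<bar> = \<bar>f y\<bar> \<longleftrightarrow> \<bar>x\<bar> = \<bar>y\<bar>"
  by (metis abs_eq_iff odd_bij_inj odd_bij_neg)

lemma odd_bij_id [simp]: "odd_bij id" "odd_bij (\<lambda>x. x)" by (auto simp: odd_bij_def bij_def)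
lemma odd_bij_comp: "odd_bij f \<Longrightarrow> odd_bij g \<Longrightarrow> odd_bij (f \<circ> g)"
  by (auto simp: odd_bij_def bij_comp)

lemma sw_conj: "odd_bij g \<Longrightarrow> g (sw x y z) = sw (g x) (g y) (g z)"
  by (auto simp: sw_def odd_bij_neg odd_bij_inj odd_bij_inj[of g _ "- _", simplified odd_bij_neg])

section \<open>Signed permutations\<close>

definition SE :: "nat \<Rightarrow> int endo" where "SE i = Endo (sw (int i) (int i + 1))"
definition CE :: "nat \<Rightarrow> int endo" where "CE i = Endo (sw (int i) (- int i))"

lemma sw_braid:
  assumes "x \<noteq> 0" "y \<noteq> 0" "w \<noteq> 0" "\<bar>w\<bar> \<noteq> \<bar>x\<bar>" "\<bar>w\<bar> \<noteq> \<bar>y\<bar>"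
  shows "sw x y (sw y w (sw x y z)) = sw x w z"
  using sw_conj[OF odd_bij_sw, of x y y w "sw x y z"] assms by (simp add: sw_other)

lemma typeB_SE: "typeB SE CE a n"
proof
  fix i assume "a < i"
  then show "SE i * SE i = 1" by (intro endo_eqI) (simp add: SE_def)
next
  fix i assume i: "a < i"
  show "CE i * CE i = 1" using i by (intro endo_eqI) (simp add: CE_def)
next
  fix i assume "a < i" "Suc i < n"
  then show "SE i * SE (Suc i) * SE i = SE (Suc i) * SE i * SE (Suc i)"
    using sw_braid[of "int i" "int i + 1" "int i + 2"] sw_braid[of "int i + 2" "int i + 1" "int i"]
    by (intro endo_eqI) (simp add: SE_def sw_sym[of "1 + int i" "int i"] sw_sym[of "int i + 2"] algebra_simps)
next
  fix i j assume "a < i" "Suc i < j"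
  then show "SE i * SE j = SE j * SE i"
    by (intro endo_eqI) (simp add: SE_def, auto simp: sw_def)
next
  fix i j assume "a < i" "a < j"
  then show "CE i * CE j = CE j * CE i"
    by (intro endo_eqI) (simp add: CE_def, auto simp: sw_def)
next
  fix i assume "a < i"
  then show "SE i * CE i = CE (Suc i) * SE i"
    by (intro endo_eqI) (simp add: SE_def CE_def, auto simp: sw_def)
next
  fix i j assume "a < i" "a < j" "j \<noteq> i" "j \<noteq> Suc i"
  then show "SE i * CE j = CE j * SE i"
    by (intro endo_eqI) (simp add: SE_def CE_def, auto simp: sw_def)
qed

text \<open>Signed permutations are odd bijections of the integers that move only points of absolute value in \<open>{a<..k}\<close>.\<close>

definition sperm :: "nat \<Rightarrow> nat \<Rightarrow> (int \<Rightarrow> int) set" where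
  "sperm a k = {g. odd_bij g \<and> (\<forall>x. g x \<noteq> x \<longrightarrow> int a < \<bar>x\<bar> \<and> \<bar>x\<bar> \<le> int k)}"

lemma sperm_odd: "g \<in> sperm a k \<Longrightarrow> odd_bij g" by (simp add: sperm_def)
lemma sperm_fix: "g \<in> sperm a k \<Longrightarrow> \<bar>x\<bar> \<le> int a \<or> \<bar>x\<bar> > int k \<Longrightarrow> g x = x"
  unfolding sperm_def by force
lemma sperm_range: "g \<in> sperm a k \<Longrightarrow> int a < \<bar>x\<bar> \<and> \<bar>x\<bar> \<le> int k \<Longrightarrow> int a < \<bar>g x\<bar> \<and> \<bar>g x\<bar> \<le> int k"
  unfolding sperm_def by (metis (mono_tags, lifting) mem_Collect_eq odd_bij_inj)
lemma sperm_range_iff: "g \<in> sperm a k \<Longrightarrow> int a < \<bar>g x\<bar> \<and> \<bar>g x\<bar> \<le> int k \<longleftrightarrow> int a < \<bar>x\<bar> \<and> \<bar>x\<bar> \<le> int k"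
  using sperm_range[of g a k x] sperm_fix[of g a k x] by linarith
lemma sperm_id [simp]: "id \<in> sperm a k" "(\<lambda>x. x) \<in> sperm a k" by (auto simp: sperm_def)
lemma sperm_comp: "g \<in> sperm a k \<Longrightarrow> h \<in> sperm a k \<Longrightarrow> g \<circ> h \<in> sperm a k"
  unfolding sperm_def by (auto simp: odd_bij_comp) (metis+)
lemma sperm_sw: "int a < \<bar>x\<bar> \<Longrightarrow> \<bar>x\<bar> \<le> int k \<Longrightarrow> int a < \<bar>y\<bar> \<Longrightarrow> \<bar>y\<bar> \<le> int k \<Longrightarrow> sw x y \<in> sperm a k"
  unfolding sperm_def by (auto simp: odd_bij_sw) (auto simp: sw_def split: if_splits)
lemma sperm_Suc_fix: "g \<in> sperm a (Suc k) \<Longrightarrow> g (int (Suc k)) = int (Suc k) \<Longrightarrow> g \<in> sperm a k"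
proof -
  assume g: "g \<in> sperm a (Suc k)" "g (int (Suc k)) = int (Suc k)"
  have "\<bar>x\<bar> \<le> int k" if "g x \<noteq> x" for x
  proof -
    have "\<bar>x\<bar> \<le> int (Suc k)" using g(1) that unfolding sperm_def by auto
    moreover have "x \<noteq> int (Suc k)" "x \<noteq> - int (Suc k)" using g that sperm_odd[OF g(1)] odd_bij_neg by metis+
    ultimately show ?thesis by linarith
  qed
  then show ?thesis using g unfolding sperm_def by auto
qed

lemma sperm_inv: assumes "g \<in> sperm a k"
  shows "inv_into UNIV g \<in> sperm a k" "inv_into UNIV g (g x) = x" "g (inv_into UNIV g x) = x"
proof -
  have b: "bij g" using assms by (simp add: sperm_def odd_bij_def)
  show 1: "inv_into UNIV g (g x) = x" "g (inv_into UNIV g x) = x" for x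
    using b by (simp_all add: bij_is_inj bij_is_surj surj_f_inv_f)
  have "inv_into UNIV g (- x) = - inv_into UNIV g x" for x
    using 1 odd_bij_neg[OF sperm_odd[OF assms]] by metis
  then have "odd_bij (inv_into UNIV g)" using b by (auto simp: odd_bij_def bij_imp_bij_inv)
  moreover have "g x \<noteq> x" if "inv_into UNIV g x \<noteq> x" for x using that 1 by metis
  ultimately show "inv_into UNIV g \<in> sperm a k" using assms unfolding sperm_def by auto
qed

context typeB begin

text \<open>The submonoid generated by the pairs of a generator and its signed permutation. It is the graph of a homomorphism from the signed permutations to the monoid (\<open>PB_unique\<close>, \<open>PB_surj\<close>), obtained without a presentation of the group of type B.\<close>

definition PB :: "nat \<Rightarrow> ('m \<times> int endo) set" where
  "PB = typeB.RB (\<lambda>i. (S i, SE i)) (\<lambda>i. (C i, CE i)) a"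

lemma typeB_pair: "typeB (\<lambda>i. (S i, SE i)) (\<lambda>i. (C i, CE i)) a n"
proof -
  interpret E: typeB SE CE a n by (rule typeB_SE)
  show ?thesis
    by standard (auto simp: times_prod_def one_prod_def S_sq S_braid C_sq S_C S_C_far
      E.S_sq E.S_braid E.C_sq E.S_C E.S_C_far intro: S_comm C_comm E.S_comm E.C_comm)
qed

interpretation P: typeB "\<lambda>i. (S i, SE i)" "\<lambda>i. (C i, CE i)" a n
  rewrites "P.RB = PB"
  by (rule typeB_pair) (simp add: PB_def)

lemma PB_fst: "p \<in> PB k \<Longrightarrow> fst p \<in> RB k"
  by (induction rule: P.RB.induct) (simp_all add: one_prod_def times_prod_def RB.intros)

lemma PB_snd: "p \<in> PB k \<Longrightarrow> ap (snd p) \<in> sperm a k"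
proof (induction rule: P.RB.induct)
  case (RB_S z i)
  then have "sw (int i) (int i + 1) \<circ> ap (snd z) \<in> sperm a k"
    by (intro sperm_comp sperm_sw) auto
  then show ?case by (simp add: times_prod_def SE_def times_endo_def o_def)
next
  case (RB_C z i)
  then have "sw (int i) (- int i) \<circ> ap (snd z) \<in> sperm a k"
    by (intro sperm_comp sperm_sw) auto
  then show ?case by (simp add: times_prod_def CE_def times_endo_def o_def)
qed (simp add: one_prod_def one_endo_def)

text \<open>By induction over the layers: in the decomposition of an element of the next layer, the image of the largest point shows that neither \<open>C\<close> nor \<open>S\<close> of the top index can occur.\<close>

lemma PB_id: "p \<in> PB k \<Longrightarrow> k \<le> n \<Longrightarrow> snd p = 1 \<Longrightarrow> p = 1"
proof (induction k arbitrary: p)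
  case 0
  then show ?case using P.RB_a[of p 0] by simp
next
  case (Suc k)
  show ?case
  proof (cases "a \<le> k")
    case False
    then show ?thesis using P.RB_a[of p "Suc k"] Suc.prems by simp
  next
    case True
    let ?n = "int (Suc k)"
    have fixn: "ap (snd x) ?n = ?n" "ap (snd x) (- ?n) = - ?n" if "x \<in> PB k" for x
      using PB_snd[OF that] by (auto intro!: sperm_fix)
    have idn: "ap (snd p) ?n = ?n" using Suc.prems by simp
    have "p \<in> P.D k" using P.RB_decomp[of p k] Suc.prems True by simp
    then consider "p \<in> PB k" | x where "x \<in> PB k" "p = x * (C (Suc k), CE (Suc k))"
      | x y where "a < k" "x \<in> PB k" "y \<in> PB k" "p = x * (S k, SE k) * y"
      unfolding P.D_def by blast
    then show ?thesis
    proof cases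
      case 1
      then show ?thesis using Suc by simp
    next
      case 2
      then have "ap (snd p) ?n = - ?n"
        using fixn[OF 2(1)] by (simp add: times_prod_def CE_def sw_def)
      then show ?thesis using idn by simp
    next
      case 3
      have "ap (snd p) ?n = ap (snd x) (int k)"
        using 3 fixn[OF 3(3)] by (simp add: times_prod_def SE_def sw_def)
      moreover have "\<bar>ap (snd x) (int k)\<bar> \<le> int k"
        using sperm_range[OF PB_snd[OF 3(2)], of "int k"] 3(1) by simp
      ultimately show ?thesis using idn by simp
    qed
  qed
qed

lemma PB_unique: assumes "p \<in> PB n" "p' \<in> PB n" "snd p = snd p'" shows "p = p'"
proof -
  obtain y where y: "y \<in> PB n" "p' * y = 1" "y * p' = 1" using P.RB_inverse[OF assms(2)] by auto
  have "snd (p * y) = snd (p' * y)" using assms by (simp add: times_prod_def)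
  then have "snd (p * y) = 1" using y by (simp add: one_prod_def)
  then have "p * y = 1" using PB_id[of "p * y" n] P.RB_mult[OF assms(1) y(1)] by simp
  then have "p * y * p' = p'" by simp
  then show ?thesis using y by (simp add: mult.assoc)
qed

lemma PB_move: assumes "a < i" "i \<le> Suc k" shows "\<exists>p\<in>PB (Suc k). ap (snd p) (int i) = int (Suc k)"
  using assms(2,1)
proof (induction i rule: inc_induct)
  case base
  then show ?case using P.RB_1[of "Suc k"] by (intro bexI[of _ 1]) (simp_all add: one_prod_def)
next
  case (step i)
  then obtain p where p: "p \<in> PB (Suc k)" "ap (snd p) (int (Suc i)) = int (Suc k)" by auto
  have "(S i, SE i) \<in> PB (Suc k)" using P.RB_gen_S[of i "Suc k"] step by simp
  then have "p * (S i, SE i) \<in> PB (Suc k)" by (rule P.RB_mult[OF p(1)])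
  moreover have "ap (snd (p * (S i, SE i))) (int i) = int (Suc k)"
    using p(2) by (simp add: times_prod_def SE_def algebra_simps)
  ultimately show ?case by blast
qed

lemma PB_surj: "g \<in> sperm a k \<Longrightarrow> k \<le> n \<Longrightarrow> \<exists>z. (z, Endo g) \<in> PB k"
proof (induction k arbitrary: g)
  case 0
  then have "g = (\<lambda>x. x)" by (intro ext) (auto simp: sperm_def)
  then have "(1, Endo g) = 1" by (simp add: one_prod_def one_endo_def)
  then show ?case using P.RB_1[of 0] by metis
next
  case (Suc k)
  show ?case
  proof (cases "a \<le> k")
    case False
    then have "g = (\<lambda>x. x)" using Suc.prems by (intro ext) (force simp: sperm_def)
    then have "(1, Endo g) = 1" by (simp add: one_prod_def one_endo_def)
    then show ?thesis using P.RB_1[of "Suc k"] by metis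
  next
    case True
    define x where "x = g (int (Suc k))"
    have x: "int a < \<bar>x\<bar>" "\<bar>x\<bar> \<le> int (Suc k)"
      using sperm_range[OF Suc.prems(1), of "int (Suc k)"] True unfolding x_def by auto
    obtain p where p: "p \<in> PB (Suc k)" "ap (snd p) x = int (Suc k)"
    proof (cases "x > 0")
      case True
      then have "\<exists>p\<in>PB (Suc k). ap (snd p) (int (nat x)) = int (Suc k)"
        using x by (intro PB_move) auto
      then show ?thesis using that True by auto
    next
      case False
      have "\<exists>p\<in>PB (Suc k). ap (snd p) (int (nat (- x))) = int (Suc k)"
        using x False by (intro PB_move) auto
      then obtain p where p: "p \<in> PB (Suc k)" "ap (snd p) (- x) = int (Suc k)"
        using False by auto
      have "(C (nat (- x)), CE (nat (- x))) \<in> PB (Suc k)" using P.RB_gen_C[of "nat (-x)" "Suc k"] False x by auto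
      then have "p * (C (nat (- x)), CE (nat (- x))) \<in> PB (Suc k)" by (rule P.RB_mult[OF p(1)])
      moreover have "ap (snd (p * (C (nat (- x)), CE (nat (- x))))) x = int (Suc k)"
        using p(2) False by (simp add: times_prod_def CE_def)
      ultimately show ?thesis by (rule that)
    qed
    have "ap (snd p) \<circ> g \<in> sperm a k"
    proof (rule sperm_Suc_fix)
      show "ap (snd p) \<circ> g \<in> sperm a (Suc k)" using p Suc.prems(1) by (intro sperm_comp PB_snd)
      show "(ap (snd p) \<circ> g) (int (Suc k)) = int (Suc k)" using p by (simp add: x_def)
    qed
    from Suc.IH[OF this] obtain z where z: "(z, Endo (ap (snd p) \<circ> g)) \<in> PB k"
      using Suc.prems(2) Suc_leD by blast
    obtain y where y: "y \<in> PB (Suc k)" "y * p = 1" using P.RB_inverse[OF p(1)] Suc.prems by auto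
    have "snd y * snd p = 1" using y(2) by (simp add: times_prod_def one_prod_def)
    then have "ap (snd y * snd p) t = t" for t by simp
    then have yp: "ap (snd y) (ap (snd p) t) = t" for t by simp
    have "y * (z, Endo (ap (snd p) \<circ> g)) \<in> PB (Suc k)"
      using P.RB_mult[OF y(1)] P.RB_mono[OF z, of "Suc k"] by simp
    moreover have "y * (z, Endo (ap (snd p) \<circ> g)) = (fst y * z, Endo g)"
      by (simp add: times_prod_def times_endo_def yp)
    ultimately have "(fst y * z, Endo g) \<in> PB (Suc k)" by (simp only:)
    then show ?thesis by blast
  qed
qed

text \<open>The homomorphism from signed permutations to the monoid.\<close>

definition rho :: "(int \<Rightarrow> int) \<Rightarrow> 'm" where "rho g = (SOME z. (z, Endo g) \<in> PB n)"

lemma rho_PB: assumes "g \<in> sperm a k" "k \<le> n" shows "(rho g, Endo g) \<in> PB k"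
proof -
  obtain z where z: "(z, Endo g) \<in> PB k" using PB_surj[OF assms] by blast
  then have zn: "(z, Endo g) \<in> PB n" using P.RB_mono assms by blast
  then have "(rho g, Endo g) \<in> PB n" unfolding rho_def by (rule someI)
  from PB_unique[OF this zn] show ?thesis using z by simp
qed

lemma rho_eqI: "(z, Endo g) \<in> PB n \<Longrightarrow> rho g = z"
  using PB_unique[of "(z, Endo g)" "(rho g, Endo g)"] rho_PB[of g n] PB_snd[of "(z, Endo g)" n] by simp

lemma rho_mult: "g \<in> sperm a n \<Longrightarrow> h \<in> sperm a n \<Longrightarrow> rho (g \<circ> h) = rho g * rho h"
  using P.RB_mult[OF rho_PB[of g n] rho_PB[of h n]]
  by (intro rho_eqI) (simp add: times_prod_def times_endo_def o_def)

lemma rho_id: "rho id = 1" "rho (\<lambda>x. x) = 1"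
  using P.RB_1[of n] by (auto intro!: rho_eqI simp: one_prod_def one_endo_def id_def)

lemma rho_S: "a < i \<Longrightarrow> i < n \<Longrightarrow> rho (sw (int i) (int i + 1)) = S i"
  using P.RB_gen_S[of i n] by (intro rho_eqI) (simp add: SE_def)

lemma rho_C: "a < i \<Longrightarrow> i \<le> n \<Longrightarrow> rho (sw (int i) (- int i)) = C i"
  using P.RB_gen_C[of i n] by (intro rho_eqI) (simp add: CE_def)

lemma rho_RB: "g \<in> sperm a k \<Longrightarrow> k \<le> n \<Longrightarrow> rho g \<in> RB k"
  using PB_fst[OF rho_PB] by simp

end

section \<open>The walled monoid\<close>

text \<open>The relations of the walled Brauer-Clifford algebra as seen in a monoid with a zero \<open>z0\<close>, written so that both walls look alike: the left generators act on the strands above \<open>a\<close>, the right ones, in reversed numbering, on those above \<open>b\<close>, and \<open>E\<close> joins the two strands with the top index \<open>n\<close>.\<close>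

locale walled = L: typeB L CL a n + R: typeB R CR b n
  for L CL R CR :: "nat \<Rightarrow> 'm::monoid_mult" and a b n :: nat +
  fixes E z0 :: 'm
  assumes n_def: "n = a + b"
    and LR: "a < i \<Longrightarrow> i < n \<Longrightarrow> b < j \<Longrightarrow> j < n \<Longrightarrow> L i * R j = R j * L i"
    and LCR: "a < i \<Longrightarrow> i < n \<Longrightarrow> b < j \<Longrightarrow> j \<le> n \<Longrightarrow> L i * CR j = CR j * L i"
    and CLR: "a < i \<Longrightarrow> i \<le> n \<Longrightarrow> b < j \<Longrightarrow> j < n \<Longrightarrow> CL i * R j = R j * CL i"
    and CLCR: "a < i \<Longrightarrow> i \<le> n \<Longrightarrow> b < j \<Longrightarrow> j \<le> n \<Longrightarrow> CL i * CR j = CR j * CL i"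
    and E_L: "b < n \<Longrightarrow> a < i \<Longrightarrow> Suc i < n \<Longrightarrow> E * L i = L i * E"
    and E_CL: "b < n \<Longrightarrow> a < i \<Longrightarrow> i < n \<Longrightarrow> E * CL i = CL i * E"
    and E_R: "a < n \<Longrightarrow> b < i \<Longrightarrow> Suc i < n \<Longrightarrow> E * R i = R i * E"
    and E_CR: "a < n \<Longrightarrow> b < i \<Longrightarrow> i < n \<Longrightarrow> E * CR i = CR i * E"
    and E_sq: "a < n \<Longrightarrow> b < n \<Longrightarrow> E * E = z0"
    and ELE: "Suc a < n \<Longrightarrow> b < n \<Longrightarrow> E * L (n - 1) * E = E"
    and ERE: "a < n \<Longrightarrow> Suc b < n \<Longrightarrow> E * R (n - 1) * E = E"
    and CE: "a < n \<Longrightarrow> b < n \<Longrightarrow> CL n * E = CR n * E"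
    and EC: "a < n \<Longrightarrow> b < n \<Longrightarrow> E * CL n = E * CR n"
    and ECE: "a < n \<Longrightarrow> b < n \<Longrightarrow> E * CL n * E = z0"
    and E_LRELR: "Suc a < n \<Longrightarrow> Suc b < n \<Longrightarrow>
       E * (L (n-1) * R (n-1) * E * R (n-1) * L (n-1)) = L (n-1) * R (n-1) * E * R (n-1) * L (n-1) * E"
    and zL: "a < i \<Longrightarrow> i < n \<Longrightarrow> L i * z0 = z0 \<and> z0 * L i = z0"
    and zCL: "a < i \<Longrightarrow> i \<le> n \<Longrightarrow> CL i * z0 = z0 \<and> z0 * CL i = z0"
    and zR: "b < i \<Longrightarrow> i < n \<Longrightarrow> R i * z0 = z0 \<and> z0 * R i = z0"
    and zCR: "b < i \<Longrightarrow> i \<le> n \<Longrightarrow> CR i * z0 = z0 \<and> z0 * CR i = z0"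
    and zE: "a < n \<Longrightarrow> b < n \<Longrightarrow> E * z0 = z0 \<and> z0 * E = z0"
begin

abbreviation "iN \<equiv> int n"
abbreviation "GL \<equiv> sperm a n"
abbreviation "GR \<equiv> sperm b n"
abbreviation "inve \<equiv> inv_into UNIV :: (int \<Rightarrow> int) \<Rightarrow> int \<Rightarrow> int"

definition vL :: "int \<Rightarrow> bool" where "vL x \<longleftrightarrow> int a < \<bar>x\<bar> \<and> \<bar>x\<bar> \<le> iN"
definition vR :: "int \<Rightarrow> bool" where "vR x \<longleftrightarrow> int b < \<bar>x\<bar> \<and> \<bar>x\<bar> \<le> iN"

lemma vL_nz: "vL x \<Longrightarrow> x \<noteq> 0" and vR_nz: "vR x \<Longrightarrow> x \<noteq> 0" by (auto simp: vL_def vR_def)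
lemma vL_neg [simp]: "vL (- x) = vL x" and vR_neg [simp]: "vR (- x) = vR x" by (auto simp: vL_def vR_def)
lemma vL_n: "vL x \<Longrightarrow> vL iN" and vR_n: "vR x \<Longrightarrow> vR iN" by (auto simp: vL_def vR_def)
lemma vL_lt: "vL x \<Longrightarrow> a < n" and vR_lt: "vR x \<Longrightarrow> b < n" by (auto simp: vL_def vR_def)
lemma GL_v: "g \<in> GL \<Longrightarrow> vL (g x) = vL x" unfolding vL_def by (rule sperm_range_iff)
lemma GR_v: "g \<in> GR \<Longrightarrow> vR (g x) = vR x" unfolding vR_def by (rule sperm_range_iff)
lemma GL_sw: "vL x \<Longrightarrow> vL y \<Longrightarrow> sw x y \<in> GL" by (auto simp: vL_def intro: sperm_sw)
lemma GR_sw: "vR x \<Longrightarrow> vR y \<Longrightarrow> sw x y \<in> GR" by (auto simp: vR_def intro: sperm_sw)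

abbreviation "rL \<equiv> L.rho"
abbreviation "rR \<equiv> R.rho"

lemma rR_sw: "vR x \<Longrightarrow> vR y \<Longrightarrow> rR (sw x y) * rR (sw x y) = 1"
  using R.rho_mult[of "sw x y" "sw x y"] GR_sw[of x y] vR_nz[of x] vR_nz[of y] R.rho_id
  by (simp add: o_def)

lemma RB_commute:
  assumes "x \<in> L.RB n" "y \<in> R.RB n" shows "x * y = y * x"
  using assms(1)
proof (induction rule: L.RB.induct)
  case (RB_S z i)
  have "L i * y = y * L i" using assms(2) 
    by (induction rule: R.RB.induct) (use RB_S LR LCR in \<open>auto intro!: commute_mult\<close>)
  then show ?case using RB_S commute_mult[of y "L i" z] by simp
next
  case (RB_C z i)
  have "CL i * y = y * CL i" using assms(2) 
    by (induction rule: R.RB.induct) (use RB_C CLR CLCR in \<open>auto intro!: commute_mult\<close>)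
  then show ?case using RB_C commute_mult[of y "CL i" z] by simp
qed simp

lemma rLR: "g \<in> GL \<Longrightarrow> h \<in> GR \<Longrightarrow> rL g * rR h = rR h * rL g"
  by (intro RB_commute L.rho_RB R.rho_RB) auto

lemma E_RB_L: assumes "b < n" "x \<in> L.RB (n - 1)" shows "E * x = x * E"
  using assms(2) by (induction rule: L.RB.induct) (use assms(1) E_L E_CL in \<open>auto intro!: commute_mult\<close>)
lemma E_RB_R: assumes "a < n" "x \<in> R.RB (n - 1)" shows "E * x = x * E"
  using assms(2) by (induction rule: R.RB.induct) (use assms(1) E_R E_CR in \<open>auto intro!: commute_mult\<close>)

lemma E_rL: "b < n \<Longrightarrow> g \<in> sperm a (n - 1) \<Longrightarrow> E * rL g = rL g * E"
  by (intro E_RB_L L.rho_RB) auto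
lemma E_rR: "a < n \<Longrightarrow> g \<in> sperm b (n - 1) \<Longrightarrow> E * rR g = rR g * E"
  by (intro E_RB_R R.rho_RB) auto

lemma z_RB_L: "x \<in> L.RB n \<Longrightarrow> x * z0 = z0 \<and> z0 * x = z0"
  by (induction rule: L.RB.induct) (use zL zCL in \<open>auto simp: mult.assoc mult.assoc[of z0, symmetric]\<close>)
lemma z_RB_R: "x \<in> R.RB n \<Longrightarrow> x * z0 = z0 \<and> z0 * x = z0"
  by (induction rule: R.RB.induct) (use zR zCR in \<open>auto simp: mult.assoc mult.assoc[of z0, symmetric]\<close>)
lemma z_rL: "g \<in> GL \<Longrightarrow> rL g * z0 = z0" "g \<in> GL \<Longrightarrow> z0 * rL g = z0"
  using z_RB_L L.rho_RB by auto
lemma z_rR: "g \<in> GR \<Longrightarrow> rR g * z0 = z0" "g \<in> GR \<Longrightarrow> z0 * rR g = z0"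
  using z_RB_R R.rho_RB by auto

definition P :: "(int \<Rightarrow> int) \<Rightarrow> (int \<Rightarrow> int) \<Rightarrow> 'm" where "P g h = rL g * rR h"

lemma P_mult: "g \<in> GL \<Longrightarrow> h \<in> GR \<Longrightarrow> g' \<in> GL \<Longrightarrow> h' \<in> GR \<Longrightarrow> P g h * P g' h' = P (g \<circ> g') (h \<circ> h')"
proof -
  assume A: "g \<in> GL" "h \<in> GR" "g' \<in> GL" "h' \<in> GR"
  have "P g h * P g' h' = rL g * (rR h * rL g') * rR h'" by (simp add: P_def mult.assoc)
  also have "\<dots> = rL g * (rL g' * rR h) * rR h'" using A rLR[of g' h] by simp
  also have "\<dots> = (rL g * rL g') * (rR h * rR h')" by (simp only: mult.assoc)
  finally show ?thesis using A by (simp add: P_def L.rho_mult R.rho_mult)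
qed

lemma P_id: "P id id = 1" by (simp add: P_def L.rho_id R.rho_id)
lemma P_L: "P g id = rL g" and P_R: "P id h = rR h" by (simp_all add: P_def L.rho_id R.rho_id)
lemma z_P: "g \<in> GL \<Longrightarrow> h \<in> GR \<Longrightarrow> P g h * z0 = z0" "g \<in> GL \<Longrightarrow> h \<in> GR \<Longrightarrow> z0 * P g h = z0"
  by (simp_all add: P_def mult.assoc z_rL z_rR mult.assoc[of z0, symmetric])

text \<open>The conjugate of \<open>E\<close> that joins the signed strands \<open>x\<close> on the left and \<open>y\<close> on the right.\<close>

definition e :: "int \<Rightarrow> int \<Rightarrow> 'm" where
  "e x y = P (sw iN x) (sw iN y) * E * P (sw iN x) (sw iN y)"

lemma e_nn: "e iN iN = E" using P_id by (simp add: e_def)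

lemma E_P: assumes "vL iN" "vR iN" "g \<in> GL" "h \<in> GR" "g iN = iN" "h iN = iN" shows "E * P g h = P g h * E"
proof -
  have n: "a < n" "b < n" "n = Suc (n - 1)" using assms by (auto simp: vL_def vR_def)
  have "g \<in> sperm a (n - 1)" "h \<in> sperm b (n - 1)"
    using sperm_Suc_fix[of g a "n - 1"] sperm_Suc_fix[of h b "n - 1"] assms n by auto
  then have 1: "E * rL g = rL g * E" "E * rR h = rR h * E" using E_rL E_rR n by auto
  have "E * P g h = (E * rL g) * rR h" by (simp only: P_def mult.assoc)
  also have "\<dots> = rL g * (E * rR h)" by (simp only: 1(1) mult.assoc)
  also have "\<dots> = P g h * E" by (simp only: 1(2) P_def mult.assoc)
  finally show ?thesis .
qed

lemma P_e:
  assumes "g \<in> GL" "h \<in> GR" "vL x" "vR y"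
  shows "P g h * e x y = e (g x) (h y) * P g h"
proof -
  note v = vL_n[OF assms(3)] vR_n[OF assms(4)] vL_nz[OF assms(3)] vR_nz[OF assms(4)] vL_nz[OF vL_n[OF assms(3)]]
  let ?u = "sw iN x" and ?v = "sw iN y" and ?u' = "sw iN (g x)" and ?v' = "sw iN (h y)"
  have gx: "vL (g x)" "vR (h y)" using assms GL_v GR_v by auto
  note v' = vL_nz[OF gx(1)] vR_nz[OF gx(2)]
  have G: "?u \<in> GL" "?v \<in> GR" "?u' \<in> GL" "?v' \<in> GR"
    using v gx assms by (auto intro: GL_sw GR_sw)
  let ?k = "?u' \<circ> g \<circ> ?u" and ?l = "?v' \<circ> h \<circ> ?v"
  have kl: "?k \<in> GL" "?l \<in> GR" using G assms by (auto intro: sperm_comp)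
  have fx: "?k iN = iN" "?l iN = iN" by auto
  have 1: "g \<circ> ?u = ?u' \<circ> ?k" "h \<circ> ?v = ?v' \<circ> ?l" "?k \<circ> ?u = ?u' \<circ> g" "?l \<circ> ?v = ?v' \<circ> h"
    using v v' by (auto simp: fun_eq_iff)
  have "P g h * e x y = (P g h * P ?u ?v) * E * P ?u ?v" by (simp only: e_def mult.assoc)
  also have "P g h * P ?u ?v = P ?u' ?v' * P ?k ?l"
    using G kl assms by (simp only: P_mult 1)
  also have "P ?u' ?v' * P ?k ?l * E * P ?u ?v = P ?u' ?v' * (P ?k ?l * E) * P ?u ?v" by (simp only: mult.assoc)
  also have "\<dots> = P ?u' ?v' * (E * P ?k ?l) * P ?u ?v" by (simp only: E_P[OF v(1,2) kl fx])
  also have "\<dots> = P ?u' ?v' * E * (P ?k ?l * P ?u ?v)" by (simp only: mult.assoc)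
  also have "P ?k ?l * P ?u ?v = P ?u' ?v' * P g h"
    using G kl assms by (simp only: P_mult 1)
  finally show ?thesis by (simp only: e_def mult.assoc)
qed

lemma rL_e: "g \<in> GL \<Longrightarrow> vL x \<Longrightarrow> vR y \<Longrightarrow> rL g * e x y = e (g x) y * rL g"
  using P_e[of g id x y] by (simp add: P_L)
lemma rR_e: "h \<in> GR \<Longrightarrow> vL x \<Longrightarrow> vR y \<Longrightarrow> rR h * e x y = e x (h y) * rR h"
  using P_e[of id h x y] by (simp add: P_R)

text \<open>Signed permutations on both sides conjugate any arcs to the arcs at the last two strands, so each relation between arcs follows from a relation between \<open>E\<close> and the generators of index \<open>n - 1\<close> and \<open>n\<close>.\<close>

lemma conj_from:
  assumes "g \<in> GL" "h \<in> GR" "X * P g h = P g h * X0" "Y * P g h = P g h * Y0" "X0 = Y0"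
  shows "X = Y"
proof -
  let ?g = "inve g" and ?h = "inve h"
  have i: "?g \<in> GL" "?h \<in> GR" "g \<circ> ?g = id" "h \<circ> ?h = id"
    using sperm_inv[OF assms(1)] sperm_inv[OF assms(2)] by (auto simp: fun_eq_iff)
  then have 1: "P g h * P ?g ?h = 1" using assms P_mult[of g h ?g ?h] P_id by simp
  have "X * (P g h * P ?g ?h) = Y * (P g h * P ?g ?h)"
    using assms(3-5) by (simp only: mult.assoc[symmetric])
  then show ?thesis using 1 by simp
qed

lemma conj_to: "g \<in> GL \<Longrightarrow> h \<in> GR \<Longrightarrow> vL x \<Longrightarrow> vR y \<Longrightarrow> e (g x) (h y) * P g h = P g h * e x y"
  using P_e by simp

lemma conj_mult: "(X::'m) * p = p * X' \<Longrightarrow> Y * p = p * Y' \<Longrightarrow> (X * Y) * p = p * (X' * Y')"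
  by (metis mult.assoc)

lemma choose_L: assumes "vL x" obtains g where "g \<in> GL" "g iN = x"
  using that[of "sw iN x"] GL_sw[of iN x] vL_n[OF assms] assms by auto
lemma choose_R: assumes "vR x" obtains g where "g \<in> GR" "g iN = x"
  using that[of "sw iN x"] GR_sw[of iN x] vR_n[OF assms] assms by auto

lemma choose2: assumes "int c < \<bar>x\<bar>" "\<bar>x\<bar> \<le> iN" "int c < \<bar>x'\<bar>" "\<bar>x'\<bar> \<le> iN" "\<bar>x\<bar> \<noteq> \<bar>x'\<bar>"
  obtains g where "g \<in> sperm c n" "g iN = x" "g (iN - 1) = x'" "int c < iN - 1"
proof -
  have c: "int c < iN - 1" "int c < iN" using assms by linarith+
  let ?x = "sw iN x x'"
  have nz: "x \<noteq> 0" "x' \<noteq> 0" "iN \<noteq> 0" using assms c by auto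
  have G: "sw iN x \<in> sperm c n" using assms c by (intro sperm_sw) auto
  have x: "int c < \<bar>?x\<bar> \<and> \<bar>?x\<bar> \<le> iN" using sperm_range[OF G] assms by auto
  have ne: "\<bar>?x\<bar> \<noteq> \<bar>iN\<bar>" using assms nz odd_bij_abs[OF sperm_odd[OF G], of x' x] by (simp)
  have "sw (iN - 1) ?x \<in> sperm c n" using x c by (intro sperm_sw) auto
  then have "sw iN x \<circ> sw (iN - 1) ?x \<in> sperm c n" using G sperm_comp by blast
  moreover have "(sw iN x \<circ> sw (iN - 1) ?x) iN = x" using ne c by (simp add: sw_other)
  moreover have "(sw iN x \<circ> sw (iN - 1) ?x) (iN - 1) = x'" using nz by simp
  ultimately show ?thesis using that c by blast
qed

lemma L_n1: "Suc a < n \<Longrightarrow> rL (sw iN (iN - 1)) = L (n - 1)"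
proof -
  assume "Suc a < n"
  then have "int (n - 1) = iN - 1" by (simp add: of_nat_diff)
  then show ?thesis using L.rho_S[of "n - 1"] \<open>Suc a < n\<close> by (simp add: sw_sym[of iN])
qed
lemma R_n1: "Suc b < n \<Longrightarrow> rR (sw iN (iN - 1)) = R (n - 1)"
proof -
  assume "Suc b < n"
  then have "int (n - 1) = iN - 1" by (simp add: of_nat_diff)
  then show ?thesis using R.rho_S[of "n - 1"] \<open>Suc b < n\<close> by (simp add: sw_sym[of iN])
qed
lemma CL_n: "a < n \<Longrightarrow> rL (sw iN (- iN)) = CL n" using L.rho_C[of n] by simp
lemma CR_n: "b < n \<Longrightarrow> rR (sw iN (- iN)) = CR n" using R.rho_C[of n] by simp

lemma e_neg: assumes "vL x" "vR y" shows "e (- x) (- y) = e x y"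
proof -
  obtain g h where g: "g \<in> GL" "g iN = x" "h \<in> GR" "h iN = y" using choose_L choose_R assms by metis
  note v = vL_n[OF assms(1)] vR_n[OF assms(2)]
  have n: "a < n" "b < n" using v by (auto simp: vL_def vR_def)
  have 1: "e (- x) (- y) * P g h = P g h * e (- iN) (- iN)"
    using conj_to[OF g(1,3), of "- iN" "- iN"] v g odd_bij_neg sperm_odd by auto
  have 2: "e x y * P g h = P g h * e iN iN" using conj_to[OF g(1,3) v] g by auto
  have PC: "P (sw iN (- iN)) (sw iN (- iN)) = CL n * CR n" using CL_n CR_n n by (simp add: P_def)
  have "e (- iN) (- iN) = CL n * (CR n * E) * (CL n * CR n)" by (simp add: e_def PC mult.assoc)
  also have "\<dots> = CL n * (CL n * E) * (CL n * CR n)" using CE[OF n] by simp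
  also have "\<dots> = (CL n * CL n) * (E * CL n) * CR n" by (simp only: mult.assoc)
  also have "\<dots> = E * (CR n * CR n)" using L.C_sq[of n] EC[OF n] n by (simp add: mult.assoc)
  also have "\<dots> = e iN iN" using R.C_sq[of n] n by (simp add: e_nn)
  finally show ?thesis by (rule conj_from[OF g(1,3) 1 2])
qed

lemma rel1: assumes "vL x" "vR y" shows "e x y * e x y = z0" "e x y * e x (- y) = z0"
proof -
  obtain g h where g: "g \<in> GL" "g iN = x" "h \<in> GR" "h iN = y" using choose_L choose_R assms by metis
  note v = vL_n[OF assms(1)] vR_n[OF assms(2)]
  have n: "a < n" "b < n" using v by (auto simp: vL_def vR_def)
  have 2: "e x y * P g h = P g h * E" using conj_to[OF g(1,3) v] g e_nn by auto
  have 3: "e x (- y) * P g h = P g h * e iN (- iN)"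
    using conj_to[OF g(1,3), of iN "- iN"] v g odd_bij_neg sperm_odd by auto
  have z: "z0 * P g h = P g h * z0" using z_P g by simp
  show "e x y * e x y = z0"
    by (rule conj_from[OF g(1,3) conj_mult[OF 2 2] z]) (rule E_sq[OF n])
  have "E * e iN (- iN) = (E * CL n * E) * CR n"
    using EC[OF n] CR_n[OF n(2)] by (simp add: e_def P_R mult.assoc[symmetric] id_def[symmetric])
  also have "\<dots> = z0" using ECE[OF n] zCR n by simp
  finally have "E * e iN (- iN) = z0" .
  then show "e x y * e x (- y) = z0"
    by (rule conj_from[OF g(1,3) conj_mult[OF 2 3] z])
qed

lemma P_sw_R: assumes "h \<in> GR" "vR y" "vR y'" "g \<in> GL"
  shows "rR (sw (h y) (h y')) * P g h = P g h * rR (sw y y')"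
proof -
  have 1: "sw (h y) (h y') \<circ> h = h \<circ> sw y y'"
    using sw_conj[OF sperm_odd[OF assms(1)]] by (auto simp: fun_eq_iff)
  have "vR (h y)" "vR (h y')" using GR_v assms by auto
  then have G: "sw (h y) (h y') \<in> GR" "sw y y' \<in> GR" using assms GR_sw by auto
  show ?thesis using P_mult[of id "sw (h y) (h y')" g h] P_mult[of g h id "sw y y'"] assms G 1 by (simp add: P_R)
qed
lemma P_sw_L: assumes "g \<in> GL" "vL x" "vL x'" "h \<in> GR"
  shows "rL (sw (g x) (g x')) * P g h = P g h * rL (sw x x')"
proof -
  have 1: "sw (g x) (g x') \<circ> g = g \<circ> sw x x'"
    using sw_conj[OF sperm_odd[OF assms(1)]] by (auto simp: fun_eq_iff)
  have "vL (g x)" "vL (g x')" using GL_v assms by auto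
  then have G: "sw (g x) (g x') \<in> GL" "sw x x' \<in> GL" using assms GL_sw by auto
  show ?thesis using P_mult[of "sw (g x) (g x')" id g h] P_mult[of g h "sw x x'" id] assms G 1 by (simp add: P_L)
qed

text \<open>Two arcs with a common end on one side: the second one only permutes the ends on the other side. This is the relation \<open>e s e = e\<close> in general position.\<close>

lemma rel2: assumes "vL x" "vR y" "vR y'" "\<bar>y\<bar> \<noteq> \<bar>y'\<bar>"
  shows "e x y * e x y' = e x y * rR (sw y y')"
proof -
  obtain g where g: "g \<in> GL" "g iN = x" using choose_L assms by metis
  obtain h where h: "h \<in> GR" "h iN = y" "h (iN - 1) = y'" "int b < iN - 1"
    using choose2[of b y y'] assms unfolding vR_def by metis
  note v = vL_n[OF assms(1)] vR_n[OF assms(2)]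
  have v1: "vR (iN - 1)" using h by (auto simp: vR_def)
  have n: "a < n" "b < n" "Suc b < n" using v h by (auto simp: vL_def vR_def)
  have 1: "e x y * P g h = P g h * E" using conj_to[OF g(1) h(1) v] g h e_nn by auto
  have 2: "e x y' * P g h = P g h * e iN (iN - 1)" using conj_to[OF g(1) h(1) v(1) v1] g h by auto
  have 3: "rR (sw y y') * P g h = P g h * rR (sw iN (iN - 1))" using P_sw_R[OF h(1) v(2) v1 g(1)] h by simp
  have "E * e iN (iN - 1) = (E * R (n - 1) * E) * R (n - 1)"
    using R_n1[OF n(3)] by (simp add: e_def P_R mult.assoc[symmetric] id_def[symmetric])
  also have "\<dots> = E * rR (sw iN (iN - 1))" using ERE n R_n1 by simp
  finally show ?thesis by (rule conj_from[OF g(1) h(1) conj_mult[OF 1 2] conj_mult[OF 1 3]])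
qed

lemma rel3: assumes "vL x" "vR y" "vL x'" "\<bar>x\<bar> \<noteq> \<bar>x'\<bar>"
  shows "e x y * e x' y = e x y * rL (sw x x')"
proof -
  obtain h where h: "h \<in> GR" "h iN = y" using choose_R assms by metis
  obtain g where g: "g \<in> GL" "g iN = x" "g (iN - 1) = x'" "int a < iN - 1"
    using choose2[of a x x'] assms unfolding vL_def by metis
  note v = vL_n[OF assms(1)] vR_n[OF assms(2)]
  have v1: "vL (iN - 1)" using g by (auto simp: vL_def)
  have n: "a < n" "b < n" "Suc a < n" using v g by (auto simp: vL_def vR_def)
  have 1: "e x y * P g h = P g h * E" using conj_to[OF g(1) h(1) v] g h e_nn by auto
  have 2: "e x' y * P g h = P g h * e (iN - 1) iN" using conj_to[OF g(1) h(1) v1 v(2)] g h by auto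
  have 3: "rL (sw x x') * P g h = P g h * rL (sw iN (iN - 1))" using P_sw_L[OF g(1) v(1) v1 h(1)] g by simp
  have "E * e (iN - 1) iN = (E * L (n - 1) * E) * L (n - 1)"
    using L_n1[OF n(3)] by (simp add: e_def P_L mult.assoc[symmetric] id_def[symmetric])
  also have "\<dots> = E * rL (sw iN (iN - 1))" using ELE n L_n1 by simp
  finally show ?thesis by (rule conj_from[OF g(1) h(1) conj_mult[OF 1 2] conj_mult[OF 1 3]])
qed

text \<open>Disjoint arcs commute: the long relation in general position.\<close>

lemma rel4: assumes "vL x" "vR y" "vL x'" "vR y'" "\<bar>x\<bar> \<noteq> \<bar>x'\<bar>" "\<bar>y\<bar> \<noteq> \<bar>y'\<bar>"
  shows "e x y * e x' y' = e x' y' * e x y"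
proof -
  obtain h where h: "h \<in> GR" "h iN = y" "h (iN - 1) = y'" "int b < iN - 1"
    using choose2[of b y y'] assms unfolding vR_def by metis
  obtain g where g: "g \<in> GL" "g iN = x" "g (iN - 1) = x'" "int a < iN - 1"
    using choose2[of a x x'] assms unfolding vL_def by metis
  note v = vL_n[OF assms(1)] vR_n[OF assms(2)]
  have v1: "vL (iN - 1)" "vR (iN - 1)" using g h by (auto simp: vL_def vR_def)
  have n: "a < n" "b < n" "Suc a < n" "Suc b < n" using v g h by (auto simp: vL_def vR_def)
  have 1: "e x y * P g h = P g h * E" using conj_to[OF g(1) h(1) v] g h e_nn by auto
  have 2: "e x' y' * P g h = P g h * e (iN - 1) (iN - 1)" using conj_to[OF g(1) h(1) v1] g h by auto
  have LRc: "L (n - 1) * R (n - 1) = R (n - 1) * L (n - 1)" using LR[of "n - 1" "n - 1"] n by simp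
  have "e (iN - 1) (iN - 1) = L (n - 1) * R (n - 1) * E * R (n - 1) * L (n - 1)"
    using L_n1 R_n1 n LRc by (simp add: e_def P_def mult.assoc)
  then have "E * e (iN - 1) (iN - 1) = e (iN - 1) (iN - 1) * E" using E_LRELR n by simp
  then show ?thesis by (rule conj_from[OF g(1) h(1) conj_mult[OF 1 2] conj_mult[OF 2 1]])
qed

lemma rel5: assumes "vL x" "vR y" shows "e x y * rL (sw x (- x)) * rR (sw y (- y)) = e x y"
proof -
  have v: "vL (- x)" "vR (- y)" using assms by auto
  have "e x y * rL (sw x (- x)) * rR (sw y (- y)) = e x y * P (sw x (- x)) (sw y (- y))"
    by (simp add: P_def mult.assoc)
  obtain g h where g: "g \<in> GL" "g iN = x" "h \<in> GR" "h iN = y" using choose_L choose_R assms by metis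
  note v = vL_n[OF assms(1)] vR_n[OF assms(2)]
  have n: "a < n" "b < n" using v by (auto simp: vL_def vR_def)
  have 2: "e x y * P g h = P g h * E" using conj_to[OF g(1,3) v] g e_nn by auto
  have neg: "g (- iN) = - x" "h (- iN) = - y" using g odd_bij_neg sperm_odd by metis+
  have 3: "rR (sw y (- y)) * P g h = P g h * rR (sw iN (- iN))" using P_sw_R[of h iN "- iN" g] v g neg by simp
  have 4: "rL (sw x (- x)) * P g h = P g h * rL (sw iN (- iN))" using P_sw_L[of g iN "- iN" h] v g neg by simp
  have "E * rL (sw iN (- iN)) * rR (sw iN (- iN)) = E"
    using CL_n CR_n n EC[OF n] R.C_sq[of n] by (simp add: mult.assoc)
  then show ?thesis by (rule conj_from[OF g(1,3) conj_mult[OF conj_mult[OF 2 4] 3] 2])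
qed

text \<open>Exchanging the end points of two disjoint arcs on both sides at once does nothing.\<close>

lemma rel6: assumes "vL x" "vR y" "vL x'" "vR y'" "\<bar>x\<bar> \<noteq> \<bar>x'\<bar>" "\<bar>y\<bar> \<noteq> \<bar>y'\<bar>"
  shows "e x y * e x' y' * rL (sw x x') * rR (sw y y') = e x y * e x' y'"
proof -
  note G = GL_sw[OF assms(1,3)] GR_sw[OF assms(2,4)]
  have c: "rL (sw x x') * rR (sw y y') = rR (sw y y') * rL (sw x x')" using rLR G by simp
  have "e x y * e x' y' * rL (sw x x') * rR (sw y y') = e x' y' * (e x y * rR (sw y y')) * rL (sw x x')"
    using rel4[OF assms] c by (simp add: mult.assoc)
  also have "\<dots> = e x' y' * (e x y * e x y') * rL (sw x x')"
    using rel2[of x y y'] assms by simp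
  also have "\<dots> = e x' y' * e x y * (e x y' * rL (sw x x'))" by (simp only: mult.assoc)
  also have "e x y' * rL (sw x x') = rL (sw x x') * e x' y'" using rL_e[of "sw x x'" x' y'] assms G by simp
  also have "e x' y' * e x y * (rL (sw x x') * e x' y') = e x' y' * (e x y * rL (sw x x')) * e x' y'"
    by (simp only: mult.assoc)
  also have "\<dots> = e x' y' * (e x y * e x' y) * e x' y'" using rel3[of x y x'] assms by simp
  also have "\<dots> = e x y * (e x' y' * e x' y) * e x' y'" using rel4[OF assms] by (simp add: mult.assoc[symmetric])
  also have "e x' y' * e x' y = e x' y' * rR (sw y y')"
    using rel2[of x' y' y] assms sw_sym[of y y'] vR_nz by auto
  also have "e x y * (e x' y' * rR (sw y y')) * e x' y' = e x y * e x' y' * (rR (sw y y') * e x' y')"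
    by (simp only: mult.assoc)
  also have "rR (sw y y') * e x' y' = e x' y * rR (sw y y')" using rR_e[of "sw y y'" x' y'] assms G by simp
  also have "e x y * e x' y' * (e x' y * rR (sw y y')) = e x y * (e x' y' * e x' y) * rR (sw y y')"
    by (simp only: mult.assoc)
  also have "e x' y' * e x' y = e x' y' * rR (sw y y')"
    using rel2[of x' y' y] assms sw_sym[of y y'] vR_nz by auto
  also have "e x y * (e x' y' * rR (sw y y')) * rR (sw y y') = e x y * e x' y' * (rR (sw y y') * rR (sw y y'))"
    by (simp only: mult.assoc)
  also have "\<dots> = e x y * e x' y'" using rR_sw assms by simp
  finally show ?thesis .
qed

end

section \<open>Normal forms in the walled monoid\<close>

context walled begin

fun EM :: "(int \<times> int) list \<Rightarrow> 'm" where
  "EM [] = 1"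
| "EM ((x, y) # m) = e x y * EM m"

text \<open>The effect of \<open>e x y\<close> on a state: afterwards the state sends \<open>y\<close> to \<open>x\<close>, and the former partners of \<open>x\<close> and \<open>y\<close> become partners.\<close>

definition est :: "int \<Rightarrow> int \<Rightarrow> (int \<Rightarrow> int) \<Rightarrow> int \<Rightarrow> int" where
  "est x y f = sw x (f y) \<circ> f"

text \<open>The state obtained from \<open>u\<close> by a list of arcs.\<close>

fun EA :: "(int \<times> int) list \<Rightarrow> (int \<Rightarrow> int) \<Rightarrow> int \<Rightarrow> int" where
  "EA [] u = u"
| "EA ((x, y) # m) u = est x y (EA m u)"

text \<open>Lists of arcs with pairwise disjoint end points.\<close>

definition val :: "(int \<times> int) list \<Rightarrow> bool" where
  "val m \<longleftrightarrow> (\<forall>(x, y)\<in>set m. vL x \<and> vR y) \<and> distinct (map (\<lambda>p. \<bar>fst p\<bar>) m) \<and> distinct (map (\<lambda>p. \<bar>snd p\<bar>) m)"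

text \<open>States in which no arc joins the two sides: right points are never sent to left points.\<close>

definition through :: "(int \<Rightarrow> int) \<Rightarrow> bool" where
  "through u \<longleftrightarrow> odd_bij u \<and> (\<forall>t. vL (u t) \<longleftrightarrow> t \<noteq> 0 \<and> \<bar>t\<bar> \<le> iN \<and> \<not> vR t)"

definition fl :: "(int \<times> int) list \<Rightarrow> int set" where "fl m = (\<lambda>p. \<bar>fst p\<bar>) ` set m"
definition fr :: "(int \<times> int) list \<Rightarrow> int set" where "fr m = (\<lambda>p. \<bar>snd p\<bar>) ` set m"

lemma val_Cons: "val ((x, y) # m) \<longleftrightarrow> vL x \<and> vR y \<and> \<bar>x\<bar> \<notin> fl m \<and> \<bar>y\<bar> \<notin> fr m \<and> val m"
  by (auto simp: val_def fl_def fr_def)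
lemma val_Nil [simp]: "val []" by (simp add: val_def)
lemma fl_simps [simp]: "fl [] = {}" "fl ((x, y) # m) = insert \<bar>x\<bar> (fl m)" by (auto simp: fl_def)
lemma fr_simps [simp]: "fr [] = {}" "fr ((x, y) # m) = insert \<bar>y\<bar> (fr m)" by (auto simp: fr_def)
lemma val_in: "val m \<Longrightarrow> (x, y) \<in> set m \<Longrightarrow> vL x \<and> vR y" by (auto simp: val_def)
lemma fl_I: "(x, y) \<in> set m \<Longrightarrow> \<bar>x\<bar> \<in> fl m" by (force simp: fl_def)
lemma fr_I: "(x, y) \<in> set m \<Longrightarrow> \<bar>y\<bar> \<in> fr m" by (force simp: fr_def)
lemma fl_vL: "val m \<Longrightarrow> \<bar>x\<bar> \<in> fl m \<Longrightarrow> vL x" by (auto simp: val_def fl_def vL_def)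
lemma fr_vR: "val m \<Longrightarrow> \<bar>x\<bar> \<in> fr m \<Longrightarrow> vR x" by (auto simp: val_def fr_def vR_def)

lemma odd_bij_est: "odd_bij f \<Longrightarrow> x \<noteq> 0 \<Longrightarrow> y \<noteq> 0 \<Longrightarrow> odd_bij (est x y f)"
  unfolding est_def by (intro odd_bij_comp odd_bij_sw) (auto simp: odd_bij_nz)

lemma odd_bij_EA: "odd_bij u \<Longrightarrow> val m \<Longrightarrow> odd_bij (EA m u)"
  by (induction m rule: EM.induct) (auto simp: val_Cons intro!: odd_bij_est dest: vL_nz vR_nz)

lemma through_odd: "through u \<Longrightarrow> odd_bij u" by (simp add: through_def)
lemma through_R: "through u \<Longrightarrow> vR t \<Longrightarrow> \<not> vL (u t)" by (simp add: through_def)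
lemma through_L: "through u \<Longrightarrow> vL (u t) \<Longrightarrow> \<not> vR t \<and> \<bar>t\<bar> \<le> iN" by (simp add: through_def)
lemma through_surj: "through u \<Longrightarrow> \<exists>t. u t = x"
  by (metis through_odd odd_bij_def bij_is_surj surjD)

lemma vL_abs: "\<bar>x\<bar> = \<bar>y\<bar> \<Longrightarrow> vL x = vL y" by (simp add: vL_def)
lemma vR_abs: "\<bar>x\<bar> = \<bar>y\<bar> \<Longrightarrow> vR x = vR y" by (simp add: vR_def)

lemma EA_values:
  assumes "val m" "through u"
  shows EA_1: "(x, y) \<in> set m \<Longrightarrow> EA m u y = x"
    and EA_2: "(x, y) \<in> set m \<Longrightarrow> u t = x \<Longrightarrow> EA m u t = u y"
    and EA_3: "\<bar>t\<bar> \<notin> fr m \<Longrightarrow> \<bar>u t\<bar> \<notin> fl m \<Longrightarrow> EA m u t = u t"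
proof -
  note ob = through_odd[OF assms(2)]
  have "(\<forall>x y. (x, y) \<in> set m \<longrightarrow> EA m u y = x) \<and> (\<forall>x y t. (x, y) \<in> set m \<longrightarrow> u t = x \<longrightarrow> EA m u t = u y) \<and>
     (\<forall>t. \<bar>t\<bar> \<notin> fr m \<longrightarrow> \<bar>u t\<bar> \<notin> fl m \<longrightarrow> EA m u t = u t)"
    using assms(1)
  proof (induction m)
    case (Cons p m)
    obtain x1 y1 where p: "p = (x1, y1)" by fastforce
    have v: "vL x1" "vR y1" "\<bar>x1\<bar> \<notin> fl m" "\<bar>y1\<bar> \<notin> fr m" "val m" using Cons.prems p val_Cons by auto
    from Cons.IH[OF v(5)] have I1: "\<And>x y. (x, y) \<in> set m \<Longrightarrow> EA m u y = x"
      and I2: "\<And>x y t. (x, y) \<in> set m \<Longrightarrow> u t = x \<Longrightarrow> EA m u t = u y"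
      and I3: "\<And>t. \<bar>t\<bar> \<notin> fr m \<Longrightarrow> \<bar>u t\<bar> \<notin> fl m \<Longrightarrow> EA m u t = u t" by auto
    have uy1: "\<not> vL (u y1)" using through_R assms v by auto
    have vy1: "EA m u y1 = u y1" using I3[of y1] v fl_vL[of m "u y1"] uy1 by auto
    have step: "EA (p # m) u t = sw x1 (u y1) (EA m u t)" for t by (simp add: p est_def vy1)
    have 1: "EA (p # m) u y = x" if "(x, y) \<in> set (p # m)" for x y
    proof (cases "(x, y) = p")
      case True then show ?thesis using step vy1 p by simp
    next
      case False
      then have xy: "(x, y) \<in> set m" using that by auto
      have "\<bar>x\<bar> \<noteq> \<bar>x1\<bar>" using fl_I[OF xy] v by auto
      moreover have "\<bar>x\<bar> \<noteq> \<bar>u y1\<bar>" using val_in[OF v(5) xy] uy1 vL_abs by metis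
      ultimately show ?thesis using step I1[OF xy] by (simp add: sw_other)
    qed
    have 2: "EA (p # m) u t = u y" if "(x, y) \<in> set (p # m)" "u t = x" for x y t
    proof (cases "(x, y) = p")
      case True
      have t: "\<not> vR t" using through_L[OF assms(2), of t] True that p v by auto
      then have "\<bar>t\<bar> \<notin> fr m" using fr_vR[OF v(5)] by auto
      then have "EA m u t = x1" using I3[of t] True that p v by auto
      then show ?thesis using step True p by simp
    next
      case False
      then have xy: "(x, y) \<in> set m" using that by auto
      have yv: "vR y" using val_in[OF v(5) xy] by simp
      have "\<bar>u y\<bar> \<noteq> \<bar>x1\<bar>" using v(1) through_R[OF assms(2) yv] vL_abs by metis
      moreover have "\<bar>y\<bar> \<noteq> \<bar>y1\<bar>" using fr_I[OF xy] v by auto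
      then have "\<bar>u y\<bar> \<noteq> \<bar>u y1\<bar>" using odd_bij_abs[OF ob] by blast
      ultimately show ?thesis using step I2[OF xy that(2)] by (simp add: sw_other)
    qed
    have 3: "EA (p # m) u t = u t" if "\<bar>t\<bar> \<notin> fr (p # m)" "\<bar>u t\<bar> \<notin> fl (p # m)" for t
    proof -
      have "EA m u t = u t" using I3 that p by simp
      moreover have "\<bar>u t\<bar> \<noteq> \<bar>u y1\<bar>" using that p odd_bij_abs[OF ob] by auto
      ultimately show ?thesis using step that p by (simp add: sw_other)
    qed
    show ?case using 1 2 3 by blast
  qed simp
  then show "(x, y) \<in> set m \<Longrightarrow> EA m u y = x" "(x, y) \<in> set m \<Longrightarrow> u t = x \<Longrightarrow> EA m u t = u y"
    "\<bar>t\<bar> \<notin> fr m \<Longrightarrow> \<bar>u t\<bar> \<notin> fl m \<Longrightarrow> EA m u t = u t" by blast+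
qed

lemma EA_free: assumes "val m" "through u" "vR y" "\<bar>y\<bar> \<notin> fr m"
  shows "EA m u y = u y" "\<not> vL (EA m u y)"
proof -
  have "\<not> vL (u y)" using through_R assms by auto
  then show "EA m u y = u y" using EA_3[OF assms(1,2,4)] fl_vL[OF assms(1)] by auto
  then show "\<not> vL (EA m u y)" using \<open>\<not> vL (u y)\<close> by simp
qed

lemma est_neg: "odd_bij f \<Longrightarrow> x \<noteq> 0 \<Longrightarrow> y \<noteq> 0 \<Longrightarrow> est (- x) (- y) f = est x y f"
  unfolding est_def using odd_bij_nz[of f y] by (simp add: odd_bij_neg sw_neg)

lemma est_comm:
  assumes "odd_bij v" "vL x" "vR y" "vL x1" "vR y1" "\<bar>x\<bar> \<noteq> \<bar>x1\<bar>" "\<bar>y\<bar> \<noteq> \<bar>y1\<bar>" "\<not> vL (v y)" "\<not> vL (v y1)"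
  shows "est x1 y1 (est x y v) = est x y (est x1 y1 v)"
proof -
  have nz: "x \<noteq> 0" "x1 \<noteq> 0" "v y \<noteq> 0" "v y1 \<noteq> 0" using assms vL_nz vR_nz odd_bij_nz by blast+
  have n: "\<bar>v y\<bar> \<noteq> \<bar>v y1\<bar>" "\<bar>v y\<bar> \<noteq> \<bar>x\<bar>" "\<bar>v y\<bar> \<noteq> \<bar>x1\<bar>" "\<bar>v y1\<bar> \<noteq> \<bar>x\<bar>" "\<bar>v y1\<bar> \<noteq> \<bar>x1\<bar>"
    using assms odd_bij_abs vL_abs by metis+
  have 1: "est x y v y1 = v y1" "est x1 y1 v y = v y" using n by (auto simp: est_def sw_other)
  have "sw x1 (v y1) (sw x (v y) z) = sw x (v y) (sw x1 (v y1) z)" for z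
    using sw_conj[OF odd_bij_sw[OF nz(2,4)], of x "v y" z] n assms(6) by (simp add: sw_other)
  then show ?thesis using 1 by (simp add: est_def[of _ _ "est _ _ _"]) (auto simp: est_def fun_eq_iff)
qed

text \<open>Disjoint arcs commute, so any arc of a list can be moved to its front; an arc is not changed by reversing the signs of both its ends.\<close>

lemma front:
  assumes "val m" "(x, y) \<in> set m \<or> (- x, - y) \<in> set m"
  shows "\<exists>m'. val ((x, y) # m') \<and> set m' \<subseteq> set m \<and> (\<forall>p\<in>set m. p \<in> set m' \<or> p = (x, y) \<or> p = (- x, - y)) \<and>
     EM m = e x y * EM m' \<and> (\<forall>u. through u \<longrightarrow> EA m u = est x y (EA m' u))"
  using assms
proof (induction m)
  case (Cons p m)
  obtain x1 y1 where p: "p = (x1, y1)" by fastforce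
  have v: "vL x1" "vR y1" "\<bar>x1\<bar> \<notin> fl m" "\<bar>y1\<bar> \<notin> fr m" "val m" using Cons.prems p val_Cons by auto
  consider "p = (x, y)" | "p = (- x, - y)" | "(x, y) \<in> set m \<or> (- x, - y) \<in> set m" using Cons.prems by auto
  then show ?case
  proof cases
    case 1
    then show ?thesis using Cons.prems by (intro exI[of _ m]) auto
  next
    case 2
    then have x: "vL x" "vR y" "\<bar>x\<bar> \<notin> fl m" "\<bar>y\<bar> \<notin> fr m" using v p by auto
    have "est (- x) (- y) (EA m u) = est x y (EA m u)" if "through u" for u
      using est_neg[OF odd_bij_EA[OF through_odd[OF that] v(5)]] x vL_nz vR_nz by blast
    then show ?thesis using 2 x v e_neg[OF x(1,2)] by (intro exI[of _ m]) (auto simp: val_Cons)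
  next
    case 3
    from Cons.IH[OF v(5) 3] obtain m' where m': "val ((x, y) # m')" "set m' \<subseteq> set m"
      "\<forall>p\<in>set m. p \<in> set m' \<or> p = (x, y) \<or> p = (- x, - y)" "EM m = e x y * EM m'"
      "\<forall>u. through u \<longrightarrow> EA m u = est x y (EA m' u)" by blast
    have xy: "\<bar>x\<bar> \<in> fl m" "\<bar>y\<bar> \<in> fr m" using 3 fl_I fr_I by force+
    then have ne: "\<bar>x\<bar> \<noteq> \<bar>x1\<bar>" "\<bar>y\<bar> \<noteq> \<bar>y1\<bar>" using v by auto
    have sub: "fl m' \<subseteq> fl m" "fr m' \<subseteq> fr m" using m'(2) by (auto simp: fl_def fr_def)
    have v': "vL x" "vR y" "\<bar>x\<bar> \<notin> fl m'" "\<bar>y\<bar> \<notin> fr m'" "val m'" using m' val_Cons by auto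
    have y1': "\<bar>y1\<bar> \<notin> fr m'" using v sub by auto
    have val: "val ((x, y) # p # m')" using v v' ne sub by (auto simp: p val_Cons)
    have "EM (p # m) = (e x1 y1 * e x y) * EM m'" by (simp add: p m' mult.assoc)
    also have "\<dots> = e x y * EM (p # m')"
      using rel4[of x1 y1 x y] v v' ne by (simp add: p mult.assoc)
    finally have EM: "EM (p # m) = e x y * EM (p # m')" .
    have EA: "EA (p # m) u = est x y (EA (p # m') u)" if u: "through u" for u
      using est_comm[OF odd_bij_EA[OF through_odd[OF u] v'(5)], of x y x1 y1] v v' ne m'(5) u
        EA_free[OF v'(5) u v'(2,4)] EA_free[OF v'(5) u v(2) y1'] by (auto simp: p)
    show ?thesis using val EM EA m'(2,3) by (intro exI[of _ "p # m'"]) auto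
  qed
qed simp

lemma arc: assumes "val m" "through u" "vR y" "vL (EA m u y)"
  shows "(EA m u y, y) \<in> set m \<or> (- EA m u y, - y) \<in> set m"
proof -
  have "\<bar>y\<bar> \<in> fr m" using EA_free[OF assms(1,2,3)] assms(4) by blast
  then obtain x1 y1 where 1: "(x1, y1) \<in> set m" "\<bar>y\<bar> = \<bar>y1\<bar>" by (auto simp: fr_def)
  have "EA m u y1 = x1" by (rule EA_1[OF assms(1,2) 1(1)])
  moreover have "EA m u (- y1) = - EA m u y1"
    by (rule odd_bij_neg[OF odd_bij_EA[OF through_odd[OF assms(2)] assms(1)]])
  moreover have "y = y1 \<or> y = - y1" using 1(2) by linarith
  ultimately show ?thesis using 1(1) by auto
qed

lemma z_e: "vL x \<Longrightarrow> vR y \<Longrightarrow> z0 * e x y = z0"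
proof -
  assume v: "vL x" "vR y"
  have "P (sw iN x) (sw iN y) * z0 = z0" "z0 * P (sw iN x) (sw iN y) = z0"
    using z_P GL_sw GR_sw v vL_n vR_n by auto
  moreover have "z0 * E = z0" using zE vL_lt vR_lt v by auto
  ultimately show ?thesis by (simp add: e_def mult.assoc[symmetric])
qed

lemma z_EM: "val m \<Longrightarrow> z0 * EM m = z0"
  by (induction m rule: EM.induct) (simp_all add: val_Cons z_e mult.assoc[symmetric])

definition mapm :: "(int \<Rightarrow> int) \<Rightarrow> (int \<Rightarrow> int) \<Rightarrow> (int \<times> int) list \<Rightarrow> (int \<times> int) list" where
  "mapm g h m = map (\<lambda>(x, y). (g x, h y)) m"

lemma mapm_simps [simp]: "mapm g h [] = []" "mapm g h ((x, y) # m) = (g x, h y) # mapm g h m"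
  by (simp_all add: mapm_def)

lemma P_EM: "g \<in> GL \<Longrightarrow> h \<in> GR \<Longrightarrow> val m \<Longrightarrow> P g h * EM m = EM (mapm g h m) * P g h"
proof (induction m rule: EM.induct)
  case (2 x y m)
  have "P g h * EM ((x, y) # m) = (P g h * e x y) * EM m" by (simp add: mult.assoc)
  also have "\<dots> = e (g x) (h y) * (P g h * EM m)" using 2 P_e[of g h x y] by (simp add: val_Cons mult.assoc)
  finally show ?case using 2 by (simp add: val_Cons mult.assoc)
qed simp

lemma fl_mapm: "odd_bij g \<Longrightarrow> \<bar>g x\<bar> \<in> fl (mapm g h m) \<longleftrightarrow> \<bar>x\<bar> \<in> fl m"
  by (induction m rule: EM.induct) (auto simp: odd_bij_abs)
lemma fr_mapm: "odd_bij h \<Longrightarrow> \<bar>h x\<bar> \<in> fr (mapm g h m) \<longleftrightarrow> \<bar>x\<bar> \<in> fr m"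
  by (induction m rule: EM.induct) (auto simp: odd_bij_abs)

lemma val_mapm: "g \<in> GL \<Longrightarrow> h \<in> GR \<Longrightarrow> val m \<Longrightarrow> val (mapm g h m)"
  by (induction m rule: EM.induct) (simp_all add: val_Cons GL_v GR_v fl_mapm fr_mapm sperm_odd)

lemma EA_act: assumes "g \<in> GL" "h \<in> GR"
  shows "EA (mapm g h m) (g \<circ> u \<circ> inve h) = g \<circ> EA m u \<circ> inve h"
proof (induction m rule: EM.induct)
  case (2 x y m)
  have hy: "inve h (h y) = y" using sperm_inv[OF assms(2)] by simp
  show ?case using 2 by (auto simp: est_def fun_eq_iff hy sw_conj[OF sperm_odd[OF assms(1)]])
qed simp

lemma through_act: assumes "g \<in> GL" "h \<in> GR" "through u" shows "through (g \<circ> u \<circ> inve h)"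
proof -
  have i: "inve h \<in> GR" using sperm_inv assms by auto
  have "odd_bij (g \<circ> u \<circ> inve h)" using assms i sperm_odd through_odd odd_bij_comp by blast
  moreover have "vL ((g \<circ> u \<circ> inve h) t) \<longleftrightarrow> t \<noteq> 0 \<and> \<bar>t\<bar> \<le> iN \<and> \<not> vR t" for t
  proof -
    have "vL ((g \<circ> u \<circ> inve h) t) \<longleftrightarrow> inve h t \<noteq> 0 \<and> \<bar>inve h t\<bar> \<le> iN \<and> \<not> vR (inve h t)"
      using assms GL_v by (simp add: through_def)
    also have "vR (inve h t) = vR t" using i GR_v by simp
    also have "inve h t \<noteq> 0 \<longleftrightarrow> t \<noteq> 0" using odd_bij_nz[OF sperm_odd[OF i]] odd_bij_0[OF sperm_odd[OF i]] by metis
    also have "(t \<noteq> 0 \<and> \<bar>inve h t\<bar> \<le> iN \<and> \<not> vR t) \<longleftrightarrow> (t \<noteq> 0 \<and> \<bar>t\<bar> \<le> iN \<and> \<not> vR t)"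
      using sperm_range_iff[OF i, of t] sperm_fix[OF i, of t] unfolding vR_def by (metis linorder_not_less)
    finally show ?thesis .
  qed
  ultimately show ?thesis unfolding through_def by blast
qed

text \<open>The state of the empty word: the two blocks of strands are exchanged.\<close>

definition b0 :: "int \<Rightarrow> int" where
  "b0 x = (if 0 < x \<and> x \<le> int b then x + int a else if int b < x \<and> x \<le> iN then x - int b
     else if - int b \<le> x \<and> x < 0 then x - int a else if - iN \<le> x \<and> x < - int b then x + int b else x)"

lemma through_b0: "through b0"
proof -
  (* the inverse of b0 *)
  define c where "c = (\<lambda>x. if 0 < x \<and> x \<le> int a then x + int b else if int a < x \<and> x \<le> iN then x - int a
     else if - int a \<le> x \<and> x < 0 then x - int b else if - iN \<le> x \<and> x < - int a then x + int a else x)"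
  have "b0 (c x) = x" "c (b0 x) = x" for x unfolding b0_def c_def using n_def by auto
  then have "bij b0" by (intro o_bij[of c]) (auto simp: fun_eq_iff)
  moreover have "b0 (- x) = - b0 x" for x unfolding b0_def using n_def by auto
  ultimately have "odd_bij b0" by (simp add: odd_bij_def)
  moreover have "vL (b0 t) \<longleftrightarrow> t \<noteq> 0 \<and> \<bar>t\<bar> \<le> iN \<and> \<not> vR t" for t
    unfolding b0_def vL_def vR_def using n_def by auto
  ultimately show ?thesis unfolding through_def by blast
qed

text \<open>An element \<open>z\<close> in normal form, arcs followed by a pair of signed permutations, together with its state \<open>f\<close>.\<close>

definition NF :: "'m \<Rightarrow> (int \<Rightarrow> int) \<Rightarrow> bool" where
  "NF z f \<longleftrightarrow> (\<exists>m g h. val m \<and> g \<in> GL \<and> h \<in> GR \<and> z = EM m * P g h \<and> f = EA m (g \<circ> b0 \<circ> inve h))"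

lemma NF_1: "NF 1 b0"
  unfolding NF_def by (intro exI[of _ "[]"] exI[of _ id]) (simp add: P_id)

lemma inve_comp: "h \<in> GR \<Longrightarrow> k \<in> GR \<Longrightarrow> inve (h \<circ> k) = inve k \<circ> inve h"
  by (rule o_inv_distrib) (auto simp: sperm_def odd_bij_def)

lemma NF_P: assumes "NF z f" "g \<in> GL" "h \<in> GR" shows "NF (P g h * z) (g \<circ> f \<circ> inve h)"
proof -
  obtain m k l where m: "val m" "k \<in> GL" "l \<in> GR" "z = EM m * P k l" "f = EA m (k \<circ> b0 \<circ> inve l)"
    using assms(1) unfolding NF_def by blast
  have "P g h * z = EM (mapm g h m) * P (g \<circ> k) (h \<circ> l)"
    using P_EM[OF assms(2,3) m(1)] m assms P_mult[of g h k l] by (simp add: mult.assoc[symmetric]) (simp add: mult.assoc)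
  moreover have "g \<circ> f \<circ> inve h = EA (mapm g h m) (g \<circ> (k \<circ> b0 \<circ> inve l) \<circ> inve h)"
    unfolding m(5) using EA_act[OF assms(2,3)] by simp
  moreover have "g \<circ> (k \<circ> b0 \<circ> inve l) \<circ> inve h = (g \<circ> k) \<circ> b0 \<circ> inve (h \<circ> l)"
    using inve_comp[of h l] assms m by (simp add: o_assoc)
  ultimately show ?thesis unfolding NF_def using val_mapm[OF assms(2,3) m(1)] sperm_comp m assms by metis
qed

text \<open>An arc either closes up with an existing arc, which gives zero, or can be added to the normal form, possibly in exchange for an arc that it touches.\<close>

lemma NF_e:
  assumes "NF z f" "vL x" "vR y"
  shows "if \<bar>f y\<bar> = \<bar>x\<bar> then e x y * z = z0 else NF (e x y * z) (est x y f)"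
proof -
  obtain m g h where m: "val m" "g \<in> GL" "h \<in> GR" "z = EM m * P g h" "f = EA m (g \<circ> b0 \<circ> inve h)"
    using assms(1) unfolding NF_def by blast
  define u where "u = g \<circ> b0 \<circ> inve h"
  have u: "through u" unfolding u_def by (intro through_act through_b0 m)
  have f: "f = EA m u" using m u_def by simp
  have ob: "odd_bij f" unfolding f by (intro odd_bij_EA through_odd u m)
  show ?thesis
  proof (cases "\<bar>y\<bar> \<in> fr m")
    case True
    then obtain x1 y1 where 1: "(x1, y1) \<in> set m" "\<bar>y\<bar> = \<bar>y1\<bar>" by (auto simp: fr_def)
    define x' where "x' = f y"
    have "f y1 = x1" unfolding f by (rule EA_1[OF m(1) u 1(1)])
    then have xy: "(x', y) \<in> set m \<or> (- x', - y) \<in> set m"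
      using 1 odd_bij_neg[OF ob, of y1] unfolding x'_def by (cases "y = y1") (auto simp: abs_eq_iff)
    then have vx': "vL x'" using val_in[OF m(1)] by force
    from front[OF m(1) xy] obtain m' where m': "val ((x', y) # m')" "EM m = e x' y * EM m'" "EA m u = est x' y (EA m' u)"
      using u by blast
    have v: "\<bar>x'\<bar> \<notin> fl m'" "\<bar>y\<bar> \<notin> fr m'" "val m'" using m'(1) val_Cons by auto
    show ?thesis
    proof (cases "\<bar>x'\<bar> = \<bar>x\<bar>")
      case eq: True
      have "e x y * e x' y = z0"
      proof (cases "x' = x")
        case True then show ?thesis using rel1 assms by simp
      next
        case False
        then have "x' = - x" using eq by linarith
        then have "e x' y = e x (- y)" using e_neg[of x "- y"] assms by simp
        then show ?thesis using rel1 assms by simp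
      qed
      then have "e x y * z = z0" using m m' z_EM[OF v(3)] z_P by (simp add: mult.assoc[symmetric])
      then show ?thesis using eq by (simp add: x'_def)
    next
      case ne: False
      let ?s = "sw x x'"
      have s: "?s \<in> GL" using GL_sw assms vx' by simp
      have sid: "id \<in> GR" by simp
      have invid: "inve id = id" by (simp add: inv_id)
      have "e x y * z = (e x y * e x' y) * EM m' * P g h" by (simp add: m m' mult.assoc)
      also have "\<dots> = e x y * (P ?s id * EM m') * P g h"
        using rel3[of x y x'] assms vx' ne by (simp add: P_L mult.assoc)
      also have "\<dots> = e x y * EM (mapm ?s id m') * (P ?s id * P g h)"
        using P_EM[OF s sid v(3)] by (simp add: mult.assoc)
      also have "\<dots> = EM ((x, y) # mapm ?s id m') * P (?s \<circ> g) h"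
        using P_mult[OF s sid m(2,3)] by simp
      finally have z: "e x y * z = EM ((x, y) # mapm ?s id m') * P (?s \<circ> g) h" .
      have val: "val ((x, y) # mapm ?s id m')"
        using fl_mapm[OF sperm_odd[OF s], of x' id m'] fr_mapm[of id y ?s m'] v val_mapm[OF s sid v(3)] assms
        by (simp add: val_Cons)
      have nz: "x \<noteq> 0" "x' \<noteq> 0" using vL_nz assms vx' by auto
      define w where "w = EA m' u"
      have wy: "\<not> vL (w y)" unfolding w_def by (rule EA_free[OF v(3) u assms(3) v(2)])
      have owb: "odd_bij w" unfolding w_def by (intro odd_bij_EA through_odd u v)
      have wyne: "\<bar>w y\<bar> \<noteq> \<bar>x\<bar>" "\<bar>w y\<bar> \<noteq> \<bar>x'\<bar>" using wy assms vx' vL_abs by metis+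
      have wyn: "w y \<noteq> 0" using odd_bij_nz[OF owb] vR_nz assms by blast
      have "EA ((x, y) # mapm ?s id m') (?s \<circ> u \<circ> inve id) = est x y (?s \<circ> w)"
        unfolding EA.simps EA_act[OF s sid] by (simp add: invid w_def)
      also have "\<dots> = sw x (w y) \<circ> ?s \<circ> w" using wyne by (simp add: est_def sw_other o_assoc)
      also have "\<dots> = ?s \<circ> sw x' (w y) \<circ> w"
        using sw_conj[OF sperm_odd[OF s], of x' "w y"] wyne by (auto simp: fun_eq_iff sw_other)
      also have "\<dots> = est x y f"
        unfolding f m'(3) w_def[symmetric] by (simp add: est_def o_assoc)
      finally have "est x y f = EA ((x, y) # mapm ?s id m') ((?s \<circ> g) \<circ> b0 \<circ> inve h)"
        by (simp add: invid u_def o_assoc)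
      then have "NF (e x y * z) (est x y f)" unfolding NF_def using z val sperm_comp[OF s m(2)] m(3) by blast
      then show ?thesis using ne by (simp add: x'_def)
    qed
  next
    case yfree: False
    have fy: "\<not> vL (f y)" unfolding f by (rule EA_free[OF m(1) u assms(3) yfree])
    then have ne: "\<bar>f y\<bar> \<noteq> \<bar>x\<bar>" using assms vL_abs by metis
    show ?thesis
    proof (cases "\<bar>x\<bar> \<in> fl m")
      case False
      then have "val ((x, y) # m)" using assms yfree m by (simp add: val_Cons)
      moreover have "e x y * z = EM ((x, y) # m) * P g h" by (simp add: m mult.assoc)
      moreover have "est x y f = EA ((x, y) # m) (g \<circ> b0 \<circ> inve h)" by (simp add: f u_def)
      ultimately have "NF (e x y * z) (est x y f)" unfolding NF_def using m by blast
      then show ?thesis using ne by simp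
    next
      case True
      then obtain x1 y1 where 1: "(x1, y1) \<in> set m" "\<bar>x\<bar> = \<bar>x1\<bar>" by (auto simp: fl_def)
      define y' where "y' = (if x = x1 then y1 else - y1)"
      have xy: "(x, y') \<in> set m \<or> (- x, - y') \<in> set m" using 1 by (auto simp: y'_def abs_eq_iff)
      then have vy': "vR y'" using val_in[OF m(1)] by force
      have "\<bar>y'\<bar> \<in> fr m" using xy fr_I by force
      then have nyy: "\<bar>y\<bar> \<noteq> \<bar>y'\<bar>" using yfree by auto
      from front[OF m(1) xy] obtain m' where m': "val ((x, y') # m')" "set m' \<subseteq> set m" "EM m = e x y' * EM m'" "EA m u = est x y' (EA m' u)"
        using u by blast
      have v: "\<bar>x\<bar> \<notin> fl m'" "\<bar>y'\<bar> \<notin> fr m'" "val m'" using m'(1) val_Cons by auto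
      have yfree': "\<bar>y\<bar> \<notin> fr m'" using yfree m'(2) by (auto simp: fr_def)
      let ?s = "sw y y'"
      have s: "?s \<in> GR" using GR_sw assms vy' by simp
      have sid: "id \<in> GL" by simp
      have sinv: "inve ?s = ?s" by (rule inv_equality) (use vR_nz assms vy' in auto)
      have "e x y * z = (e x y * e x y') * EM m' * P g h" by (simp add: m m' mult.assoc)
      also have "\<dots> = e x y * (P id ?s * EM m') * P g h"
        using rel2[of x y y'] assms vy' nyy by (simp add: P_R mult.assoc)
      also have "\<dots> = e x y * EM (mapm id ?s m') * (P id ?s * P g h)"
        using P_EM[OF sid s v(3)] by (simp add: mult.assoc)
      also have "\<dots> = EM ((x, y) # mapm id ?s m') * P g (?s \<circ> h)"
        using P_mult[OF sid s m(2,3)] by simp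
      finally have z: "e x y * z = EM ((x, y) # mapm id ?s m') * P g (?s \<circ> h)" .
      have val: "val ((x, y) # mapm id ?s m')"
        using fr_mapm[OF sperm_odd[OF s], of y' id m'] fl_mapm[of id x ?s m'] v val_mapm[OF sid s v(3)] assms
        by (simp add: val_Cons)
      define w where "w = EA m' u"
      have wy: "\<not> vL (w y)" "\<not> vL (w y')" unfolding w_def
        by (rule EA_free[OF v(3) u assms(3) yfree'], rule EA_free[OF v(3) u vy' v(2)])
      have owb: "odd_bij w" unfolding w_def by (intro odd_bij_EA through_odd u v)
      have wyne: "\<bar>w y\<bar> \<noteq> \<bar>x\<bar>" "\<bar>w y'\<bar> \<noteq> \<bar>x\<bar>" using wy assms vL_abs by metis+
      have wyne2: "\<bar>w y\<bar> \<noteq> \<bar>w y'\<bar>" using odd_bij_abs[OF owb] nyy by blast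
      have nz: "x \<noteq> 0" "w y \<noteq> 0" "w y' \<noteq> 0" using odd_bij_nz[OF owb] vR_nz vL_nz assms vy' by blast+
      have "EA ((x, y) # mapm id ?s m') (id \<circ> u \<circ> inve ?s) = est x y (w \<circ> ?s)"
        unfolding EA.simps EA_act[OF sid s] by (simp add: sinv w_def)
      also have "\<dots> = sw x (w y') \<circ> sw (w y) (w y') \<circ> w"
        using sw_conj[OF owb] by (auto simp: est_def fun_eq_iff)
      also have "\<dots> = sw x (w y) \<circ> sw x (w y') \<circ> w"
        using sw_conj[OF odd_bij_sw[OF nz(1,3)], of "w y" "w y'"] wyne wyne2 sw_sym[OF nz(1,2)]
        by (auto simp: fun_eq_iff sw_other)
      also have "\<dots> = est x y f"
        unfolding f m'(4) w_def[symmetric] using wyne wyne2 by (simp add: est_def o_assoc sw_other)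
      finally have "est x y f = EA ((x, y) # mapm id ?s m') (g \<circ> b0 \<circ> inve (?s \<circ> h))"
        using inve_comp[OF s m(3)] by (simp add: sinv u_def o_assoc)
      then have "NF (e x y * z) (est x y f)" unfolding NF_def using z val sperm_comp[OF s m(3)] m(2) by blast
      then show ?thesis using ne by simp
    qed
  qed
qed

end

section \<open>Uniqueness of normal forms\<close>

context walled begin

lemma align:
  assumes "val m" "val m'"
    and "\<And>x y. (x, y) \<in> set m \<Longrightarrow> (x, y) \<in> set m' \<or> (- x, - y) \<in> set m'"
    and "\<And>x y. (x, y) \<in> set m' \<Longrightarrow> (x, y) \<in> set m \<or> (- x, - y) \<in> set m"
  shows "EM m = EM m' \<and> (\<forall>u. through u \<longrightarrow> EA m u = EA m' u)"
  using assms
proof (induction m arbitrary: m')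
  case Nil
  then have "m' = []" by (cases m') auto
  then show ?case by simp
next
  case (Cons p m)
  obtain x y where p: "p = (x, y)" by fastforce
  have "(x, y) \<in> set m' \<or> (- x, - y) \<in> set m'" using Cons.prems(3) p by simp
  from front[OF Cons.prems(2) this] obtain m1 where m1: "val ((x, y) # m1)" "set m1 \<subseteq> set m'"
      "\<forall>p\<in>set m'. p \<in> set m1 \<or> p = (x, y) \<or> p = (- x, - y)" "EM m' = e x y * EM m1"
      "\<forall>u. through u \<longrightarrow> EA m' u = est x y (EA m1 u)" by blast
  have v: "\<bar>x\<bar> \<notin> fl m" "\<bar>x\<bar> \<notin> fl m1" "val m" "val m1" using Cons.prems(1) m1(1) p val_Cons by auto
  have "EM m = EM m1 \<and> (\<forall>u. through u \<longrightarrow> EA m u = EA m1 u)"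
  proof (rule Cons.IH[OF v(3,4)])
    fix x2 y2 assume 2: "(x2, y2) \<in> set m"
    have "\<bar>x2\<bar> \<noteq> \<bar>x\<bar>" using fl_I[OF 2] v by auto
    moreover have "(x2, y2) \<in> set m' \<or> (- x2, - y2) \<in> set m'" using Cons.prems(3) 2 by simp
    ultimately show "(x2, y2) \<in> set m1 \<or> (- x2, - y2) \<in> set m1"
      using bspec[OF m1(3), of "(x2, y2)"] bspec[OF m1(3), of "(- x2, - y2)"] by auto
  next
    fix x2 y2 assume 2: "(x2, y2) \<in> set m1"
    have "\<bar>x2\<bar> \<noteq> \<bar>x\<bar>" using fl_I[OF 2] v by auto
    moreover have "(x2, y2) \<in> set (p # m) \<or> (- x2, - y2) \<in> set (p # m)" using Cons.prems(4) 2 m1(2) by blast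
    ultimately show "(x2, y2) \<in> set m \<or> (- x2, - y2) \<in> set m" using p by auto
  qed
  then show ?case using p m1(4,5) by simp
qed

lemma est5:
  assumes "odd_bij w" "vL x" "vR y" "\<not> vL (w y)"
  shows "est x y (sw x (- x) \<circ> w \<circ> sw y (- y)) = est x y w"
proof -
  have nz: "x \<noteq> 0" "w y \<noteq> 0" "y \<noteq> 0"
    using vL_nz[OF assms(2)] vR_nz[OF assms(3)] odd_bij_nz[OF assms(1)] by auto
  have ne: "\<bar>w y\<bar> \<noteq> \<bar>x\<bar>" using assms vL_abs[of "w y" x] by auto
  have key: "sw x (- p) (sw x (- x) (sw p (- p) z)) = sw x p z" if "p \<noteq> 0" "\<bar>p\<bar> \<noteq> \<bar>x\<bar>" for p z
  proof -
    have "z = x \<or> z = - x \<or> z = p \<or> z = - p \<or> (\<bar>z\<bar> \<noteq> \<bar>x\<bar> \<and> \<bar>z\<bar> \<noteq> \<bar>p\<bar>)" by linarith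
    moreover have "sw x (- p) p = - x" using that nz by (auto simp: sw_def)
    ultimately show ?thesis using that nz by (elim disjE conjE) (simp_all add: sw_other)
  qed
  have "est x y (sw x (- x) \<circ> w \<circ> sw y (- y)) z = est x y w z" for z
    using ne key[OF nz(2) ne, of "w z"] sw_conj[OF assms(1), of y "- y" z]
    by (simp add: est_def odd_bij_neg[OF assms(1)] sw_other)
  then show ?thesis by auto
qed

lemma sw4:
  assumes "x \<noteq> 0" "x3 \<noteq> 0" "p \<noteq> 0" "q \<noteq> 0" "\<bar>x\<bar> \<noteq> \<bar>x3\<bar>" "\<bar>x\<bar> \<noteq> \<bar>p\<bar>" "\<bar>x\<bar> \<noteq> \<bar>q\<bar>" "\<bar>x3\<bar> \<noteq> \<bar>p\<bar>" "\<bar>x3\<bar> \<noteq> \<bar>q\<bar>" "\<bar>p\<bar> \<noteq> \<bar>q\<bar>"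
  shows "sw x q (sw x3 p (sw x x3 (sw p q z))) = sw x p (sw x3 q z)"
proof -
  have neg: "sw x q (sw x3 p (sw x x3 (sw p q (- z)))) = - sw x q (sw x3 p (sw x x3 (sw p q z)))"
    "sw x p (sw x3 q (- z)) = - sw x p (sw x3 q z)" for z using assms by simp_all
  have "sw x q (sw x3 p (sw x x3 (sw p q x))) = sw x p (sw x3 q x)"
    "sw x q (sw x3 p (sw x x3 (sw p q x3))) = sw x p (sw x3 q x3)"
    "sw x q (sw x3 p (sw x x3 (sw p q p))) = sw x p (sw x3 q p)"
    "sw x q (sw x3 p (sw x x3 (sw p q q))) = sw x p (sw x3 q q)"
    using assms by (simp_all add: sw_other)
  note pos = this
  have "sw x q (sw x3 p (sw x x3 (sw p q z))) = sw x p (sw x3 q z)"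
    if "\<bar>z\<bar> \<noteq> \<bar>x\<bar>" "\<bar>z\<bar> \<noteq> \<bar>x3\<bar>" "\<bar>z\<bar> \<noteq> \<bar>p\<bar>" "\<bar>z\<bar> \<noteq> \<bar>q\<bar>"
    using that by (simp add: sw_other)
  moreover have "z = x \<or> z = - x \<or> z = x3 \<or> z = - x3 \<or> z = p \<or> z = - p \<or> z = q \<or> z = - q \<or>
     (\<bar>z\<bar> \<noteq> \<bar>x\<bar> \<and> \<bar>z\<bar> \<noteq> \<bar>x3\<bar> \<and> \<bar>z\<bar> \<noteq> \<bar>p\<bar> \<and> \<bar>z\<bar> \<noteq> \<bar>q\<bar>)" by (metis abs_eq_iff)
  ultimately show ?thesis using pos neg by (elim disjE conjE) simp_all
qed

lemma est6:
  assumes "odd_bij w" "vL x" "vR y" "vL x3" "vR y3" "\<bar>x\<bar> \<noteq> \<bar>x3\<bar>" "\<bar>y\<bar> \<noteq> \<bar>y3\<bar>" "\<not> vL (w y)" "\<not> vL (w y3)"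
  shows "est x y (est x3 y3 (sw x x3 \<circ> w \<circ> sw y y3)) = est x y (est x3 y3 w)"
proof -
  have nz: "x \<noteq> 0" "x3 \<noteq> 0" "w y \<noteq> 0" "w y3 \<noteq> 0"
    using vL_nz[OF assms(2)] vL_nz[OF assms(4)] vR_nz[OF assms(3)] vR_nz[OF assms(5)] odd_bij_nz[OF assms(1)] by auto
  have ne: "\<bar>x\<bar> \<noteq> \<bar>w y\<bar>" "\<bar>x\<bar> \<noteq> \<bar>w y3\<bar>" "\<bar>x3\<bar> \<noteq> \<bar>w y\<bar>" "\<bar>x3\<bar> \<noteq> \<bar>w y3\<bar>" "\<bar>w y\<bar> \<noteq> \<bar>w y3\<bar>"
    using assms odd_bij_abs[OF assms(1), of y y3] vL_abs[of x "w y"] vL_abs[of x "w y3"]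
      vL_abs[of x3 "w y"] vL_abs[of x3 "w y3"] by auto
  note ne' = ne ne[symmetric]
  show ?thesis
  proof (rule ext)
    fix z
    have o1: "sw x x3 (w y) = w y" "sw x x3 (w y3) = w y3" using ne' by (simp_all only: sw_other simp_thms)
    have o2: "sw x3 (w y) (w y3) = w y3" "sw x3 (w y3) (w y) = w y" using ne' by (simp_all only: sw_other simp_thms)
    have 1: "est x3 y3 (sw x x3 \<circ> w \<circ> sw y y3) t = sw x3 (w y) (sw x x3 (w (sw y y3 t)))" for t
      by (simp add: est_def o1)
    have 2: "est x3 y3 (sw x x3 \<circ> w \<circ> sw y y3) y = w y3" unfolding 1 by (simp add: o1 o2)
    have 3: "est x3 y3 w t = sw x3 (w y3) (w t)" for t by (simp add: est_def)
    have "est x y (est x3 y3 (sw x x3 \<circ> w \<circ> sw y y3)) z = sw x (w y3) (sw x3 (w y) (sw x x3 (w (sw y y3 z))))"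
      using 2 by (simp only: est_def[of x y] o_apply 1)
    also have "\<dots> = sw x (w y) (sw x3 (w y3) (w z))"
      unfolding sw_conj[OF assms(1), of y y3 z] by (rule sw4[OF nz assms(6) ne])
    also have "\<dots> = est x y (est x3 y3 w) z"
      by (simp only: est_def[of x y] o_apply 3 o2)
    finally show "est x y (est x3 y3 (sw x x3 \<circ> w \<circ> sw y y3)) z = est x y (est x3 y3 w) z" .
  qed
qed

lemma mapm_fix:
  "val m \<Longrightarrow> \<bar>x\<bar> \<notin> fl m \<Longrightarrow> \<bar>x3\<bar> \<notin> fl m \<Longrightarrow> \<bar>y\<bar> \<notin> fr m \<Longrightarrow> \<bar>y3\<bar> \<notin> fr m \<Longrightarrow> mapm (sw x x3) (sw y y3) m = m"
  by (induction m rule: EM.induct) (auto simp: sw_other val_Cons)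

text \<open>Permuting two arcs, or changing the signs at both ends of one arc (\<open>x3 = - x\<close>), affects neither the element nor the state.\<close>

lemma absorb:
  assumes m: "val m" and xy: "(x, y) \<in> set m" and xy3: "(x3, y3) \<in> set m \<or> (- x3, - y3) \<in> set m"
    and ne: "x3 \<noteq> x"
  shows "EM m * P (sw x x3) (sw y y3) = EM m"
    "through u \<Longrightarrow> EA m (sw x x3 \<circ> u \<circ> sw y y3) = EA m u"
proof -
  have v: "vL x" "vR y" "vL x3" "vR y3"
    using val_in[OF m xy] xy3 val_in[OF m, of x3 y3] val_in[OF m, of "- x3" "- y3"] by auto
  let ?s = "sw x x3" and ?t = "sw y y3"
  have G: "?s \<in> GL" "?t \<in> GR" using v GL_sw GR_sw by auto
  have tinv: "inve ?t = ?t" by (rule inv_equality) (use vR_nz v in auto)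
  from front[OF m] xy obtain m1 where m1: "val ((x, y) # m1)" "set m1 \<subseteq> set m"
      "\<forall>p\<in>set m. p \<in> set m1 \<or> p = (x, y) \<or> p = (- x, - y)" "EM m = e x y * EM m1"
      "\<forall>u. through u \<longrightarrow> EA m u = est x y (EA m1 u)" by blast
  have v1: "\<bar>x\<bar> \<notin> fl m1" "\<bar>y\<bar> \<notin> fr m1" "val m1" using m1(1) val_Cons by auto
  have thr: "through (?s \<circ> u \<circ> ?t)" if "through u" for u
    using through_act[OF G that] tinv by simp
  have "EM m * P ?s ?t = EM m \<and> (\<forall>u. through u \<longrightarrow> EA m (?s \<circ> u \<circ> ?t) = EA m u)"
  proof (cases "(x3, y3) \<in> set m1 \<or> (- x3, - y3) \<in> set m1")
    case False
    then have 3: "x3 = - x" "y3 = - y" using xy3 m1(3) ne by auto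
    have fx: "mapm ?s ?t m1 = m1" using v1 3 by (intro mapm_fix) auto
    have "EM m * P ?s ?t = e x y * (P ?s ?t * EM m1)"
      using P_EM[OF G v1(3)] fx m1(4) by (simp add: mult.assoc)
    also have "\<dots> = (e x y * rL ?s * rR ?t) * EM m1" by (simp only: P_def mult.assoc)
    also have "\<dots> = EM m" using rel5[OF v(1,2)] 3 m1(4) by simp
    finally have "EM m * P ?s ?t = EM m" .
    moreover have "EA m (?s \<circ> u \<circ> ?t) = EA m u" if u: "through u" for u
    proof -
      have "EA m (?s \<circ> u \<circ> ?t) = est x y (EA m1 (?s \<circ> u \<circ> ?t))" using m1(5) thr[OF u] by simp
      also have "EA m1 (?s \<circ> u \<circ> ?t) = ?s \<circ> EA m1 u \<circ> ?t" using EA_act[OF G, of m1 u] fx tinv by simp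
      also have "est x y \<dots> = est x y (EA m1 u)"
        unfolding 3 using v1 v u by (intro est5 odd_bij_EA through_odd EA_free(2)) auto
      finally show ?thesis using m1(5) u by (simp only:)
    qed
    ultimately show ?thesis by blast
  next
    case True
    from front[OF v1(3) True] obtain m2 where m2: "val ((x3, y3) # m2)" "set m2 \<subseteq> set m1"
      "EM m1 = e x3 y3 * EM m2" "\<forall>u. through u \<longrightarrow> EA m1 u = est x3 y3 (EA m2 u)" by blast
    have v2: "\<bar>x3\<bar> \<notin> fl m2" "\<bar>y3\<bar> \<notin> fr m2" "val m2" using m2(1) val_Cons by auto
    have v2': "\<bar>x\<bar> \<notin> fl m2" "\<bar>y\<bar> \<notin> fr m2" using v1 m2(2) by (auto simp: fl_def fr_def)
    have "\<bar>x3\<bar> \<in> fl m1" "\<bar>y3\<bar> \<in> fr m1" 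
      using True fl_I[of x3 y3 m1] fl_I[of "- x3" "- y3" m1] fr_I[of x3 y3 m1] fr_I[of "- x3" "- y3" m1] by auto
    then have ne3: "\<bar>x\<bar> \<noteq> \<bar>x3\<bar>" "\<bar>y\<bar> \<noteq> \<bar>y3\<bar>" using v1 by auto
    have fx: "mapm ?s ?t m2 = m2" using v2 v2' by (intro mapm_fix) auto
    have "EM m * P ?s ?t = e x y * e x3 y3 * (P ?s ?t * EM m2)"
      using P_EM[OF G v2(3)] fx m1(4) m2(3) by (simp add: mult.assoc)
    also have "\<dots> = (e x y * e x3 y3 * rL ?s * rR ?t) * EM m2" by (simp only: P_def mult.assoc)
    also have "\<dots> = EM m" using rel6[OF v ne3] m1(4) m2(3) by (simp add: mult.assoc)
    finally have "EM m * P ?s ?t = EM m" .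
    moreover have "EA m (?s \<circ> u \<circ> ?t) = EA m u" if u: "through u" for u
    proof -
      have "EA m (?s \<circ> u \<circ> ?t) = est x y (est x3 y3 (EA m2 (?s \<circ> u \<circ> ?t)))" using m1(5) m2(4) thr[OF u] by simp
      also have "EA m2 (?s \<circ> u \<circ> ?t) = ?s \<circ> EA m2 u \<circ> ?t" using EA_act[OF G, of m2 u] fx tinv by simp
      also have "est x y (est x3 y3 \<dots>) = est x y (est x3 y3 (EA m2 u))"
        using v2 v2' v u ne3 by (intro est6 odd_bij_EA through_odd EA_free(2)) auto
      finally show ?thesis using m1(5) m2(4) u by (simp only:)
    qed
    ultimately show ?thesis by blast
  qed
  then show "EM m * P ?s ?t = EM m" "through u \<Longrightarrow> EA m (?s \<circ> u \<circ> ?t) = EA m u" by auto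
qed

lemma through_unique:
  assumes G: "g \<in> GL" "h \<in> GR" "g' \<in> GL" "h' \<in> GR" and eq: "g \<circ> b0 \<circ> inve h = g' \<circ> b0 \<circ> inve h'"
  shows "g = g' \<and> h = h'"
proof -
  have eq': "g (b0 (inve h t)) = g' (b0 (inve h' t))" for t using eq by (auto simp: fun_eq_iff)
  have gfix: "k x = x" if "k \<in> GL" "\<not> vL x" for k x
    using sperm_fix[OF that(1)] that(2) unfolding vL_def by force
  have hfix: "k x = x" if "k \<in> GR" "\<not> vR x" for k x
    using sperm_fix[OF that(1)] that(2) unfolding vR_def by force
  have hh: "h s = h' s" for s
  proof (cases "vR s")
    case True
    define s' where "s' = inve h' (h s)"
    have s': "vR s'" unfolding s'_def using sperm_inv[OF G(4)] GR_v G True by simp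
    have nb: "\<not> vL (b0 s)" "\<not> vL (b0 s')" using through_R[OF through_b0] True s' by auto
    have "g (b0 s) = g' (b0 s')" using eq'[of "h s"] sperm_inv[OF G(2)] by (simp add: s'_def)
    then have "b0 s = b0 s'" using gfix[OF G(1) nb(1)] gfix[OF G(3) nb(2)] by simp
    then have "s = s'" using odd_bij_inj[OF through_odd[OF through_b0]] by simp
    moreover have "h' s' = h s" unfolding s'_def by (rule sperm_inv(3)[OF G(4)])
    ultimately show ?thesis by simp
  next
    case False
    then show ?thesis using hfix[OF G(2)] hfix[OF G(4)] by simp
  qed
  then have h: "h = h'" by auto
  have "g x = g' x" for x
  proof -
    obtain s where "b0 s = x" using through_surj[OF through_b0] by blast
    then show ?thesis using eq'[of "h s"] sperm_inv[OF G(2)] by (simp add: h)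
  qed
  then show ?thesis using h by auto
qed

text \<open>The arcs whose left end is reached from different points under the two states.\<close>

definition bad :: "(int \<times> int) list \<Rightarrow> (int \<Rightarrow> int) \<Rightarrow> (int \<Rightarrow> int) \<Rightarrow> (int \<times> int) set" where
  "bad m u u' = {p \<in> set m. \<exists>t. u' t = fst p \<and> u t \<noteq> fst p}"

lemma finite_bad [simp]: "finite (bad m u u')" by (simp add: bad_def)

text \<open>A state determines the permutation away from the arcs, and at the arcs as soon as none of them is bad.\<close>

lemma bad_empty:
  assumes m: "val m" and u: "through u" "through u'" and eq: "EA m u = EA m u'" and b: "bad m u u' = {}"
  shows "u = u'"
proof
  fix s
  note o = through_odd[OF u(1)] through_odd[OF u(2)]
  have good: "u t = x" if "(x, y) \<in> set m" "u' t = x" for x y t using b that unfolding bad_def by force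
  have good': "u' t = x" if xy: "(x, y) \<in> set m" and t: "u t = x" for x y t
  proof -
    obtain t' where t': "u' t' = x" using through_surj[OF u(2)] by blast
    then have "u t' = x" using good[OF xy] by blast
    then have "t' = t" using t odd_bij_inj[OF o(1)] by metis
    then show ?thesis using t' by simp
  qed
  consider x y where "(x, y) \<in> set m" "\<bar>u s\<bar> = \<bar>x\<bar>" | x y where "(x, y) \<in> set m" "\<bar>u' s\<bar> = \<bar>x\<bar>"
    | x y where "(x, y) \<in> set m" "\<bar>s\<bar> = \<bar>y\<bar>" | "\<bar>u s\<bar> \<notin> fl m" "\<bar>u' s\<bar> \<notin> fl m" "\<bar>s\<bar> \<notin> fr m"
    by (force simp: fl_def fr_def)
  then show "u s = u' s"
  proof cases
    case 1
    then have "u s = x \<or> u s = - x" by linarith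
    then show ?thesis
    proof
      assume "u s = x" then show ?thesis using good'[OF 1(1)] by simp
    next
      assume *: "u s = - x"
      then have "u (- s) = x" using odd_bij_neg[OF o(1), of s] by simp
      then have "u' (- s) = x" by (rule good'[OF 1(1)])
      then show ?thesis using * odd_bij_neg[OF o(2), of s] by simp
    qed
  next
    case 2
    then have "u' s = x \<or> u' s = - x" by linarith
    then show ?thesis
    proof
      assume "u' s = x" then show ?thesis using good[OF 2(1)] by simp
    next
      assume *: "u' s = - x"
      then have "u' (- s) = x" using odd_bij_neg[OF o(2), of s] by simp
      then have "u (- s) = x" by (rule good[OF 2(1)])
      then show ?thesis using * odd_bij_neg[OF o(1), of s] by simp
    qed
  next
    case 3
    obtain t where t: "u' t = x" using through_surj[OF u(2)] by blast
    have "u y = EA m u t" using EA_2[OF m u(1) 3(1) good[OF 3(1) t]] by simp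
    also have "\<dots> = u' y" using EA_2[OF m u(2) 3(1) t] eq by simp
    finally have "u y = u' y" .
    moreover have "s = y \<or> s = - y" using 3(2) by linarith
    ultimately show ?thesis using odd_bij_neg[OF o(1), of y] odd_bij_neg[OF o(2), of y] by auto
  next
    case 4
    then show ?thesis using EA_3[OF m u(1) 4(3,1)] EA_3[OF m u(2) 4(3,2)] eq by simp
  qed
qed

text \<open>By induction on the number of bad arcs: \<open>absorb\<close> corrects the permutation at one of them without changing the element or the state, and when none is left the permutations agree by \<open>bad_empty\<close> and \<open>through_unique\<close>.\<close>

lemma kappa:
  assumes m: "val m" and G: "g \<in> GL" "h \<in> GR"
  shows "g' \<in> GL \<Longrightarrow> h' \<in> GR \<Longrightarrow> EA m (g \<circ> b0 \<circ> inve h) = EA m (g' \<circ> b0 \<circ> inve h') \<Longrightarrow>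
    EM m * P g h = EM m * P g' h'"
proof (induction "card (bad m (g \<circ> b0 \<circ> inve h) (g' \<circ> b0 \<circ> inve h'))" arbitrary: g' h' rule: less_induct)
  case less
  define u where "u = g \<circ> b0 \<circ> inve h"
  define u' where "u' = g' \<circ> b0 \<circ> inve h'"
  have u: "through u" "through u'" unfolding u_def u'_def using through_act through_b0 G less.prems by auto
  note o = through_odd[OF u(1)] through_odd[OF u(2)]
  have eq: "EA m u = EA m u'" using less.prems u_def u'_def by simp
  show ?case
  proof (cases "bad m u u' = {}")
    case True
    then have "u = u'" using bad_empty[OF m u eq] by simp
    then have "g = g' \<and> h = h'" using through_unique G less.prems u_def u'_def by blast
    then show ?thesis by simp
  next
    case False
    then obtain x y t where xy: "(x, y) \<in> set m" "u' t = x" "u t \<noteq> x" unfolding bad_def by force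
    have vx: "vL x" "vR y" using val_in[OF m xy(1)] by auto
    have t: "\<not> vR t" "t \<noteq> 0" "\<bar>t\<bar> \<le> iN" using u(2) xy(2) vx unfolding through_def by auto
    then have vut: "vL (u t)" using u(1) unfolding through_def by blast
    have tfr: "\<bar>t\<bar> \<notin> fr m" using fr_vR[OF m] t by blast
    have "\<bar>u t\<bar> \<in> fl m"
    proof (rule ccontr)
      assume "\<bar>u t\<bar> \<notin> fl m"
      then have "EA m u t = u t" using EA_3[OF m u(1) tfr] by simp
      moreover have "EA m u' t = u' y" by (rule EA_2[OF m u(2) xy(1,2)])
      ultimately show False using eq vut through_R[OF u(2) vx(2)] by simp
    qed
    then obtain x2 y2 where x2: "(x2, y2) \<in> set m" "\<bar>u t\<bar> = \<bar>x2\<bar>" by (auto simp: fl_def)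
    define x3 where "x3 = u t"
    define y3 where "y3 = (if u t = x2 then y2 else - y2)"
    have xy3: "(x3, y3) \<in> set m \<or> (- x3, - y3) \<in> set m" using x2 by (auto simp: x3_def y3_def abs_eq_iff)
    have ne: "x3 \<noteq> x" using xy by (simp add: x3_def)
    have v3: "vL x3" "vR y3" using xy3 val_in[OF m, of x3 y3] val_in[OF m, of "- x3" "- y3"] by auto
    let ?s = "sw x x3" and ?t = "sw y y3"
    have S: "?s \<in> GL" "?t \<in> GR" using GL_sw GR_sw vx v3 by auto
    have tinv: "inve ?t = ?t" by (rule inv_equality) (use vR_nz vx v3 in auto)
    have G'': "?s \<circ> g' \<in> GL" "?t \<circ> h' \<in> GR" using S less.prems sperm_comp by auto
    have u'': "(?s \<circ> g') \<circ> b0 \<circ> inve (?t \<circ> h') = ?s \<circ> u' \<circ> ?t"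
      using inve_comp[OF S(2) less.prems(2)] tinv by (simp add: u'_def o_assoc)
    note ab = absorb[OF m xy(1) xy3 ne]
    have sub: "bad m u (?s \<circ> u' \<circ> ?t) \<subseteq> bad m u u'"
    proof
      fix p assume "p \<in> bad m u (?s \<circ> u' \<circ> ?t)"
      then obtain t2 where p: "p \<in> set m" "(?s \<circ> u' \<circ> ?t) t2 = fst p" "u t2 \<noteq> fst p" unfolding bad_def by auto
      have vp: "vL (fst p)" using val_in[OF m, of "fst p" "snd p"] p by simp
      have st: "through (?s \<circ> u' \<circ> ?t)" using through_act[OF S u(2)] tinv by simp
      have t2: "\<not> vR t2" using through_L[OF st, of t2] p vp by simp
      then have "\<bar>t2\<bar> \<noteq> \<bar>y\<bar>" "\<bar>t2\<bar> \<noteq> \<bar>y3\<bar>" using vx v3 vR_abs by metis+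
      then have t2': "?s (u' t2) = fst p" using p by (simp add: sw_other)
      show "p \<in> bad m u u'"
      proof (cases "\<bar>fst p\<bar> = \<bar>x\<bar> \<or> \<bar>fst p\<bar> = \<bar>x3\<bar>")
        case False
        have "u' t2 = ?s (fst p)" using t2' vL_nz vx v3 by (metis sw_sq)
        then have "u' t2 = fst p" using False by (simp add: sw_other)
        then show ?thesis using p unfolding bad_def by blast
      next
        case True
        have x3: "p' \<in> bad m u u'" if "p' \<in> set m" "\<bar>fst p'\<bar> = \<bar>x3\<bar>" for p'
        proof -
          obtain t3 where t3: "u' t3 = fst p'" using through_surj[OF u(2)] by blast
          have "u t3 \<noteq> fst p'"
          proof
            assume "u t3 = fst p'"
            then have "\<bar>u t3\<bar> = \<bar>u t\<bar>" using that by (simp add: x3_def)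
            then have "\<bar>t3\<bar> = \<bar>t\<bar>" using odd_bij_abs[OF o(1)] by blast
            then consider "t3 = t" | "t3 = - t" by linarith
            then show False
              using t3 \<open>u t3 = fst p'\<close> xy odd_bij_neg[OF o(1), of t] odd_bij_neg[OF o(2), of t] by cases auto
          qed
          then show ?thesis using that t3 unfolding bad_def by blast
        qed
        show ?thesis
        proof (cases "\<bar>fst p\<bar> = \<bar>x3\<bar>")
          case True then show ?thesis using x3 p by blast
        next
          case False
          then have "\<bar>fst p\<bar> = \<bar>fst (x, y)\<bar>" using True by simp
          then have "p = (x, y)" using m p(1) xy(1) unfolding val_def by (auto simp: distinct_map inj_on_def)
          then show ?thesis using xy unfolding bad_def by force
        qed
      qed
    qed
    have "(x2, y2) \<in> bad m u u'"
    proof -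
      obtain t3 where t3: "u' t3 = x2" using through_surj[OF u(2)] by blast
      have "u t3 \<noteq> x2"
      proof
        assume "u t3 = x2"
        then have "\<bar>u t3\<bar> = \<bar>u t\<bar>" using x2 by simp
        then have "\<bar>t3\<bar> = \<bar>t\<bar>" using odd_bij_abs[OF o(1)] by blast
        then consider "t3 = t" | "t3 = - t" by linarith
        then show False
          using t3 \<open>u t3 = x2\<close> xy odd_bij_neg[OF o(1), of t] odd_bij_neg[OF o(2), of t] by cases auto
      qed
      then show ?thesis using x2 t3 unfolding bad_def by force
    qed
    moreover have "(x2, y2) \<notin> bad m u (?s \<circ> u' \<circ> ?t)"
    proof
      assume "(x2, y2) \<in> bad m u (?s \<circ> u' \<circ> ?t)"
      then obtain t2 where t2: "(?s \<circ> u' \<circ> ?t) t2 = x2" "u t2 \<noteq> x2" unfolding bad_def by auto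
      have st: "odd_bij (?s \<circ> u' \<circ> ?t)" using through_odd through_act[OF S u(2)] tinv by simp
      have "\<bar>t\<bar> \<noteq> \<bar>y\<bar>" "\<bar>t\<bar> \<noteq> \<bar>y3\<bar>" using t vx v3 vR_abs by metis+
      then have "(?s \<circ> u' \<circ> ?t) t = u t" using xy by (simp add: sw_other x3_def)
      then have "\<bar>(?s \<circ> u' \<circ> ?t) t2\<bar> = \<bar>(?s \<circ> u' \<circ> ?t) t\<bar>" using t2 x2 by simp
      then have "\<bar>t2\<bar> = \<bar>t\<bar>" using odd_bij_abs[OF st] by blast
      then consider "t2 = t" | "t2 = - t" by linarith
      then show False
        using t2 \<open>(?s \<circ> u' \<circ> ?t) t = u t\<close> odd_bij_neg[OF o(1), of t] odd_bij_neg[OF st, of t] by cases auto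
    qed
    ultimately have "bad m u (?s \<circ> u' \<circ> ?t) \<subset> bad m u u'" using sub by blast
    then have "card (bad m u (?s \<circ> u' \<circ> ?t)) < card (bad m u u')" by (intro psubset_card_mono) auto
    then have "EM m * P g h = EM m * P (?s \<circ> g') (?t \<circ> h')"
      using less.hyps[of "?s \<circ> g'" "?t \<circ> h'"] G'' u'' ab(2)[OF u(2)] eq by (simp add: u_def[symmetric] u'_def[symmetric])
    also have "\<dots> = (EM m * P ?s ?t) * P g' h'"
      using P_mult[OF S less.prems(1,2)] by (simp add: mult.assoc)
    finally show ?thesis using ab(1) by simp
  qed
qed

text \<open>The arcs are determined by the state up to order and simultaneous sign (\<open>align\<close>); what is then left to compare are the permutations, which is done by \<open>kappa\<close>.\<close>

theorem NF_unique: assumes "NF z f" "NF z' f" shows "z = z'"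
proof -
  obtain m g h where m: "val m" "g \<in> GL" "h \<in> GR" "z = EM m * P g h" "f = EA m (g \<circ> b0 \<circ> inve h)"
    using assms(1) unfolding NF_def by blast
  obtain m' g' h' where m': "val m'" "g' \<in> GL" "h' \<in> GR" "z' = EM m' * P g' h'" "f = EA m' (g' \<circ> b0 \<circ> inve h')"
    using assms(2) unfolding NF_def by blast
  have u: "through (g \<circ> b0 \<circ> inve h)" "through (g' \<circ> b0 \<circ> inve h')"
    using through_act through_b0 m m' by auto
  have "EM m = EM m' \<and> (\<forall>u. through u \<longrightarrow> EA m u = EA m' u)"
  proof (rule align[OF m(1) m'(1)])
    fix x y assume xy: "(x, y) \<in> set m"
    have "f y = x" unfolding m(5) by (rule EA_1[OF m(1) u(1) xy])
    then show "(x, y) \<in> set m' \<or> (- x, - y) \<in> set m'"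
      using arc[OF m'(1) u(2), of y] val_in[OF m(1) xy] m'(5) by simp
  next
    fix x y assume xy: "(x, y) \<in> set m'"
    have "f y = x" unfolding m'(5) by (rule EA_1[OF m'(1) u(2) xy])
    then show "(x, y) \<in> set m \<or> (- x, - y) \<in> set m"
      using arc[OF m(1) u(1), of y] val_in[OF m'(1) xy] m(5) by simp
  qed
  then show ?thesis using kappa[OF m(1-3) m'(2,3)] m m' u by simp
qed

end

section \<open>Free algebras and change of coefficients\<close>

text \<open>Evaluation of an element of a free module from values on the basis.\<close>

definition ev :: "('w \<Rightarrow> 'k::comm_monoid_add \<Rightarrow> 'm::comm_monoid_add) \<Rightarrow> ('w \<Rightarrow>\<^sub>0 'k) \<Rightarrow> 'm" where
  "ev f u = (\<Sum>w\<in>Poly_Mapping.keys u. f w (Poly_Mapping.lookup u w))"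

lemma ev_superset:
  assumes "finite S" "Poly_Mapping.keys u \<subseteq> S" "\<And>w. f w 0 = 0"
  shows "ev f u = (\<Sum>w\<in>S. f w (Poly_Mapping.lookup u w))"
  unfolding ev_def by (rule sum.mono_neutral_left) (use assms in \<open>auto simp: in_keys_iff\<close>)

lemma ev_add:
  assumes "\<And>w. f w 0 = 0" "\<And>w a b. f w (a + b) = f w a + f w b"
  shows "ev f (u + v) = ev f u + ev f v"
proof -
  let ?S = "Poly_Mapping.keys u \<union> Poly_Mapping.keys v"
  have "ev f (u + v) = (\<Sum>w\<in>?S. f w (Poly_Mapping.lookup (u + v) w))"
    using Poly_Mapping.keys_add[of u v] assms(1) by (intro ev_superset) auto
  also have "\<dots> = ev f u + ev f v"
    using assms ev_superset[of ?S u f] ev_superset[of ?S v f] by (simp add: lookup_add sum.distrib)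
  finally show ?thesis .
qed

lemma ev_0 [simp]: "ev f 0 = 0" by (simp add: ev_def)

lemma ev_single: "f w 0 = 0 \<Longrightarrow> ev f (Poly_Mapping.single w a) = f w a"
  by (cases "a = 0") (auto simp: ev_def lookup_single)

lemma poly_mapping_as_sum: "u = (\<Sum>w\<in>Poly_Mapping.keys u. Poly_Mapping.single w (Poly_Mapping.lookup u w))"
  by (rule poly_mapping_eqI) (auto simp: lookup_sum lookup_single when_def in_keys_iff)

lemma free_induct [case_names zero single add]:
  fixes u :: "'w \<Rightarrow>\<^sub>0 'k::comm_monoid_add"
  assumes "Poly_Mapping.keys u \<subseteq> S"
    and "Q 0" "\<And>w a. w \<in> S \<Longrightarrow> Q (Poly_Mapping.single w a)"
    and "\<And>u v. Poly_Mapping.keys u \<subseteq> S \<Longrightarrow> Poly_Mapping.keys v \<subseteq> S \<Longrightarrow> Q u \<Longrightarrow> Q v \<Longrightarrow> Q (u + v)"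
  shows "Q u"
proof -
  have "Q (\<Sum>w\<in>T. Poly_Mapping.single w (g w)) \<and> Poly_Mapping.keys (\<Sum>w\<in>T. Poly_Mapping.single w (g w)) \<subseteq> S"
    if "finite T" "T \<subseteq> S" for T and g :: "'w \<Rightarrow> 'k"
    using that
  proof (induction T rule: finite_induct)
    case (insert w T)
    have k: "Poly_Mapping.keys (Poly_Mapping.single w (g w)) \<subseteq> S" using insert by auto
    then show ?case
      using insert assms(3)[of w "g w"] assms(4)[OF k]
        Poly_Mapping.keys_add[of "Poly_Mapping.single w (g w)" "\<Sum>w\<in>T. Poly_Mapping.single w (g w)"] by auto
  qed (use assms in auto)
  from this[of "Poly_Mapping.keys u" "Poly_Mapping.lookup u"] assms(1) show ?thesis
    using poly_mapping_as_sum[of u] by simp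
qed

lemma free_induct' [case_names zero single add]:
  fixes u :: "'w \<Rightarrow>\<^sub>0 'k::comm_monoid_add"
  assumes "Q 0" "\<And>w a. Q (Poly_Mapping.single w a)" "\<And>u v. Q u \<Longrightarrow> Q v \<Longrightarrow> Q (u + v)"
  shows "Q u"
  using free_induct[of u UNIV Q] assms by blast

definition free_map :: "('g \<Rightarrow> 'h) \<Rightarrow> ('k \<Rightarrow> 'l) \<Rightarrow> ('g, 'k::comm_ring_1) free \<Rightarrow> ('h, 'l::comm_ring_1) free" where
  "free_map f g = ev (\<lambda>w a. Poly_Mapping.single (Word (map f (letters w))) (g a))"

text \<open>The carrier of the free superalgebra on \<open>G\<close>.\<close>

definition FC :: "'g set \<Rightarrow> ('g, 'k::comm_ring_1) free set" where
  "FC G = {p. \<forall>w\<in>Poly_Mapping.keys p. set (letters w) \<subseteq> G}"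

lemma FC_keys: "p \<in> FC G \<longleftrightarrow> Poly_Mapping.keys p \<subseteq> {w. set (letters w) \<subseteq> G}" by (auto simp: FC_def)

lemma FC_0 [simp]: "0 \<in> FC G" and FC_1 [simp]: "1 \<in> FC G" and FC_scal [simp]: "scal a \<in> FC G"
  by (auto simp: FC_def scal_def zero_word_def simp del: single_one simp flip: single_one split: if_splits)
lemma FC_add: "p \<in> FC G \<Longrightarrow> r \<in> FC G \<Longrightarrow> p + r \<in> FC G"
  using Poly_Mapping.keys_add[of p r] by (auto simp: FC_def)
lemma FC_uminus: "p \<in> FC G \<Longrightarrow> - p \<in> FC G"
  by (simp add: FC_def)
lemma FC_diff: "p \<in> FC G \<Longrightarrow> r \<in> FC G \<Longrightarrow> p - r \<in> FC G"
  using FC_add[OF _ FC_uminus, of p G r] by simp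
lemma FC_mult: "p \<in> FC G \<Longrightarrow> r \<in> FC G \<Longrightarrow> p * r \<in> FC G"
  using Poly_Mapping.keys_mult[of p r] by (fastforce simp: FC_def plus_word_def)
lemma FC_gen: "x \<in> G \<Longrightarrow> gen x \<in> FC G"
  by (auto simp: FC_def gen_def)
lemma FC_single: "set (letters w) \<subseteq> G \<Longrightarrow> Poly_Mapping.single w a \<in> FC G"
  by (auto simp: FC_def)

lemma FC_induct [consumes 1, case_names zero single add]:
  assumes "u \<in> FC G" "Q 0" "\<And>w a. set (letters w) \<subseteq> G \<Longrightarrow> Q (Poly_Mapping.single w a)"
    "\<And>u v. u \<in> FC G \<Longrightarrow> v \<in> FC G \<Longrightarrow> Q u \<Longrightarrow> Q v \<Longrightarrow> Q (u + v)"
  shows "Q u"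
  using assms free_induct[of u "{w. set (letters w) \<subseteq> G}" Q] unfolding FC_keys by blast

lemma scal_add: "scal (a + b) = scal a + scal b" by (simp add: scal_def single_add)
lemma scal_mult: "scal (a * b) = scal a * scal b" by (simp add: scal_def mult_single)
lemma scal_1 [simp]: "scal 1 = 1" by (simp add: scal_def)
lemma scal_0 [simp]: "scal 0 = 0" by (simp add: scal_def)
lemma scal_uminus: "scal (- a) = - scal a" by (simp add: scal_def single_uminus)
lemma scal_central: "scal a * (p :: ('g, 'k::comm_ring_1) free) = p * scal a"
  by (induction p rule: free_induct') (simp_all add: scal_def mult_single mult.commute distrib_left distrib_right)
lemma scal_single: "scal a * Poly_Mapping.single w b = Poly_Mapping.single w (a * b)"
  by (simp add: scal_def mult_single)
lemma lookup_scal: "Poly_Mapping.lookup (scal a * p) w = a * Poly_Mapping.lookup p w" for p :: "('g, 'k::comm_ring_1) free"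
  by (induction p rule: free_induct') (auto simp: scal_single lookup_single when_def lookup_add distrib_left)

text \<open>Ring homomorphisms between coefficient rings, applied to the coefficients of free algebras together with a renaming of the letters.\<close>

locale coeff_hom =
  fixes g :: "'k::comm_ring_1 \<Rightarrow> 'l::comm_ring_1"
  assumes g_add: "g (a + b) = g a + g b" and g_mult: "g (a * b) = g a * g b" and g_1: "g 1 = 1"
begin

lemma g_0: "g 0 = 0" using g_add[of 0 0] by simp

lemma g_uminus: "g (- a) = - g a"
  using g_add[of a "- a"] g_0 by (simp add: eq_neg_iff_add_eq_0 add.commute)

lemma g_diff: "g (a - b) = g a - g b"
  using g_add[of a "- b"] g_uminus by simp

lemma free_map_add: "free_map f g (u + v) = free_map f g u + free_map f g v"
  unfolding free_map_def by (rule ev_add) (simp_all add: g_0 g_add single_add)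

lemma free_map_0 [simp]: "free_map f g 0 = 0" by (simp add: free_map_def)

lemma free_map_uminus: "free_map f g (- u) = - free_map f g u"
  using free_map_add[of f u "- u"] by (simp add: eq_neg_iff_add_eq_0 add.commute)

lemma free_map_diff: "free_map f g (u - v) = free_map f g u - free_map f g v"
  using free_map_add[of f u "- v"] free_map_uminus[of f v] by simp

lemma free_map_single: "free_map f g (Poly_Mapping.single w a) = Poly_Mapping.single (Word (map f (letters w))) (g a)"
  unfolding free_map_def by (rule ev_single) (simp add: g_0)

lemma free_map_scal [simp]: "free_map f g (scal a) = scal (g a)"
  by (simp add: scal_def free_map_single zero_word_def)

lemma free_map_gen [simp]: "free_map f g (gen x) = gen (f x)"
  by (simp add: gen_def free_map_single g_1)

lemma free_map_1 [simp]: "free_map f g 1 = 1"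
  using free_map_scal[of f 1] by (simp add: g_1 del: free_map_scal)

lemma free_map_mult: "free_map f g (u * v) = free_map f g u * free_map f g v"
proof (induction u rule: free_induct')
  case (single w a)
  show ?case
    by (induction v rule: free_induct')
      (simp_all add: mult_single free_map_single plus_word_def g_mult free_map_add distrib_left)
qed (simp_all add: free_map_add distrib_right)

lemma free_map_FC: "u \<in> FC G \<Longrightarrow> (\<And>x. x \<in> G \<Longrightarrow> f x \<in> G') \<Longrightarrow> free_map f g u \<in> FC G'"
proof (induction rule: FC_induct)
  case (single w a)
  then have "f ` set (letters w) \<subseteq> G'" by blast
  then show ?case by (simp add: free_map_single FC_single)
qed (simp_all add: free_map_add FC_add)

lemma lookup_free_map_id: "Poly_Mapping.lookup (free_map id g u) w = g (Poly_Mapping.lookup u w)"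
  by (induction u rule: free_induct') (auto simp: free_map_single lookup_single when_def lookup_add free_map_add g_add g_0)

end

interpretation cst: coeff_hom const_ratfun
  by standard (simp_all add: const_ratfun_def flip: to_fract_add to_fract_mult one_pCons)

interpretation tof: coeff_hom "to_fract :: complex poly \<Rightarrow> ratfun"
  by standard simp_all

text \<open>The predicate \<open>Q\<close> restricts the denominators; it is used for all nonzero polynomials and for those that do not vanish at 1.\<close>

lemma common_denominator:
  fixes u :: "('g, ratfun) free"
  assumes "u \<in> FC G" and D: "\<And>w. \<exists>d a. Q d \<and> to_fract d * Poly_Mapping.lookup u w = to_fract a"
    and Q: "\<And>a b. Q a \<Longrightarrow> Q b \<Longrightarrow> Q (a * b)" "Q 1"
  shows "\<exists>d u'. Q d \<and> u' \<in> FC G \<and> free_map id to_fract u' = scal (to_fract d) * u"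
proof -
  obtain d a where da: "\<And>w. Q (d w) \<and> to_fract (d w) * Poly_Mapping.lookup u w = to_fract (a w :: complex poly)" using D by metis
  define e where "e = (\<Prod>w\<in>Poly_Mapping.keys u. d w)"
  have Qp: "Q (\<Prod>w\<in>S. d w)" if "finite S" for S
    using that by (induction S rule: finite_induct) (auto simp: Q da)
  define u' where "u' = (\<Sum>w\<in>Poly_Mapping.keys u. Poly_Mapping.single w ((\<Prod>v\<in>Poly_Mapping.keys u - {w}. d v) * a w))"
  have l: "Poly_Mapping.lookup u' w = (if w \<in> Poly_Mapping.keys u then (\<Prod>v\<in>Poly_Mapping.keys u - {w}. d v) * a w else 0)" for w
    unfolding u'_def by (simp add: lookup_sum lookup_single when_def)
  have "free_map id to_fract u' = scal (to_fract e) * u"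
  proof (rule poly_mapping_eqI)
    fix w
    show "Poly_Mapping.lookup (free_map id to_fract u') w = Poly_Mapping.lookup (scal (to_fract e) * u) w"
    proof (cases "w \<in> Poly_Mapping.keys u")
      case True
      then have "e = (\<Prod>v\<in>Poly_Mapping.keys u - {w}. d v) * d w"
        unfolding e_def by (simp add: prod.remove mult.commute)
      then show ?thesis using True da[of w] by (simp add: tof.lookup_free_map_id l lookup_scal mult.assoc)
    next
      case False
      then show ?thesis by (simp add: tof.lookup_free_map_id l lookup_scal in_keys_iff)
    qed
  qed
  moreover have "Poly_Mapping.keys u' \<subseteq> Poly_Mapping.keys u" using l by (auto simp: in_keys_iff split: if_splits)
  then have "u' \<in> FC G" using assms(1) by (auto simp: FC_def)
  ultimately show ?thesis using Qp[of "Poly_Mapping.keys u"] e_def by auto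
qed

lemma ratfun_denominator: "\<exists>d a. d \<noteq> 0 \<and> to_fract d * x = to_fract (a :: complex poly)" for x :: ratfun
proof (cases x)
  case (Fract a b)
  then have "to_fract b * x = to_fract a" by (simp add: Fract_conv_to_fract)
  then show ?thesis using Fract by blast
qed

context hecke_clifford begin

definition linear_on :: "nat \<Rightarrow> ((dword, 'k) lop \<Rightarrow> (dword, 'k) lop) \<Rightarrow> bool" where
  "linear_on n f \<longleftrightarrow> (\<forall>x\<in>A n. f x \<in> A n) \<and> (\<forall>x\<in>A n. \<forall>y\<in>A n. f (x + y) = f x + f y) \<and>
     (\<forall>k. \<forall>x\<in>A n. f (lscal k * x) = lscal k * f x)"

lemma linear_onD:
  assumes "linear_on n f"
  shows "x \<in> A n \<Longrightarrow> f x \<in> A n" "x \<in> A n \<Longrightarrow> y \<in> A n \<Longrightarrow> f (x + y) = f x + f y"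
    "x \<in> A n \<Longrightarrow> f (lscal k * x) = lscal k * f x" "f 0 = 0"
  using assms unfolding linear_on_def by (blast, blast, blast, metis A_0 lscal_0 mult_zero_left)

lemma linear_on_id: "linear_on n (\<lambda>x. x)" by (simp add: linear_on_def)
lemma linear_on_comp: "linear_on n f \<Longrightarrow> linear_on n f' \<Longrightarrow> linear_on n (\<lambda>x. f (f' x))"
  by (simp add: linear_on_def)
lemma linear_on_add: "linear_on n f \<Longrightarrow> linear_on n f' \<Longrightarrow> linear_on n (\<lambda>x. f x + f' x)"
  by (simp add: linear_on_def A_add algebra_simps)
lemma linear_on_scal: "linear_on n f \<Longrightarrow> linear_on n (\<lambda>x. lscal k * f x)"
  by (simp add: linear_on_def A_mult A_scal distrib_left)
    (metis lscal_central mult.assoc)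

definition act :: "('c::comm_ring_1 \<Rightarrow> 'k) \<Rightarrow> ('g \<Rightarrow> (dword, 'k) lop \<Rightarrow> (dword, 'k) lop) \<Rightarrow> ('g, 'c) free
    \<Rightarrow> (dword, 'k) lop \<Rightarrow> (dword, 'k) lop" where
  "act \<iota> ga u x = ev (\<lambda>w k. lscal (\<iota> k) * foldr ga (letters w) x) u"

context
  fixes \<iota> :: "'c::comm_ring_1 \<Rightarrow> 'k" and ga :: "'g \<Rightarrow> (dword, 'k) lop \<Rightarrow> (dword, 'k) lop" and n and G :: "'g set"
  assumes io: "coeff_hom \<iota>" and ga: "\<And>g. g \<in> G \<Longrightarrow> linear_on n (ga g)"
begin

interpretation io: coeff_hom \<iota> by (rule io)

lemma act_add: "act \<iota> ga (u + v) x = act \<iota> ga u x + act \<iota> ga v x"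
  unfolding act_def by (rule ev_add) (simp_all add: io.g_0 io.g_add lscal_add distrib_right)

lemma act_0: "act \<iota> ga 0 x = 0" by (simp add: act_def)

lemma act_single: "act \<iota> ga (Poly_Mapping.single w k) x = lscal (\<iota> k) * foldr ga (letters w) x"
  unfolding act_def by (rule ev_single) (simp add: io.g_0)

lemma act_gen: "act \<iota> ga (gen g) x = ga g x"
  by (simp add: gen_def act_single io.g_1)

lemma act_scal: "act \<iota> ga (scal k) x = lscal (\<iota> k) * x"
  by (simp add: scal_def act_single zero_word_def)

lemma linear_foldr: "set w \<subseteq> G \<Longrightarrow> linear_on n (foldr ga w)"
proof (induction w)
  case Nil
  then show ?case using linear_on_id by (simp add: id_def)
next
  case (Cons g w)
  then show ?case using linear_on_comp[OF ga[of g], of "foldr ga w"] by (simp add: o_def)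
qed

lemma linear_act: "u \<in> FC G \<Longrightarrow> linear_on n (act \<iota> ga u)"
proof (induction rule: FC_induct)
  case zero
  show ?case by (simp add: act_0 linear_on_def)
next
  case (single w a)
  have "linear_on n (\<lambda>x. lscal (\<iota> a) * foldr ga (letters w) x)" by (rule linear_on_scal[OF linear_foldr[OF single]])
  then show ?case by (simp add: act_single linear_on_def)
next
  case (add u v)
  then have "linear_on n (\<lambda>x. act \<iota> ga u x + act \<iota> ga v x)" by (intro linear_on_add)
  then show ?case by (simp add: act_add linear_on_def)
qed

lemma act_mult: "u \<in> FC G \<Longrightarrow> v \<in> FC G \<Longrightarrow> x \<in> A n \<Longrightarrow> act \<iota> ga (u * v) x = act \<iota> ga u (act \<iota> ga v x)"
proof (induction u rule: FC_induct)
  case (single w a)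
  note lw = linear_onD[OF linear_foldr[OF single(1)]]
  show ?case using single(2)
  proof (induction v rule: FC_induct)
    case zero
    then show ?case by (simp add: act_0 act_single lw)
  next
    case (single w' a')
    have "foldr ga (letters w') x \<in> A n" using linear_onD(1)[OF linear_foldr[OF single]] \<open>x \<in> A n\<close> by simp
    then show ?case by (simp add: mult_single act_single plus_word_def io.g_mult lscal_mult lw mult.assoc)
  next
    case (add v v')
    have "act \<iota> ga v x \<in> A n" "act \<iota> ga v' x \<in> A n"
      using linear_onD(1)[OF linear_act[OF add(1)]] linear_onD(1)[OF linear_act[OF add(2)]] \<open>x \<in> A n\<close> by auto
    then show ?case using add by (simp add: distrib_left act_add act_single lw)
  qed
qed (simp_all add: act_0 act_add distrib_right)

lemma act_scal_mult: "act \<iota> ga (scal k * u) x = lscal (\<iota> k) * act \<iota> ga u x"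
  by (induction u rule: free_induct')
    (simp_all add: scal_single act_single act_0 act_add distrib_left io.g_mult lscal_mult mult.assoc)

end

end

section \<open>The quantum action on a Hecke-Clifford algebra\<close>

lemma qbc_gens_iff:
  "Tgen i \<in> qbc_gens r s \<longleftrightarrow> 1 \<le> i \<and> i \<le> r - 1"
  "Tsgen i \<in> qbc_gens r s \<longleftrightarrow> 1 \<le> i \<and> i \<le> s - 1"
  "Qegen \<in> qbc_gens r s \<longleftrightarrow> 1 \<le> r \<and> 1 \<le> s"
  "Qcgen i \<in> qbc_gens r s \<longleftrightarrow> 1 \<le> i \<and> i \<le> r"
  "Qcsgen i \<in> qbc_gens r s \<longleftrightarrow> 1 \<le> i \<and> i \<le> s"
  by (auto simp: qbc_gens_def)

lemma bc_gens_iff: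
  "Sgen i \<in> bc_gens r s \<longleftrightarrow> 1 \<le> i \<and> i \<le> r + s - 1 \<and> i \<noteq> r"
  "Egen \<in> bc_gens r s \<longleftrightarrow> 1 \<le> r \<and> 1 \<le> s"
  "Cgen i \<in> bc_gens r s \<longleftrightarrow> 1 \<le> i \<and> i \<le> r + s"
  by (auto simp: bc_gens_def)

context hecke_clifford begin

text \<open>The action of the quantum generators. Indices on the left are shifted by \<open>s\<close>; on the right they are reversed, so that \<open>t\<^sub>1\<^sup>*\<close> and \<open>c\<^sub>1\<^sup>*\<close> meet the last strand, which is also the one removed by \<open>eps\<close>.\<close>

fun gact :: "nat \<Rightarrow> nat \<Rightarrow> qbc_gen \<Rightarrow> (dword, 'k) lop \<Rightarrow> (dword, 'k) lop" where
  "gact r s (Tgen i) x = T (s + i) * x"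
| "gact r s (Tsgen j) x = x * T (r + s - j)"
| "gact r s Qegen x = eps (r + s) x"
| "gact r s (Qcgen i) x = c (s + i) * x"
| "gact r s (Qcsgen j) x = th (r + s) x * c (r + s + 1 - j)"

lemma linear_on_lmult: "a \<in> A n \<Longrightarrow> linear_on n (\<lambda>x. a * x)"
  unfolding linear_on_def
  by (auto simp: A_mult distrib_left) (metis lscal_central mult.assoc)
lemma linear_on_rmult: "a \<in> A n \<Longrightarrow> linear_on n (\<lambda>x. x * a)"
  unfolding linear_on_def by (auto simp: A_mult distrib_right mult.assoc)
lemma T_c_far: "j \<noteq> i \<Longrightarrow> j \<noteq> Suc i \<Longrightarrow> T i * c j = c j * T i" by (rule top_cop_far)

lemma c_anti: "i \<noteq> j \<Longrightarrow> c i * c j = - (c j * c i)" by (rule cop_anti)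

lemma lscal_left_commute: "x * (lscal a * y) = lscal a * (x * y)" for x y :: "(dword, 'k) lop"
proof -
  have "x * (lscal a * y) = (x * lscal a) * y" by (simp only: mult.assoc)
  also have "\<dots> = (lscal a * x) * y" by (simp only: lscal_central)
  finally show ?thesis by (simp only: mult.assoc)
qed
lemma linear_on_th: "linear_on n (th n)"
  unfolding linear_on_def by (simp add: th_A th_add th_mult)
lemma linear_on_eps: "linear_on (Suc m) (eps (Suc m))"
  unfolding linear_on_def by (simp add: A_Suc eps_A eps_add eps_scal)

lemma gact_linear: assumes "g \<in> qbc_gens r s" shows "linear_on (r + s) (gact r s g)"
proof (cases g)
  case (Tgen i)
  have "linear_on (r + s) (\<lambda>x. T (s + i) * x)"
    using assms Tgen by (intro linear_on_lmult A_T) (auto simp: qbc_gens_iff)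
  then show ?thesis using Tgen by (simp add: linear_on_def)
next
  case (Tsgen j)
  have "linear_on (r + s) (\<lambda>x. x * T (r + s - j))"
    using assms Tsgen by (intro linear_on_rmult A_T) (auto simp: qbc_gens_iff)
  then show ?thesis using Tsgen by (simp add: linear_on_def)
next
  case Qegen
  then obtain m where "r + s = Suc m" using assms by (cases "r + s") (auto simp: qbc_gens_iff)
  then show ?thesis using Qegen linear_on_eps[of m] by (simp add: linear_on_def)
next
  case (Qcgen i)
  have "linear_on (r + s) (\<lambda>x. c (s + i) * x)"
    using assms Qcgen by (intro linear_on_lmult A_c) (auto simp: qbc_gens_iff)
  then show ?thesis using Qcgen by (simp add: linear_on_def)
next
  case (Qcsgen j)
  have "linear_on (r + s) (\<lambda>x. th (r + s) x * c (r + s + 1 - j))"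
    using assms Qcsgen by (intro linear_on_comp[OF linear_on_rmult linear_on_th] A_c) (auto simp: qbc_gens_iff)
  then show ?thesis using Qcsgen by (simp add: linear_on_def)
qed

context
  fixes \<iota> :: "complex poly \<Rightarrow> 'k" and r s :: nat
  assumes io: "coeff_hom \<iota>" and io_q: "\<iota> [:0, 1:] = q"
begin

interpretation io: coeff_hom \<iota> by (rule io)

abbreviation (input) "G \<equiv> qbc_gens r s"
abbreviation (input) "aw \<equiv> act \<iota> (gact r s)"

lemma aw_simps:
  "aw (u + v) x = aw u x + aw v x" "aw 0 x = 0" "aw (gen g) x = gact r s g x" "aw (scal k) x = lscal (\<iota> k) * x"
  "aw (scal k * u) x = lscal (\<iota> k) * aw u x"
  by (rule act_add[OF io], erule gact_linear, rule act_0[OF io], erule gact_linear, rule act_gen[OF io], erule gact_linear,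
    rule act_scal[OF io], erule gact_linear, rule act_scal_mult[OF io], erule gact_linear)

lemma aw_linear: "u \<in> FC G \<Longrightarrow> linear_on (r + s) (aw u)"
  by (rule linear_act[OF io]) (erule gact_linear)

lemma aw_mult: "u \<in> FC G \<Longrightarrow> v \<in> FC G \<Longrightarrow> x \<in> A (r + s) \<Longrightarrow> aw (u * v) x = aw u (aw v x)"
  by (rule act_mult[OF io]) (erule gact_linear)

text \<open>The coefficient map \<open>\<iota>\<close> is only defined on polynomials, so an element with rational coefficients acts by \<open>f\<close> if it does so after multiplication with a common denominator.\<close>

definition acts :: "(qbc_gen, ratfun) free \<Rightarrow> ((dword, 'k) lop \<Rightarrow> (dword, 'k) lop) \<Rightarrow> bool" where
  "acts u f \<longleftrightarrow> u \<in> FC G \<and> linear_on (r + s) f \<and>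
     (\<exists>d u'. d \<noteq> 0 \<and> u' \<in> FC G \<and> free_map id to_fract u' = scal (to_fract d) * u \<and>
       (\<forall>x\<in>A (r + s). aw u' x = lscal (\<iota> d) * f x))"

lemma acts_gen: "g \<in> G \<Longrightarrow> acts (gen g) (gact r s g)"
  unfolding acts_def
  by (intro conjI exI[of _ "1 :: complex poly"] exI[of _ "gen g"]) (simp_all add: FC_gen gact_linear aw_simps io.g_1)

lemma acts_scal: "acts (scal (to_fract k)) (\<lambda>x. lscal (\<iota> k) * x)"
  unfolding acts_def
  by (intro conjI exI[of _ "1 :: complex poly"] exI[of _ "scal k"]) (simp_all add: aw_simps io.g_1 linear_on_scal[OF linear_on_id])

lemma acts_1: "acts 1 (\<lambda>x. x)"
  using acts_scal[of 1] by (simp add: io.g_1)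

lemma acts_0: "acts 0 (\<lambda>x. 0)"
  using acts_scal[of 0] by (simp add: io.g_0)

lemma acts_xi: "acts (scal (qq - inverse qq)) (\<lambda>x. xi * x)"
  unfolding acts_def
proof (intro conjI exI[of _ "[:0, 1:]"] exI[of _ "scal ([:0, 1:] * [:0, 1:] - 1)"] ballI)
  have "qq \<noteq> 0" by (simp add: qq_def)
  then have "qq * qq - 1 = qq * (qq - inverse qq)" by (simp add: algebra_simps)
  moreover have "to_fract ([:0, 1:] * [:0, 1:] - 1 :: complex poly) = qq * qq - 1"
    by (simp only: to_fract_diff to_fract_mult to_fract_1 qq_def)
  ultimately show "free_map id to_fract (scal ([:0, 1:] * [:0, 1:] - 1)) =
     scal (to_fract [:0, 1:]) * (scal (qq - inverse qq) :: (qbc_gen, ratfun) free)"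
    by (simp only: tof.free_map_scal scal_mult[symmetric] qq_def)
  have 1: "\<iota> ([:0, 1:] * [:0, 1:] - 1) = q * (q - p)"
    using qp by (simp only: io.g_diff io.g_mult io_q io.g_1 algebra_simps)
  show "aw (scal ([:0, 1:] * [:0, 1:] - 1)) x = lscal (\<iota> [:0, 1:]) * (xi * x)" for x
    unfolding aw_simps(4) 1 io_q by (simp add: lscal_mult mult.assoc)
qed (simp_all add: linear_on_scal[OF linear_on_id])

lemma acts_add: assumes "acts u f" "acts v h" shows "acts (u + v) (\<lambda>x. f x + h x)"
proof -
  obtain d u' where d: "d \<noteq> 0" "u' \<in> FC G" "free_map id to_fract u' = scal (to_fract d) * u"
       "\<And>x. x \<in> A (r + s) \<Longrightarrow> aw u' x = lscal (\<iota> d) * f x" using assms(1) unfolding acts_def by blast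
  obtain e v' where e: "e \<noteq> 0" "v' \<in> FC G" "free_map id to_fract v' = scal (to_fract e) * v"
       "\<And>x. x \<in> A (r + s) \<Longrightarrow> aw v' x = lscal (\<iota> e) * h x" using assms(2) unfolding acts_def by blast
  have "free_map id to_fract (scal e * u' + scal d * v') = scal (to_fract (d * e)) * (u + v)"
    by (simp add: tof.free_map_add tof.free_map_mult d e distrib_left mult.assoc[symmetric] scal_mult[symmetric] mult.commute)
  moreover have "aw (scal e * u' + scal d * v') x = lscal (\<iota> (d * e)) * (f x + h x)" if "x \<in> A (r + s)" for x
    using that d e by (simp add: aw_simps distrib_left mult.assoc[symmetric] lscal_mult[symmetric] io.g_mult mult.commute)
  moreover have "linear_on (r + s) (\<lambda>x. f x + h x)" "u + v \<in> FC G"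
    using linear_on_add assms by (auto simp: acts_def intro: FC_add)
  moreover have "d * e \<noteq> 0" "scal e * u' + scal d * v' \<in> FC G"
    using d e FC_mult[OF FC_scal[of e] d(2)] FC_mult[OF FC_scal[of d] e(2)] by (auto intro: FC_add)
  ultimately show ?thesis unfolding acts_def by blast
qed

lemma acts_mult: assumes "acts u f" "acts v h" shows "acts (u * v) (\<lambda>x. f (h x))"
proof -
  obtain d u' where d: "d \<noteq> 0" "u' \<in> FC G" "free_map id to_fract u' = scal (to_fract d) * u"
       "\<And>x. x \<in> A (r + s) \<Longrightarrow> aw u' x = lscal (\<iota> d) * f x" using assms(1) unfolding acts_def by blast
  obtain e v' where e: "e \<noteq> 0" "v' \<in> FC G" "free_map id to_fract v' = scal (to_fract e) * v"
       "\<And>x. x \<in> A (r + s) \<Longrightarrow> aw v' x = lscal (\<iota> e) * h x" using assms(2) unfolding acts_def by blast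
  have lin: "linear_on (r + s) f" "linear_on (r + s) h" using assms by (auto simp: acts_def)
  have "free_map id to_fract (u' * v') = scal (to_fract d) * (u * scal (to_fract e)) * v"
    by (simp add: tof.free_map_mult d e mult.assoc)
  also have "\<dots> = scal (to_fract (d * e)) * (u * v)"
    by (simp add: scal_central[of "to_fract e" u, symmetric] mult.assoc[symmetric] scal_mult)
  finally have 1: "free_map id to_fract (u' * v') = scal (to_fract (d * e)) * (u * v)" .
  have 2: "aw (u' * v') x = lscal (\<iota> (d * e)) * f (h x)" if x: "x \<in> A (r + s)" for x
  proof -
    have hx: "h x \<in> A (r + s)" using linear_onD(1)[OF lin(2) x] .
    have "aw (u' * v') x = aw u' (lscal (\<iota> e) * h x)" using aw_mult[OF d(2) e(2) x] e(4)[OF x] by simp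
    also have "\<dots> = lscal (\<iota> e) * aw u' (h x)" using linear_onD(3)[OF aw_linear[OF d(2)] hx] by simp
    also have "\<dots> = lscal (\<iota> (d * e)) * f (h x)"
      using d(4)[OF hx] by (simp add: mult.assoc[symmetric] lscal_mult[symmetric] io.g_mult mult.commute)
    finally show ?thesis .
  qed
  have "linear_on (r + s) (\<lambda>x. f (h x))" "u * v \<in> FC G"
    using linear_on_comp[OF lin] assms by (auto simp: acts_def intro: FC_mult)
  moreover have "d * e \<noteq> 0" "u' * v' \<in> FC G" using d e by (auto intro: FC_mult)
  ultimately show ?thesis using 1 2 unfolding acts_def by blast
qed

lemma acts_cong: "acts u f \<Longrightarrow> (\<And>x. x \<in> A (r + s) \<Longrightarrow> f x = h x) \<Longrightarrow> acts u h"
  unfolding acts_def linear_on_def by (simp add: A_add A_mult A_scal)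

lemma acts_uminus: "acts u f \<Longrightarrow> acts (- u) (\<lambda>x. - f x)"
  using acts_mult[OF acts_scal[of "- 1"], of u f]
  by (simp add: scal_uminus io.g_uminus io.g_1 lscal_uminus)

lemma acts_diff: "acts u f \<Longrightarrow> acts v h \<Longrightarrow> acts (u - v) (\<lambda>x. f x - h x)"
  using acts_add[OF _ acts_uminus, of u f v h] by simp

lemma acts_relI: "acts u f \<Longrightarrow> acts v h \<Longrightarrow> (\<And>x. x \<in> A (r + s) \<Longrightarrow> f x = h x) \<Longrightarrow> acts (u - v) (\<lambda>x. 0)"
  using acts_cong[OF acts_diff, of u f v h "\<lambda>x. 0"] by simp

lemmas acts_intros = acts_mult acts_diff acts_add acts_uminus acts_xi acts_1 acts_0 acts_gen

text \<open>Each relation is one of the identities for \<open>T\<close>, \<open>c\<close>, the parity automorphism and \<open>eps\<close>. The starred generators satisfy the same relations as the others because right multiplication and index reversal both reverse the order.\<close>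

lemma qbc_rel_acts: "qbc_rel r s u v \<Longrightarrow> acts (u - v) (\<lambda>x. 0)"
proof (induction rule: qbc_rel.induct)
  case (t_quad i)
  then show ?case
    apply -
    apply (rule acts_relI, (rule acts_intros; simp?)+)
    by (simp add: mult.assoc[symmetric] T_sq distrib_right)
next
  case (t_braid i)
  then show ?case
    apply -
    apply (rule acts_relI, (rule acts_intros; simp?)+)
    by (simp add: mult.assoc[symmetric] T_braid)
next
  case (t_comm i j)
  then have "i + 1 < j \<or> j + 1 < i" by linarith
  with t_comm show ?case
    apply -
    apply (rule acts_relI, (rule acts_intros; simp?)+)
    by (auto simp add: mult.assoc[symmetric] top_top_far[of "s + i" "s + j"] top_top_far[of "s + j" "s + i"])
next
  case (ts_quad i)
  then show ?case
    apply -
    apply (rule acts_relI, (rule acts_intros; simp?)+)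
    by (simp add: mult.assoc T_sq distrib_left lscal_left_commute)
next
  case (ts_braid i)
  define k where "k = r + s - (i + 1)"
  have k: "r + s - (i + 1) = k" "r + s - Suc i = k" "r + s - i = Suc k"
    using ts_braid by (auto simp: qbc_gens_iff k_def)
  show ?case using ts_braid
    apply -
    apply (rule acts_relI, (rule acts_intros; simp?)+)
    by (simp add: k mult.assoc T_braid[of k, unfolded mult.assoc])
next
  case (ts_comm i j)
  then have "r + s - i + 1 < r + s - j \<or> r + s - j + 1 < r + s - i" by (auto simp: qbc_gens_iff)
  with ts_comm show ?case
    apply -
    apply (rule acts_relI, (rule acts_intros; simp?)+)
    by (auto simp add: mult.assoc top_top_far[of "r + s - i" "r + s - j"] top_top_far[of "r + s - j" "r + s - i"])
next
  case (t_ts_comm i j)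
  then show ?case
    apply -
    apply (rule acts_relI, (rule acts_intros; simp?)+)
    by (simp add: mult.assoc)
next
  case qe_sq
  then obtain m where m: "r + s = Suc m" by (cases "r + s") (auto simp: qbc_gens_iff)
  from qe_sq show ?case
    apply -
    apply (rule acts_relI, (rule acts_intros; simp?)+)
    by (simp add: m eps_B1 eps_A)
next
  case e_t_e
  then obtain m where m: "r + s = Suc m" "s + (r - 1) = m" "1 \<le> m" "s + (r - Suc 0) = m" by (cases "r + s") (auto simp: qbc_gens_iff)
  from e_t_e show ?case
    apply -
    apply (rule acts_relI, (rule acts_intros; simp?)+)
    by (use eps_B3[OF m(3) A_1] eps_A in \<open>simp add: m\<close>)
next
  case (e_t_comm j)
  then obtain m where m: "r + s = Suc m" "Suc (s + j) \<le> m" by (cases "r + s") (auto simp: qbc_gens_iff)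
  from e_t_comm show ?case
    apply -
    apply (rule acts_relI, (rule acts_intros; simp?)+)
    by (use m in \<open>simp add: eps_lmult A_T qbc_gens_iff\<close>)
next
  case e_ts_e
  then obtain m where m: "r + s = Suc m" "1 \<le> m" by (cases "r + s") (auto simp: qbc_gens_iff)
  from e_ts_e show ?case
    apply -
    apply (rule acts_relI, (rule acts_intros; simp?)+)
    by (use eps_B3[OF m(2) _ A_1] eps_A in \<open>simp add: m\<close>)
next
  case (e_ts_comm j)
  then obtain m where m: "r + s = Suc m" "Suc (r + s - j) \<le> m" "1 \<le> r + s - j" by (cases "r + s") (auto simp: qbc_gens_iff)
  then have "T (r + s - j) \<in> A m" by (intro A_T)
  with e_ts_comm show ?case
    apply -
    apply (rule acts_relI, (rule acts_intros; simp?)+)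
    by (use m in \<open>simp add: eps_rmult\<close>)
next
  case e_t_ts
  then obtain m where m: "r + s = Suc (Suc m)" "s + (r - 1) = Suc m" "s + (r - Suc 0) = Suc m" "1 \<le> m"
    by (cases "r + s"; cases "r + s - 1") (auto simp: qbc_gens_iff)
  have a: "acts (tg (r - 1)) (gact r s (Tgen (r - 1)))" using e_t_ts by (intro acts_gen) simp
  have "acts (tg_inv (r - 1)) (\<lambda>x. gact r s (Tgen (r - 1)) x - xi * x)"
    unfolding tg_inv_def by (rule acts_diff[OF a acts_xi])
  then have inv: "acts (tg_inv (r - 1)) (\<lambda>x. Ti (Suc m) * x)"
    by (rule acts_cong) (simp add: m Ti_def left_diff_distrib)
  note inv = inv inv[unfolded One_nat_def]
  have T: "T (Suc m) \<in> A (Suc (Suc m))" "Ti (Suc m) \<in> A (Suc (Suc m))" by (simp_all add: A_T Ti_A)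
  have 1: "eps (Suc (Suc m)) (Ti (Suc m) * (eps (Suc (Suc m)) (Ti (Suc m) * x * T (Suc m)) * T (Suc m))) = 
        Ti (Suc m) * (eps (Suc (Suc m)) (Ti (Suc m) * eps (Suc (Suc m)) x * T (Suc m)) * T (Suc m))"
    if x: "x \<in> A (r + s)" for x
  proof -
    have x: "x \<in> A (Suc (Suc m))" using x m by simp
    let ?y = "eps (Suc (Suc m)) (Ti (Suc m) * x * T (Suc m))"
    have y: "?y \<in> A (Suc m)" "eps (Suc (Suc m)) x \<in> A (Suc m)" using x T by (simp_all add: eps_A A_mult)
    have "eps (Suc (Suc m)) (Ti (Suc m) * (?y * T (Suc m))) = eps (Suc m) ?y"
      using eps_Ti_conj[OF y(1) m(4)] by (simp add: mult.assoc)
    also have "\<dots> = eps (Suc m) (eps (Suc (Suc m)) x)" by (rule eps_eps_conj[OF x m(4)])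
    also have "\<dots> = Ti (Suc m) * (eps (Suc m) (eps (Suc (Suc m)) x) * T (Suc m))"
      using Ti_comm_A[OF eps_A[OF y(2)], of "Suc m"] by (simp add: mult.assoc[symmetric]) (simp add: mult.assoc Ti_left)
    finally show ?thesis using eps_Ti_conj[OF y(2) m(4)] by simp
  qed
  from e_t_ts show ?case
    apply -
    apply (rule acts_relI, (rule inv acts_intros; simp?)+)
    by (use 1 m in \<open>simp add: mult.assoc\<close>)
next
  case (qc_sq i)
  then show ?case
    apply -
    apply (rule acts_relI, (rule acts_intros; simp?)+)
    by (simp add: mult.assoc[symmetric] cop_sq)
next
  case (qc_anticomm i j)
  then show ?case
    apply -
    apply (rule acts_relI, (rule acts_intros; simp?)+)
    by (use c_anti[of "s + i" "s + j"] in \<open>simp add: mult.assoc[symmetric]\<close>)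
next
  case (qc_qcs_anticomm i j)
  then show ?case
    apply -
    apply (rule acts_relI, (rule acts_intros; simp?)+)
    by (simp add: th_mult th_c qbc_gens_iff mult.assoc)
next
  case (qcs_sq i)
  then have k: "Suc (r + s) - i \<le> r + s" by (auto simp: qbc_gens_iff)
  from qcs_sq show ?case
    apply -
    apply (rule acts_relI, (rule acts_intros; simp?)+)
    by (use th_c[OF k] in \<open>simp add: th_mult mult.assoc cop_sq\<close>)
next
  case (qcs_anticomm i j)
  then have ne: "r + s + 1 - i \<noteq> r + s + 1 - j" and k: "Suc (r + s) - i \<le> r + s" "Suc (r + s) - j \<le> r + s"
    by (auto simp: qbc_gens_iff)
  from qcs_anticomm show ?case
    apply -
    apply (rule acts_relI, (rule acts_intros; simp?)+)
    by (use c_anti[OF ne] th_c[OF k(1)] th_c[OF k(2)] in \<open>simp add: th_mult mult.assoc\<close>)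
next
  case (t_c i)
  then show ?case
    apply -
    apply (rule acts_relI, (rule acts_intros; simp?)+)
    by (simp add: mult.assoc[symmetric] Tc)
next
  case (t_c_comm i j)
  then show ?case
    apply -
    apply (rule acts_relI, (rule acts_intros; simp?)+)
    by (simp add: mult.assoc[symmetric] top_cop_far)
next
  case (ts_cs i)
  define k where "k = r + s - i"
  have k: "r + s - i = k" "r + s + 1 - i = Suc k" "r + s + 1 - (i + 1) = k" "Suc (r + s) - i = Suc k" "Suc k \<le> r + s"
    using ts_cs by (auto simp: qbc_gens_iff k_def)
  from ts_cs show ?case
    apply -
    apply (rule acts_relI, (rule acts_intros; simp?)+)
    by (use k in \<open>simp add: th_mult th_T mult.assoc Tc\<close>)
next
  case (ts_cs_comm i j)
  then have ne: "r + s + 1 - j \<noteq> r + s - i" "r + s + 1 - j \<noteq> Suc (r + s - i)" "Suc (r + s - i) \<le> r + s" by (auto simp: qbc_gens_iff)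
  from ts_cs_comm show ?case
    apply -
    apply (rule acts_relI, (rule acts_intros; simp?)+)
    by (use T_c_far[OF ne(1,2)] ne(3) in \<open>simp add: th_mult th_T mult.assoc\<close>)
next
  case (t_cs_comm i j)
  then have "Suc (s + i) \<le> r + s" by (auto simp: qbc_gens_iff)
  with t_cs_comm show ?case
    apply -
    apply (rule acts_relI, (rule acts_intros; simp?)+)
    by (simp add: th_mult th_T mult.assoc)
next
  case (ts_c_comm i j)
  then show ?case
    apply -
    apply (rule acts_relI, (rule acts_intros; simp?)+)
    by (simp add: mult.assoc)
next
  case qc_e
  then obtain m where m0: "r + s = Suc m" by (cases "r + s") (auto simp: qbc_gens_iff)
  then have m: "r + s = Suc m" "s + r = Suc m" by simp_all
  from qc_e show ?case
    apply -
    apply (rule acts_relI, (rule acts_intros; simp?)+)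
    by (use c_A[of _ m "Suc m" "Suc m"] eps_A in \<open>simp add: m\<close>)
next
  case qe_c
  then obtain m where m0: "r + s = Suc m" by (cases "r + s") (auto simp: qbc_gens_iff)
  then have m: "r + s = Suc m" "s + r = Suc m" by simp_all
  from qe_c show ?case
    apply -
    apply (rule acts_relI, (rule acts_intros; simp?)+)
    by (use eps_c_trace in \<open>simp add: m\<close>)
next
  case (qc_e_comm j)
  then obtain m where m: "r + s = Suc m" "s + j \<le> m" "1 \<le> s + j" by (cases "r + s") (auto simp: qbc_gens_iff)
  from qc_e_comm show ?case
    apply -
    apply (rule acts_relI, (rule acts_intros; simp?)+)
    by (use m in \<open>simp add: eps_lmult A_c\<close>)
next
  case (qcs_e_comm j)
  then obtain m where m: "r + s = Suc m" "r + s + 1 - j \<le> m" "1 \<le> r + s + 1 - j" by (cases "r + s") (auto simp: qbc_gens_iff)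
  have c: "c (r + s + 1 - j) \<in> A m" by (intro A_c m)
  from qcs_e_comm show ?case
    apply -
    apply (rule acts_relI, (rule acts_intros; simp?)+)
    by (use m c in \<open>simp add: eps_rmult eps_th th_A del: One_nat_def\<close>)
next
  case qe_c_e
  then obtain m where m0: "r + s = Suc m" by (cases "r + s") (auto simp: qbc_gens_iff)
  then have m: "r + s = Suc m" "s + r = Suc m" by simp_all
  from qe_c_e show ?case
    apply -
    apply (rule acts_relI, (rule acts_intros; simp?)+)
    by (use c_A[of _ m "Suc m" "Suc m"] eps_A eps_B2 th_A in \<open>simp add: m\<close>)
qed

end

end

section \<open>Superalgebras given by representatives in a ring\<close>

text \<open>All algebras in question are images \<open>h ` S\<close> of subrings \<open>S\<close> of a free algebra, with operations computed on representatives. Stating this once turns every verification of axioms into ring identities, and passing to a quotient is again of this form (\<open>quot\<close>).\<close>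

locale typed_image =
  fixes S :: "'a::ring_1 set" and K :: "'k::comm_ring_1 set" and sc :: "'k \<Rightarrow> 'a" and h :: "'a \<Rightarrow> 'b"
    and B :: "('k, 'b) superalgebra"
  assumes S_1: "1 \<in> S" and S_add: "\<And>x y. x \<in> S \<Longrightarrow> y \<in> S \<Longrightarrow> x + y \<in> S"
    and S_mult: "\<And>x y. x \<in> S \<Longrightarrow> y \<in> S \<Longrightarrow> x * y \<in> S" and S_uminus: "\<And>x. x \<in> S \<Longrightarrow> - x \<in> S"
    and sc_S: "\<And>a. a \<in> K \<Longrightarrow> sc a \<in> S"
    and carr: "carrier B = h ` S"
    and mult_h: "\<And>x y. x \<in> S \<Longrightarrow> y \<in> S \<Longrightarrow> h x \<otimes>\<^bsub>B\<^esub> h y = h (x * y)"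
    and add_h: "\<And>x y. x \<in> S \<Longrightarrow> y \<in> S \<Longrightarrow> h x \<oplus>\<^bsub>B\<^esub> h y = h (x + y)"
    and one_h: "\<one>\<^bsub>B\<^esub> = h 1" and zero_h: "\<zero>\<^bsub>B\<^esub> = h 0"
    and smult_h: "\<And>a x. a \<in> K \<Longrightarrow> x \<in> S \<Longrightarrow> a \<odot>\<^bsub>B\<^esub> h x = h (sc a * x)"
begin

lemma S_0: "0 \<in> S" using S_add[OF S_1 S_uminus[OF S_1]] by simp
lemma S_diff: "x \<in> S \<Longrightarrow> y \<in> S \<Longrightarrow> x - y \<in> S" using S_add[OF _ S_uminus, of x y] by simp

lemma h_carr: "x \<in> S \<Longrightarrow> h x \<in> carrier B" by (simp add: carr)

lemma abelian: "abelian_group B"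
proof (rule abelian_groupI)
  fix x assume "x \<in> carrier B"
  then obtain u where u: "u \<in> S" "x = h u" by (auto simp: carr)
  have "h (- u) \<oplus>\<^bsub>B\<^esub> x = \<zero>\<^bsub>B\<^esub>" using u by (simp add: add_h zero_h S_uminus)
  then show "\<exists>y\<in>carrier B. y \<oplus>\<^bsub>B\<^esub> x = \<zero>\<^bsub>B\<^esub>" using h_carr[OF S_uminus[OF u(1)]] by blast
qed (auto simp: carr zero_h add_h S_0 S_add ac_simps)

lemma ring: "ring B"
proof (rule ringI[OF abelian])
  show "monoid B" by (rule monoidI) (auto simp: carr one_h mult_h S_1 S_mult mult.assoc)
qed (auto simp: carr add_h mult_h S_add S_mult distrib_left distrib_right)

lemma inv_h: "x \<in> S \<Longrightarrow> \<ominus>\<^bsub>B\<^esub> h x = h (- x)"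
  by (rule abelian_group.minus_equality[OF abelian]) (simp_all add: add_h zero_h S_uminus h_carr)

lemma minus_h: "x \<in> S \<Longrightarrow> y \<in> S \<Longrightarrow> h x \<ominus>\<^bsub>B\<^esub> h y = h (x - y)"
  by (simp add: a_minus_def inv_h add_h S_uminus)

definition tideal :: "'a set \<Rightarrow> bool" where
  "tideal J \<longleftrightarrow> J \<subseteq> S \<and> 0 \<in> J \<and> (\<forall>x\<in>J. \<forall>y\<in>J. x + y \<in> J) \<and> (\<forall>x\<in>J. - x \<in> J) \<and>
     (\<forall>x\<in>S. \<forall>j\<in>J. x * j \<in> J \<and> j * x \<in> J)"

lemma ideal_image: assumes "tideal J" shows "ideal (h ` J) B"
proof (rule idealI[OF ring])
  have J: "x \<in> S" if "x \<in> J" for x using assms that by (auto simp: tideal_def)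
  interpret abelian_group B by (rule abelian)
  show "subgroup (h ` J) (add_monoid B)"
  proof (rule group.subgroupI[OF a_group])
    show "h ` J \<subseteq> carrier (add_monoid B)" using J h_carr by auto
    show "h ` J \<noteq> {}" using assms by (auto simp: tideal_def)
    fix a assume "a \<in> h ` J"
    then obtain j where j: "j \<in> J" "a = h j" by auto
    have "inv\<^bsub>add_monoid B\<^esub> a = h (- j)" using inv_h[OF J[OF j(1)]] j by (simp add: a_inv_def)
    then show "inv\<^bsub>add_monoid B\<^esub> a \<in> h ` J" using assms j by (auto simp: tideal_def)
    fix b assume "b \<in> h ` J"
    then obtain i where i: "i \<in> J" "b = h i" by auto
    have "a \<oplus>\<^bsub>B\<^esub> b = h (j + i)" using i j J by (simp add: add_h)
    then show "a \<otimes>\<^bsub>add_monoid B\<^esub> b \<in> h ` J" using assms i j by (auto simp: tideal_def)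
  qed
  fix a x assume "a \<in> h ` J" "x \<in> carrier B"
  then obtain j u where j: "j \<in> J" "a = h j" "u \<in> S" "x = h u" by (auto simp: carr)
  have "x \<otimes>\<^bsub>B\<^esub> a = h (u * j)" "a \<otimes>\<^bsub>B\<^esub> x = h (j * u)" using j J by (auto simp: mult_h)
  then show "x \<otimes>\<^bsub>B\<^esub> a \<in> h ` J" "a \<otimes>\<^bsub>B\<^esub> x \<in> h ` J" using assms j by (auto simp: tideal_def)
qed

lemma coset_eq:
  assumes "ideal I B" "x \<in> S" "y \<in> S"
  shows "I +>\<^bsub>B\<^esub> h x = I +>\<^bsub>B\<^esub> h y \<longleftrightarrow> h (x - y) \<in> I"
  using ring.quotient_eq_iff_same_a_r_cos[OF ring assms(1) h_carr[OF assms(2)] h_carr[OF assms(3)]] minus_h[OF assms(2,3)]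
  by simp

lemma quot: assumes "tideal J" shows "typed_image S K sc (\<lambda>x. h ` J +>\<^bsub>B\<^esub> h x) (quot_superalgebra B (h ` J))"
proof -
  let ?I = "h ` J"
  have JS: "x \<in> S" if "x \<in> J" for x using assms that by (auto simp: tideal_def)
  have id: "ideal ?I B" by (rule ideal_image[OF assms])
  have cos: "?I +>\<^bsub>B\<^esub> h x = ?I +>\<^bsub>B\<^esub> h y" if "x - y \<in> J" "x \<in> S" "y \<in> S" for x y
    unfolding coset_eq[OF id that(2,3)] using that by blast
  have mem: "h x \<in> ?I +>\<^bsub>B\<^esub> h x" if "x \<in> S" for x
  proof -
    have "h 0 \<oplus>\<^bsub>B\<^esub> h x = h x" using that by (simp add: add_h S_0)
    moreover have "h 0 \<in> ?I" using assms by (auto simp: tideal_def)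
    ultimately show ?thesis unfolding a_r_coset_def' by force
  qed
  show ?thesis
  proof (unfold_locales, goal_cases)
    case 6
    then show ?case by (auto simp: quot_superalgebra_def FactRing_def A_RCOSETS_def' carr)
  next
    case (7 x y)
    then show ?case using ideal.rcoset_mult_add[OF id h_carr[of x] h_carr[of y]]
      by (simp add: quot_superalgebra_def FactRing_def mult_h)
  next
    case (8 x y)
    then show ?case using ideal.a_rcos_sum[OF id h_carr[of x] h_carr[of y]]
      by (simp add: quot_superalgebra_def FactRing_def add_h)
  next
    case 9
    show ?case by (simp add: quot_superalgebra_def FactRing_def one_h)
  next
    case 10
    have "?I +>\<^bsub>B\<^esub> h 0 = ?I"
      using abelian_group.a_coset_join2[OF abelian h_carr[OF S_0], of ?I] assms
        additive_subgroup.a_subgroup[OF ideal.axioms(1)[OF id]] by (auto simp: tideal_def)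
    then show ?case by (simp add: quot_superalgebra_def FactRing_def)
  next
    case (11 a x)
    have 1: "?I +>\<^bsub>B\<^esub> (a \<odot>\<^bsub>B\<^esub> y) = ?I +>\<^bsub>B\<^esub> h (sc a * x)" if y: "y \<in> ?I +>\<^bsub>B\<^esub> h x" for y
    proof -
      obtain j where j: "j \<in> J" "y = h j \<oplus>\<^bsub>B\<^esub> h x" using y by (auto simp: a_r_coset_def')
      then have y: "y = h (j + x)" using JS 11 by (simp add: add_h)
      have "sc a * (j + x) - sc a * x \<in> J" using assms j sc_S[OF 11(1)] by (auto simp: distrib_left tideal_def)
      then have "?I +>\<^bsub>B\<^esub> h (sc a * (j + x)) = ?I +>\<^bsub>B\<^esub> h (sc a * x)"
        using j 11 JS sc_S by (intro cos) (auto simp: S_mult S_add)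
      then show ?thesis using y j 11 JS by (simp add: smult_h S_add)
    qed
    have "(\<Union>y\<in>?I +>\<^bsub>B\<^esub> h x. ?I +>\<^bsub>B\<^esub> (a \<odot>\<^bsub>B\<^esub> y)) = ?I +>\<^bsub>B\<^esub> h (sc a * x)"
      using 1 mem[OF 11(2)] by blast
    then show ?case by (simp add: quot_superalgebra_def)
  qed (auto simp: S_1 S_add S_mult S_uminus sc_S)
qed

lemma hpart_quot: "hpart (quot_superalgebra B I) i = (\<lambda>x. I +>\<^bsub>B\<^esub> x) ` hpart B i"
  by (simp add: quot_superalgebra_def)

lemma restrict: assumes "\<And>a. \<phi> a \<in> K" shows "typed_image S UNIV (sc \<circ> \<phi>) h (restrict_scalars \<phi> B)"
  by unfold_locales
    (auto simp: S_1 S_add S_mult S_uminus sc_S assms restrict_scalars_def carr mult_h add_h one_h zero_h smult_h)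

text \<open>Homogeneous elements as eigenvectors of a parity involution \<open>\<alpha>\<close>.\<close>

definition homog :: "('a \<Rightarrow> 'a) \<Rightarrow> bit \<Rightarrow> 'a set" where
  "homog \<alpha> i = {x \<in> S. \<alpha> x = (if i = 0 then x else - x)}"

text \<open>With \<open>2\<close> invertible, \<open>x = (x + \<alpha> x) / 2 + (x - \<alpha> x) / 2\<close> splits \<open>S\<close> into homogeneous parts, and the parts stay disjoint in the image as soon as the kernel of \<open>h\<close> is stable under \<open>\<alpha>\<close>.\<close>

lemma superalgebra:
  fixes \<alpha> :: "'a \<Rightarrow> 'a"
  assumes K: "K = UNIV" and sc: "\<And>a b. sc (a + b) = sc a + sc b" "\<And>a b. sc (a * b) = sc a * sc b" "sc 1 = 1"
      "\<And>a x. sc a * x = x * sc a"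
    and \<alpha>: "\<And>x. x \<in> S \<Longrightarrow> \<alpha> x \<in> S" "\<And>x y. \<alpha> (x + y) = \<alpha> x + \<alpha> y" "\<And>x y. \<alpha> (x * y) = \<alpha> x * \<alpha> y"
      "\<And>x. \<alpha> (\<alpha> x) = x" "\<And>a. \<alpha> (sc a) = sc a"
    and half: "half + half = (1 :: 'k)"
    and hpart: "\<And>i. hpart B i = h ` homog \<alpha> i"
    and ker: "\<And>x y. x \<in> S \<Longrightarrow> y \<in> S \<Longrightarrow> h x = h y \<Longrightarrow> h (\<alpha> x) = h (\<alpha> y)"
  shows "superalgebra type_ring B"
proof -
  have \<alpha>0: "\<alpha> 0 = 0" using \<alpha>(2)[of 0 0] by simp
  have \<alpha>m: "\<alpha> (- x) = - \<alpha> x" for x using \<alpha>(2)[of x "- x"] \<alpha>0 by (simp add: eq_neg_iff_add_eq_0 add.commute)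
  have \<alpha>d: "\<alpha> (x - y) = \<alpha> x - \<alpha> y" for x y using \<alpha>(2)[of x "- y"] \<alpha>m by simp
  have hS: "x \<in> S" if "x \<in> homog \<alpha> i" for x i using that by (simp add: homog_def)
  have H0: "0 \<in> homog \<alpha> i" for i by (simp add: homog_def S_0 \<alpha>0)
  have Ha: "x + y \<in> homog \<alpha> i" if "x \<in> homog \<alpha> i" "y \<in> homog \<alpha> i" for x y i
    using that by (auto simp: homog_def S_add \<alpha>)
  have Hs: "sc a * x \<in> homog \<alpha> i" if "x \<in> homog \<alpha> i" for a x i
    using that by (auto simp: homog_def S_mult sc_S K \<alpha>)
  have Hm: "- x \<in> homog \<alpha> i" if "x \<in> homog \<alpha> i" for x i
    using that by (auto simp: homog_def S_uminus \<alpha>m)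
  have H: "x * y \<in> homog \<alpha> (i + j)" if "x \<in> homog \<alpha> i" "y \<in> homog \<alpha> j" for x y i j
    using that by (cases i; cases j) (auto simp: homog_def S_mult \<alpha>)
  have hlf: "sc half * x + sc half * x = x" for x
    using sc(1)[of half half] by (simp add: half sc(3) distrib_right[symmetric])
  have cr: "cring (type_ring :: 'k ring)"
  proof (rule cringI)
    show "abelian_group (type_ring :: 'k ring)"
    proof (rule abelian_groupI)
      fix x :: 'k
      show "\<exists>y\<in>carrier type_ring. y \<oplus>\<^bsub>type_ring\<^esub> x = \<zero>\<^bsub>type_ring\<^esub>"
        by (rule bexI[of _ "- x"]) (simp_all add: type_ring_def)
    qed (simp_all add: type_ring_def add.assoc add.commute)
    show "comm_monoid (type_ring :: 'k ring)"
      by (rule comm_monoidI) (simp_all add: type_ring_def mult.assoc mult.commute)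
  qed (simp add: type_ring_def distrib_right)
  have md: "Module.module type_ring B"
    by (rule moduleI[OF cr abelian])
      (auto simp: type_ring_def carr smult_h K add_h S_mult sc_S S_add sc(1-3) distrib_left distrib_right mult.assoc)
  interpret B: Module.module type_ring B by (rule md)
  show ?thesis
  proof (intro superalgebra.intro md ring superalgebra_axioms.intro, goal_cases)
    case (1 a x y)
    then show ?case by (auto simp: carr smult_h K mult_h S_mult sc_S mult.assoc)
  next
    case (2 a x y)
    have "u * (sc a * v) = sc a * (u * v)" for u v by (metis sc(4) mult.assoc)
    then show ?case using 2 by (auto simp: carr smult_h K mult_h S_mult sc_S)
  next
    case (3 i)
    show ?case unfolding hpart
    proof (rule B.submoduleI)
      fix a assume "a \<in> h ` homog \<alpha> i"
      then show "\<ominus>\<^bsub>B\<^esub> a \<in> h ` homog \<alpha> i" using Hm hS by (auto simp: inv_h)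
    next
      fix a b assume "a \<in> h ` homog \<alpha> i" "b \<in> h ` homog \<alpha> i"
      then show "a \<oplus>\<^bsub>B\<^esub> b \<in> h ` homog \<alpha> i" using Ha hS by (auto simp: add_h)
    next
      fix a x assume "x \<in> h ` homog \<alpha> i"
      then show "a \<odot>\<^bsub>B\<^esub> x \<in> h ` homog \<alpha> i" using Hs hS by (auto simp: smult_h K)
    qed (use hS H0 in \<open>auto simp: carr zero_h\<close>)
  next
    case 4
    show ?case
    proof (intro equalityI subsetI)
      fix x assume "x \<in> carrier B"
      then obtain u where u: "u \<in> S" "x = h u" by (auto simp: carr)
      let ?a = "sc half * (u + \<alpha> u)" and ?b = "sc half * (u - \<alpha> u)"
      have ab: "?a \<in> homog \<alpha> 0" "?b \<in> homog \<alpha> 1"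
        using u by (auto simp: homog_def S_mult sc_S K \<alpha> S_add S_diff \<alpha>d right_diff_distrib add.commute)
      have "?a + ?b = u" using hlf[of u] by (simp add: distrib_left right_diff_distrib)
      then have "x = h ?a \<oplus>\<^bsub>B\<^esub> h ?b" using u ab hS by (simp add: add_h)
      then show "x \<in> hpart B 0 <+>\<^bsub>B\<^esub> hpart B 1" using ab by (auto simp: hpart set_add_def')
    next
      fix x assume "x \<in> hpart B 0 <+>\<^bsub>B\<^esub> hpart B 1"
      then show "x \<in> carrier B" using hS by (auto simp: hpart set_add_def' add_h carr S_add)
    qed
  next
    case 5
    show ?case
    proof (intro equalityI subsetI)
      fix z assume "z \<in> hpart B 0 \<inter> hpart B 1"
      then obtain x y where xy: "x \<in> homog \<alpha> 0" "y \<in> homog \<alpha> 1" "z = h x" "z = h y" by (auto simp: hpart)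
      have S: "x \<in> S" "y \<in> S" using xy hS by auto
      have "h x = h (- y)" using ker[OF S] xy by (simp add: homog_def)
      then have "h x \<oplus>\<^bsub>B\<^esub> h x = h y \<oplus>\<^bsub>B\<^esub> h (- y)" using xy by simp
      then have "h (x + x) = h 0" using S by (simp add: add_h S_uminus)
      then have "half \<odot>\<^bsub>B\<^esub> h (x + x) = half \<odot>\<^bsub>B\<^esub> h 0" by simp
      then have "h x = h 0" using S hlf by (simp add: smult_h K S_add S_0 distrib_left)
      then show "z \<in> {\<zero>\<^bsub>B\<^esub>}" using xy by (simp add: zero_h)
    qed (use H0 in \<open>auto simp: hpart zero_h\<close>)
  next
    case (6 x i y j)
    then obtain u v where uv: "u \<in> homog \<alpha> i" "x = h u" "v \<in> homog \<alpha> j" "y = h v" by (auto simp: hpart)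
    then have "x \<otimes>\<^bsub>B\<^esub> y = h (u * v)" using hS by (simp add: mult_h)
    then show ?case using H[OF uv(1,3)] by (simp add: hpart)
  qed
qed

end

section \<open>The parity involution\<close>

definition sgnb :: "bit \<Rightarrow> 'k::comm_ring_1" where "sgnb i = (if i = 0 then 1 else - 1)"
definition wpar :: "('g \<Rightarrow> bit) \<Rightarrow> 'g word \<Rightarrow> bit" where "wpar par w = sum_list (map par (letters w))"
text \<open>The parity involution of a free superalgebra.\<close>

definition twist :: "('g \<Rightarrow> bit) \<Rightarrow> ('g, 'k::comm_ring_1) free \<Rightarrow> ('g, 'k) free" where
  "twist par = ev (\<lambda>w a. Poly_Mapping.single w (sgnb (wpar par w) * a))"

lemma sgnb_add: "sgnb (a + b) = sgnb a * sgnb b"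
  by (cases a; cases b) (simp_all add: sgnb_def)
lemma wpar_add: "wpar par (v + w) = wpar par v + wpar par w" by (simp add: wpar_def plus_word_def)
lemma wpar_0: "wpar par 0 = 0" by (simp add: wpar_def zero_word_def)

lemma twist_single: "twist par (Poly_Mapping.single w a) = Poly_Mapping.single w (sgnb (wpar par w) * a)"
  unfolding twist_def by (rule ev_single) simp
lemma twist_add: "twist par (u + v) = twist par u + twist par v"
  unfolding twist_def by (rule ev_add) (simp_all add: single_add distrib_left)
lemma twist_0 [simp]: "twist par 0 = 0" by (simp add: twist_def)
lemma twist_mult:
  fixes u v :: "('g, 'k::comm_ring_1) free"
  shows "twist par (u * v) = twist par u * twist par v"
proof (induction u rule: free_induct')
  case (single w a)
  show ?case
  proof (induction v rule: free_induct')
    case (single w' a')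
    have "sgnb (wpar par (w + w')) = (sgnb (wpar par w) * sgnb (wpar par w') :: 'k)" by (simp only: wpar_add sgnb_add)
    then show ?case by (simp add: twist_single mult_single mult_ac)
  qed (simp_all add: twist_add distrib_left)
qed (simp_all add: twist_add distrib_right)
lemma twist_uminus: "twist par (- u) = - twist par u"
  using twist_add[of par u "- u"] by (simp add: eq_neg_iff_add_eq_0 add.commute)
lemma twist_diff: "twist par (u - v) = twist par u - twist par v"
  using twist_add[of par u "- v"] by (simp add: twist_uminus)
lemma sgnb_sq: "sgnb i * sgnb i = 1" "sgnb i * (sgnb i * a) = a" by (simp_all add: sgnb_def)
lemma twist_twist: "twist par (twist par u) = u"
  by (induction u rule: free_induct') (simp_all add: twist_single twist_add sgnb_sq)
lemma twist_scal: "twist par (scal a) = scal a"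
  by (simp add: scal_def twist_single wpar_0 sgnb_def)
lemma twist_1: "twist par 1 = 1"
  using twist_scal[of par 1] by simp
lemma twist_gen: "twist par (gen g) = scal (sgnb (par g)) * gen g"
  by (simp add: gen_def twist_single scal_single wpar_def)
lemma lookup_twist: "Poly_Mapping.lookup (twist par u) w = sgnb (wpar par w) * Poly_Mapping.lookup u w"
  by (induction u rule: free_induct') (auto simp: twist_single twist_add lookup_single when_def lookup_add distrib_left)
lemma twist_FC: "u \<in> FC G \<Longrightarrow> twist par u \<in> FC G"
  by (induction rule: FC_induct) (simp_all add: twist_single twist_add FC_single FC_add)

lemma homogeneous_iff:
  fixes u :: "('g, 'k::comm_ring_1) free"
  assumes half: "half + half = (1 :: 'k)"
  shows "twist par u = (if i = 0 then u else - u) \<longleftrightarrow> (\<forall>w\<in>Poly_Mapping.keys u. wpar par w = i)"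
proof -
  have h: "a = 0" if "a = - a" for a :: 'k
  proof -
    have "a = (half + half) * a" by (simp add: half)
    also have "\<dots> = half * (a + a)" by (simp add: algebra_simps)
    also have "a + a = 0" by (subst that) simp
    finally show ?thesis by simp
  qed
  have 1: "sgnb j * a = (if i = 0 then a else - a) \<longleftrightarrow> a = 0 \<or> j = i" for j and a :: 'k
    using h[of a] h[of "- a"] by (cases i; cases j) (auto simp: sgnb_def)
  have "twist par u = (if i = 0 then u else - u) \<longleftrightarrow>
    (\<forall>w. sgnb (wpar par w) * Poly_Mapping.lookup u w = (if i = 0 then Poly_Mapping.lookup u w else - Poly_Mapping.lookup u w))"
    by (auto simp: poly_mapping_eq_iff fun_eq_iff lookup_twist)
  then show ?thesis unfolding 1 by (auto simp: in_keys_iff)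
qed

lemma typed_free: "typed_image (FC G) UNIV scal id (free_superalgebra G par)"
  by unfold_locales (auto simp: FC_add FC_mult FC_uminus free_superalgebra_def FC_def[symmetric])

context fixes G :: "'g set" and par :: "'g \<Rightarrow> bit" and rel :: "('g, 'k::comm_ring_1) free \<Rightarrow> ('g, 'k) free \<Rightarrow> bool"
  assumes rel_FC: "\<And>u v. rel u v \<Longrightarrow> u \<in> FC G \<and> v \<in> FC G"
begin

interpretation F: typed_image "FC G" UNIV scal id "free_superalgebra G par :: ('k, ('g, 'k) free) superalgebra"
  by (rule typed_free)

lemma relation_carrier: "{x - y |x y. rel x y} \<subseteq> carrier (free_superalgebra G par :: ('k, ('g, 'k) free) superalgebra)"
  using rel_FC by (auto simp: F.carr intro!: FC_diff)

lemma relation_ideal: "ideal (relation_ideal G par rel) (free_superalgebra G par :: ('k, ('g, 'k) free) superalgebra)"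
  unfolding relation_ideal_def by (rule ring.genideal_ideal[OF F.ring relation_carrier])

lemma relation_in_ideal: "rel u v \<Longrightarrow> u - v \<in> relation_ideal G par rel"
  using ring.genideal_self[OF F.ring relation_carrier] unfolding relation_ideal_def by blast

lemma relation_ideal_minimal: assumes "F.tideal J" "\<And>u v. rel u v \<Longrightarrow> u - v \<in> J"
  shows "relation_ideal G par rel \<subseteq> J"
  unfolding relation_ideal_def using F.ideal_image[OF assms(1)] assms(2)
  by (intro ring.genideal_minimal[OF F.ring]) auto

lemma relation_tideal: "F.tideal (relation_ideal G par rel)"
proof -
  let ?I = "relation_ideal G par rel" and ?F = "free_superalgebra G par :: ('k, ('g, 'k) free) superalgebra"
  interpret I: ideal ?I ?F by (rule relation_ideal)
  have ops: "x \<otimes>\<^bsub>?F\<^esub> y = x * y" "x \<oplus>\<^bsub>?F\<^esub> y = x + y" "\<zero>\<^bsub>?F\<^esub> = 0" for x y by (simp_all add: free_superalgebra_def)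
  have sub: "?I \<subseteq> FC G" using I.a_subset by (simp add: F.carr)
  show ?thesis unfolding F.tideal_def
  proof (intro conjI ballI)
    fix x assume x: "x \<in> ?I"
    have "- 1 \<in> FC G" by (simp add: FC_uminus)
    then show "- x \<in> ?I" using I.I_l_closed[OF x, of "- 1"] by (simp add: ops F.carr)
  next
    show "0 \<in> ?I" using additive_subgroup.zero_closed[OF ideal.axioms(1)[OF relation_ideal]] by (simp add: ops)
  next
    fix x y assume "x \<in> ?I" "y \<in> ?I"
    then show "x + y \<in> ?I" using additive_subgroup.a_closed[OF ideal.axioms(1)[OF relation_ideal], of x y] by (simp add: ops)
  next
    fix x y :: "('g, 'k) free" assume "x \<in> FC G" "y \<in> ?I"
    then show "x * y \<in> ?I" "y * x \<in> ?I" using I.I_l_closed[of y x] I.I_r_closed[of y x] by (simp_all add: ops F.carr)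
  qed (rule sub)
qed

lemma presented: "typed_image (FC G) UNIV scal (\<lambda>p. relation_ideal G par rel +>\<^bsub>(free_superalgebra G par :: ('k, ('g, 'k) free) superalgebra)\<^esub> p)
    (presented_superalgebra G par rel)"
  using F.quot[OF relation_tideal] by (simp add: presented_superalgebra_def)

lemma presented_eq: "u \<in> FC G \<Longrightarrow> v \<in> FC G \<Longrightarrow>
   relation_ideal G par rel +>\<^bsub>(free_superalgebra G par :: ('k, ('g, 'k) free) superalgebra)\<^esub> u =
   relation_ideal G par rel +>\<^bsub>(free_superalgebra G par :: ('k, ('g, 'k) free) superalgebra)\<^esub> v \<longleftrightarrow> u - v \<in> relation_ideal G par rel"
  using F.coset_eq[OF relation_ideal, of u v] by simp

lemma presented_hpart: assumes half: "half + half = (1 :: 'k)"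
  shows "hpart (presented_superalgebra G par rel) i =
    (\<lambda>p. relation_ideal G par rel +>\<^bsub>(free_superalgebra G par :: ('k, ('g, 'k) free) superalgebra)\<^esub> p) ` F.homog (twist par) i"
proof -
  have "hpart (free_superalgebra G par :: ('k, ('g, 'k) free) superalgebra) i = F.homog (twist par) i"
    unfolding F.homog_def homogeneous_iff[OF half]
    by (auto simp: free_superalgebra_def FC_def wpar_def)
  then show ?thesis by (simp add: presented_superalgebra_def F.hpart_quot)
qed

text \<open>The preimage of the relation ideal under the parity involution is an ideal that contains all relations, since these are homogeneous.\<close>

lemma twist_ideal:
  assumes hom: "\<And>u v. rel u v \<Longrightarrow> \<exists>i. twist par u = scal (sgnb i) * u \<and> twist par v = scal (sgnb i) * v"
    and x: "x \<in> relation_ideal G par rel"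
  shows "twist par x \<in> relation_ideal G par rel"
proof -
  let ?I = "relation_ideal G par rel"
  have I: "?I \<subseteq> FC G" "0 \<in> ?I" "\<And>x y. x \<in> ?I \<Longrightarrow> y \<in> ?I \<Longrightarrow> x + y \<in> ?I" "\<And>x. x \<in> ?I \<Longrightarrow> - x \<in> ?I"
    "\<And>x y. x \<in> FC G \<Longrightarrow> y \<in> ?I \<Longrightarrow> x * y \<in> ?I" "\<And>x y. x \<in> FC G \<Longrightarrow> y \<in> ?I \<Longrightarrow> y * x \<in> ?I"
    using relation_tideal unfolding F.tideal_def by auto
  have "?I \<subseteq> {x \<in> FC G. twist par x \<in> ?I}"
  proof (rule relation_ideal_minimal)
    fix u v assume r: "rel u v"
    then obtain i where "twist par u = scal (sgnb i) * u" "twist par v = scal (sgnb i) * v" using hom by blast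
    then have "twist par (u - v) = scal (sgnb i) * (u - v)" by (simp add: twist_diff right_diff_distrib)
    then show "u - v \<in> {x \<in> FC G. twist par x \<in> ?I}"
      using I(5)[OF FC_scal relation_in_ideal[OF r], of "sgnb i"] rel_FC[OF r] by (simp add: FC_diff)
  qed (auto simp: F.tideal_def FC_add FC_uminus FC_mult twist_add twist_uminus twist_mult twist_FC intro: I)
  then show ?thesis using x by blast
qed

end

section \<open>The local ring at q = 1 and integral elements\<close>

text \<open>Powers of \<open>q\<close> are units at \<open>q = 1\<close>, so Laurent polynomials can be replaced by polynomials, and being divisible by \<open>q - 1\<close> means vanishing at 1.\<close>

lemma local_ring_iff: "x \<in> local_ring \<longleftrightarrow> (\<exists>f g. poly g 1 \<noteq> 0 \<and> x = to_fract f / to_fract g)"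
proof
  have q: "qq \<noteq> 0" by (simp add: qq_def)
  have qp: "qq ^ m = to_fract ([:0, 1:] ^ m)" for m
    unfolding qq_def by (induction m) (simp_all only: power_0 power_Suc to_fract_1 to_fract_mult)
  have q1: "qq - 1 = to_fract [:- 1, 1:]"
  proof -
    have "[:- 1, 1:] = [:0, 1:] - (1 :: complex poly)" by (simp add: one_pCons)
    then show ?thesis by (simp only: to_fract_diff to_fract_1 qq_def)
  qed
  {
    assume "x \<in> local_ring"
    then obtain f g where fg: "f \<in> laurent" "g \<in> laurent" "g \<notin> {(qq - 1) * h |h. h \<in> laurent}" "x = f / g"
      unfolding local_ring_def by blast
    then obtain f' m g' k where f: "f = to_fract f' / qq ^ m" and g: "g = to_fract g' / qq ^ k"
      unfolding laurent_def by blast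
    have "poly g' 1 \<noteq> 0"
    proof
      assume "poly g' 1 = 0"
      then have "[:- 1, 1:] dvd g'" by (simp add: poly_eq_0_iff_dvd)
      then obtain h where "g' = [:- 1, 1:] * h" unfolding dvd_def by blast
      then have "g = (qq - 1) * (to_fract h / qq ^ k)" by (simp only: g q1 to_fract_mult) simp
      moreover have "to_fract h / qq ^ k \<in> laurent" unfolding laurent_def by blast
      ultimately show False using fg(3) by blast
    qed
    then have "poly ([:0, 1:] ^ m * g') 1 \<noteq> 0" by simp
    moreover have "x = to_fract (f' * [:0, 1:] ^ k) / to_fract ([:0, 1:] ^ m * g')"
      unfolding fg(4) f g to_fract_mult qp[symmetric] using q by simp
    ultimately show "\<exists>f g. poly g 1 \<noteq> 0 \<and> x = to_fract f / to_fract g" by blast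
  }
  {
    assume "\<exists>f g. poly g 1 \<noteq> 0 \<and> x = to_fract f / to_fract g"
    then obtain f g where fg: "poly g 1 \<noteq> 0" "x = to_fract f / to_fract g" by blast
    have l: "to_fract f \<in> laurent" for f
    proof -
      have "to_fract f = to_fract f / qq ^ 0" by simp
      then show ?thesis unfolding laurent_def by blast
    qed
    have "to_fract g \<noteq> (qq - 1) * h" if hl: "h \<in> laurent" for h
    proof
      assume e: "to_fract g = (qq - 1) * h"
      obtain h' k where h: "h = to_fract h' / qq ^ k" using hl unfolding laurent_def by blast
      have "to_fract (g * [:0, 1:] ^ k) = to_fract ([:- 1, 1:] * h')"
        unfolding to_fract_mult e h qp[symmetric] q1[symmetric] using q by simp
      then have "g * [:0, 1:] ^ k = [:- 1, 1:] * h'" by (simp only: to_fract_eq_iff)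
      then have "poly (g * [:0, 1:] ^ k) 1 = poly ([:- 1, 1:] * h') 1" by simp
      then show False using fg by simp
    qed
    then show "x \<in> local_ring" unfolding local_ring_def fg(2) using l by blast
  }
qed

lemma local_ring_to_fract: "to_fract f \<in> local_ring"
  unfolding local_ring_iff by (rule exI[of _ f], rule exI[of _ 1]) simp

lemma local_ring_add: assumes "x \<in> local_ring" "y \<in> local_ring" shows "x + y \<in> local_ring"
proof -
  obtain f g f' g' where 1: "poly g 1 \<noteq> 0" "x = to_fract f / to_fract g" "poly g' 1 \<noteq> 0" "y = to_fract f' / to_fract g'"
    using assms unfolding local_ring_iff by blast
  then have "g \<noteq> 0" "g' \<noteq> 0" by auto
  then have "x + y = to_fract (f * g' + f' * g) / to_fract (g * g')"
    by (simp add: 1 to_fract_add to_fract_mult field_simps)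
  moreover have "poly (g * g') 1 \<noteq> 0" using 1 by simp
  ultimately show ?thesis unfolding local_ring_iff by blast
qed

lemma local_ring_mult: assumes "x \<in> local_ring" "y \<in> local_ring" shows "x * y \<in> local_ring"
proof -
  obtain f g f' g' where 1: "poly g 1 \<noteq> 0" "x = to_fract f / to_fract g" "poly g' 1 \<noteq> 0" "y = to_fract f' / to_fract g'"
    using assms unfolding local_ring_iff by blast
  then have "x * y = to_fract (f * f') / to_fract (g * g')" by (simp add: to_fract_mult)
  moreover have "poly (g * g') 1 \<noteq> 0" using 1 by simp
  ultimately show ?thesis unfolding local_ring_iff by blast
qed

lemma local_ring_const: "const_ratfun a \<in> local_ring" by (simp add: const_ratfun_def local_ring_to_fract)
lemma local_ring_0: "0 \<in> local_ring" and local_ring_1: "1 \<in> local_ring"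
  using local_ring_to_fract[of 0] local_ring_to_fract[of 1] by simp_all
lemma local_ring_uminus: "x \<in> local_ring \<Longrightarrow> - x \<in> local_ring"
  using local_ring_mult[OF local_ring_const[of "- 1"], of x] by (simp add: cst.g_uminus cst.g_1)
lemma qq_to_fract: "qq - 1 = to_fract ([:0, 1:] - 1)"
  by (simp only: qq_def to_fract_diff to_fract_1)
lemma local_ring_q: "qq - 1 \<in> local_ring" "1 + inverse qq \<in> local_ring"
proof -
  show "qq - 1 \<in> local_ring" unfolding qq_to_fract by (rule local_ring_to_fract)
  have "inverse qq \<in> local_ring" unfolding local_ring_iff qq_def
    by (rule exI[of _ 1], rule exI[of _ "[:0, 1:]"]) (simp add: divide_inverse)
  then show "1 + inverse qq \<in> local_ring" by (rule local_ring_add[OF local_ring_1])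
qed

text \<open>The residue field at \<open>q = 1\<close> is the field of constants.\<close>

lemma local_ring_residue: assumes "x \<in> local_ring"
  obtains c y where "y \<in> local_ring" "x = const_ratfun c + (qq - 1) * y"
proof -
  obtain f g where fg: "poly g 1 \<noteq> 0" "x = to_fract f / to_fract g" using assms unfolding local_ring_iff by blast
  define c where "c = poly f 1 / poly g 1"
  have "poly (f - [:c:] * g) 1 = 0" using fg by (simp add: c_def)
  then have "[:- 1, 1:] dvd f - [:c:] * g" by (simp only: poly_eq_0_iff_dvd)
  moreover have "[:- 1, 1:] = [:0, 1:] - (1 :: complex poly)" by (simp add: one_pCons)
  ultimately obtain h where h: "f - [:c:] * g = ([:0, 1:] - 1) * h" unfolding dvd_def by metis
  have "f = [:c:] * g + ([:0, 1:] - 1) * h" using h by (simp only: diff_eq_eq add.commute)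
  then have "to_fract f = const_ratfun c * to_fract g + (qq - 1) * to_fract h"
    unfolding const_ratfun_def qq_to_fract by (simp only: to_fract_add to_fract_mult)
  moreover have "to_fract g \<noteq> 0" using fg by auto
  ultimately have "x = const_ratfun c + (qq - 1) * (to_fract h / to_fract g)" by (simp add: fg(2) field_simps)
  moreover have "to_fract h / to_fract g \<in> local_ring" using fg(1) unfolding local_ring_iff by blast
  ultimately show ?thesis using that by blast
qed

lemma local_ring_denominator: "x \<in> local_ring \<Longrightarrow> \<exists>d a. poly d 1 \<noteq> 0 \<and> to_fract d * x = to_fract a"
proof -
  assume "x \<in> local_ring"
  then obtain f g where fg: "poly g 1 \<noteq> 0" "x = to_fract f / to_fract g" unfolding local_ring_iff by blast
  then have "to_fract g * x = to_fract f" by auto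
  then show ?thesis using fg(1) by blast
qed

text \<open>The elements of the free algebra with coefficients in the local ring; they represent the integral form.\<close>

definition FR :: "'g set \<Rightarrow> ('g, ratfun) free set" where
  "FR G = {u \<in> FC G. \<forall>w. Poly_Mapping.lookup u w \<in> local_ring}"

lemma FR_FC: "u \<in> FR G \<Longrightarrow> u \<in> FC G" by (simp add: FR_def)
lemma FR_add: "u \<in> FR G \<Longrightarrow> v \<in> FR G \<Longrightarrow> u + v \<in> FR G"
  by (simp add: FR_def FC_add lookup_add local_ring_add)
lemma FR_0: "0 \<in> FR G" by (simp add: FR_def local_ring_0)
lemma FR_single: "set (letters w) \<subseteq> G \<Longrightarrow> a \<in> local_ring \<Longrightarrow> Poly_Mapping.single w a \<in> FR G"
  by (simp add: FR_def FC_single lookup_single when_def local_ring_0)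

lemma FR_induct [consumes 1, case_names zero single add]:
  assumes u: "u \<in> FR G" and "Q 0" "\<And>w a. set (letters w) \<subseteq> G \<Longrightarrow> a \<in> local_ring \<Longrightarrow> Q (Poly_Mapping.single w a)"
    "\<And>u v. u \<in> FR G \<Longrightarrow> v \<in> FR G \<Longrightarrow> Q u \<Longrightarrow> Q v \<Longrightarrow> Q (u + v)"
  shows "Q u"
proof -
  let ?f = "\<lambda>w. Poly_Mapping.single w (Poly_Mapping.lookup u w)"
  have "Q (sum ?f T) \<and> sum ?f T \<in> FR G" if "finite T" "T \<subseteq> Poly_Mapping.keys u" for T
    using that
  proof (induction T rule: finite_induct)
    case (insert w T)
    have "set (letters w) \<subseteq> G" "Poly_Mapping.lookup u w \<in> local_ring" using insert.prems u by (auto simp: FR_def FC_def)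
    then have "?f w \<in> FR G" "Q (?f w)" by (simp_all add: FR_single assms(3))
    moreover have "Q (sum ?f T)" "sum ?f T \<in> FR G" using insert by auto
    ultimately have "Q (?f w + sum ?f T)" "?f w + sum ?f T \<in> FR G" by (simp_all add: assms(4) FR_add)
    then show ?case using insert.hyps by simp
  qed (use assms(2) FR_0 in simp)
  from this[of "Poly_Mapping.keys u"] show ?thesis using poly_mapping_as_sum[of u] by simp
qed

lemma FR_mult: "u \<in> FR G \<Longrightarrow> v \<in> FR G \<Longrightarrow> u * v \<in> FR G"
proof (induction u rule: FR_induct)
  case (single w a)
  note w = single(1,2)
  show ?case using single(3)
  proof (induction v rule: FR_induct)
    case (single w' a')
    then show ?case using w by (simp add: mult_single FR_single plus_word_def local_ring_mult)
  qed (simp_all add: FR_0 distrib_left FR_add)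
qed (simp_all add: FR_0 distrib_right FR_add)

lemma FR_scal: "a \<in> local_ring \<Longrightarrow> scal a \<in> FR G"
  unfolding scal_def by (rule FR_single) (simp_all add: zero_word_def)
lemma FR_1: "1 \<in> FR G" using FR_scal[OF local_ring_1] by simp
lemma FR_uminus: "u \<in> FR G \<Longrightarrow> - u \<in> FR G"
  using FR_mult[OF FR_scal[OF local_ring_uminus[OF local_ring_1]], of u G] by (simp add: scal_uminus)
lemma FR_diff: "u \<in> FR G \<Longrightarrow> v \<in> FR G \<Longrightarrow> u - v \<in> FR G"
  using FR_add[OF _ FR_uminus, of u G v] by simp
lemma FR_gen: "g \<in> G \<Longrightarrow> gen g \<in> FR G"
  unfolding gen_def by (rule FR_single) (simp_all add: local_ring_1)
lemma FR_twist: "u \<in> FR G \<Longrightarrow> twist par u \<in> FR G"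
proof -
  assume u: "u \<in> FR G"
  have "sgnb i * a \<in> local_ring" if "a \<in> local_ring" for a i
    using local_ring_uminus that by (simp add: sgnb_def)
  then show ?thesis using u by (simp add: FR_def twist_FC lookup_twist)
qed

lemmas FR_intros = FR_mult FR_scal FR_1 FR_uminus FR_diff FR_gen FR_0 FR_add

lemma FC_tg_inv: "Tgen i \<in> G \<Longrightarrow> tg_inv i \<in> FC G" by (simp add: tg_inv_def FC_diff FC_gen)

lemma qbc_rel_FC: "qbc_rel r s u v \<Longrightarrow> u \<in> FC (qbc_gens r s) \<and> v \<in> FC (qbc_gens r s)"
  by (induction rule: qbc_rel.induct) (simp_all add: FC_mult FC_diff FC_gen FC_uminus FC_tg_inv)

lemma bc_rel_FC: "bc_rel r s u v \<Longrightarrow> u \<in> FC (bc_gens r s) \<and> v \<in> FC (bc_gens r s)"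
  by (induction rule: bc_rel.induct) (simp_all add: FC_mult FC_diff FC_gen FC_uminus bc_gens_iff)

lemma twist_tg_inv: "twist qbc_par (tg_inv i) = tg_inv i"
  by (simp add: tg_inv_def twist_diff twist_gen twist_scal sgnb_def)

lemma scal_minus_1: "scal (- 1) = (- 1 :: ('g, 'k::comm_ring_1) free)" by (simp add: scal_uminus)

lemma qbc_rel_homogeneous:
  "qbc_rel r s u v \<Longrightarrow> \<exists>i. twist qbc_par u = scal (sgnb i) * u \<and> twist qbc_par v = scal (sgnb i) * v"
proof -
  have "qbc_rel r s u v \<Longrightarrow> (twist qbc_par u = u \<and> twist qbc_par v = v) \<or> (twist qbc_par u = - u \<and> twist qbc_par v = - v)"
    by (induction rule: qbc_rel.induct)
      (simp_all add: twist_mult twist_gen twist_scal twist_diff twist_uminus twist_1 twist_tg_inv sgnb_def scal_minus_1)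
  moreover assume "qbc_rel r s u v"
  ultimately consider "twist qbc_par u = u \<and> twist qbc_par v = v" | "twist qbc_par u = - u \<and> twist qbc_par v = - v" by blast
  then show ?thesis
    by cases (rule exI[of _ 0], simp add: sgnb_def, rule exI[of _ 1], simp add: sgnb_def scal_minus_1)
qed

lemma bc_rel_homogeneous:
  "bc_rel r s u v \<Longrightarrow> \<exists>i. twist bc_par u = scal (sgnb i) * u \<and> twist bc_par v = scal (sgnb i) * v"
proof -
  have "bc_rel r s u v \<Longrightarrow> (twist bc_par u = u \<and> twist bc_par v = v) \<or> (twist bc_par u = - u \<and> twist bc_par v = - v)"
    by (induction rule: bc_rel.induct)
      (simp_all add: twist_mult twist_gen twist_scal twist_diff twist_uminus twist_1 sgnb_def scal_minus_1)
  moreover assume "bc_rel r s u v"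
  ultimately consider "twist bc_par u = u \<and> twist bc_par v = v" | "twist bc_par u = - u \<and> twist bc_par v = - v" by blast
  then show ?thesis
    by cases (rule exI[of _ 0], simp add: sgnb_def, rule exI[of _ 1], simp add: sgnb_def scal_minus_1)
qed

section \<open>Congruence modulo q - 1\<close>

context fixes r s :: nat begin

abbreviation (input) "QG \<equiv> qbc_gens r s"
abbreviation (input) "BG \<equiv> bc_gens r s"
abbreviation (input) "QF \<equiv> free_superalgebra QG qbc_par :: (ratfun, (qbc_gen, ratfun) free) superalgebra"
abbreviation (input) "Iq \<equiv> relation_ideal QG qbc_par (qbc_rel r s)"
abbreviation (input) "Ib \<equiv> relation_ideal BG bc_par (bc_rel r s)"

interpretation QFi: typed_image "FC QG" UNIV scal id QF by (rule typed_free)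
interpretation BFi: typed_image "FC BG" UNIV scal id "free_superalgebra BG bc_par :: (complex, (bc_gen, complex) free) superalgebra"
  by (rule typed_free)

lemma Iq_props: "Iq \<subseteq> FC QG" "0 \<in> Iq" "x \<in> Iq \<Longrightarrow> y \<in> Iq \<Longrightarrow> x + y \<in> Iq" "x \<in> Iq \<Longrightarrow> - x \<in> Iq"
    "z \<in> FC QG \<Longrightarrow> y \<in> Iq \<Longrightarrow> z * y \<in> Iq" "z \<in> FC QG \<Longrightarrow> y \<in> Iq \<Longrightarrow> y * z \<in> Iq"
proof -
  have "QFi.tideal Iq" by (rule relation_tideal) (erule qbc_rel_FC)
  then show "Iq \<subseteq> FC QG" "0 \<in> Iq" "x \<in> Iq \<Longrightarrow> y \<in> Iq \<Longrightarrow> x + y \<in> Iq" "x \<in> Iq \<Longrightarrow> - x \<in> Iq"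
    "z \<in> FC QG \<Longrightarrow> y \<in> Iq \<Longrightarrow> z * y \<in> Iq" "z \<in> FC QG \<Longrightarrow> y \<in> Iq \<Longrightarrow> y * z \<in> Iq"
    unfolding QFi.tideal_def by auto
qed

lemma qbc_in_ideal: "qbc_rel r s u v \<Longrightarrow> u - v \<in> Iq"
  by (rule relation_in_ideal) (erule qbc_rel_FC)

lemma Ib_props: "Ib \<subseteq> FC BG" "0 \<in> Ib" "x \<in> Ib \<Longrightarrow> y \<in> Ib \<Longrightarrow> x + y \<in> Ib" "x \<in> Ib \<Longrightarrow> - x \<in> Ib"
    "z \<in> FC BG \<Longrightarrow> y \<in> Ib \<Longrightarrow> z * y \<in> Ib" "z \<in> FC BG \<Longrightarrow> y \<in> Ib \<Longrightarrow> y * z \<in> Ib"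
proof -
  have "BFi.tideal Ib" by (rule relation_tideal) (erule bc_rel_FC)
  then show "Ib \<subseteq> FC BG" "0 \<in> Ib" "x \<in> Ib \<Longrightarrow> y \<in> Ib \<Longrightarrow> x + y \<in> Ib" "x \<in> Ib \<Longrightarrow> - x \<in> Ib"
    "z \<in> FC BG \<Longrightarrow> y \<in> Ib \<Longrightarrow> z * y \<in> Ib" "z \<in> FC BG \<Longrightarrow> y \<in> Ib \<Longrightarrow> y * z \<in> Ib"
    unfolding BFi.tideal_def by auto
qed

lemma bc_in_ideal: "bc_rel r s u v \<Longrightarrow> u - v \<in> Ib"
  by (rule relation_in_ideal) (erule bc_rel_FC)

text \<open>Equality in the limit, expressed for representatives: congruence modulo the relations and \<open>q - 1\<close> times integral elements.\<close>

definition lq :: "(qbc_gen, ratfun) free \<Rightarrow> (qbc_gen, ratfun) free \<Rightarrow> bool" where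
  "lq u v \<longleftrightarrow> u \<in> FR QG \<and> v \<in> FR QG \<and> (\<exists>y\<in>FR QG. u - v - scal (qq - 1) * y \<in> Iq)"

lemma lq_FR: "lq u v \<Longrightarrow> u \<in> FR QG" "lq u v \<Longrightarrow> v \<in> FR QG" by (simp_all add: lq_def)

lemma lq_Iq: "u \<in> FR QG \<Longrightarrow> v \<in> FR QG \<Longrightarrow> u - v \<in> Iq \<Longrightarrow> lq u v"
  unfolding lq_def by (intro conjI bexI[of _ 0]) (simp_all add: FR_0)

lemma lq_refl: "u \<in> FR QG \<Longrightarrow> lq u u" by (rule lq_Iq) (simp_all add: Iq_props)

lemma lq_rel: "qbc_rel r s u v \<Longrightarrow> u \<in> FR QG \<Longrightarrow> v \<in> FR QG \<Longrightarrow> lq u v"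
  by (rule lq_Iq) (simp_all add: qbc_in_ideal)

lemma lq_shift: "u \<in> FR QG \<Longrightarrow> y \<in> FR QG \<Longrightarrow> lq (u + scal (qq - 1) * y) u"
  unfolding lq_def by (intro conjI bexI[of _ y]) (simp_all add: FR_intros local_ring_q Iq_props)

lemma lq_sym: assumes "lq u v" shows "lq v u"
proof -
  obtain y where y: "y \<in> FR QG" "u - v - scal (qq - 1) * y \<in> Iq" using assms by (auto simp: lq_def)
  have eq: "- (u - v - scal (qq - 1) * y) = v - u - scal (qq - 1) * (- y)" by (simp add: algebra_simps)
  then have "v - u - scal (qq - 1) * (- y) \<in> Iq" using Iq_props(4)[OF y(2)] by (simp only: eq)
  then show ?thesis using assms FR_uminus[OF y(1)] unfolding lq_def by blast
qed

lemma lq_trans: assumes "lq u v" "lq v w" shows "lq u w"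
proof -
  obtain y where y: "y \<in> FR QG" "u - v - scal (qq - 1) * y \<in> Iq" using assms by (auto simp: lq_def)
  obtain z where z: "z \<in> FR QG" "v - w - scal (qq - 1) * z \<in> Iq" using assms by (auto simp: lq_def)
  have eq: "(u - v - scal (qq - 1) * y) + (v - w - scal (qq - 1) * z) = u - w - scal (qq - 1) * (y + z)"
    by (simp add: algebra_simps)
  then have "u - w - scal (qq - 1) * (y + z) \<in> Iq" using Iq_props(3)[OF y(2) z(2)] by (simp only: eq)
  then show ?thesis using assms FR_add[OF y(1) z(1)] unfolding lq_def by blast
qed

lemma lq_add: assumes "lq u v" "lq u' v'" shows "lq (u + u') (v + v')"
proof -
  obtain y where y: "y \<in> FR QG" "u - v - scal (qq - 1) * y \<in> Iq" using assms by (auto simp: lq_def)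
  obtain z where z: "z \<in> FR QG" "u' - v' - scal (qq - 1) * z \<in> Iq" using assms by (auto simp: lq_def)
  have eq: "(u - v - scal (qq - 1) * y) + (u' - v' - scal (qq - 1) * z) = (u + u') - (v + v') - scal (qq - 1) * (y + z)"
    by (simp add: algebra_simps)
  then have "(u + u') - (v + v') - scal (qq - 1) * (y + z) \<in> Iq" using Iq_props(3)[OF y(2) z(2)] by (simp only: eq)
  then show ?thesis using assms FR_add unfolding lq_def by (auto intro!: bexI[of _ "y + z"] FR_add y(1) z(1))
qed

lemma lq_left: assumes "lq u v" "w \<in> FR QG" shows "lq (w * u) (w * v)"
proof -
  obtain y where y: "y \<in> FR QG" "u - v - scal (qq - 1) * y \<in> Iq" using assms by (auto simp: lq_def)
  have "w * (scal (qq - 1) * y) = (w * scal (qq - 1)) * y" by (simp only: mult.assoc)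
  also have "\<dots> = (scal (qq - 1) * w) * y" by (simp only: scal_central[of "qq - 1" w])
  finally have "w * (scal (qq - 1) * y) = scal (qq - 1) * (w * y)" by (simp only: mult.assoc)
  then have "w * (u - v - scal (qq - 1) * y) = w * u - w * v - scal (qq - 1) * (w * y)"
    by (simp add: right_diff_distrib)
  then have "w * u - w * v - scal (qq - 1) * (w * y) \<in> Iq" using Iq_props(5)[OF FR_FC[OF assms(2)] y(2)] by simp
  then show ?thesis using assms FR_mult[OF assms(2)] y(1) unfolding lq_def by blast
qed

lemma lq_right: assumes "lq u v" "w \<in> FR QG" shows "lq (u * w) (v * w)"
proof -
  obtain y where y: "y \<in> FR QG" "u - v - scal (qq - 1) * y \<in> Iq" using assms by (auto simp: lq_def)
  have "(u - v - scal (qq - 1) * y) * w = u * w - v * w - scal (qq - 1) * (y * w)"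
    by (simp add: left_diff_distrib mult.assoc)
  then have "u * w - v * w - scal (qq - 1) * (y * w) \<in> Iq" using Iq_props(6)[OF FR_FC[OF assms(2)] y(2)] by simp
  then show ?thesis using assms FR_mult[OF _ assms(2)] y(1) unfolding lq_def by blast
qed

lemma lq_mult: "lq u v \<Longrightarrow> lq u' v' \<Longrightarrow> lq (u * u') (v * v')"
  by (rule lq_trans[OF lq_right lq_left]) (auto simp: lq_FR)

lemma lq_twist: assumes "lq u v" shows "lq (twist qbc_par u) (twist qbc_par v)"
proof -
  obtain y where y: "y \<in> FR QG" "u - v - scal (qq - 1) * y \<in> Iq" using assms by (auto simp: lq_def)
  have "twist qbc_par (u - v - scal (qq - 1) * y) \<in> Iq"
    by (rule twist_ideal[OF _ _ y(2)]) (erule qbc_rel_FC, erule qbc_rel_homogeneous)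
  then show ?thesis using assms FR_twist[OF y(1)] unfolding lq_def
    by (auto simp: twist_diff twist_mult twist_scal intro: FR_twist)
qed

text \<open>This is why the quadratic relation becomes \<open>t\<^sub>i\<^sup>2 = 1\<close>: the coefficient of the linear term is divisible by \<open>q - 1\<close> in the local ring.\<close>

lemma xi_factor: "qq - inverse qq = (qq - 1) * (1 + inverse qq)"
  by (simp add: qq_def algebra_simps)

lemma lq_tg_inv: "Tgen i \<in> QG \<Longrightarrow> lq (tg_inv i) (tg i)"
  using lq_shift[of "tg i" "- scal (1 + inverse qq)"]
  by (simp add: tg_inv_def xi_factor scal_mult FR_intros local_ring_q)

lemma lq_quad: assumes "x * x - scal (qq - inverse qq) * x - 1 \<in> Iq" "x \<in> FR QG" shows "lq (x * x) 1"
  unfolding lq_def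
proof (intro conjI bexI[of _ "scal (1 + inverse qq) * x"])
  show "x * x - 1 - scal (qq - 1) * (scal (1 + inverse qq) * x) \<in> Iq"
  proof -
    have e: "scal (qq - 1) * (scal (1 + inverse qq) * x) = scal (qq - inverse qq) * x"
      by (simp only: xi_factor scal_mult mult.assoc)
    have "x * x - 1 - a = x * x - a - 1" for a by simp
    then show ?thesis using assms(1) by (simp only: e)
  qed
qed (simp_all add: assms FR_intros local_ring_q)

lemma lq_t_sq: "Tgen i \<in> QG \<Longrightarrow> lq (tg i * tg i) 1"
  using qbc_in_ideal[OF qbc_rel.t_quad[of i r s]] by (intro lq_quad) (simp_all add: FR_gen)
lemma lq_ts_sq: "Tsgen i \<in> QG \<Longrightarrow> lq (tsg i * tsg i) 1"
  using qbc_in_ideal[OF qbc_rel.ts_quad[of i r s]] by (intro lq_quad) (simp_all add: FR_gen)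

definition tr :: "bc_gen \<Rightarrow> qbc_gen" where
  "tr g = (case g of Sgen i \<Rightarrow> if i < r then Tgen i else Tsgen (i - r) | Egen \<Rightarrow> Qegen
     | Cgen i \<Rightarrow> if i \<le> r then Qcgen i else Qcsgen (i - r))"

lemma tr_simps: "tr (Sgen i) = (if i < r then Tgen i else Tsgen (i - r))" "tr Egen = Qegen"
  "tr (Cgen i) = (if i \<le> r then Qcgen i else Qcsgen (i - r))"
  by (simp_all add: tr_def)

lemma tr_gens: "g \<in> BG \<Longrightarrow> tr g \<in> QG"
  by (cases g) (auto simp: tr_simps bc_gens_iff qbc_gens_iff)

abbreviation "sub \<equiv> free_map tr const_ratfun"

lemmas sub_simps = cst.free_map_add cst.free_map_mult cst.free_map_diff cst.free_map_uminus tr_simps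

lemma sub_FR: "u \<in> FC BG \<Longrightarrow> sub u \<in> FR QG"
proof (induction rule: FC_induct)
  case (single w a)
  then have "tr ` set (letters w) \<subseteq> QG" using tr_gens by blast
  then show ?case by (simp add: cst.free_map_single FR_single local_ring_const)
qed (simp_all add: cst.free_map_add FR_0 FR_add)

text \<open>Most relations are literal copies of quantum relations, some of them read backwards. The exceptions are those for squares of \<open>s\<^sub>i\<close> and for \<open>s\<^sub>i c\<^sub>i s\<^sub>i\<close>, which use \<open>t\<^sub>i\<^sup>2 = 1\<close>, and the long relation, which uses that \<open>t\<^sub>i\<close> is its own inverse.\<close>

lemma bc_rel_limit: "bc_rel r s u v \<Longrightarrow> lq (sub u) (sub v)"
proof (induction rule: bc_rel.induct)
  case (s_sq i)
  show ?case
  proof (cases "i < r")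
    case True
    then have "Tgen i \<in> QG" using s_sq by (auto simp: bc_gens_iff qbc_gens_iff)
    then show ?thesis using lq_t_sq[of i] True by (simp add: sub_simps)
  next
    case False
    then have "Tsgen (i - r) \<in> QG" using s_sq by (auto simp: bc_gens_iff qbc_gens_iff)
    then show ?thesis using lq_ts_sq[of "i - r"] False by (simp add: sub_simps)
  qed
next
  case (s_braid i)
  show ?case
  proof (cases "i < r")
    case True
    then have "Suc i < r" "Tgen i \<in> QG" "Tgen (i + 1) \<in> QG" using s_braid by (auto simp: bc_gens_iff qbc_gens_iff)
    then show ?thesis using lq_rel[OF qbc_rel.t_braid[of i r s]] True by (simp add: sub_simps FR_intros)
  next
    case False
    then have "Suc i - r = Suc (i - r)" "Tsgen (i - r) \<in> QG" "Tsgen (i - r + 1) \<in> QG" using s_braid by (auto simp: bc_gens_iff qbc_gens_iff)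
    then show ?thesis using lq_rel[OF qbc_rel.ts_braid[of "i - r" r s]] False by (simp add: sub_simps FR_intros)
  qed
next
  case (s_comm i j)
  consider "i < r" "j < r" | "i < r" "r < j" | "r < i" "j < r" | "r < i" "r < j"
    using s_comm by (auto simp: bc_gens_iff) linarith
  then show ?case
  proof cases
    case 1
    then have "Tgen i \<in> QG" "Tgen j \<in> QG" using s_comm by (auto simp: bc_gens_iff qbc_gens_iff)
    then show ?thesis using lq_rel[OF qbc_rel.t_comm[of i j r s]] 1 s_comm by (simp add: sub_simps FR_intros)
  next
    case 2
    then have "Tgen i \<in> QG" "Tsgen (j - r) \<in> QG" using s_comm by (auto simp: bc_gens_iff qbc_gens_iff)
    then show ?thesis using lq_rel[OF qbc_rel.t_ts_comm[of i "j - r" r s]] 2 by (simp add: sub_simps FR_intros)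
  next
    case 3
    then have "Tgen j \<in> QG" "Tsgen (i - r) \<in> QG" using s_comm by (auto simp: bc_gens_iff qbc_gens_iff)
    then show ?thesis using lq_sym[OF lq_rel[OF qbc_rel.t_ts_comm[of j "i - r" r s]]] 3 by (simp add: sub_simps FR_intros)
  next
    case 4
    then have "Tsgen (i - r) \<in> QG" "Tsgen (j - r) \<in> QG" "\<bar>int (i - r) - int (j - r)\<bar> > 1" using s_comm by (auto simp: bc_gens_iff qbc_gens_iff)
    then show ?thesis using lq_rel[OF qbc_rel.ts_comm[of "i - r" "j - r" r s]] 4 by (simp add: sub_simps FR_intros)
  qed
next
  case e_sq
  then have "Qegen \<in> QG" by (auto simp: bc_gens_iff qbc_gens_iff)
  then show ?case using lq_rel[OF qbc_rel.qe_sq[of r s]] by (simp add: sub_simps FR_intros)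
next
  case (e_s_comm j)
  show ?case
  proof (cases "j < r")
    case True
    then have "Qegen \<in> QG" "Tgen j \<in> QG" using e_s_comm by (auto simp: bc_gens_iff qbc_gens_iff)
    then show ?thesis using lq_rel[OF qbc_rel.e_t_comm[of j r s]] True e_s_comm by (simp add: sub_simps FR_intros)
  next
    case False
    then have "Qegen \<in> QG" "Tsgen (j - r) \<in> QG" "j - r \<noteq> 1" using e_s_comm by (auto simp: bc_gens_iff qbc_gens_iff)
    then show ?thesis using lq_rel[OF qbc_rel.e_ts_comm[of "j - r" r s]] False by (simp add: sub_simps FR_intros)
  qed
next
  case e_s_e_left
  then have "Qegen \<in> QG" "Tgen (r - 1) \<in> QG" "r - 1 < r" by (auto simp: bc_gens_iff qbc_gens_iff)
  then show ?case using lq_sym[OF lq_rel[OF qbc_rel.e_t_e[of r s]]] by (simp add: sub_simps FR_intros)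
next
  case e_s_e_right
  then have "Qegen \<in> QG" "Tsgen 1 \<in> QG" by (auto simp: bc_gens_iff qbc_gens_iff)
  then show ?case using lq_sym[OF lq_rel[OF qbc_rel.e_ts_e[of r s]]] by (simp add: sub_simps FR_intros)
next
  case e_s_s
  then have g: "Qegen \<in> QG" "Tsgen 1 \<in> QG" "Tgen (r - 1) \<in> QG" "r - 1 < r" by (auto simp: bc_gens_iff qbc_gens_iff)
  let ?t = "tg (r - 1)" and ?i = "tg_inv (r - 1)" and ?s = "tsg 1"
  have i: "lq ?i ?t" by (rule lq_tg_inv[OF g(3)])
  have F: "lq qeg qeg" "lq ?s ?s" using g by (auto intro: lq_refl FR_gen)
  have 1: "lq (qeg * ?i * ?s * qeg * ?s * ?i) (qeg * ?t * ?s * qeg * ?s * ?t)"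
    by (intro lq_mult F i)
  have 2: "lq (?i * ?s * qeg * ?s * ?i * qeg) (?t * ?s * qeg * ?s * ?t * qeg)"
    by (intro lq_mult F i)
  have 3: "lq (qeg * ?i * ?s * qeg * ?s * ?i) (?i * ?s * qeg * ?s * ?i * qeg)"
    using g by (intro lq_rel qbc_rel.e_t_ts lq_FR[OF 1] lq_FR[OF 2]) auto
  have "lq (?t * ?s * qeg * ?s * ?t * qeg) (qeg * ?t * ?s * qeg * ?s * ?t)"
    by (rule lq_trans[OF lq_sym[OF lq_trans[OF 3 2]] 1])
  then show ?case using g(4) by (simp add: sub_simps)
next
  case (c_sq_left i)
  then have "Qcgen i \<in> QG" by (auto simp: qbc_gens_iff)
  then show ?case using lq_rel[OF qbc_rel.qc_sq[of i r s]] c_sq_left by (simp add: sub_simps FR_intros)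
next
  case (c_sq_right i)
  then have "Qcsgen (i - r) \<in> QG" by (auto simp: qbc_gens_iff)
  then show ?case using lq_rel[OF qbc_rel.qcs_sq[of "i - r" r s]] c_sq_right by (simp add: sub_simps FR_intros)
next
  case (c_anticomm i j)
  have m: "lq (- u) (- v)" if "lq u v" for u v
    using lq_left[OF that FR_uminus[OF FR_1]] by simp
  consider "i \<le> r" "j \<le> r" | "i \<le> r" "r < j" | "r < i" "j \<le> r" | "r < i" "r < j" by linarith
  then show ?case
  proof cases
    case 1
    then have "Qcgen i \<in> QG" "Qcgen j \<in> QG" using c_anticomm by (auto simp: bc_gens_iff qbc_gens_iff)
    then show ?thesis using lq_rel[OF qbc_rel.qc_anticomm[of i j r s]] 1 c_anticomm by (simp add: sub_simps FR_intros)
  next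
    case 2
    then have "Qcgen i \<in> QG" "Qcsgen (j - r) \<in> QG" using c_anticomm by (auto simp: bc_gens_iff qbc_gens_iff)
    then show ?thesis using lq_rel[OF qbc_rel.qc_qcs_anticomm[of i "j - r" r s]] 2 by (simp add: sub_simps FR_intros)
  next
    case 3
    then have "Qcgen j \<in> QG" "Qcsgen (i - r) \<in> QG" using c_anticomm by (auto simp: bc_gens_iff qbc_gens_iff)
    then show ?thesis using m[OF lq_sym[OF lq_rel[OF qbc_rel.qc_qcs_anticomm[of j "i - r" r s]]]] 3 by (simp add: sub_simps FR_intros)
  next
    case 4
    then have "Qcsgen (i - r) \<in> QG" "Qcsgen (j - r) \<in> QG" "i - r \<noteq> j - r" using c_anticomm by (auto simp: bc_gens_iff qbc_gens_iff)
    then show ?thesis using lq_rel[OF qbc_rel.qcs_anticomm[of "i - r" "j - r" r s]] 4 by (simp add: sub_simps FR_intros)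
  qed
next
  case (s_c_s i)
  show ?case
  proof (cases "i < r")
    case True
    then have g: "Tgen i \<in> QG" "Qcgen i \<in> QG" "Qcgen (i + 1) \<in> QG" "Suc i \<le> r" using s_c_s by (auto simp: bc_gens_iff qbc_gens_iff)
    have "lq (tg i * qcg i) (qcg (i + 1) * tg i)" using g by (intro lq_rel qbc_rel.t_c) (auto simp: FR_intros)
    then have "lq (tg i * qcg i * tg i) (qcg (i + 1) * tg i * tg i)" using g by (intro lq_right FR_gen)
    moreover have "lq (qcg (i + 1) * tg i * tg i) (qcg (i + 1))"
      using lq_left[OF lq_t_sq[OF g(1)] FR_gen[OF g(3)]] by (simp add: mult.assoc)
    ultimately have "lq (tg i * qcg i * tg i) (qcg (i + 1))" by (rule lq_trans)
    then show ?thesis using True g by (simp add: sub_simps)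
  next
    case False
    then have g: "Tsgen (i - r) \<in> QG" "Qcsgen (i - r) \<in> QG" "Qcsgen (i - r + 1) \<in> QG" "Suc i - r = Suc (i - r)" "r < i"
      using s_c_s by (auto simp: bc_gens_iff qbc_gens_iff)
    have "lq (tsg (i - r) * qcsg (i - r)) (qcsg (i - r + 1) * tsg (i - r))"
      using g by (intro lq_rel qbc_rel.ts_cs) (auto simp: FR_intros)
    then have "lq (tsg (i - r) * qcsg (i - r) * tsg (i - r)) (qcsg (i - r + 1) * tsg (i - r) * tsg (i - r))" using g by (intro lq_right FR_gen)
    moreover have "lq (qcsg (i - r + 1) * tsg (i - r) * tsg (i - r)) (qcsg (i - r + 1))"
      using lq_left[OF lq_ts_sq[OF g(1)] FR_gen[OF g(3)]] by (simp add: mult.assoc)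
    ultimately have "lq (tsg (i - r) * qcsg (i - r) * tsg (i - r)) (qcsg (i - r + 1))" by (rule lq_trans)
    then show ?thesis using False g by (simp add: sub_simps)
  qed
next
  case (s_c_comm i j)
  consider "i < r" "j \<le> r" | "i < r" "r < j" | "r < i" "j \<le> r" | "r < i" "r < j"
    using s_c_comm by (auto simp: bc_gens_iff) linarith
  then show ?case
  proof cases
    case 1
    then have "Tgen i \<in> QG" "Qcgen j \<in> QG" using s_c_comm by (auto simp: bc_gens_iff qbc_gens_iff)
    then show ?thesis using lq_rel[OF qbc_rel.t_c_comm[of i j r s]] 1 s_c_comm by (simp add: sub_simps FR_intros)
  next
    case 2
    then have "Tgen i \<in> QG" "Qcsgen (j - r) \<in> QG" using s_c_comm by (auto simp: bc_gens_iff qbc_gens_iff)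
    then show ?thesis using lq_rel[OF qbc_rel.t_cs_comm[of i "j - r" r s]] 2 by (simp add: sub_simps FR_intros)
  next
    case 3
    then have "Tsgen (i - r) \<in> QG" "Qcgen j \<in> QG" using s_c_comm by (auto simp: bc_gens_iff qbc_gens_iff)
    then show ?thesis using lq_rel[OF qbc_rel.ts_c_comm[of "i - r" j r s]] 3 by (simp add: sub_simps FR_intros)
  next
    case 4
    then have "Tsgen (i - r) \<in> QG" "Qcsgen (j - r) \<in> QG" "j - r \<noteq> i - r" "j - r \<noteq> i - r + 1"
      using s_c_comm by (auto simp: bc_gens_iff qbc_gens_iff)
    then show ?thesis using lq_rel[OF qbc_rel.ts_cs_comm[of "i - r" "j - r" r s]] 4 by (simp add: sub_simps FR_intros)
  qed
next
  case c_e
  then have "Qegen \<in> QG" "Qcgen r \<in> QG" "Qcsgen 1 \<in> QG" by (auto simp: bc_gens_iff qbc_gens_iff)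
  then show ?case using lq_rel[OF qbc_rel.qc_e[of r s]] by (simp add: sub_simps FR_intros)
next
  case e_c
  then have "Qegen \<in> QG" "Qcgen r \<in> QG" "Qcsgen 1 \<in> QG" by (auto simp: bc_gens_iff qbc_gens_iff)
  then show ?case using lq_rel[OF qbc_rel.qe_c[of r s]] by (simp add: sub_simps FR_intros)
next
  case e_c_e
  then have "Qegen \<in> QG" "Qcgen r \<in> QG" by (auto simp: bc_gens_iff qbc_gens_iff)
  then show ?case using lq_rel[OF qbc_rel.qe_c_e[of r s]] by (simp add: sub_simps FR_intros)
next
  case (e_c_comm j)
  show ?case
  proof (cases "j \<le> r")
    case True
    then have "Qegen \<in> QG" "Qcgen j \<in> QG" using e_c_comm by (auto simp: bc_gens_iff qbc_gens_iff)
    then show ?thesis using lq_sym[OF lq_rel[OF qbc_rel.qc_e_comm[of j r s]]] True e_c_comm by (simp add: sub_simps FR_intros)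
  next
    case False
    then have "Qegen \<in> QG" "Qcsgen (j - r) \<in> QG" "j - r \<noteq> 1" using e_c_comm by (auto simp: bc_gens_iff qbc_gens_iff)
    then show ?thesis using lq_sym[OF lq_rel[OF qbc_rel.qcs_e_comm[of "j - r" r s]]] False by (simp add: sub_simps FR_intros)
  qed
qed

lemma sub_Ib: "u \<in> Ib \<Longrightarrow> lq (sub u) 0"
proof -
  have "Ib \<subseteq> {u \<in> FC BG. lq (sub u) 0}"
  proof (rule relation_ideal_minimal)
    fix u v assume "bc_rel r s u v"
    then show "u \<in> FC BG \<and> v \<in> FC BG" by (rule bc_rel_FC)
  next
    fix u v assume r: "bc_rel r s u v"
    have "lq (sub u - sub v) 0" using bc_rel_limit[OF r] by (auto simp: lq_def intro: FR_diff FR_0)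
    then show "u - v \<in> {u \<in> FC BG. lq (sub u) 0}" using bc_rel_FC[OF r] by (simp add: sub_simps FC_diff)
  next
    have 1: "lq (x + y) 0" if "lq x 0" "lq y 0" for x y using lq_add[OF that] by simp
    have 2: "lq (- x) 0" if "lq x 0" for x using lq_left[OF that FR_uminus[OF FR_1]] by simp
    show "BFi.tideal {u \<in> FC BG. lq (sub u) 0}"
      unfolding BFi.tideal_def using lq_left[of _ 0] lq_right[of _ 0] lq_refl[OF FR_0]
      by (auto simp: FC_add FC_mult FC_uminus sub_simps sub_FR intro: 1 2)
  qed
  then show "u \<in> Ib \<Longrightarrow> lq (sub u) 0" by blast
qed

end

section \<open>The integral form, its limit and the natural homomorphism\<close>

lemma free_single_Cons: "Poly_Mapping.single (Word (g # l)) 1 = gen g * Poly_Mapping.single (Word l) 1"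
  by (simp add: gen_def mult_single plus_word_def)
lemma free_single_Nil: "Poly_Mapping.single (Word []) 1 = (1 :: ('g, 'k::comm_ring_1) free)"
  by (simp add: zero_word_def[symmetric])
context fixes r s :: nat begin

abbreviation (input) "BF \<equiv> free_superalgebra (BG r s) bc_par :: (complex, (bc_gen, complex) free) superalgebra"
abbreviation (input) "subst \<equiv> free_map (tr r) const_ratfun"

definition hq :: "(qbc_gen, ratfun) free \<Rightarrow> (qbc_gen, ratfun) free set" where "hq u = (Iq r s) +>\<^bsub>(QF r s)\<^esub> u"
definition hb :: "(bc_gen, complex) free \<Rightarrow> (bc_gen, complex) free set" where "hb u = (Ib r s) +>\<^bsub>BF\<^esub> u"
definition hl :: "(qbc_gen, ratfun) free \<Rightarrow> (qbc_gen, ratfun) free set set" where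
  "hl u = spec_ideal r s +>\<^bsub>BC_int r s\<^esub> hq u"

interpretation qB: typed_image "FC (QG r s)" UNIV scal hq "qBC r s"
  unfolding qBC_def hq_def by (rule presented) (erule qbc_rel_FC)
interpretation bB: typed_image "FC (BG r s)" UNIV scal hb "BC r s"
  unfolding BC_def hb_def by (rule presented) (erule bc_rel_FC)

lemma hq_eq: "u \<in> FC (QG r s) \<Longrightarrow> v \<in> FC (QG r s) \<Longrightarrow> hq u = hq v \<longleftrightarrow> u - v \<in> (Iq r s)"
  unfolding hq_def by (rule presented_eq) (erule qbc_rel_FC)
lemma hb_eq: "u \<in> FC (BG r s) \<Longrightarrow> v \<in> FC (BG r s) \<Longrightarrow> hb u = hb v \<longleftrightarrow> u - v \<in> (Ib r s)"
  unfolding hb_def by (rule presented_eq) (erule bc_rel_FC)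

lemma half_ratfun: "const_ratfun (1 / 2) + const_ratfun (1 / 2) = 1"
  by (simp add: cst.g_add[symmetric] cst.g_1)

lemma hpart_qBC: "hpart (qBC r s) i = hq ` qB.homog (twist qbc_par) i"
  unfolding qBC_def hq_def by (rule presented_hpart[OF _ half_ratfun]) (erule qbc_rel_FC)
lemma hpart_BC: "hpart (BC r s) i = hb ` bB.homog (twist bc_par) i"
proof -
  have h: "1 / 2 + 1 / 2 = (1 :: complex)" by simp
  show ?thesis unfolding BC_def hb_def by (rule presented_hpart[OF _ h]) (erule bc_rel_FC)
qed

lemma qBC_gen_hq: "qBC_gen r s g = hq (gen g)" by (simp add: qBC_gen_def presented_gen_def hq_def)
lemma BC_gen_hb: "BC_gen r s g = hb (gen g)" by (simp add: BC_gen_def presented_gen_def hb_def)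
lemma BC_lim_gen_hl: "BC_lim_gen r s g = hl (gen g)" by (simp add: BC_lim_gen_def hl_def qBC_gen_hq)

abbreviation (input) "HH \<equiv> gen_subalgebra (qBC r s) local_ring (qBC_gen r s ` (QG r s))"

text \<open>An element with integral coefficients is a combination of products of generators, and conversely such elements are closed under all operations.\<close>

lemma integral_form: "HH = hq ` FR (QG r s)"
proof (intro equalityI subsetI)
  fix x assume "x \<in> HH"
  then show "x \<in> hq ` FR (QG r s)"
  proof (induction rule: gen_subalgebra.induct)
    case one
    then show ?case using FR_1 qB.one_h by auto
  next
    case (incl x)
    then obtain g where g: "g \<in> (QG r s)" "x = hq (gen g)" by (auto simp: qBC_gen_hq)
    show ?case unfolding g(2) using FR_gen[OF g(1)] by (rule imageI)
  next
    case (smult a x)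
    then obtain u where u: "u \<in> FR (QG r s)" "x = hq u" by blast
    then have "a \<odot>\<^bsub>qBC r s\<^esub> x = hq (scal a * u)" using qB.smult_h[of a u] FR_FC by auto
    then show ?case using FR_mult[OF FR_scal[OF smult(1)] u(1)] by blast
  next
    case (add x y)
    then obtain u v where u: "u \<in> FR (QG r s)" "x = hq u" "v \<in> FR (QG r s)" "y = hq v" by blast
    then have "x \<oplus>\<^bsub>qBC r s\<^esub> y = hq (u + v)" using qB.add_h[of u v] FR_FC by auto
    then show ?case using FR_add[OF u(1,3)] by blast
  next
    case (mult x y)
    then obtain u v where u: "u \<in> FR (QG r s)" "x = hq u" "v \<in> FR (QG r s)" "y = hq v" by blast
    then have "x \<otimes>\<^bsub>qBC r s\<^esub> y = hq (u * v)" using qB.mult_h[of u v] FR_FC by auto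
    then show ?case using FR_mult[OF u(1,3)] by blast
  qed
next
  fix x assume "x \<in> hq ` FR (QG r s)"
  then obtain u where u: "u \<in> FR (QG r s)" "x = hq u" by blast
  have one: "hq 1 \<in> HH" using gen_subalgebra.one[of "qBC r s"] by (simp add: qB.one_h)
  have sm: "hq (scal a * u) \<in> HH" if "a \<in> local_ring" "u \<in> FC (QG r s)" "hq u \<in> HH" for a u
    using gen_subalgebra.smult[OF that(1,3)] that(2) by (simp add: qB.smult_h)
  have w: "hq (Poly_Mapping.single (Word l) 1) \<in> HH" if "set l \<subseteq> (QG r s)" for l
    using that
  proof (induction l)
    case Nil
    then show ?case using one by (simp add: free_single_Nil)
  next
    case (Cons g l)
    have "hq (gen g) \<in> HH" using Cons.prems by (intro gen_subalgebra.incl) (simp add: qBC_gen_hq)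
    moreover have "hq (Poly_Mapping.single (Word l) 1) \<in> HH" using Cons by simp
    ultimately have "hq (gen g) \<otimes>\<^bsub>qBC r s\<^esub> hq (Poly_Mapping.single (Word l) 1) \<in> HH" by (rule gen_subalgebra.mult)
    then show ?case using Cons.prems by (simp add: free_single_Cons qB.mult_h FC_gen FC_single)
  qed
  have "hq u \<in> HH" using u(1)
  proof (induction u rule: FR_induct)
    case zero
    show ?case using sm[OF local_ring_0 _ one] by simp
  next
    case (single w' a)
    then show ?case using sm[OF single(2) _ w[OF single(1)]] by (simp add: scal_single FC_single)
  next
    case (add u v)
    have "hq u \<oplus>\<^bsub>qBC r s\<^esub> hq v \<in> HH" using add by (intro gen_subalgebra.add)
    then show ?case using add by (simp add: qB.add_h FR_FC)
  qed
  then show "x \<in> HH" using u by simp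
qed

interpretation iB: typed_image "FR (QG r s)" local_ring scal hq "BC_int r s"
proof unfold_locales
  show "carrier (BC_int r s) = hq ` FR (QG r s)" by (simp add: BC_int_def Let_def integral_form)
qed (simp_all add: BC_int_def Let_def FR_intros qB.mult_h qB.add_h qB.one_h qB.zero_h qB.smult_h FR_FC)

text \<open>Representatives of the ideal generated by \<open>q - 1\<close>.\<close>

definition JJ :: "(qbc_gen, ratfun) free set" where "JJ = {scal (qq - 1) * y |y. y \<in> FR (QG r s)}"

lemma JJ_tideal: "iB.tideal JJ"
  unfolding iB.tideal_def
proof (intro conjI ballI)
  show "JJ \<subseteq> FR (QG r s)" by (auto simp: JJ_def intro: FR_mult FR_scal local_ring_q)
  show "0 \<in> JJ" using FR_0 by (force simp: JJ_def)
next
  fix x y assume "x \<in> JJ" "y \<in> JJ"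
  then obtain u v where "u \<in> FR (QG r s)" "v \<in> FR (QG r s)" "x = scal (qq - 1) * u" "y = scal (qq - 1) * v" by (auto simp: JJ_def)
  then show "x + y \<in> JJ" using FR_add[of u "QG r s" v] unfolding JJ_def by (auto simp: distrib_left[symmetric])
next
  fix x assume "x \<in> JJ"
  then obtain u where "u \<in> FR (QG r s)" "x = scal (qq - 1) * u" by (auto simp: JJ_def)
  then have "- x = scal (qq - 1) * (- u)" "- u \<in> FR (QG r s)" by (simp_all add: FR_uminus)
  then show "- x \<in> JJ" unfolding JJ_def by blast
next
  fix x y assume x: "x \<in> FR (QG r s)" and "y \<in> JJ"
  then obtain u where u: "u \<in> FR (QG r s)" "y = scal (qq - 1) * u" by (auto simp: JJ_def)
  have "x * y = x * scal (qq - 1) * u" by (simp only: u mult.assoc)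
  also have "\<dots> = scal (qq - 1) * (x * u)" by (simp only: scal_central[symmetric] mult.assoc)
  finally show "x * y \<in> JJ" using FR_mult[OF x u(1)] unfolding JJ_def by blast
  have "y * x = scal (qq - 1) * (u * x)" by (simp only: u mult.assoc)
  then show "y * x \<in> JJ" using FR_mult[OF u(1) x] unfolding JJ_def by blast
qed

lemma spec_ideal_eq: "spec_ideal r s = hq ` JJ"
proof -
  have "(qq - 1) \<odot>\<^bsub>BC_int r s\<^esub> hq y = hq (scal (qq - 1) * y)" if "y \<in> FR (QG r s)" for y
    using iB.smult_h[OF local_ring_q(1) that] .
  then show ?thesis unfolding spec_ideal_def iB.carr JJ_def by (auto simp: image_iff)
qed

interpretation lB: typed_image "FR (QG r s)" UNIV "scal \<circ> const_ratfun" hl "BC_lim r s"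
  unfolding BC_lim_def hl_def spec_ideal_eq
  by (rule typed_image.restrict[OF iB.quot[OF JJ_tideal]]) (rule local_ring_const)

lemma hl_eq: assumes "u \<in> FR (QG r s)" "v \<in> FR (QG r s)" shows "hl u = hl v \<longleftrightarrow> lq r s u v"
proof -
  have uv: "u - v \<in> FR (QG r s)" by (rule FR_diff[OF assms])
  have "hl u = hl v \<longleftrightarrow> hq (u - v) \<in> hq ` JJ"
    unfolding hl_def spec_ideal_eq by (rule iB.coset_eq[OF iB.ideal_image[OF JJ_tideal] assms])
  also have "\<dots> \<longleftrightarrow> (\<exists>y\<in>FR (QG r s). hq (u - v) = hq (scal (qq - 1) * y))" by (auto simp: JJ_def)
  also have "\<dots> \<longleftrightarrow> lq r s u v"
    using hq_eq[OF FR_FC[OF uv]] assms by (auto simp: lq_def FR_FC FR_mult FR_scal local_ring_q)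
  finally show ?thesis .
qed

text \<open>A class that has a homogeneous representative and an integral one also has a representative with both properties: the homogeneous component of the integral representative.\<close>

lemma hpart_BC_lim: "hpart (BC_lim r s) i = hl ` lB.homog (twist qbc_par) i"
proof -
  have "hpart (BC_int r s) i = hpart (qBC r s) i \<inter> hq ` FR (QG r s)" by (simp add: BC_int_def Let_def integral_form)
  also have "\<dots> = hq ` lB.homog (twist qbc_par) i"
  proof (intro equalityI subsetI)
    fix x assume "x \<in> hpart (qBC r s) i \<inter> hq ` FR (QG r s)"
    then obtain u v where u: "u \<in> FC (QG r s)" "twist qbc_par u = (if i = 0 then u else - u)" "x = hq u" and v: "v \<in> FR (QG r s)" "x = hq v"
      by (auto simp: hpart_qBC qB.homog_def)
    let ?h = "scal (const_ratfun (1 / 2)) :: (qbc_gen, ratfun) free"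
    let ?e = "\<lambda>w :: (qbc_gen, ratfun) free. if i = 0 then w else - w"
    let ?v = "?h * (v + ?e (twist qbc_par v))"
    have hh: "?h * w + ?h * w = w" for w
      using half_ratfun by (simp add: distrib_right[symmetric] scal_add[symmetric])
    have v': "?v \<in> FR (QG r s)" using v(1) by (auto intro!: FR_mult FR_scal FR_add FR_diff FR_uminus FR_twist local_ring_const)
    have tv: "twist qbc_par ?v = ?e ?v"
      by (auto simp: twist_mult twist_scal twist_add twist_uminus twist_twist twist_diff distrib_left right_diff_distrib add.commute)
    have d: "v - u \<in> (Iq r s)" using hq_eq[OF FR_FC[OF v(1)] u(1)] u(3) v(2) by simp
    have "twist qbc_par (v - u) \<in> (Iq r s)"
      by (rule twist_ideal[OF _ _ d]) (erule qbc_rel_FC, erule qbc_rel_homogeneous)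
    then have "?e (twist qbc_par (v - u)) \<in> (Iq r s)" using Iq_props(4) by simp
    then have "(v - u) + ?e (twist qbc_par (v - u)) \<in> (Iq r s)" by (rule Iq_props(3)[OF d])
    then have "?h * ((v - u) + ?e (twist qbc_par (v - u))) \<in> (Iq r s)" by (rule Iq_props(5)[OF FC_scal])
    moreover have "(v - u) + ?e (twist qbc_par (v - u)) = v + ?e (twist qbc_par v) - (u + u)"
      using u(2) by (auto simp: twist_diff)
    ultimately have "?v - (?h * u + ?h * u) \<in> (Iq r s)" by (simp only: right_diff_distrib distrib_left)
    then have "?v - u \<in> (Iq r s)" by (simp only: hh)
    then have "hq ?v = x" using hq_eq[OF FR_FC[OF v'] u(1)] u(3) by simp
    then show "x \<in> hq ` lB.homog (twist qbc_par) i" using v' tv by (auto simp: lB.homog_def)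
  next
    fix x assume "x \<in> hq ` lB.homog (twist qbc_par) i"
    then show "x \<in> hpart (qBC r s) i \<inter> hq ` FR (QG r s)" by (auto simp: hpart_qBC qB.homog_def lB.homog_def FR_FC)
  qed
  finally have "hpart (BC_int r s) i = hq ` lB.homog (twist qbc_par) i" .
  then show ?thesis by (simp add: BC_lim_def restrict_scalars_def quot_superalgebra_def image_image hl_def)
qed

lemma superalgebra_BC: "superalgebra type_ring (BC r s)"
proof (rule bB.superalgebra[where \<alpha> = "twist bc_par" and half = "1 / 2"])
  fix x y assume "x \<in> FC (BG r s)" "y \<in> FC (BG r s)" "hb x = hb y"
  then have d: "x - y \<in> (Ib r s)" by (simp add: hb_eq)
  have "twist bc_par (x - y) \<in> (Ib r s)"
    by (rule twist_ideal[OF _ _ d]) (erule bc_rel_FC, erule bc_rel_homogeneous)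
  then show "hb (twist bc_par x) = hb (twist bc_par y)"
    using \<open>x \<in> FC (BG r s)\<close> \<open>y \<in> FC (BG r s)\<close> by (simp add: hb_eq twist_FC twist_diff)
next
  fix a :: complex and x :: "(bc_gen, complex) free"
  show "scal a * x = x * scal a" by (rule scal_central)
qed (simp_all add: scal_add scal_mult twist_FC twist_add twist_mult twist_twist twist_scal hpart_BC)

lemma superalgebra_BC_lim: "superalgebra type_ring (BC_lim r s)"
proof (rule lB.superalgebra[where \<alpha> = "twist qbc_par" and half = "1 / 2"])
  fix x y assume "x \<in> FR (QG r s)" "y \<in> FR (QG r s)" "hl x = hl y"
  then show "hl (twist qbc_par x) = hl (twist qbc_par y)"
    using lq_twist[of r s x y] by (simp add: hl_eq FR_twist)
next
  fix a :: complex and x :: "(qbc_gen, ratfun) free"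
  show "(scal \<circ> const_ratfun) a * x = x * (scal \<circ> const_ratfun) a" unfolding o_apply by (rule scal_central)
qed (simp_all add: scal_add scal_mult cst.g_add cst.g_mult cst.g_1 FR_twist twist_add twist_mult twist_twist twist_scal hpart_BC_lim)

definition tri :: "qbc_gen \<Rightarrow> bc_gen" where
  "tri g = (case g of Tgen i \<Rightarrow> Sgen i | Tsgen j \<Rightarrow> Sgen (r + j) | Qegen \<Rightarrow> Egen | Qcgen i \<Rightarrow> Cgen i | Qcsgen j \<Rightarrow> Cgen (r + j))"

lemma tri: "g \<in> (QG r s) \<Longrightarrow> tr r (tri g) = g" "g \<in> (QG r s) \<Longrightarrow> tri g \<in> (BG r s)"
  by (cases g; auto simp: tri_def tr_simps qbc_gens_iff bc_gens_iff)+

text \<open>Coefficientwise, replace an element of the local ring by its residue.\<close>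

lemma lift_mod: "u \<in> FR (QG r s) \<Longrightarrow> \<exists>p\<in>FC (BG r s). lq r s u (subst p)"
proof (induction rule: FR_induct)
  case zero
  then show ?case using lq_refl[OF FR_0, of r s] by (intro bexI[of _ 0]) simp_all
next
  case (single w a)
  obtain c y where y: "y \<in> local_ring" "a = const_ratfun c + (qq - 1) * y" by (rule local_ring_residue[OF single(2)])
  let ?p = "Poly_Mapping.single (Word (map tri (letters w))) c"
  have m: "map (tr r) (map tri (letters w)) = letters w" using single(1) tri(1) by (auto intro!: map_idI simp: o_def)
  have s: "subst ?p = Poly_Mapping.single w (const_ratfun c)" using m by (simp add: cst.free_map_single)
  have "Poly_Mapping.single w a = subst ?p + scal (qq - 1) * Poly_Mapping.single w y"
    by (simp add: s y(2) single_add scal_single)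
  moreover have "set (letters (Word (map tri (letters w)))) \<subseteq> (BG r s)" using single(1) tri(2) by auto
  ultimately show ?case
    using lq_shift[of "subst ?p" r s "Poly_Mapping.single w y"] FR_single[OF single(1) y(1)] FR_single[OF single(1) local_ring_const[of c]]
    by (intro bexI[of _ ?p]) (simp_all add: s FC_single)
next
  case (add u v)
  then obtain p p' where "p \<in> FC (BG r s)" "lq r s u (subst p)" "p' \<in> FC (BG r s)" "lq r s v (subst p')" by blast
  then show ?case using lq_add by (intro bexI[of _ "p + p'"]) (simp_all add: cst.free_map_add FC_add)
qed

definition natural_map :: "(bc_gen, complex) free set \<Rightarrow> (qbc_gen, ratfun) free set set" where
  "natural_map X = hl (subst (SOME p. p \<in> FC (BG r s) \<and> hb p = X))"

lemma natural_map_hb: assumes p: "p \<in> FC (BG r s)" shows "natural_map (hb p) = hl (subst p)"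
proof -
  define p' where "p' = (SOME p'. p' \<in> FC (BG r s) \<and> hb p' = hb p)"
  have p': "p' \<in> FC (BG r s) \<and> hb p' = hb p" unfolding p'_def by (rule someI[of _ p]) (simp add: p)
  then have "p' - p \<in> (Ib r s)" using p hb_eq[of p' p] by simp
  then have "lq r s (subst (p' - p)) 0" by (rule sub_Ib)
  then have "lq r s (subst p' - subst p + subst p) (0 + subst p)"
    using p unfolding cst.free_map_diff by (intro lq_add lq_refl sub_FR)
  then have "lq r s (subst p') (subst p)" by simp
  then have "hl (subst p') = hl (subst p)" using p p' by (simp add: hl_eq sub_FR)
  then show ?thesis by (simp add: natural_map_def p'_def)
qed

lemma natural_map_natural: "natural_hom r s natural_map"
proof -
  have "superalgebra_hom type_ring (BC r s) (BC_lim r s) natural_map"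
  proof (intro superalgebra_hom.intro superalgebra_BC superalgebra_BC_lim superalgebra_hom_axioms.intro)
    show "natural_map \<in> ring_hom (BC r s) (BC_lim r s)"
      by (rule ring_hom_memI)
        (auto simp: bB.carr lB.carr natural_map_hb sub_FR bB.mult_h bB.add_h lB.mult_h lB.add_h bB.one_h lB.one_h
          FC_mult FC_add cst.free_map_mult cst.free_map_add)
  next
    fix a x assume "x \<in> carrier (BC r s)"
    then show "natural_map (a \<odot>\<^bsub>BC r s\<^esub> x) = a \<odot>\<^bsub>BC_lim r s\<^esub> natural_map x"
      by (auto simp: bB.carr bB.smult_h lB.smult_h natural_map_hb sub_FR FC_mult cst.free_map_mult)
  next
    fix x i assume "x \<in> hpart (BC r s) i"
    then obtain u where u: "u \<in> FC (BG r s)" "twist bc_par u = (if i = 0 then u else - u)" "x = hb u"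
      by (auto simp: hpart_BC bB.homog_def)
    have "twist qbc_par (subst u) = subst (twist bc_par u)" using u(1)
    proof (induction rule: FC_induct)
      case (single w a)
      have "qbc_par (tr r g) = bc_par g" for g by (cases g) (simp_all add: tr_simps)
      then have "wpar qbc_par (Word (map (tr r) (letters w))) = wpar bc_par w" by (simp add: wpar_def o_def)
      moreover have "const_ratfun (sgnb j * a) = sgnb j * const_ratfun a" for j a
        by (simp add: sgnb_def cst.g_uminus)
      ultimately show ?case by (simp add: cst.free_map_single twist_single)
    qed (simp_all add: twist_add cst.free_map_add)
    then have "twist qbc_par (subst u) = (if i = 0 then subst u else - subst u)" using u(2) by (simp add: cst.free_map_uminus)
    then show "natural_map x \<in> hpart (BC_lim r s) i"
      using u by (auto simp: hpart_BC_lim lB.homog_def natural_map_hb sub_FR)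
  qed
  moreover have gn: "natural_map (BC_gen r s g) = BC_lim_gen r s g'" if "g \<in> (BG r s)" "tr r g = g'" for g g'
    using that by (simp add: BC_gen_hb BC_lim_gen_hl natural_map_hb FC_gen)
  ultimately show ?thesis unfolding natural_hom_def
    by (intro conjI allI impI gn) (auto simp: bc_gens_iff tr_simps)
qed

text \<open>A homomorphism of superalgebras is determined by its values on the generators; hence all natural homomorphisms agree.\<close>

lemma natural_hom_hb:
  assumes nat: "natural_hom r s \<pi>" and p: "p \<in> FC (BG r s)" shows "\<pi> (hb p) = hl (subst p)"
proof -
  have hom: "superalgebra_hom type_ring (BC r s) (BC_lim r s) \<pi>" using nat by (simp add: natural_hom_def)
  note rh = superalgebra_hom.hom_ring[OF hom]
  have sm: "\<pi> (hb (scal a * u)) = hl (scal (const_ratfun a) * v)" if "u \<in> FC (BG r s)" "v \<in> FR (QG r s)" "\<pi> (hb u) = hl v" for a u v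
    using superalgebra_hom.hom_smult[OF hom, of a "hb u"] that
    by (simp add: type_ring_def bB.h_carr bB.smult_h lB.smult_h)
  have one: "\<pi> (hb 1) = hl 1" using ring_hom_one[OF rh] by (simp add: bB.one_h lB.one_h)
  have g: "\<pi> (hb (gen g)) = hl (gen (tr r g))" if g: "g \<in> (BG r s)" for g
  proof (cases g)
    case (Sgen i)
    then consider "1 \<le> i \<and> i \<le> r - 1" "i < r" | "1 \<le> i - r \<and> i - r \<le> s - 1" "r + (i - r) = i"
      using g by (auto simp: bc_gens_iff) linarith
    then show ?thesis
    proof cases
      case 1
      then have "\<pi> (BC_gen r s (Sgen i)) = BC_lim_gen r s (Tgen i)" using nat unfolding natural_hom_def by blast
      then show ?thesis using 1 Sgen by (simp add: BC_gen_hb BC_lim_gen_hl tr_simps)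
    next
      case 2
      then have "\<pi> (BC_gen r s (Sgen (r + (i - r)))) = BC_lim_gen r s (Tsgen (i - r))" using nat unfolding natural_hom_def by blast
      then show ?thesis using 2 Sgen by (simp add: BC_gen_hb BC_lim_gen_hl tr_simps)
    qed
  next
    case Egen
    then have "1 \<le> r \<and> 1 \<le> s" using g by (simp add: bc_gens_iff)
    then have "\<pi> (BC_gen r s Egen) = BC_lim_gen r s Qegen" using nat unfolding natural_hom_def by blast
    then show ?thesis using Egen by (simp add: BC_gen_hb BC_lim_gen_hl tr_simps)
  next
    case (Cgen i)
    show ?thesis
    proof (cases "i \<le> r")
      case True
      then have "1 \<le> i \<and> i \<le> r" using g Cgen by (simp add: bc_gens_iff)
      then have "\<pi> (BC_gen r s (Cgen i)) = BC_lim_gen r s (Qcgen i)" using nat unfolding natural_hom_def by blast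
      then show ?thesis using True Cgen by (simp add: BC_gen_hb BC_lim_gen_hl tr_simps)
    next
      case False
      then have i: "1 \<le> i - r \<and> i - r \<le> s" "r + (i - r) = i" using g Cgen by (auto simp: bc_gens_iff)
      then have "\<pi> (BC_gen r s (Cgen (r + (i - r)))) = BC_lim_gen r s (Qcsgen (i - r))" using nat unfolding natural_hom_def by blast
      then show ?thesis using False i(2) Cgen by (simp add: BC_gen_hb BC_lim_gen_hl tr_simps)
    qed
  qed
  have w: "\<pi> (hb (Poly_Mapping.single (Word l) 1)) = hl (Poly_Mapping.single (Word (map (tr r) l)) 1)" if "set l \<subseteq> (BG r s)" for l
    using that
  proof (induction l)
    case Nil
    then show ?case using one by (simp add: free_single_Nil)
  next
    case (Cons x l)
    then have l: "set l \<subseteq> (BG r s)" "x \<in> (BG r s)" by auto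
    have L: "tr r ` set l \<subseteq> (QG r s)" using l(1) tr_gens by blast
    have "\<pi> (hb (gen x) \<otimes>\<^bsub>BC r s\<^esub> hb (Poly_Mapping.single (Word l) 1)) = hl (gen (tr r x)) \<otimes>\<^bsub>BC_lim r s\<^esub> hl (Poly_Mapping.single (Word (map (tr r) l)) 1)"
      using ring_hom_mult[OF rh, of "hb (gen x)" "hb (Poly_Mapping.single (Word l) 1)"] l Cons.IH g[OF l(2)]
      by (simp add: bB.h_carr FC_gen FC_single)
    then show ?case using l L tr_gens[OF l(2)]
      by (simp add: bB.mult_h lB.mult_h free_single_Cons FC_gen FC_single FR_gen FR_single local_ring_1)
  qed
  show ?thesis using p
  proof (induction rule: FC_induct)
    case zero
    then show ?case using sm[OF _ FR_1 one, of 0] by (simp add: cst.g_0)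
  next
    case (single v a)
    have L: "tr r ` set (letters v) \<subseteq> (QG r s)" using single tr_gens by blast
    show ?case using sm[OF _ _ w[OF single], of a] single L
      by (simp add: FC_single FR_single local_ring_1 scal_single cst.free_map_single)
  next
    case (add u v)
    then show ?case using ring_hom_add[OF rh, of "hb u" "hb v"]
      by (simp add: bB.h_carr bB.add_h lB.add_h sub_FR cst.free_map_add)
  qed
qed

text \<open>The hypothesis \<open>ker\<close> is the injectivity of the natural homomorphism.\<close>

lemma natural_hom_iso:
  assumes ker: "\<And>p. p \<in> FC (BG r s) \<Longrightarrow> lq r s (subst p) 0 \<Longrightarrow> p \<in> (Ib r s)" and nat: "natural_hom r s \<pi>"
  shows "superalgebra_iso type_ring (BC r s) (BC_lim r s) \<pi>"
proof -
  have "inj_on \<pi> (carrier (BC r s))"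
  proof (rule inj_onI)
    fix x y assume "x \<in> carrier (BC r s)" "y \<in> carrier (BC r s)" and e: "\<pi> x = \<pi> y"
    then obtain p p' where p: "p \<in> FC (BG r s)" "x = hb p" "p' \<in> FC (BG r s)" "y = hb p'" by (auto simp: bB.carr)
    then have "hl (subst p) = hl (subst p')" using e natural_hom_hb[OF nat] by simp
    then have "lq r s (subst p) (subst p')" using p by (simp add: hl_eq sub_FR)
    then have "lq r s (subst p + - subst p') (subst p' + - subst p')"
      using p by (intro lq_add lq_refl FR_uminus sub_FR)
    then have "lq r s (subst (p - p')) 0" by (simp add: cst.free_map_diff)
    then have "p - p' \<in> (Ib r s)" using p by (intro ker FC_diff)
    then show "x = y" using p by (simp add: hb_eq)
  qed
  moreover have "\<pi> ` carrier (BC r s) = carrier (BC_lim r s)"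
  proof (intro equalityI subsetI)
    fix x assume "x \<in> \<pi> ` carrier (BC r s)"
    then show "x \<in> carrier (BC_lim r s)" by (auto simp: bB.carr lB.carr natural_hom_hb[OF nat] sub_FR)
  next
    fix x assume "x \<in> carrier (BC_lim r s)"
    then obtain u where u: "u \<in> FR (QG r s)" "x = hl u" by (auto simp: lB.carr)
    obtain p where p: "p \<in> FC (BG r s)" "lq r s u (subst p)" using lift_mod[OF u(1)] by blast
    then have "x = \<pi> (hb p)" using u by (simp add: natural_hom_hb[OF nat] hl_eq sub_FR)
    then show "x \<in> \<pi> ` carrier (BC r s)" using p(1) bB.h_carr by blast
  qed
  ultimately have "bij_betw \<pi> (carrier (BC r s)) (carrier (BC_lim r s))" by (simp add: bij_betw_def)
  moreover have "superalgebra_hom type_ring (BC r s) (BC_lim r s) \<pi>" using nat by (simp add: natural_hom_def)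
  ultimately show ?thesis by (intro superalgebra_iso.intro superalgebra_iso_axioms.intro)
qed

end

section \<open>Monoids of classes up to sign\<close>

context typeB begin

interpretation P: typeB "\<lambda>i. (S i, SE i)" "\<lambda>i. (C i, CE i)" a n
  rewrites "P.RB = PB"
  by (rule typeB_pair) (simp add: PB_def)

lemmas PB_1 = P.RB_1 and PB_S = P.RB_S and PB_C = P.RB_C and PB_mult = P.RB_mult
lemmas PB_gen_S = P.RB_gen_S and PB_gen_C = P.RB_gen_C
lemmas PB_induct [consumes 1, case_names 1 S C] = P.RB.induct
lemmas PB_mono = P.RB_mono

text \<open>The decomposition of one layer for the pairs of a monoid element and its signed permutation.\<close>

lemma PB_cases:
  assumes "p \<in> PB (Suc k)" "a \<le> k" "Suc k \<le> n"
  obtains "p \<in> PB k" | x where "x \<in> PB k" "p = x * (C (Suc k), CE (Suc k))"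
    | x y where "a < k" "x \<in> PB k" "y \<in> PB k" "p = x * (S k, SE k) * y"
  using P.RB_decomp[OF assms] unfolding P.D_def by blast

end

text \<open>A ring \<open>M\<close> modulo an ideal \<open>I\<close> and up to sign. Anticommuting elements commute there, and \<open>- 1\<close> becomes 1.\<close>

locale sign_quotient =
  fixes M I :: "'a::ring_1 set"
  assumes M_1: "1 \<in> M" and M_mult: "x \<in> M \<Longrightarrow> y \<in> M \<Longrightarrow> x * y \<in> M" and M_uminus: "x \<in> M \<Longrightarrow> - x \<in> M"
    and I_M: "I \<subseteq> M" and I_0: "0 \<in> I" and I_add: "x \<in> I \<Longrightarrow> y \<in> I \<Longrightarrow> x + y \<in> I" and I_uminus: "x \<in> I \<Longrightarrow> - x \<in> I"
    and I_left: "x \<in> M \<Longrightarrow> y \<in> I \<Longrightarrow> x * y \<in> I" and I_right: "x \<in> M \<Longrightarrow> y \<in> I \<Longrightarrow> y * x \<in> I"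
begin

definition sim :: "'a \<Rightarrow> 'a \<Rightarrow> bool" where "sim x y \<longleftrightarrow> x - y \<in> I \<or> x + y \<in> I"

lemma sim_refl: "sim x x" by (simp add: sim_def I_0)
lemma sim_sym: "sim x y \<Longrightarrow> sim y x" unfolding sim_def using I_uminus[of "x - y"] by (auto simp: add.commute)
lemma sim_trans: assumes "sim x y" "sim y z" shows "sim x z"
proof -
  have "x - y + (y - z) = x - z" "x - y + (y + z) = x + z" "x + y + - (y + z) = x - z" "x + y + - (y - z) = x + z"
    by (simp_all add: algebra_simps)
  then show ?thesis using assms unfolding sim_def by (metis I_add I_uminus)
qed
lemma sim_mult: assumes "sim x y" "z \<in> M" shows "sim (z * x) (z * y)"
  using assms I_left[of z "x - y"] I_left[of z "x + y"] unfolding sim_def by (auto simp: algebra_simps)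
lemma sim_uminus: "sim (- x) y \<longleftrightarrow> sim x y"
proof -
  have "z \<in> I \<longleftrightarrow> - z \<in> I" for z using I_uminus[of z] I_uminus[of "- z"] by auto
  from this[of "x + y"] this[of "x - y"] show ?thesis by (auto simp: sim_def)
qed

definition saturated :: "'a set \<Rightarrow> bool" where
  "saturated X \<longleftrightarrow> X \<subseteq> M \<and> (\<forall>z\<in>X. \<forall>y\<in>M. sim y z \<longrightarrow> y \<in> X)"

text \<open>The class of \<open>x\<close> is represented by left multiplication on saturated sets (Cayley's theorem), which yields elements of a monoid as a type even though \<open>M\<close> and \<open>I\<close> are only sets.\<close>

definition cay :: "'a \<Rightarrow> 'a set endo" where
  "cay x = Endo (\<lambda>X. if saturated X then {y \<in> M. \<exists>z\<in>X. sim y (x * z)} else X)"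

lemma ap_cay: "saturated X \<Longrightarrow> ap (cay x) X = {y \<in> M. \<exists>z\<in>X. sim y (x * z)}"
  "\<not> saturated X \<Longrightarrow> ap (cay x) X = X"
  by (simp_all add: cay_def)

lemma saturated_cay: "saturated X \<Longrightarrow> saturated (ap (cay x) X)"
  using sim_trans by (auto simp: ap_cay saturated_def)

lemma cay_mult: assumes x: "x \<in> M" and y: "y \<in> M" shows "cay (x * y) = cay x * cay y"
proof (rule endo_eqI)
  fix X
  show "ap (cay (x * y)) X = ap (cay x * cay y) X"
  proof (cases "saturated X")
    case True
    then have XM: "z \<in> M" if "z \<in> X" for z using that by (auto simp: saturated_def)
    have "(\<exists>z\<in>X. sim w (x * y * z)) \<longleftrightarrow> (\<exists>u\<in>M. (\<exists>z\<in>X. sim u (y * z)) \<and> sim w (x * u))" for w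
    proof
      assume "\<exists>z\<in>X. sim w (x * y * z)"
      then obtain z where z: "z \<in> X" "sim w (x * (y * z))" by (auto simp: mult.assoc)
      moreover have "y * z \<in> M" using XM[OF z(1)] y by (rule M_mult[rotated])
      ultimately show "\<exists>u\<in>M. (\<exists>z\<in>X. sim u (y * z)) \<and> sim w (x * u)" using sim_refl by blast
    next
      assume "\<exists>u\<in>M. (\<exists>z\<in>X. sim u (y * z)) \<and> sim w (x * u)"
      then obtain u z where "z \<in> X" "sim u (y * z)" "sim w (x * u)" by blast
      then have "sim (x * u) (x * y * z)" using sim_mult[OF _ x, of u "y * z"] by (simp add: mult.assoc)
      with \<open>sim w (x * u)\<close> have "sim w (x * y * z)" by (rule sim_trans)
      then show "\<exists>z\<in>X. sim w (x * y * z)" using \<open>z \<in> X\<close> by blast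
    qed
    then show ?thesis using saturated_cay[OF True, of y] by (auto simp: ap_cay True)
  qed (simp add: ap_cay)
qed

lemma cay_1: "cay 1 = 1"
proof (rule endo_eqI)
  fix X show "ap (cay 1) X = ap 1 X"
    by (cases "saturated X") (auto simp: ap_cay saturated_def intro: sim_refl)
qed

lemma cay_eq_iff: assumes x: "x \<in> M" and y: "y \<in> M" shows "cay x = cay y \<longleftrightarrow> sim x y"
proof
  assume e: "cay x = cay y"
  (* the class of 1 recovers an element from its left multiplication *)
  let ?X = "{z \<in> M. sim z 1}"
  have X: "saturated ?X" using sim_trans by (auto simp: saturated_def)
  have 1: "1 \<in> ?X" using M_1 sim_refl by simp
  have "x \<in> ap (cay x) ?X" using x 1 sim_refl[of x] unfolding ap_cay(1)[OF X] by (auto intro!: bexI[of _ 1])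
  then have "x \<in> ap (cay y) ?X" by (simp add: e)
  then obtain z where z: "sim z 1" "sim x (y * z)" unfolding ap_cay(1)[OF X] by blast
  then show "sim x y" using sim_mult[OF z(1) y] sim_trans[of x "y * z" y] by simp
next
  assume s: "sim x y"
  have r: "sim (x * z) (y * z)" if "z \<in> M" for z
    using s that I_right[of z "x - y"] I_right[of z "x + y"] unfolding sim_def by (auto simp: algebra_simps)
  show "cay x = cay y"
  proof (rule endo_eqI)
    fix X
    show "ap (cay x) X = ap (cay y) X"
    proof (cases "saturated X")
      case True
      then have "z \<in> M" if "z \<in> X" for z using that by (auto simp: saturated_def)
      then have "sim w (x * z) \<longleftrightarrow> sim w (y * z)" if "z \<in> X" for w z
        using r[of z] that sim_trans sim_sym by blast
      then show ?thesis by (auto simp: ap_cay True)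
    qed (simp add: ap_cay)
  qed
qed

lemma cay_uminus: "x \<in> M \<Longrightarrow> cay (- x) = cay x"
  by (simp add: cay_eq_iff M_uminus sim_uminus sim_refl)

lemma cay_eqI: "x \<in> M \<Longrightarrow> y \<in> M \<Longrightarrow> x - y \<in> I \<Longrightarrow> cay x = cay y"
  by (simp add: cay_eq_iff sim_def)

lemma cay_zero_iff: "x \<in> M \<Longrightarrow> cay x = cay 0 \<longleftrightarrow> x \<in> I"
  using I_M I_0 by (subst cay_eq_iff) (auto simp: sim_def)

end

section \<open>The module at q = 1\<close>

interpretation H: hecke_clifford "1 :: complex" 1 by standard simp

interpretation Z: sign_quotient UNIV "{0 :: (dword, complex) lop}"
  by standard auto

lemma Zcay_eq: "Z.cay x = Z.cay y \<longleftrightarrow> x = y \<or> x = - y"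
  by (simp add: Z.cay_eq_iff Z.sim_def eq_neg_iff_add_eq_0)

lemma Zcay_mult: "Z.cay x * Z.cay y = Z.cay (x * y)" by (simp add: Z.cay_mult)
lemma Zcay_uminus: "Z.cay (- x) = Z.cay x" by (simp add: Zcay_eq)

abbreviation "ZT i \<equiv> Z.cay (H.T i)"
abbreviation "ZC i \<equiv> Z.cay (H.c i)"

lemma typeB_Z: "typeB ZT ZC a n"
proof
  fix i j
  show "ZT i * ZT i = 1" using H.T_sq[of i] by (simp add: Zcay_mult Z.cay_1)
  show "ZT i * ZT (Suc i) * ZT i = ZT (Suc i) * ZT i * ZT (Suc i)" by (simp add: Zcay_mult H.T_braid)
  show "ZC i * ZC i = 1" by (simp add: Zcay_mult cop_sq Zcay_uminus Z.cay_1)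
  show "ZC i * ZC j = ZC j * ZC i" using H.c_anti[of i j] by (cases "i = j") (simp_all add: Zcay_mult Zcay_eq)
  show "ZT i * ZC i = ZC (Suc i) * ZT i" by (simp add: Zcay_mult H.Tc)
  assume "j \<noteq> i" "j \<noteq> Suc i"
  then show "ZT i * ZC j = ZC j * ZT i" by (simp add: Zcay_mult H.T_c_far)
next
  fix i j assume "Suc i < j"
  then have "H.T i * H.T j = H.T j * H.T i" by (rule top_top_far)
  then show "ZT i * ZT j = ZT j * ZT i" by (simp add: Zcay_mult)
qed

lemma endo_mult: "Endo f * z = Endo (\<lambda>x. f (ap z x))" "z * Endo f = Endo (\<lambda>x. ap z (f x))"
  by (simp_all add: times_endo_def)

definition ZP :: "nat \<Rightarrow> nat \<Rightarrow> ((dword, complex) lop set endo \<times> int endo) set" where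
  "ZP n = typeB.PB ZT ZC 0"

text \<open>\<open>x\<close> is, up to sign, a product of generators with underlying signed permutation \<open>f\<close>.\<close>

definition rep :: "nat \<Rightarrow> nat \<Rightarrow> (dword, complex) lop \<Rightarrow> (int \<Rightarrow> int) \<Rightarrow> bool" where
  "rep n k x f \<longleftrightarrow> x \<in> H.A k \<and> (Z.cay x, Endo f) \<in> ZP n k"

lemma app_T_classical:
  fixes w :: dword
  shows "app (H.T i) \<phi> w = \<phi> (w(i := w (Suc i), Suc i := w i)) \<or> app (H.T i) \<phi> w = - \<phi> (w(i := w (Suc i), Suc i := w i))"
  unfolding app_top' by (cases "w i"; cases "w (Suc i)") (auto simp: tker_def hker_def)

lemma app_c_classical:
  fixes w :: dword
  shows "app (H.c i) \<phi> w = \<phi> (w(i := (fst (w i), \<not> snd (w i)))) \<or> app (H.c i) \<phi> w = - \<phi> (w(i := (fst (w i), \<not> snd (w i))))"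
proof -
  have "wsg w j * dsg b = (1 :: complex) \<or> wsg w j * dsg b = (- 1 :: complex)" for j b
  proof (induction j arbitrary: b)
    case (Suc j)
    show ?case using Suc[of "snd (w j)"] by (cases b) (auto simp: wsg_Suc dsg_def)
  qed (simp add: wsg_def dsg_def)
  from this[of i "snd (w i)"] show ?thesis unfolding cop.rep_eq by (auto simp del: fun_upd_apply)
qed

context fixes n :: nat begin

interpretation P: typeB ZT ZC 0 n rewrites "P.PB = ZP n"
  by (rule typeB_Z) (simp add: ZP_def)

lemma rep_sperm: "rep n k x f \<Longrightarrow> f \<in> sperm 0 k"
  using P.PB_snd[of "(Z.cay x, Endo f)" k] by (simp add: rep_def)

lemma rep_mult: "rep n k x f \<Longrightarrow> rep n k y g \<Longrightarrow> rep n k (x * y) (f \<circ> g)"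
  using P.PB_mult[of "(Z.cay x, Endo f)" k "(Z.cay y, Endo g)"]
  by (simp add: rep_def H.A_mult times_prod_def Zcay_mult endo_mult o_def)

lemma rep_T: "1 \<le> i \<Longrightarrow> Suc i \<le> k \<Longrightarrow> rep n k (H.T i) (sw (int i) (int i + 1))"
  using P.PB_gen_S[of i k] by (simp add: rep_def H.A_T SE_def)
lemma rep_c: "1 \<le> i \<Longrightarrow> i \<le> k \<Longrightarrow> rep n k (H.c i) (sw (int i) (- int i))"
  using P.PB_gen_C[of i k] by (simp add: rep_def H.A_c CE_def)
lemma rep_1: "rep n k 1 id"
  using P.PB_1[of k] by (simp add: rep_def one_prod_def one_endo_def Z.cay_1 id_def)
lemma rep_uminus: "rep n k x f \<Longrightarrow> rep n k (- x) f" by (simp add: rep_def H.A_uminus Zcay_uminus)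
lemma rep_mono: "rep n k x f \<Longrightarrow> k \<le> l \<Longrightarrow> rep n l x f"
  using P.PB_mono by (auto simp: rep_def intro: H.A_mono)

text \<open>One induction over the generators gives everything that is needed about monomials at \<open>q = 1\<close>: a representative, its behaviour under the parity automorphism, and its action on the word whose letters are their positions.\<close>

lemma PB_rep: "p \<in> ZP n k \<Longrightarrow> \<exists>x. rep n k x (ap (snd p)) \<and> fst p = Z.cay x \<and>
    (k \<le> N \<longrightarrow> H.th N x = x \<or> H.th N x = - x) \<and> (\<forall>\<phi>. app x \<phi> (\<lambda>j. (j, False)) =
        \<phi> (\<lambda>j. let m = inv_into UNIV (ap (snd p)) (int j) in (nat \<bar>m\<bar>, m < 0)) \<or>
       app x \<phi> (\<lambda>j. (j, False)) = - \<phi> (\<lambda>j. let m = inv_into UNIV (ap (snd p)) (int j) in (nat \<bar>m\<bar>, m < 0)))"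
  (is "_ \<Longrightarrow> \<exists>x. ?Q p x")
proof (induction rule: P.PB_induct)
  case 1
  have "inv_into UNIV (\<lambda>x :: int. x) m = m" for m by (rule inv_f_eq) auto
  then have "?Q 1 1" using rep_1[of k] by (simp add: one_prod_def Z.cay_1 one_endo_def app_simps Let_def id_def)
  then show ?case by blast
next
  case (S z i)
  then obtain x where x: "?Q z x" by blast
  let ?f = "ap (snd z)" and ?s = "sw (int i) (int i + 1)"
  have f: "?f \<in> sperm 0 k" using x rep_sperm by blast
  have s: "?s \<in> sperm 0 k" using S by (intro sperm_sw) auto
  have inv: "inv_into UNIV (\<lambda>x. ?s (?f x)) m = inv_into UNIV ?f (?s m)" for m
  proof (rule inv_f_eq)
    show "inj (\<lambda>x. ?s (?f x))" using sperm_comp[OF s f] by (auto simp: sperm_def odd_bij_def bij_def o_def)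
    show "?s (?f (inv_into UNIV ?f (?s m))) = m" using S sperm_inv(3)[OF f] by simp
  qed
  let ?W = "\<lambda>j. let m = inv_into UNIV ?f (int j) in (nat \<bar>m\<bar>, m < 0)"
  let ?W' = "\<lambda>j. let m = inv_into UNIV ?f (?s (int j)) in (nat \<bar>m\<bar>, m < 0)"
  have W: "?W' = ?W(i := ?W (Suc i), Suc i := ?W i)"
    using S by (auto simp: fun_eq_iff sw_def add.commute)
  have ap: "app (H.T i) \<phi> ?W = \<phi> ?W' \<or> app (H.T i) \<phi> ?W = - \<phi> ?W'" for \<phi>
    unfolding W by (rule app_T_classical)
  have "app (H.T i * x) \<phi> (\<lambda>j. (j, False)) = \<phi> ?W' \<or> app (H.T i * x) \<phi> (\<lambda>j. (j, False)) = - \<phi> ?W'" for \<phi>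
  proof -
    have e: "app (H.T i * x) \<phi> (\<lambda>j. (j, False)) = app x (app (H.T i) \<phi>) (\<lambda>j. (j, False))" by (simp add: app_simps)
    have "app x (app (H.T i) \<phi>) (\<lambda>j. (j, False)) = app (H.T i) \<phi> ?W \<or> app x (app (H.T i) \<phi>) (\<lambda>j. (j, False)) = - app (H.T i) \<phi> ?W"
      using x by blast
    then show ?thesis unfolding e using ap[of \<phi>] by (elim disjE) simp_all
  qed
  moreover have "rep n k (H.T i * x) (?s \<circ> ?f)" using x S by (intro rep_mult rep_T) auto
  moreover have "k \<le> N \<longrightarrow> H.th N (H.T i * x) = H.T i * x \<or> H.th N (H.T i * x) = - (H.T i * x)"
    using x S by (auto simp: H.th_mult H.th_T)
  ultimately have "?Q ((ZT i, SE i) * z) (H.T i * x)"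
    using x by (simp add: times_prod_def SE_def endo_mult o_def inv Zcay_mult)
  then show ?case by blast
next
  case (C z i)
  then obtain x where x: "?Q z x" by blast
  let ?f = "ap (snd z)" and ?s = "sw (int i) (- int i)"
  have f: "?f \<in> sperm 0 k" using x rep_sperm by blast
  have s: "?s \<in> sperm 0 k" using C by (intro sperm_sw) auto
  have inv: "inv_into UNIV (\<lambda>x. ?s (?f x)) m = inv_into UNIV ?f (?s m)" for m
  proof (rule inv_f_eq)
    show "inj (\<lambda>x. ?s (?f x))" using sperm_comp[OF s f] by (auto simp: sperm_def odd_bij_def bij_def o_def)
    show "?s (?f (inv_into UNIV ?f (?s m))) = m" using C sperm_inv(3)[OF f] by simp
  qed
  let ?W = "\<lambda>j. let m = inv_into UNIV ?f (int j) in (nat \<bar>m\<bar>, m < 0)"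
  let ?W' = "\<lambda>j. let m = inv_into UNIV ?f (?s (int j)) in (nat \<bar>m\<bar>, m < 0)"
  have odd: "odd_bij (inv_into UNIV ?f)" using sperm_inv(1)[OF f] by (simp add: sperm_def)
  have "inv_into UNIV ?f (int i) \<noteq> 0" using odd_bij_nz[OF odd] C by simp
  then have W: "?W' = ?W(i := (fst (?W i), \<not> snd (?W i)))"
    using C odd_bij_neg[OF odd] by (auto simp: fun_eq_iff sw_def Let_def)
  have ap: "app (H.c i) \<phi> ?W = \<phi> ?W' \<or> app (H.c i) \<phi> ?W = - \<phi> ?W'" for \<phi>
    unfolding W by (rule app_c_classical)
  have "app (H.c i * x) \<phi> (\<lambda>j. (j, False)) = \<phi> ?W' \<or> app (H.c i * x) \<phi> (\<lambda>j. (j, False)) = - \<phi> ?W'" for \<phi>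
  proof -
    have e: "app (H.c i * x) \<phi> (\<lambda>j. (j, False)) = app x (app (H.c i) \<phi>) (\<lambda>j. (j, False))" by (simp add: app_simps)
    have "app x (app (H.c i) \<phi>) (\<lambda>j. (j, False)) = app (H.c i) \<phi> ?W \<or> app x (app (H.c i) \<phi>) (\<lambda>j. (j, False)) = - app (H.c i) \<phi> ?W"
      using x by blast
    then show ?thesis unfolding e using ap[of \<phi>] by (elim disjE) simp_all
  qed
  moreover have "rep n k (H.c i * x) (?s \<circ> ?f)" using x C by (intro rep_mult rep_c) auto
  moreover have "k \<le> N \<longrightarrow> H.th N (H.c i * x) = H.c i * x \<or> H.th N (H.c i * x) = - (H.c i * x)"
    using x C by (auto simp: H.th_mult H.th_c)
  ultimately have "?Q ((ZC i, CE i) * z) (H.c i * x)"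
    using x by (simp add: times_prod_def CE_def endo_mult o_def inv Zcay_mult)
  then show ?case by blast
qed

lemma rep_th: assumes "rep n k x f" "k \<le> N" shows "H.th N x = x \<or> H.th N x = - x"
proof -
  obtain y where y: "Z.cay x = Z.cay y" "H.th N y = y \<or> H.th N y = - y"
    using PB_rep[of "(Z.cay x, Endo f)" k N] assms by (auto simp: rep_def)
  then show ?thesis by (auto simp: Zcay_eq H.th_uminus)
qed

text \<open>The word that the monomial with signed permutation \<open>f\<close> makes out of the standard word: the sign of an entry becomes a dot.\<close>

definition word_of :: "(int \<Rightarrow> int) \<Rightarrow> dword" where
  "word_of f = (\<lambda>j. let m = inv_into UNIV f (int j) in (nat \<bar>m\<bar>, m < 0))"

lemma rep_app: assumes "rep n k x f"
  shows "app x \<phi> (\<lambda>j. (j, False)) = \<phi> (word_of f) \<or> app x \<phi> (\<lambda>j. (j, False)) = - \<phi> (word_of f)"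
proof -
  obtain y where y: "Z.cay x = Z.cay y" "\<forall>\<phi>. app y \<phi> (\<lambda>j. (j, False)) = \<phi> (word_of f) \<or> app y \<phi> (\<lambda>j. (j, False)) = - \<phi> (word_of f)"
    using PB_rep[of "(Z.cay x, Endo f)" k 0] assms unfolding rep_def word_of_def by auto
  then show ?thesis by (auto simp: Zcay_eq app_simps)
qed

lemma word_of_inj: assumes "f \<in> sperm 0 n" "g \<in> sperm 0 n" "word_of f = word_of g" shows "f = g"
proof -
  have e: "inv_into UNIV f (int j) = inv_into UNIV g (int j)" for j
  proof -
    have "word_of f j = word_of g j" by (simp add: assms(3))
    then show ?thesis by (auto simp: word_of_def Let_def split: if_splits)
  qed
  have o: "odd_bij (inv_into UNIV f)" "odd_bij (inv_into UNIV g)" using assms sperm_inv(1) sperm_odd by blast+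
  have "inv_into UNIV f x = inv_into UNIV g x" for x
    using e[of "nat x"] e[of "nat (- x)"] odd_bij_neg[OF o(1), of x] odd_bij_neg[OF o(2), of x] by (cases "x \<ge> 0") auto
  then have "g (inv_into UNIV f (f y)) = g (inv_into UNIV g (f y))" for y by simp
  then show ?thesis using sperm_inv(2)[OF assms(1)] sperm_inv(3)[OF assms(2)] by (auto simp: fun_eq_iff)
qed

text \<open>Different signed permutations lead to different words, and these are separated by indicator functions.\<close>

lemma rep_independent:
  assumes "finite F" "\<And>f. f \<in> F \<Longrightarrow> rep n n (x f) f" "(\<Sum>f\<in>F. lscal (cf f) * x f) = 0" "g \<in> F"
  shows "cf g = 0"
proof -
  (* the indicator function of the word of g separates g from the other states *)
  let ?w = "\<lambda>j. (j, False)" and ?\<phi> = "\<lambda>w. if w = word_of g then 1 else (0 :: complex)"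
  have "app (\<Sum>f\<in>F. lscal (cf f) * x f) \<phi> w = (\<Sum>f\<in>F. cf f * app (x f) \<phi> w)" for \<phi> w
    using assms(1) by (induction F rule: finite_induct) (simp_all add: app_simps app_scale)
  then have "(\<Sum>f\<in>F. cf f * app (x f) ?\<phi> ?w) = 0" by (simp add: assms(3) app_simps)
  moreover have "app (x f) ?\<phi> ?w = 0" if "f \<in> F - {g}" for f
  proof -
    have "word_of f \<noteq> word_of g" using word_of_inj[of f g] that assms(2,4) rep_sperm by blast
    then show ?thesis using rep_app[OF assms(2), of f ?\<phi>] that by auto
  qed
  ultimately have "cf g * app (x g) ?\<phi> ?w = 0" using assms(1,4) by (simp add: sum.remove)
  then show ?thesis using rep_app[OF assms(2)[OF assms(4)], of ?\<phi>] by auto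
qed

lemma rep_exists: "f \<in> sperm 0 n \<Longrightarrow> \<exists>x. rep n n x f"
  using P.PB_surj[of f n] PB_rep[of _ n] by fastforce

end

lemma rep_lift: assumes "p \<in> ZP n k" obtains x where "rep n k x (ap (snd p))" "fst p = Z.cay x"
  using PB_rep[OF assms] by blast

text \<open>The three cases of \<open>PB_cases\<close> correspond to the three values that define \<open>eps\<close>; the first two are the ones where \<open>f\<close> fixes the last strand up to sign.\<close>

lemma rep_eps:
  assumes n: "n = Suc m" and x: "rep n n x f"
  shows "if \<bar>f (int n)\<bar> = int n then H.eps n x = 0 else rep n n (H.eps n x) (sw (int n) (f (int n)) \<circ> f)"
proof -
  interpret P: typeB ZT ZC 0 n rewrites "P.PB = ZP n"
    by (rule typeB_Z) (simp add: ZP_def)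
  have fixn: "g (int n) = int n" if "rep n m y g" for y g
    using rep_sperm[OF that] n by (intro sperm_fix) auto
  have pm: "H.eps n x = H.eps n y \<or> H.eps n x = - H.eps n y" if "Z.cay x = Z.cay y" "y \<in> H.A n" for y
  proof -
    have "H.eps n (- y) = - H.eps n y" using H.eps_scal[of y m "- 1"] that n by (simp add: lscal_uminus)
    then show ?thesis using that by (auto simp: Zcay_eq)
  qed
  have "(Z.cay x, Endo f) \<in> ZP n (Suc m)" using x n by (simp add: rep_def)
  then show ?thesis
  proof (rule P.PB_cases)
    assume a: "(Z.cay x, Endo f) \<in> ZP n m"
    obtain y where "rep n m y (ap (snd (Z.cay x, Endo f)))" "fst (Z.cay x, Endo f) = Z.cay y" by (rule rep_lift[OF a])
    then have y: "rep n m y f" "Z.cay x = Z.cay y" by simp_all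
    then have "H.eps n y = 0" using H.eps_B1 n by (auto simp: rep_def)
    then show ?thesis using fixn[OF y(1)] pm[OF y(2)] y(1) n by (auto simp: rep_def H.A_Suc)
  next
    fix p assume p: "p \<in> ZP n m" "(Z.cay x, Endo f) = p * (ZC (Suc m), CE (Suc m))"
    obtain y where y: "rep n m y (ap (snd p))" "fst p = Z.cay y" using rep_lift[OF p(1)] by blast
    have f: "Z.cay x = Z.cay (y * H.c n)" "f = (\<lambda>x. ap (snd p) (sw (int n) (- int n) x))"
      using p(2) y n by (simp_all add: times_prod_def endo_mult CE_def Zcay_mult)
    have o: "odd_bij (ap (snd p))" using rep_sperm[OF y(1)] sperm_odd by blast
    have "H.eps n (y * H.c n) = 0" using H.eps_B2[of y m] n y by (auto simp: rep_def)
    moreover have "y \<in> H.A n" using y(1) n by (simp add: rep_def H.A_Suc)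
    then have "y * H.c n \<in> H.A n" using n by (intro H.A_mult H.A_c) auto
    ultimately have "H.eps n x = 0" using pm[OF f(1)] by auto
    moreover have "f (int n) = - int n" using fixn[OF y(1)] odd_bij_neg[OF o] by (simp add: f(2))
    ultimately show ?thesis by simp
  next
    fix p p' assume p: "0 < m" "p \<in> ZP n m" "p' \<in> ZP n m" "(Z.cay x, Endo f) = p * (ZT m, SE m) * p'"
    obtain y where y: "rep n m y (ap (snd p))" "fst p = Z.cay y" using rep_lift[OF p(2)] by blast
    obtain w where w: "rep n m w (ap (snd p'))" "fst p' = Z.cay w" using rep_lift[OF p(3)] by blast
    let ?g = "ap (snd p)" and ?h = "ap (snd p')" and ?s = "sw (int m) (int m + 1)"
    have f: "Z.cay x = Z.cay (y * H.T m * w)" "f = ?g \<circ> ?s \<circ> ?h"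
      using p(4) y w n by (simp_all add: times_prod_def endo_mult SE_def Zcay_mult o_def)
    have o: "odd_bij ?g" using rep_sperm[OF y(1)] sperm_odd by blast
    have N: "int m + 1 = int n" using n by simp
    have fn: "f (int n) = ?g (int m)" using fixn[OF w(1)] by (simp add: f(2) N)
    have "\<bar>?g (int m)\<bar> \<le> int m" using sperm_range[OF rep_sperm[OF y(1)], of "int m"] p(1) by simp
    then have ne: "\<bar>f (int n)\<bar> \<noteq> int n" using fn n by simp
    have "y \<in> H.A n" "w \<in> H.A n" using y(1) w(1) n by (simp_all add: rep_def H.A_Suc)
    then have "y * H.T m * w \<in> H.A n" using n p(1) by (intro H.A_mult H.A_T) auto
    note pm' = pm[OF f(1) this]
    have "H.eps n (y * H.T m * w) = y * w" using H.eps_B3[of m y w] y w n p(1) by (simp add: rep_def)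
    moreover have "rep n n (y * w) (?g \<circ> ?h)" using rep_mono[OF rep_mult[OF y(1) w(1)], of n] n by simp
    ultimately have r: "rep n n (H.eps n x) (?g \<circ> ?h)" using pm' rep_uminus by auto
    have "sw (int n) (?g (int m)) (?g (?s t)) = ?g t" for t
    proof -
      have "?g (sw (int n) (int m) (?s t)) = sw (?g (int n)) (?g (int m)) (?g (?s t))" by (rule sw_conj[OF o])
      moreover have "sw (int n) (int m) = ?s" using n p(1) by (simp add: N sw_sym)
      ultimately show ?thesis using p(1) by (simp add: fixn[OF y(1)])
    qed
    then have "sw (int n) (f (int n)) \<circ> f = ?g \<circ> ?h" by (simp add: fn) (simp add: f(2) fun_eq_iff)
    then show ?thesis using r ne by simp
  qed (use n in simp_all)
qed

section \<open>Reduction of power series to constant terms\<close>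

definition qF :: "complex fps" where "qF = 1 + fps_X"
definition pF :: "complex fps" where "pF = inverse (1 + fps_X)"

interpretation F: hecke_clifford qF pF
  unfolding qF_def pF_def by standard (simp add: inverse_mult_eq_1')

lemma qF_pF_at_0: "fps_nth qF 0 = 1" "fps_nth pF 0 = 1"
  by (simp_all add: qF_def pF_def)

text \<open>Operators are linear over the power series ring, so the constant term of a value depends only on the constant terms of the function.\<close>

lemma app_at_0: "fps_nth (app y \<phi> w) 0 = fps_nth (app y (\<lambda>v. fps_const (fps_nth (\<phi> v) 0)) w) 0"
  for y :: "('i, complex fps) lop"
proof -
  have "\<phi> v = fps_const (fps_nth (\<phi> v) 0) + fps_X * fps_shift 1 (\<phi> v)" for v
    by (rule fps_ext) (auto simp: fps_X_mult_nth)
  then have "\<phi> = (\<lambda>v. fps_const (fps_nth (\<phi> v) 0) + fps_X * fps_shift 1 (\<phi> v))" by blast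
  then have "app y \<phi> w = app y (\<lambda>v. fps_const (fps_nth (\<phi> v) 0)) w + fps_X * app y (\<lambda>v. fps_shift 1 (\<phi> v)) w"
    by (metis (no_types) app_plus app_scale)
  then show ?thesis by simp
qed

text \<open>Reduction at \<open>q = 1\<close>, a ring homomorphism to operators with complex coefficients.\<close>

lift_definition red :: "('i, complex fps) lop \<Rightarrow> ('i, complex) lop" is
  "\<lambda>F \<phi> w. fps_nth (F (\<lambda>v. fps_const (\<phi> v)) w) 0"
proof -
  fix F :: "('i \<Rightarrow> complex fps) \<Rightarrow> 'i \<Rightarrow> complex fps"
  assume a: "(\<forall>f g. F (\<lambda>i. f i + g i) = (\<lambda>i. F f i + F g i)) \<and> (\<forall>a f. F (\<lambda>i. a * f i) = (\<lambda>i. a * F f i))"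
  have "F (\<lambda>v. fps_const (f v + g v)) w = F (\<lambda>v. fps_const (f v)) w + F (\<lambda>v. fps_const (g v)) w" for f g w
    using a by (simp flip: fps_const_add)
  moreover have "F (\<lambda>v. fps_const (b * f v)) w = fps_const b * F (\<lambda>v. fps_const (f v)) w" for b f w
    using a by (simp flip: fps_const_mult)
  ultimately show "(\<forall>f g. (\<lambda>w. fps_nth (F (\<lambda>v. fps_const (f v + g v)) w) 0) =
      (\<lambda>i. fps_nth (F (\<lambda>v. fps_const (f v)) i) 0 + fps_nth (F (\<lambda>v. fps_const (g v)) i) 0)) \<and>
    (\<forall>a f. (\<lambda>w. fps_nth (F (\<lambda>v. fps_const (a * f v)) w) 0) = (\<lambda>i. a * fps_nth (F (\<lambda>v. fps_const (f v)) i) 0))"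
    by simp
qed

lemma red_add: "red (x + y) = red x + red y"
  by (rule lop_eqI) (simp add: red.rep_eq app_simps)
lemma red_mult: "red (x * y) = red x * red y"
  by (rule lop_eqI) (simp add: red.rep_eq app_simps app_at_0[of y "app x _"])
lemma red_0: "red 0 = 0" by (rule lop_eqI) (simp add: red.rep_eq app_simps)
lemma red_1: "red 1 = 1" by (rule lop_eqI) (simp add: red.rep_eq app_simps)
lemma red_lscal: "red (lscal a) = lscal (fps_nth a 0)" by (rule lop_eqI) (simp add: red.rep_eq app_simps)
lemma red_sum: "red (sum f I) = (\<Sum>i\<in>I. red (f i))"
  by (induction I rule: infinite_finite_induct) (simp_all add: red_0 red_add)
lemma dsg_fps: "fps_nth (dsg b) 0 = (dsg b :: complex)" "fps_nth (wsg w i) 0 = (wsg w i :: complex)"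
proof -
  show d: "fps_nth (dsg b) 0 = (dsg b :: complex)" for b by (simp add: dsg_def)
  show "fps_nth (wsg w i) 0 = (wsg w i :: complex)" by (induction i) (simp_all add: wsg_Suc d, simp_all add: wsg_def)
qed
lemma red_c: "red (cop i) = cop i"
  by (rule lop_eqI) (simp add: red.rep_eq cop.rep_eq dsg_fps)
lemma red_pop: "red (pop i) = pop i"
  by (rule lop_eqI) (simp add: red.rep_eq pop.rep_eq dsg_fps)
lemma red_T: "red (F.T i) = H.T i"
  by (rule lop_eqI) (simp add: red.rep_eq top'.rep_eq tker_def hker_def qF_pF_at_0)

lemma red_A: "x \<in> F.A k \<Longrightarrow> red x \<in> H.A k"
  by (induction rule: F.A.induct) (simp_all add: red_lscal red_T red_c red_add red_mult H.A_scal H.A_T H.A_c H.A_add H.A_mult)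

lemma red_surj: "y \<in> H.A k \<Longrightarrow> \<exists>x\<in>F.A k. red x = y"
proof (induction rule: H.A.induct)
  case (A_scal a)
  show ?case by (rule bexI[of _ "lscal (fps_const a)"]) (simp_all add: red_lscal F.A_scal)
next
  case (A_T i) then show ?case using F.A_T[of i k] red_T by blast
next
  case (A_c i) then show ?case using F.A_c[of i k] red_c by blast
next
  case (A_add x y)
  then obtain x' y' where "x' \<in> F.A k" "red x' = x" "y' \<in> F.A k" "red y' = y" by blast
  then show ?case by (intro bexI[of _ "x' + y'"]) (simp_all add: F.A_add red_add)
next
  case (A_mult x y)
  then obtain x' y' where "x' \<in> F.A k" "red x' = x" "y' \<in> F.A k" "red y' = y" by blast
  then show ?case by (intro bexI[of _ "x' * y'"]) (simp_all add: F.A_mult red_mult)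
qed

lemma red_th: "red (F.th N x) = H.th N (red x)"
  by (simp add: F.th_def H.th_def red_mult red_pop)

lemma red_X: "red (F.X k j d) = H.X k j d"
  by (induction k) (simp_all add: red_1 red_c red_T red_mult)

text \<open>The expansion into coset representatives reduces to the corresponding expansion at \<open>q = 1\<close>.\<close>

lemma red_eps: assumes "x \<in> F.A (Suc m)" shows "red (F.eps (Suc m) x) = H.eps (Suc m) (red x)"
proof -
  from F.A_X_decomp[OF assms] obtain a where a: "\<forall>i\<in>F.xidx (Suc m). a i \<in> F.A m"
    and x: "x = (\<Sum>i\<in>F.xidx (Suc m). a i * F.X (Suc m) (fst i) (snd i))" by (elim exE conjE)
  have aF: "a i \<in> F.A m" if "i \<in> F.xidx (Suc m)" for i using a that by (rule bspec)
  have aH: "red (a i) \<in> H.A m" if "i \<in> F.xidx (Suc m)" for i by (rule red_A[OF aF[OF that]])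
  have "red x = (\<Sum>i\<in>F.xidx (Suc m). red (a i) * H.X (Suc m) (fst i) (snd i))"
    by (simp only: x red_sum red_mult red_X)
  from H.eps_eq[OF aH this]
  have "H.eps (Suc m) (red x) = (\<Sum>i\<in>F.xidx m. red (a i) * H.X m (fst i) (snd i))" .
  moreover from F.eps_eq[OF aF x]
  have "F.eps (Suc m) x = (\<Sum>i\<in>F.xidx m. a i * F.X m (fst i) (snd i))" .
  ultimately show ?thesis by (simp only: red_sum red_mult red_X)
qed

lemma lscal_cancel: assumes "d \<noteq> (0 :: complex fps)" "lscal d * x = 0" shows "x = 0"
proof (rule lop_eqI)
  fix f w
  have "app (lscal d * x) f w = 0" by (simp add: assms app_simps)
  then show "app x f w = app 0 f w" using assms(1) by (simp add: app_simps app_scale)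
qed

section \<open>Passing from the quantum relations to q = 1\<close>

definition eval1 :: "complex poly \<Rightarrow> complex" where "eval1 f = poly f 1"
definition expand1 :: "complex poly \<Rightarrow> complex fps" where "expand1 f = fps_of_poly (pcompose f [:1, 1:])"

lemma eval1_hom: "coeff_hom eval1" by standard (simp_all add: eval1_def)
lemma expand1_hom: "coeff_hom expand1"
proof
  have "pcompose 1 [:1, 1:] = (1 :: complex poly)" by (metis pcompose_const one_pCons)
  then show "expand1 1 = 1" by (simp add: expand1_def)
qed (simp_all add: expand1_def pcompose_add pcompose_mult fps_of_poly_add fps_of_poly_mult)
lemma eval1_q: "eval1 [:0, 1:] = 1" by (simp add: eval1_def)
lemma expand1_q: "expand1 [:0, 1:] = qF"
  by (simp add: expand1_def pcompose_pCons fps_of_poly_pCons qF_def)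
lemma expand1_at_0: "fps_nth (expand1 f) 0 = eval1 f"
  by (simp add: expand1_def eval1_def fps_of_poly_nth poly_0_coeff_0[symmetric] poly_pcompose)
lemma expand1_nz: "f \<noteq> 0 \<Longrightarrow> expand1 f \<noteq> 0"
  by (simp add: expand1_def pcompose_eq_0_iff)

context fixes r s :: nat begin

lemmas Faw = F.aw_simps[OF expand1_hom expand1_q, where r = r and s = s]
lemmas Haw = H.aw_simps[OF eval1_hom eval1_q, where r = r and s = s]

abbreviation (input) "actF \<equiv> F.act expand1 (F.gact r s)"
abbreviation (input) "actH \<equiv> H.act eval1 (H.gact r s)"

lemma red_gact: assumes "g \<in> (QG r s)" "x \<in> F.A (r + s)" shows "red (F.gact r s g x) = H.gact r s g (red x)"
proof (cases g)
  case Qegen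
  then obtain m where "r + s = Suc m" using assms by (cases "r + s") (auto simp: qbc_gens_iff)
  then show ?thesis using red_eps[of x m] assms Qegen by simp
qed (simp_all add: red_mult red_T red_c red_th)

lemma F_single: "actF (Poly_Mapping.single w k) x = lscal (expand1 k) * foldr (F.gact r s) (letters w) x"
  by (rule F.act_single[OF expand1_hom]) (erule F.gact_linear)
lemma H_single: "actH (Poly_Mapping.single w k) x = lscal (eval1 k) * foldr (H.gact r s) (letters w) x"
  by (rule H.act_single[OF eval1_hom]) (erule H.gact_linear)

lemma red_foldr: "set w \<subseteq> (QG r s) \<Longrightarrow> x \<in> F.A (r + s) \<Longrightarrow>
   foldr (F.gact r s) w x \<in> F.A (r + s) \<and> red (foldr (F.gact r s) w x) = foldr (H.gact r s) w (red x)"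
proof (induction w)
  case (Cons g w)
  then have "foldr (F.gact r s) w x \<in> F.A (r + s)" "g \<in> (QG r s)" by auto
  then show ?case using Cons F.linear_onD(1)[OF F.gact_linear] red_gact by simp
qed simp

lemma red_act: "u \<in> FC (QG r s) \<Longrightarrow> x \<in> F.A (r + s) \<Longrightarrow> red (actF u x) = actH u (red x)"
proof (induction u rule: FC_induct)
  case (single w a)
  then show ?case using red_foldr[of "letters w" x] by (simp add: F_single H_single red_mult red_lscal expand1_at_0)
qed (simp_all add: Faw Haw red_0 red_add)

text \<open>The elements that act by zero once their denominators are cleared.\<close>

definition torsion :: "(qbc_gen, ratfun) free set" where
  "torsion = {u \<in> FC (QG r s). \<exists>d u'. d \<noteq> 0 \<and> u' \<in> FC (QG r s) \<and> free_map id to_fract u' = scal (to_fract d) * u \<and>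
     (\<forall>x\<in>F.A (r + s). actF u' x = 0)}"

lemma torsionI: "u \<in> FC (QG r s) \<Longrightarrow> d \<noteq> 0 \<Longrightarrow> u' \<in> FC (QG r s) \<Longrightarrow> free_map id to_fract u' = scal (to_fract d) * u \<Longrightarrow>
     (\<And>x. x \<in> F.A (r + s) \<Longrightarrow> actF u' x = 0) \<Longrightarrow> u \<in> torsion"
  unfolding torsion_def by blast

lemma torsionE: assumes "u \<in> torsion"
  obtains d u' where "u \<in> FC (QG r s)" "d \<noteq> 0" "u' \<in> FC (QG r s)" "free_map id to_fract u' = scal (to_fract d) * u"
     "\<And>x. x \<in> F.A (r + s) \<Longrightarrow> actF u' x = 0"
  using assms unfolding torsion_def by blast

lemma clear_denominators:
  fixes u :: "(qbc_gen, ratfun) free"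
  assumes "u \<in> FC (QG r s)"
  obtains d u' where "d \<noteq> 0" "u' \<in> FC (QG r s)" "free_map id to_fract u' = scal (to_fract d) * u"
  using common_denominator[OF assms, of "\<lambda>d. d \<noteq> 0"] ratfun_denominator by auto

lemma scal_swap: "u * (scal a * v) = scal a * (u * v)"
proof -
  have "u * (scal a * v) = (u * scal a) * v" by (simp only: mult.assoc)
  also have "\<dots> = (scal a * u) * v" by (simp only: scal_central)
  finally show ?thesis by (simp only: mult.assoc)
qed

lemma Iq_torsion: "(Iq r s) \<subseteq> torsion"
proof (rule relation_ideal_minimal)
  fix u v assume r: "qbc_rel r s u v"
  then show FC: "u \<in> FC (QG r s) \<and> v \<in> FC (QG r s)" by (rule qbc_rel_FC)
  have "F.acts expand1 r s (u - v) (\<lambda>x. 0)" by (rule F.qbc_rel_acts[OF expand1_hom expand1_q r])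
  then show "u - v \<in> torsion" unfolding F.acts_def[OF expand1_hom expand1_q] torsion_def by auto
next
  interpret QFi: typed_image "FC (QG r s)" UNIV scal id "free_superalgebra (QG r s) qbc_par :: (ratfun, (qbc_gen, ratfun) free) superalgebra"
    by (rule typed_free)
  have lin: "F.linear_on (r + s) (actF u)" if "u \<in> FC (QG r s)" for u by (rule F.aw_linear[OF expand1_hom expand1_q that])
  have mult: "actF (u * v) x = actF u (actF v x)" if "u \<in> FC (QG r s)" "v \<in> FC (QG r s)" "x \<in> F.A (r + s)" for u v x
    by (rule F.aw_mult[OF expand1_hom expand1_q that])
  show "QFi.tideal torsion" unfolding QFi.tideal_def
  proof (intro conjI ballI)
    show "torsion \<subseteq> FC (QG r s)" by (auto simp: torsion_def)
    show "0 \<in> torsion" by (rule torsionI[of 0 1 0]) (simp_all add: Faw)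
    fix x assume x: "x \<in> torsion"
    obtain d x' where d: "x \<in> FC (QG r s)" "d \<noteq> 0" "x' \<in> FC (QG r s)" "free_map id to_fract x' = scal (to_fract d) * x"
       "\<And>y. y \<in> F.A (r + s) \<Longrightarrow> actF x' y = 0" using x by (rule torsionE) blast
    have "actF (scal (- 1) * x') y = 0" if "y \<in> F.A (r + s)" for y using d(5)[OF that] by (simp add: Faw)
    then show "- x \<in> torsion"
      using d by (intro torsionI[of "- x" d "scal (- 1) * x'"]) (simp_all add: FC_uminus FC_mult tof.free_map_mult tof.free_map_uminus scal_uminus)
  next
    fix x y assume "x \<in> torsion" "y \<in> torsion"
    obtain d x' where d: "x \<in> FC (QG r s)" "d \<noteq> 0" "x' \<in> FC (QG r s)" "free_map id to_fract x' = scal (to_fract d) * x"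
       "\<And>y. y \<in> F.A (r + s) \<Longrightarrow> actF x' y = 0" using \<open>x \<in> torsion\<close> by (rule torsionE) blast
    obtain e y' where e: "y \<in> FC (QG r s)" "e \<noteq> 0" "y' \<in> FC (QG r s)" "free_map id to_fract y' = scal (to_fract e) * y"
       "\<And>x. x \<in> F.A (r + s) \<Longrightarrow> actF y' x = 0" using \<open>y \<in> torsion\<close> by (rule torsionE) blast
    have "free_map id to_fract (scal e * x' + scal d * y') = scal (to_fract (d * e)) * (x + y)"
      by (simp add: tof.free_map_add tof.free_map_mult d e distrib_left mult.assoc[symmetric] scal_mult[symmetric] mult.commute)
    then show "x + y \<in> torsion"
      using d e by (intro torsionI[of "x + y" "d * e" "scal e * x' + scal d * y'"]) (simp_all add: FC_add FC_mult Faw)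
  next
    fix v x :: "(qbc_gen, ratfun) free" assume "v \<in> FC (QG r s)" "x \<in> torsion"
    obtain d x' where d: "x \<in> FC (QG r s)" "d \<noteq> 0" "x' \<in> FC (QG r s)" "free_map id to_fract x' = scal (to_fract d) * x"
       "\<And>y. y \<in> F.A (r + s) \<Longrightarrow> actF x' y = 0" using \<open>x \<in> torsion\<close> by (rule torsionE) blast
    obtain e v' where e: "e \<noteq> 0" "v' \<in> FC (QG r s)" "free_map id to_fract v' = scal (to_fract e) * v"
      by (rule clear_denominators[OF \<open>v \<in> FC (QG r s)\<close>])
    have "free_map id to_fract (v' * x') = (scal (to_fract e) * v) * (scal (to_fract d) * x)"
      by (simp only: tof.free_map_mult d(4) e(3))
    also have "\<dots> = scal (to_fract d) * ((scal (to_fract e) * v) * x)" by (rule scal_swap)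
    also have "\<dots> = scal (to_fract (d * e)) * (v * x)" by (simp only: to_fract_mult scal_mult mult.assoc)
    finally have f1: "free_map id to_fract (v' * x') = scal (to_fract (d * e)) * (v * x)" .
    have "free_map id to_fract (x' * v') = (scal (to_fract d) * x) * (scal (to_fract e) * v)"
      by (simp only: tof.free_map_mult d(4) e(3))
    also have "\<dots> = scal (to_fract e) * ((scal (to_fract d) * x) * v)" by (rule scal_swap)
    also have "\<dots> = scal (to_fract (e * d)) * (x * v)" by (simp only: to_fract_mult scal_mult mult.assoc)
    finally have f2: "free_map id to_fract (x' * v') = scal (to_fract (e * d)) * (x * v)" .
    have "actF (v' * x') y = 0" "actF (x' * v') y = 0" if y: "y \<in> F.A (r + s)" for y
      using d(5)[OF y] d(5)[OF F.linear_onD(1)[OF lin[OF e(2)] y]] F.linear_onD(4)[OF lin[OF e(2)]]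
      by (simp_all add: mult[OF e(2) d(3) y] mult[OF d(3) e(2) y])
    note zero = this
    show "v * x \<in> torsion"
      by (rule torsionI[OF _ _ _ f1 zero(1)]) (use d(1-3) e(1,2) \<open>v \<in> FC (QG r s)\<close> in \<open>simp_all add: FC_mult\<close>)
    show "x * v \<in> torsion"
      by (rule torsionI[OF _ _ _ f2 zero(2)]) (use d(1-3) e(1,2) \<open>v \<in> FC (QG r s)\<close> in \<open>simp_all add: FC_mult\<close>)
  qed
qed

text \<open>Two ways of clearing denominators differ by nonzero factors, which can be cancelled over the power series ring.\<close>

lemma torsion_zero:
  assumes "u \<in> torsion" "v \<in> FC (QG r s)" "d \<noteq> 0" "free_map id to_fract v = scal (to_fract d) * u" "x \<in> F.A (r + s)"
  shows "actF v x = 0"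
proof -
  obtain e u' where e: "u \<in> FC (QG r s)" "e \<noteq> 0" "u' \<in> FC (QG r s)" "free_map id to_fract u' = scal (to_fract e) * u"
     "\<And>x. x \<in> F.A (r + s) \<Longrightarrow> actF u' x = 0" using assms(1) by (rule torsionE) blast
  have "free_map id to_fract (scal d * u') = free_map id to_fract (scal e * v)"
    by (simp add: tof.free_map_mult e(4) assms(4) mult.assoc[symmetric] scal_mult[symmetric] mult.commute)
  then have "to_fract (Poly_Mapping.lookup (scal d * u') w) = to_fract (Poly_Mapping.lookup (scal e * v) w)" for w
    by (simp only: tof.lookup_free_map_id[symmetric])
  then have "scal d * u' = scal e * v" by (intro poly_mapping_eqI) simp
  then have "actF (scal e * v) x = 0" using e(5)[OF assms(5)] Faw(5)[of d u' x] by simp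
  then show ?thesis using lscal_cancel[OF expand1_nz[OF e(2)]] by (simp add: Faw)
qed

text \<open>The action of the classical algebra at \<open>q = 1\<close>.\<close>

definition bact :: "(bc_gen, complex) free \<Rightarrow> (dword, complex) lop \<Rightarrow> (dword, complex) lop" where
  "bact = H.act (\<lambda>c. c) (\<lambda>g. H.gact r s (tr r g))"

lemma bact_gen_linear: "g \<in> (BG r s) \<Longrightarrow> H.linear_on (r + s) (H.gact r s (tr r g))"
  by (rule H.gact_linear) (rule tr_gens)

lemma id_hom: "coeff_hom (\<lambda>c. c)" by standard simp_all

lemma bact_simps:
  "bact (u + v) x = bact u x + bact v x" "bact 0 x = 0"
  "bact (Poly_Mapping.single w k) x = lscal k * foldr (\<lambda>g. H.gact r s (tr r g)) (letters w) x"
  unfolding bact_def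
  by (rule H.act_add[OF id_hom], erule bact_gen_linear, rule H.act_0[OF id_hom], erule bact_gen_linear,
    rule H.act_single[OF id_hom], erule bact_gen_linear)

lemma poly_const_hom: "coeff_hom (\<lambda>a. [:a :: complex:])" by standard (simp_all add: one_pCons)

abbreviation "psub \<equiv> free_map (tr r) (\<lambda>a. [:a :: complex:])"

lemma psub_FC: "u \<in> FC (BG r s) \<Longrightarrow> psub u \<in> FC (QG r s)"
  by (rule coeff_hom.free_map_FC[OF poly_const_hom]) (auto intro: tr_gens)

lemma psub_fract: "free_map id to_fract (psub u) = free_map (tr r) const_ratfun u"
  by (induction u rule: free_induct')
    (simp_all add: coeff_hom.free_map_0[OF poly_const_hom] coeff_hom.free_map_add[OF poly_const_hom]
      coeff_hom.free_map_single[OF poly_const_hom] tof.free_map_add tof.free_map_single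
      cst.free_map_add cst.free_map_single const_ratfun_def[symmetric])

lemma psub_act: "actH (psub u) x = bact u x"
proof (induction u rule: free_induct')
  case (single w a)
  have "foldr (H.gact r s) (map (tr r) v) x = foldr (\<lambda>g. H.gact r s (tr r g)) v x" for v
    by (induction v) simp_all
  moreover have "eval1 [:a:] = a" by (simp add: eval1_def)
  ultimately show ?case
    by (simp add: coeff_hom.free_map_single[OF poly_const_hom] H_single bact_simps)
qed (simp_all add: coeff_hom.free_map_0[OF poly_const_hom] coeff_hom.free_map_add[OF poly_const_hom] Haw bact_simps)

text \<open>Clear the denominators of the integral element \<open>y\<close>; they do not vanish at 1. What results acts by zero over the power series ring, and at \<open>q = 1\<close> the term with the factor \<open>q - 1\<close> disappears while the denominator remains invertible.\<close>

lemma transfer: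
  assumes p: "p \<in> FC (BG r s)" and lim: "lq r s (free_map (tr r) const_ratfun p) 0" and x: "x \<in> H.A (r + s)"
  shows "bact p x = 0"
proof -
  obtain y where y: "y \<in> FR (QG r s)" and i: "free_map (tr r) const_ratfun p - scal (qq - 1) * y \<in> (Iq r s)"
    using lim by (auto simp: lq_def)
  have den: "\<exists>d a. poly d 1 \<noteq> 0 \<and> to_fract d * Poly_Mapping.lookup y w = to_fract a" for w
    using y local_ring_denominator by (simp add: FR_def)
  obtain d y' where d: "poly d 1 \<noteq> 0" "y' \<in> FC (QG r s)" "free_map id to_fract y' = scal (to_fract d) * y"
    using common_denominator[OF FR_FC[OF y], of "\<lambda>d. poly d 1 \<noteq> 0", OF den] by auto
  (* the vanishing of p in the limit, multiplied by the denominator d *)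
  let ?v = "scal d * psub p - scal ([:0, 1:] - 1) * y'"
  have v: "?v \<in> FC (QG r s)" using d psub_FC[OF p] by (intro FC_diff FC_mult FC_scal)
  have "free_map id to_fract ?v = scal (to_fract d) * (free_map (tr r) const_ratfun p) - scal (qq - 1) * (scal (to_fract d) * y)"
    by (simp only: tof.free_map_diff tof.free_map_mult tof.free_map_scal psub_fract d(3) qq_to_fract)
  also have "\<dots> = scal (to_fract d) * (free_map (tr r) const_ratfun p - scal (qq - 1) * y)"
    by (simp only: right_diff_distrib scal_swap[of "scal (qq - 1)"])
  finally have f: "free_map id to_fract ?v = scal (to_fract d) * (free_map (tr r) const_ratfun p - scal (qq - 1) * y)" .
  have d0: "d \<noteq> 0" using d by auto
  obtain x' where x': "x' \<in> F.A (r + s)" "red x' = x" using red_surj[OF x] by blast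
  have "actF ?v x' = 0" using Iq_torsion i by (intro torsion_zero[OF _ v d0 f x'(1)]) blast
  then have "actH ?v x = 0" using red_act[OF v x'(1)] x' by (simp add: red_0)
  moreover have "actH ?v x + actH (scal ([:0, 1:] - 1) * y') x = actH (scal d * psub p) x"
    unfolding Haw(1)[symmetric] by simp
  ultimately have "lscal (eval1 ([:0, 1:] - 1)) * actH y' x = lscal (eval1 d) * actH (psub p) x"
    by (simp add: Haw)
  then have "lscal (poly d 1) * bact p x = 0" by (simp add: eval1_def psub_act)
  then have "lscal (inverse (poly d 1)) * (lscal (poly d 1) * bact p x) = 0" by simp
  then show ?thesis using d(1) by (simp add: mult.assoc[symmetric] lscal_mult[symmetric])
qed

lemma bact_Ib: "u \<in> (Ib r s) \<Longrightarrow> x \<in> H.A (r + s) \<Longrightarrow> bact u x = 0"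
  using transfer[of u x] sub_Ib[of u] Ib_props(1) by blast

end

section \<open>States of words in the classical algebra\<close>

context fixes r s :: nat begin

interpretation K: sign_quotient "FC (BG r s)" "Ib r s"
  by unfold_locales (auto simp: FC_mult FC_uminus intro: Ib_props Ib_props(1)[THEN subsetD])

abbreviation (input) "n \<equiv> r + s"
definition kap :: "bc_gen \<Rightarrow> (bc_gen, complex) free set endo" where "kap g = K.cay (gen g)"
abbreviation "sig i \<equiv> kap (Sgen i)"
abbreviation "gam i \<equiv> kap (Cgen i)"
abbreviation "epsi \<equiv> kap Egen"
definition zet :: "(bc_gen, complex) free set endo" where "zet = K.cay 0"

lemma rel_cay: "bc_rel r s u v \<Longrightarrow> K.cay u = K.cay v"
  using bc_rel_FC bc_in_ideal by (intro K.cay_eqI) auto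

lemmas cay_simps = kap_def zet_def K.cay_mult K.cay_1 K.cay_uminus FC_gen FC_mult FC_uminus

lemma sig_sq: "Sgen i \<in> BG r s \<Longrightarrow> sig i * sig i = 1"
  using rel_cay[OF bc_rel.s_sq[of i r s]] by (simp add: cay_simps)
lemma sig_braid: "Sgen i \<in> BG r s \<Longrightarrow> Sgen (Suc i) \<in> BG r s \<Longrightarrow> sig i * sig (Suc i) * sig i = sig (Suc i) * sig i * sig (Suc i)"
  using rel_cay[OF bc_rel.s_braid[of i r s]] by (simp add: cay_simps)
lemma sig_comm: "Sgen i \<in> BG r s \<Longrightarrow> Sgen j \<in> BG r s \<Longrightarrow> i + 1 < j \<or> j + 1 < i \<Longrightarrow> sig i * sig j = sig j * sig i"
proof -
  assume a: "Sgen i \<in> BG r s" "Sgen j \<in> BG r s" "i + 1 < j \<or> j + 1 < i"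
  then have "\<bar>int i - int j\<bar> > 1" by linarith
  then show ?thesis using a rel_cay[OF bc_rel.s_comm[of i j r s]] by (simp add: cay_simps)
qed
lemma eps_sq: "Egen \<in> BG r s \<Longrightarrow> epsi * epsi = zet"
  using rel_cay[OF bc_rel.e_sq[of r s]] by (simp add: cay_simps)
lemma eps_sig: "Egen \<in> BG r s \<Longrightarrow> Sgen j \<in> BG r s \<Longrightarrow> j \<noteq> r - 1 \<Longrightarrow> j \<noteq> r + 1 \<Longrightarrow> epsi * sig j = sig j * epsi"
  using rel_cay[OF bc_rel.e_s_comm[of j r s]] by (simp add: cay_simps)
lemma eps_sig_eps_left: "Egen \<in> BG r s \<Longrightarrow> Sgen (r - 1) \<in> BG r s \<Longrightarrow> epsi * sig (r - 1) * epsi = epsi"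
  using rel_cay[OF bc_rel.e_s_e_left[of r s]] by (simp add: cay_simps)
lemma eps_sig_eps_right: "Egen \<in> BG r s \<Longrightarrow> Sgen (r + 1) \<in> BG r s \<Longrightarrow> epsi * sig (r + 1) * epsi = epsi"
  using rel_cay[OF bc_rel.e_s_e_right[of r s]] by (simp add: cay_simps)
lemma eps_sig_sig: "Egen \<in> BG r s \<Longrightarrow> Sgen (r - 1) \<in> BG r s \<Longrightarrow> Sgen (r + 1) \<in> BG r s \<Longrightarrow>
   sig (r - 1) * sig (r + 1) * epsi * sig (r + 1) * sig (r - 1) * epsi = epsi * sig (r - 1) * sig (r + 1) * epsi * sig (r + 1) * sig (r - 1)"
  using rel_cay[OF bc_rel.e_s_s[of r s]] by (simp add: cay_simps)
lemma gam_sq: "Cgen i \<in> BG r s \<Longrightarrow> gam i * gam i = 1"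
  using rel_cay[OF bc_rel.c_sq_left[of i r s]] rel_cay[OF bc_rel.c_sq_right[of r i s]]
  by (cases "i \<le> r") (auto simp: cay_simps bc_gens_iff)
lemma gam_comm: "Cgen i \<in> BG r s \<Longrightarrow> Cgen j \<in> BG r s \<Longrightarrow> gam i * gam j = gam j * gam i"
  using rel_cay[OF bc_rel.c_anticomm[of i j r s]] by (cases "i = j") (simp_all add: cay_simps)
lemma sig_gam_far: "Sgen i \<in> BG r s \<Longrightarrow> Cgen j \<in> BG r s \<Longrightarrow> j \<noteq> i \<Longrightarrow> j \<noteq> i + 1 \<Longrightarrow> sig i * gam j = gam j * sig i"
  using rel_cay[OF bc_rel.s_c_comm[of i j r s]] by (simp add: cay_simps)
lemma sig_gam: assumes "Sgen i \<in> BG r s" shows "sig i * gam i = gam (Suc i) * sig i" "sig i * gam (Suc i) = gam i * sig i"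
proof -
  have c: "Cgen i \<in> BG r s" "Cgen (Suc i) \<in> BG r s" using assms by (auto simp: bc_gens_iff)
  have 1: "sig i * gam i * sig i = gam (Suc i)"
    using rel_cay[OF bc_rel.s_c_s[of i r s]] assms c by (simp add: cay_simps)
  have "gam (Suc i) * sig i = sig i * gam i * (sig i * sig i)" "sig i * gam (Suc i) = (sig i * sig i) * gam i * sig i"
    by (simp_all only: 1[symmetric] mult.assoc)
  then show "sig i * gam i = gam (Suc i) * sig i" "sig i * gam (Suc i) = gam i * sig i" using sig_sq[OF assms] by simp_all
qed
lemma gam_eps: "Egen \<in> BG r s \<Longrightarrow> gam r * epsi = gam (r + 1) * epsi" "Egen \<in> BG r s \<Longrightarrow> epsi * gam r = epsi * gam (r + 1)"
    "Egen \<in> BG r s \<Longrightarrow> epsi * gam r * epsi = zet"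
proof -
  assume e: "Egen \<in> BG r s"
  then have c: "Cgen r \<in> BG r s" "Cgen (Suc r) \<in> BG r s" by (auto simp: bc_gens_iff)
  show "gam r * epsi = gam (r + 1) * epsi" using rel_cay[OF bc_rel.c_e[of r s]] e c by (simp add: cay_simps)
  show "epsi * gam r = epsi * gam (r + 1)" using rel_cay[OF bc_rel.e_c[of r s]] e c by (simp add: cay_simps)
  show "epsi * gam r * epsi = zet" using rel_cay[OF bc_rel.e_c_e[of r s]] e c by (simp add: cay_simps)
qed
lemma eps_gam: "Egen \<in> BG r s \<Longrightarrow> Cgen j \<in> BG r s \<Longrightarrow> j \<noteq> r \<Longrightarrow> j \<noteq> r + 1 \<Longrightarrow> epsi * gam j = gam j * epsi"
  using rel_cay[OF bc_rel.e_c_comm[of j r s]] by (simp add: cay_simps)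
lemma zet_kap: "g \<in> BG r s \<Longrightarrow> kap g * zet = zet" "g \<in> BG r s \<Longrightarrow> zet * kap g = zet"
  using K.cay_mult[of "gen g" 0] K.cay_mult[of 0 "gen g"] by (simp_all add: kap_def zet_def FC_gen)

lemma typeB_left: "typeB (\<lambda>i. sig (i - s)) (\<lambda>i. gam (i - s)) s n"
proof
  fix i assume "s < i" "i < n"
  then have g: "Sgen (i - s) \<in> BG r s" "Suc i - s = Suc (i - s)" by (auto simp: bc_gens_iff)
  show "sig (i - s) * sig (i - s) = 1" by (rule sig_sq[OF g(1)])
  show "sig (i - s) * gam (i - s) = gam (Suc i - s) * sig (i - s)" using sig_gam(1)[OF g(1)] g(2) by simp
next
  fix i assume "s < i" "Suc i < n"
  then have "Sgen (i - s) \<in> BG r s" "Sgen (Suc (i - s)) \<in> BG r s" "Suc i - s = Suc (i - s)" by (auto simp: bc_gens_iff)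
  then show "sig (i - s) * sig (Suc i - s) * sig (i - s) = sig (Suc i - s) * sig (i - s) * sig (Suc i - s)" using sig_braid by simp
next
  fix i j assume "s < i" "Suc i < j" "j < n"
  then have "Sgen (i - s) \<in> BG r s" "Sgen (j - s) \<in> BG r s" "i - s + 1 < j - s" by (auto simp: bc_gens_iff)
  then show "sig (i - s) * sig (j - s) = sig (j - s) * sig (i - s)" by (intro sig_comm) auto
next
  fix i assume "s < i" "i \<le> n"
  then show "gam (i - s) * gam (i - s) = 1" by (intro gam_sq) (auto simp: bc_gens_iff)
next
  fix i j assume "s < i" "i \<le> n" "s < j" "j \<le> n"
  then show "gam (i - s) * gam (j - s) = gam (j - s) * gam (i - s)" by (intro gam_comm) (auto simp: bc_gens_iff)
next
  fix i j assume "s < i" "i < n" "s < j" "j \<le> n" "j \<noteq> i" "j \<noteq> Suc i"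
  then show "sig (i - s) * gam (j - s) = gam (j - s) * sig (i - s)" by (intro sig_gam_far) (auto simp: bc_gens_iff)
qed

lemma typeB_right: "typeB (\<lambda>i. sig (n + r - i)) (\<lambda>i. gam (n + r + 1 - i)) r n"
proof
  fix i assume i: "r < i" "i < n"
  then have g: "Sgen (n + r - i) \<in> BG r s" "n + r + 1 - i = Suc (n + r - i)" "n + r + 1 - Suc i = n + r - i" by (auto simp: bc_gens_iff)
  show "sig (n + r - i) * sig (n + r - i) = 1" by (rule sig_sq[OF g(1)])
  show "sig (n + r - i) * gam (n + r + 1 - i) = gam (n + r + 1 - Suc i) * sig (n + r - i)"
    using sig_gam(2)[OF g(1)] unfolding g(2,3) .
next
  fix i assume "r < i" "Suc i < n"
  then have g: "Sgen (n + r - Suc i) \<in> BG r s" "Sgen (Suc (n + r - Suc i)) \<in> BG r s" "n + r - i = Suc (n + r - Suc i)" by (auto simp: bc_gens_iff)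
  then show "sig (n + r - i) * sig (n + r - Suc i) * sig (n + r - i) = sig (n + r - Suc i) * sig (n + r - i) * sig (n + r - Suc i)"
    using sig_braid[OF g(1,2)] unfolding g(3) by (simp only:)
next
  fix i j assume "r < i" "Suc i < j" "j < n"
  then have "Sgen (n + r - i) \<in> BG r s" "Sgen (n + r - j) \<in> BG r s" "n + r - j + 1 < n + r - i" by (auto simp: bc_gens_iff)
  then show "sig (n + r - i) * sig (n + r - j) = sig (n + r - j) * sig (n + r - i)" by (intro sig_comm) auto
next
  fix i assume "r < i" "i \<le> n"
  then show "gam (n + r + 1 - i) * gam (n + r + 1 - i) = 1" by (intro gam_sq) (auto simp: bc_gens_iff)
next
  fix i j assume "r < i" "i \<le> n" "r < j" "j \<le> n"
  then show "gam (n + r + 1 - i) * gam (n + r + 1 - j) = gam (n + r + 1 - j) * gam (n + r + 1 - i)" by (intro gam_comm) (auto simp: bc_gens_iff)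
next
  fix i j assume "r < i" "i < n" "r < j" "j \<le> n" "j \<noteq> i" "j \<noteq> Suc i"
  then show "sig (n + r - i) * gam (n + r + 1 - j) = gam (n + r + 1 - j) * sig (n + r - i)" by (intro sig_gam_far) (auto simp: bc_gens_iff)
qed

text \<open>The generators \<open>s\<^sub>i\<close>, \<open>c\<^sub>i\<close> with \<open>i \<le> r\<close> act on the left strands with indices shifted by \<open>s\<close>, the others on the right strands in reversed numbering, as in the quantum action.\<close>

lemma walled_BC: "walled (\<lambda>i. sig (i - s)) (\<lambda>i. gam (i - s)) (\<lambda>i. sig (n + r - i)) (\<lambda>i. gam (n + r + 1 - i)) s r n epsi zet"
proof (intro walled.intro typeB_left typeB_right walled_axioms.intro, goal_cases)
  case 1 then show ?case by simp
next
  case (2 i j) then show ?case by (intro sig_comm) (auto simp: bc_gens_iff)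
next
  case (3 i j) then show ?case by (intro sig_gam_far) (auto simp: bc_gens_iff)
next
  case (4 i j) then show ?case by (intro sig_gam_far[symmetric]) (auto simp: bc_gens_iff)
next
  case (5 i j) then show ?case by (intro gam_comm) (auto simp: bc_gens_iff)
next
  case (6 i) then show ?case by (intro eps_sig) (auto simp: bc_gens_iff)
next
  case (7 i) then show ?case by (intro eps_gam) (auto simp: bc_gens_iff)
next
  case (8 i) then show ?case by (intro eps_sig) (auto simp: bc_gens_iff)
next
  case (9 i) then show ?case by (intro eps_gam) (auto simp: bc_gens_iff)
next
  case 10 then show ?case by (intro eps_sq) (auto simp: bc_gens_iff)
next
  case 11
  then have "n - 1 - s = r - 1" "Egen \<in> BG r s" "Sgen (r - 1) \<in> BG r s" by (auto simp: bc_gens_iff)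
  then show ?case using eps_sig_eps_left by simp
next
  case 12
  then have "n + r - (n - 1) = r + 1" "Egen \<in> BG r s" "Sgen (r + 1) \<in> BG r s" by (auto simp: bc_gens_iff)
  then show ?case using eps_sig_eps_right by simp
next
  case 13
  then have "n - s = r" "n + r + 1 - n = r + 1" "Egen \<in> BG r s" by (auto simp: bc_gens_iff)
  then show ?case using gam_eps(1) by simp
next
  case 14
  then have "n - s = r" "n + r + 1 - n = r + 1" "Egen \<in> BG r s" by (auto simp: bc_gens_iff)
  then show ?case using gam_eps(2) by simp
next
  case 15
  then have "n - s = r" "Egen \<in> BG r s" by (auto simp: bc_gens_iff)
  then show ?case using gam_eps(3) by simp
next
  case 16
  then have e: "n - 1 - s = r - 1" "n + r - (n - 1) = r + 1" and g: "Egen \<in> BG r s" "Sgen (r - 1) \<in> BG r s" "Sgen (r + 1) \<in> BG r s"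
    by (auto simp: bc_gens_iff)
  show ?case unfolding e using eps_sig_sig[OF g] by (simp only: mult.assoc)
next
  case (17 i) then show ?case by (intro conjI zet_kap) (auto simp: bc_gens_iff)
next
  case (18 i) then show ?case by (intro conjI zet_kap) (auto simp: bc_gens_iff)
next
  case (19 i) then show ?case by (intro conjI zet_kap) (auto simp: bc_gens_iff)
next
  case (20 i) then show ?case by (intro conjI zet_kap) (auto simp: bc_gens_iff)
next
  case 21 then show ?case by (intro conjI zet_kap) (auto simp: bc_gens_iff)
qed

interpretation W: walled "\<lambda>i. sig (i - s)" "\<lambda>i. gam (i - s)" "\<lambda>i. sig (n + r - i)" "\<lambda>i. gam (n + r + 1 - i)" s r n epsi zet
  by (rule walled_BC)

definition start :: "int \<Rightarrow> int" where "start = W.b0"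
definition normal :: "(bc_gen, complex) free set endo \<Rightarrow> (int \<Rightarrow> int) \<Rightarrow> bool" where "normal = W.NF"

text \<open>The effect of the generators on states; it describes both the action at \<open>q = 1\<close> and the normal form of words.\<close>

fun gst :: "bc_gen \<Rightarrow> (int \<Rightarrow> int) \<Rightarrow> (int \<Rightarrow> int) option" where
  "gst (Sgen i) f = Some (if i < r then sw (int (s + i)) (int (s + i) + 1) \<circ> f
     else f \<circ> sw (int (n - (i - r))) (int (n - (i - r)) + 1))"
| "gst (Cgen i) f = Some (if i \<le> r then sw (int (s + i)) (- int (s + i)) \<circ> f
     else f \<circ> sw (int (n + 1 - (i - r))) (- int (n + 1 - (i - r))))"
| "gst Egen f = (if \<bar>f (int n)\<bar> = int n then None else Some (sw (int n) (f (int n)) \<circ> f))"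

fun st :: "bc_gen list \<Rightarrow> (int \<Rightarrow> int) option" where
  "st [] = Some start"
| "st (g # w) = Option.bind (st w) (gst g)"

lemma inv_sw: "x \<noteq> 0 \<Longrightarrow> y \<noteq> 0 \<Longrightarrow> inv_into UNIV (sw x y) = sw x y"
  by (rule inv_unique_comp) (auto simp: fun_eq_iff)

lemma normal_left: assumes "normal z f" "g \<in> sperm s n" shows "normal (W.rL g * z) (g \<circ> f)"
proof -
  have "W.NF (W.P g id * z) (g \<circ> f \<circ> inv_into UNIV id)"
    by (rule W.NF_P) (use assms in \<open>simp_all add: normal_def\<close>)
  then show ?thesis by (simp only: W.P_L normal_def inv_id comp_id)
qed

lemma normal_right: assumes "normal z f" "h \<in> sperm r n" shows "normal (W.rR h * z) (f \<circ> inv_into UNIV h)"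
proof -
  have "W.NF (W.P id h * z) (id \<circ> f \<circ> inv_into UNIV h)"
    by (rule W.NF_P) (use assms in \<open>simp_all add: normal_def\<close>)
  then show ?thesis by (simp only: W.P_R normal_def id_comp)
qed

lemma normal_step: assumes nf: "normal z f" and g: "g \<in> BG r s"
  shows "case gst g f of None \<Rightarrow> kap g * z = zet | Some f' \<Rightarrow> normal (kap g * z) f'"
proof (cases g)
  case (Sgen i)
  show ?thesis
  proof (cases "i < r")
    case True
    then have i: "1 \<le> i" using g Sgen by (simp add: bc_gens_iff)
    have "W.rL (sw (int (s + i)) (int (s + i) + 1)) = sig i" using W.L.rho_S[of "s + i"] i True by simp
    moreover have "sw (int (s + i)) (int (s + i) + 1) \<in> sperm s n" using i True by (intro sperm_sw) auto
    ultimately show ?thesis using normal_left[OF nf] Sgen True by fastforce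
  next
    case False
    then have i: "r < i" "i < n" using g Sgen by (auto simp: bc_gens_iff)
    let ?k = "n - (i - r)"
    have k: "r < ?k" "?k < n" "n + r - ?k = i" using i by auto
    have "W.rR (sw (int ?k) (int ?k + 1)) = sig i" using W.R.rho_S[OF k(1,2)] k(3) by simp
    moreover have "sw (int ?k) (int ?k + 1) \<in> sperm r n" using k by (intro sperm_sw) auto
    moreover have "inv_into UNIV (sw (int ?k) (int ?k + 1)) = sw (int ?k) (int ?k + 1)" using k by (intro inv_sw) auto
    ultimately have "normal (sig i * z) (f \<circ> sw (int ?k) (int ?k + 1))" using normal_right[OF nf, of "sw (int ?k) (int ?k + 1)"] by (simp only:)
    then show ?thesis using Sgen False by simp
  qed
next
  case (Cgen i)
  show ?thesis
  proof (cases "i \<le> r")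
    case True
    then have i: "1 \<le> i" using g Cgen by (simp add: bc_gens_iff)
    have "W.rL (sw (int (s + i)) (- int (s + i))) = gam i" using W.L.rho_C[of "s + i"] i True by simp
    moreover have "sw (int (s + i)) (- int (s + i)) \<in> sperm s n" using i True by (intro sperm_sw) auto
    ultimately show ?thesis using normal_left[OF nf] Cgen True by fastforce
  next
    case False
    then have i: "r < i" "i \<le> n" using g Cgen by (auto simp: bc_gens_iff)
    let ?k = "n + 1 - (i - r)"
    have k: "r < ?k" "?k \<le> n" "n + r + 1 - ?k = i" using i by auto
    have "W.rR (sw (int ?k) (- int ?k)) = gam i" using W.R.rho_C[OF k(1,2)] k(3) by simp
    moreover have "sw (int ?k) (- int ?k) \<in> sperm r n" using k by (intro sperm_sw) auto
    moreover have "inv_into UNIV (sw (int ?k) (- int ?k)) = sw (int ?k) (- int ?k)" using k by (intro inv_sw) auto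
    ultimately have "normal (gam i * z) (f \<circ> sw (int ?k) (- int ?k))" using normal_right[OF nf, of "sw (int ?k) (- int ?k)"] by (simp only:)
    then show ?thesis using Cgen False by simp
  qed
next
  case Egen
  then have "1 \<le> r" "1 \<le> s" using g by (auto simp: bc_gens_iff)
  then have "W.vL (int n)" "W.vR (int n)" by (auto simp: W.vL_def W.vR_def)
  note e = W.NF_e[OF nf[unfolded normal_def] this, unfolded W.e_nn W.est_def, folded normal_def]
  have e': "if \<bar>f (int n)\<bar> = int n then epsi * z = zet else normal (epsi * z) (sw (int n) (f (int n)) \<circ> f)"
    using e by (simp only: abs_of_nat)
  show ?thesis
  proof (cases "\<bar>f (int n)\<bar> = int n")
    case True
    then show ?thesis using e' Egen by simp
  next
    case False
    then show ?thesis using e' Egen by simp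
  qed
qed

lemma normal_word: "set w \<subseteq> BG r s \<Longrightarrow>
  case st w of None \<Rightarrow> K.cay (Poly_Mapping.single (Word w) 1) = zet | Some f \<Rightarrow> normal (K.cay (Poly_Mapping.single (Word w) 1)) f"
proof (induction w)
  case Nil
  have "Poly_Mapping.single (Word []) 1 = (1 :: (bc_gen, complex) free)" by (simp add: zero_word_def[symmetric])
  then show ?case using W.NF_1 by (simp add: K.cay_1 normal_def start_def)
next
  case (Cons g w)
  then have g: "g \<in> BG r s" "set w \<subseteq> BG r s" by auto
  have "Poly_Mapping.single (Word (g # w)) 1 = gen g * (Poly_Mapping.single (Word w) 1 :: (bc_gen, complex) free)"
    by (simp add: gen_def mult_single plus_word_def)
  then have e: "K.cay (Poly_Mapping.single (Word (g # w)) 1) = kap g * K.cay (Poly_Mapping.single (Word w) 1)"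
    using g by (simp add: K.cay_mult FC_gen FC_single kap_def)
  show ?case
  proof (cases "st w")
    case None
    then show ?thesis using Cons.IH[OF g(2)] e zet_kap(1)[OF g(1)] by simp
  next
    case (Some f)
    then show ?thesis using Cons.IH[OF g(2)] normal_step[OF _ g(1), of "K.cay (Poly_Mapping.single (Word w) 1)" f] unfolding e by simp
  qed
qed

text \<open>Uniqueness of normal forms, translated back from classes up to sign.\<close>

lemma same_state:
  assumes "set w \<subseteq> BG r s" "set w' \<subseteq> BG r s" "st w = Some f" "st w' = Some f"
  obtains c where "Poly_Mapping.single (Word w) 1 - scal c * Poly_Mapping.single (Word w') 1 \<in> Ib r s"
proof -
  let ?x = "Poly_Mapping.single (Word w) 1 :: (bc_gen, complex) free" and ?y = "Poly_Mapping.single (Word w') 1 :: (bc_gen, complex) free"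
  have "K.cay ?x = K.cay ?y"
  proof (rule W.NF_unique)
    show "W.NF (K.cay ?x) f" using normal_word[OF assms(1)] assms(3) by (simp add: normal_def)
    show "W.NF (K.cay ?y) f" using normal_word[OF assms(2)] assms(4) by (simp add: normal_def)
  qed
  then have "K.sim ?x ?y" using assms by (subst (asm) K.cay_eq_iff) (simp_all add: FC_single)
  then have "?x - scal 1 * ?y \<in> Ib r s \<or> ?x - scal (- 1) * ?y \<in> Ib r s" by (auto simp: K.sim_def scal_uminus)
  then show ?thesis using that by blast
qed

lemma zero_state: assumes "set w \<subseteq> BG r s" "st w = None" shows "Poly_Mapping.single (Word w) 1 \<in> Ib r s"
  using normal_word[OF assms(1)] assms K.cay_zero_iff[of "Poly_Mapping.single (Word w) 1"] by (simp add: zet_def FC_single)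

lemma start_sperm: "start \<in> sperm 0 n"
proof -
  have "odd_bij start" using W.through_b0 by (simp add: W.through_def start_def)
  moreover have fixed: "start x = x" if "x = 0 \<or> \<bar>x\<bar> > int n" for x
  proof -
    from that consider "x = 0" | "x > int n" | "x < - int n" by (auto simp: abs_if split: if_splits)
    then show ?thesis by cases (simp_all add: start_def W.b0_def)
  qed
  have "int 0 < \<bar>x\<bar> \<and> \<bar>x\<bar> \<le> int n" if "start x \<noteq> x" for x
  proof -
    have "\<not> (x = 0 \<or> \<bar>x\<bar> > int n)" using fixed[of x] that by blast
    then show ?thesis by simp
  qed
  ultimately show ?thesis unfolding sperm_def by blast
qed

lemma rep_step: assumes x: "rep n n x f" and g: "g \<in> BG r s"
  shows "case gst g f of None \<Rightarrow> H.gact r s (tr r g) x = 0 | Some f' \<Rightarrow> rep n n (H.gact r s (tr r g) x) f'"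
proof (cases g)
  case (Sgen i)
  show ?thesis
  proof (cases "i < r")
    case True
    then have "rep n n (H.T (s + i)) (sw (int (s + i)) (int (s + i) + 1))" using g Sgen by (intro rep_T) (auto simp: bc_gens_iff)
    from rep_mult[OF this x] show ?thesis using Sgen True by (simp add: tr_simps)
  next
    case False
    then have "rep n n (H.T (n - (i - r))) (sw (int (n - (i - r))) (int (n - (i - r)) + 1))" using g Sgen by (intro rep_T) (auto simp: bc_gens_iff)
    from rep_mult[OF x this] show ?thesis using Sgen False by (simp add: tr_simps)
  qed
next
  case (Cgen i)
  show ?thesis
  proof (cases "i \<le> r")
    case True
    then have "rep n n (H.c (s + i)) (sw (int (s + i)) (- int (s + i)))" using g Cgen by (intro rep_c) (auto simp: bc_gens_iff)
    from rep_mult[OF this x] show ?thesis using Cgen True by (simp add: tr_simps)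
  next
    case False
    then have c: "rep n n (H.c (n + 1 - (i - r))) (sw (int (n + 1 - (i - r))) (- int (n + 1 - (i - r))))" using g Cgen by (intro rep_c) (auto simp: bc_gens_iff)
    have "rep n n (H.th n x) f" using rep_th[OF x order_refl] x rep_uminus by auto
    from rep_mult[OF this c] show ?thesis using Cgen False by (simp add: tr_simps)
  qed
next
  case Egen
  then obtain m where m: "n = Suc m" using g by (cases n) (auto simp: bc_gens_iff)
  from rep_eps[OF m x] show ?thesis using Egen by (auto simp: tr_simps)
qed

lemma rep_word: assumes v: "rep n n v start"
  shows "set w \<subseteq> BG r s \<Longrightarrow> case st w of None \<Rightarrow> foldr (\<lambda>g. H.gact r s (tr r g)) w v = 0
    | Some f \<Rightarrow> rep n n (foldr (\<lambda>g. H.gact r s (tr r g)) w v) f"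
proof (induction w)
  case Nil
  then show ?case using v by simp
next
  case (Cons g w)
  then have g: "g \<in> BG r s" "set w \<subseteq> BG r s" by auto
  show ?case
  proof (cases "st w")
    case None
    have "H.linear_on n (H.gact r s (tr r g))" by (rule H.gact_linear[OF tr_gens[OF g(1)]])
    then show ?thesis using None Cons.IH[OF g(2)] H.linear_onD(4) by simp
  next
    case (Some f)
    have e: "foldr (\<lambda>g. H.gact r s (tr r g)) (g # w) v = H.gact r s (tr r g) (foldr (\<lambda>g. H.gact r s (tr r g)) w v)"
      by simp
    show ?thesis using Cons.IH[OF g(2)] rep_step[OF _ g(1), of "foldr (\<lambda>g. H.gact r s (tr r g)) w v" f]
      unfolding e by (simp add: Some)
  qed
qed

end

section \<open>The classical action is faithful\<close>

context fixes r s :: nat begin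

text \<open>Modulo relations, \<open>p\<close> is a combination \<open>D l\<close> of one chosen word for each state. Applied to the starting vector, these words give linearly independent elements, so that all coefficients vanish.\<close>

lemma bact_faithful:
  assumes p: "p \<in> FC (BG r s)" and z: "\<And>x. x \<in> H.A (r + s) \<Longrightarrow> bact r s p x = 0"
  shows "p \<in> Ib r s"
proof -
  (* the vector whose orbit under words realizes the states *)
  obtain v where v: "rep (r + s) (r + s) v (start r s)" using rep_exists[OF start_sperm] by blast
  have vA: "v \<in> H.A (r + s)" using v by (simp add: rep_def)
  define R where "R = {f. \<exists>w. set w \<subseteq> BG r s \<and> st r s w = Some f}"
  define wf where "wf f = (SOME w. set w \<subseteq> BG r s \<and> st r s w = Some f)" for f
  have wf: "set (wf f) \<subseteq> BG r s \<and> st r s (wf f) = Some f" if "f \<in> R" for f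
  proof -
    have "\<exists>w. set w \<subseteq> BG r s \<and> st r s w = Some f" using that by (simp add: R_def)
    then show ?thesis unfolding wf_def by (rule someI_ex)
  qed
  define X where "X f = foldr (\<lambda>g. H.gact r s (tr r g)) (wf f) v" for f
  have X: "rep (r + s) (r + s) (X f) f" if "f \<in> R" for f
    using rep_word[OF v, of "wf f"] wf[OF that] by (simp add: X_def)
  define D :: "((int \<Rightarrow> int) \<Rightarrow>\<^sub>0 complex) \<Rightarrow> (bc_gen, complex) free" where
    "D = ev (\<lambda>f a. Poly_Mapping.single (Word (wf f)) a)"
  have D_add: "D (l + m) = D l + D m" for l m unfolding D_def by (rule ev_add) (simp_all add: single_add)
  have D_single: "D (Poly_Mapping.single f a) = Poly_Mapping.single (Word (wf f)) a" for f a
    unfolding D_def by (rule ev_single) simp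
  have "\<exists>l. Poly_Mapping.keys l \<subseteq> R \<and> p - D l \<in> Ib r s" using p
  proof (induction rule: FC_induct)
    case zero
    show ?case using Ib_props(2) by (intro exI[of _ 0]) (simp add: D_def)
  next
    case (single w a)
    have e: "Poly_Mapping.single w a = scal a * Poly_Mapping.single (Word (letters w)) 1" by (simp add: scal_single)
    show ?case
    proof (cases "st r s (letters w)")
      case None
      have "Poly_Mapping.single w a \<in> Ib r s" unfolding e by (rule Ib_props(5)[OF FC_scal zero_state[OF single None]])
      then show ?thesis by (intro exI[of _ 0]) (simp add: D_def)
    next
      case (Some f)
      then have f: "f \<in> R" using single by (auto simp: R_def)
      obtain c where c: "Poly_Mapping.single (Word (letters w)) 1 - scal c * Poly_Mapping.single (Word (wf f)) 1 \<in> Ib r s"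
        by (rule same_state[OF single _ Some, of "wf f"]) (use wf[OF f] in auto)
      have "scal a * (Poly_Mapping.single (Word (letters w)) 1 - scal c * Poly_Mapping.single (Word (wf f)) 1) \<in> Ib r s"
        by (rule Ib_props(5)[OF FC_scal c])
      then have "Poly_Mapping.single w a - D (Poly_Mapping.single f (a * c)) \<in> Ib r s"
        by (simp add: D_single right_diff_distrib scal_single)
      moreover have "Poly_Mapping.keys (Poly_Mapping.single f (a * c)) \<subseteq> R" using f by auto
      ultimately show ?thesis by blast
    qed
  next
    case (add x y)
    then obtain l m where l: "Poly_Mapping.keys l \<subseteq> R" "x - D l \<in> Ib r s" "Poly_Mapping.keys m \<subseteq> R" "y - D m \<in> Ib r s" by blast
    have eq: "(x - D l) + (y - D m) = x + y - D (l + m)" by (simp add: D_add)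
    have "x + y - D (l + m) \<in> Ib r s" using Ib_props(3)[OF l(2,4)] by (simp only: eq)
    moreover have "Poly_Mapping.keys (l + m) \<subseteq> R" using Poly_Mapping.keys_add[of l m] l by blast
    ultimately show ?case by blast
  qed
  then obtain l where l: "Poly_Mapping.keys l \<subseteq> R" "p - D l \<in> Ib r s" by blast
  have "bact r s (p - D l) v + bact r s (D l) v = bact r s p v" by (simp add: bact_simps(1)[symmetric])
  then have "bact r s (D l) v = 0" using z[OF vA] bact_Ib[OF l(2) vA] by simp
  moreover have "bact r s (D l) v = ev (\<lambda>f a. lscal a * X f) l"
  proof (induction l rule: free_induct')
    case (single f a)
    show ?case by (subst ev_single) (simp_all add: D_single bact_simps X_def)
  next
    case (add l m)
    have "ev (\<lambda>f a. lscal a * X f) (l + m) = ev (\<lambda>f a. lscal a * X f) l + ev (\<lambda>f a. lscal a * X f) m"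
      by (rule ev_add) (simp_all add: lscal_add distrib_right)
    then show ?case using add by (simp add: D_add bact_simps)
  qed (simp add: D_def bact_simps)
  ultimately have "(\<Sum>f\<in>Poly_Mapping.keys l. lscal (Poly_Mapping.lookup l f) * X f) = 0" by (simp add: ev_def)
  then have coeff: "Poly_Mapping.lookup l f = 0" if "f \<in> Poly_Mapping.keys l" for f
    using X l(1) that by (intro rep_independent[of "Poly_Mapping.keys l" "r + s" X]) auto
  have "Poly_Mapping.lookup l f = 0" for f
  proof (cases "f \<in> Poly_Mapping.keys l")
    case True
    then show ?thesis by (rule coeff)
  next
    case False
    then show ?thesis by (simp add: in_keys_iff)
  qed
  then have "l = 0" by (intro poly_mapping_eqI) simp
  then show ?thesis using l(2) by (simp add: D_def)
qed

lemma limit_kernel: "p \<in> FC (BG r s) \<Longrightarrow> lq r s (free_map (tr r) const_ratfun p) 0 \<Longrightarrow> p \<in> Ib r s"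
  by (rule bact_faithful) (auto intro: transfer)

end



theorem proposition3p21:
  fixes r s :: nat
  shows "(\<exists>\<pi>. natural_hom r s \<pi>) \<and>
    (\<forall>\<pi>. natural_hom r s \<pi> \<longrightarrow> superalgebra_iso type_ring (BC r s) (BC_lim r s) \<pi>)"
  using natural_map_natural natural_hom_iso[OF limit_kernel] by blast

end
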